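(* Let $\mathcal{M}$ be an $o$-minimal expansion of an ordered group, with $\mathrm{Th}(\mathcal{M})$ locally modular. Let $\Phi(x;y)$ be a finite set of formulas in the language of $\mathcal{M}$. Then $\Phi$ admits a distal cell decomposition of exponent $|x|$.
   Context: Let $\mathcal{M}$ be a first-order structure with universe $M$ in a language $\mathcal{L}$. Formulas are $\mathcal{L}$-formulas without parameters. In a partitioned formula $\varphi(x;y)$ the variables are split into finite tuples $x,y$ of lengths $|x|,|y|$; all formulas in a set $\Phi(x;y)$ share the same $x$ and $y$. For $b\in M^{|y|}$ put $\varphi(M^{|x|};b)=\{a\in M^{|x|}:\mathcal{M}\models\varphi(a,b)\}$. For $B\subseteq M^{|y|}$, a set $X\subseteq M^{|x|}$ is crossed by $\Phi(x;B)$ if for some $\varphi\in\Phi$, $b\in B$ both $X\cap\varphi(M^{|x|};b)$ and $X\setminus\varphi(M^{|x|};b)$ are nonempty. A distal cell decomposition $\mathcal{T}$ for a finite set $\Phi(x;y)$ is given by a finite set $\Psi(x;y_1,\dots,y_k)$ of formulas with $|y_1|=\dots=|y_k|=|y|$ and, for each $\psi\in\Psi$, a formula $\theta_\psi(y;y_1,\dots,y_k)$ such that for each finite nonempty $B\subseteq M^{|y|}$ the following holds. Let $\mathcal{T}(B)$ be the set of all $\Delta=\psi(M^{|x|};b_1,\dots,b_k)$ with $\psi\in\Psi$, $b_1,\dots,b_k\in B$, such that no $b\in B$ satisfies $\theta_\psi(b;b_1,\dots,b_k)$. Then $\bigcup\mathcal{T}(B)=M^{|x|}$ and no element of $\mathcal{T}(B)$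 is crossed by $\Phi(x;B)$. $\mathcal{T}$ has exponent $r$ if there is $C$ with $|\mathcal{T}(B)|\le C|B|^r$ for all finite nonempty $B\subseteq M^{|y|}$. Local modularity of the theory is in the usual sense of geometric model theory: in models of the theory, the pregeometry given by algebraic closure satisfies $\dim(A\cup B)+\dim(A\cap B)=\dim(A)+\dim(B)$ for all finite-dimensional closed sets $A,B$ with $\dim(A\cap B)>0$. *)

theory Defs
  imports Complex_Main "HOL-Algebra.Group" "HOL-Library.NList"
begin

section \<open>First-order logic\<close>

text \<open>
  The symbols of a language are all the elements of the types \<open>'f\<close> (function symbols; constants have
  arity 0) and \<open>'r\<close> (relation symbols).
\<close>

record ('f, 'r) language =
  fun_arity :: "'f \<Rightarrow> nat"
  rel_arity :: "'r \<Rightarrow> nat"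

datatype 'f tm = Var nat | App 'f "'f tm list"

text \<open>
  Variables are de Bruijn indices: in \<open>Ex \<phi>\<close> the variable 0 of \<open>\<phi>\<close> is the bound one, and the variable
  \<open>Suc i\<close> of \<open>\<phi>\<close> is the variable \<open>i\<close> outside the quantifier.
\<close>

datatype ('f, 'r) fm =
    Eq "'f tm" "'f tm"
  | Rel 'r "'f tm list"
  | Neg "('f, 'r) fm"
  | Conj "('f, 'r) fm" "('f, 'r) fm"
  | Ex "('f, 'r) fm"

fun is_term :: "('f, 'r) language \<Rightarrow> nat \<Rightarrow> 'f tm \<Rightarrow> bool" where
  "is_term L n (Var i) \<longleftrightarrow> i < n"
| "is_term L n (App f ts) \<longleftrightarrow> length ts = fun_arity L f \<and> (\<forall>t\<in>set ts. is_term L n t)"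

fun is_formula :: "('f, 'r) language \<Rightarrow> nat \<Rightarrow> ('f, 'r) fm \<Rightarrow> bool" where
  "is_formula L n (Eq s t) \<longleftrightarrow> is_term L n s \<and> is_term L n t"
| "is_formula L n (Rel R ts) \<longleftrightarrow> length ts = rel_arity L R \<and> (\<forall>t\<in>set ts. is_term L n t)"
| "is_formula L n (Neg \<phi>) \<longleftrightarrow> is_formula L n \<phi>"
| "is_formula L n (Conj \<phi> \<psi>) \<longleftrightarrow> is_formula L n \<phi> \<and> is_formula L n \<psi>"
| "is_formula L n (Ex \<phi>) \<longleftrightarrow> is_formula L (Suc n) \<phi>"

text \<open>The \<open>L\<close>-formulas (without parameters) whose free variables are among \<open>0, \<dots>, n - 1\<close>.\<close>

definition formulas :: "('f, 'r) language \<Rightarrow> nat \<Rightarrow> ('f, 'r) fm set" where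
  "formulas L n = {\<phi>. is_formula L n \<phi>}"

record ('f, 'r, 'a) struct =
  univ :: "'a set"
  fun_int :: "'f \<Rightarrow> 'a list \<Rightarrow> 'a"
  rel_int :: "'r \<Rightarrow> 'a list \<Rightarrow> bool"

definition is_structure :: "('f, 'r) language \<Rightarrow> ('f, 'r, 'a) struct \<Rightarrow> bool" where
  "is_structure L M \<longleftrightarrow>
     univ M \<noteq> {} \<and> (\<forall>f. \<forall>as\<in>nlists (fun_arity L f) (univ M). fun_int M f as \<in> univ M)"

text \<open>The list \<open>e\<close> is the assignment: it gives the variable \<open>i\<close> the value \<open>e ! i\<close>.\<close>

primrec eval :: "('f, 'r, 'a) struct \<Rightarrow> 'a list \<Rightarrow> 'f tm \<Rightarrow> 'a" where
  "eval M e (Var i) = e ! i"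
| "eval M e (App f ts) = fun_int M f (map (eval M e) ts)"

fun sat :: "('f, 'r, 'a) struct \<Rightarrow> 'a list \<Rightarrow> ('f, 'r) fm \<Rightarrow> bool" where
  "sat M e (Eq s t) \<longleftrightarrow> eval M e s = eval M e t"
| "sat M e (Rel R ts) \<longleftrightarrow> rel_int M R (map (eval M e) ts)"
| "sat M e (Neg \<phi>) \<longleftrightarrow> \<not> sat M e \<phi>"
| "sat M e (Conj \<phi> \<psi>) \<longleftrightarrow> sat M e \<phi> \<and> sat M e \<psi>"
| "sat M e (Ex \<phi>) \<longleftrightarrow> (\<exists>c\<in>univ M. sat M (c # e) \<phi>)"

definition Th :: "('f, 'r) language \<Rightarrow> ('f, 'r, 'a) struct \<Rightarrow> ('f, 'r) fm set" where
  "Th L M = {\<phi> \<in> formulas L 0. sat M [] \<phi>}"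

definition is_model :: "('f, 'r) language \<Rightarrow> ('f, 'r, 'a) struct \<Rightarrow> ('f, 'r) fm set \<Rightarrow> bool" where
  "is_model L N T \<longleftrightarrow> is_structure L N \<and> (\<forall>\<phi>\<in>T. sat N [] \<phi>)"

text \<open>
  The set \<open>\<phi>(M\<^sup>m; b)\<close>. In a partitioned formula \<open>\<phi>(x; y)\<close> with \<open>|x| = m\<close> and \<open>|y| = n\<close> the tuple \<open>x\<close>
  consists of the variables \<open>0, \<dots>, m - 1\<close> and \<open>y\<close> of the variables \<open>m, \<dots>, m + n - 1\<close>.
\<close>

definition solutions :: "('f, 'r, 'a) struct \<Rightarrow> nat \<Rightarrow> ('f, 'r) fm \<Rightarrow> 'a list \<Rightarrow> 'a list set" where
  "solutions M m \<phi> b = {a \<in> nlists m (univ M). sat M (a @ b) \<phi>}"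


section \<open>O-minimal expansions of ordered groups\<close>

definition less_rel :: "('f, 'r, 'a) struct \<Rightarrow> 'r \<Rightarrow> ('a \<times> 'a) set" where
  "less_rel M lt = {(a, b) \<in> univ M \<times> univ M. rel_int M lt [a, b]}"

text \<open>
  The group is written with \<open>pl\<close> only, since its neutral element and inverses are determined by it. As
  usual for ordered groups, commutativity is not assumed and the order is invariant under translations
  on both sides.
\<close>

definition expands_ordered_group ::
  "('f, 'r) language \<Rightarrow> ('f, 'r, 'a) struct \<Rightarrow> 'r \<Rightarrow> 'f \<Rightarrow> bool" where
  "expands_ordered_group L M lt pl \<longleftrightarrow>
     is_structure L M \<and> rel_arity L lt = 2 \<and> fun_arity L pl = 2 \<and>
     strict_linear_order_on (univ M) (less_rel M lt) \<and>
     (\<exists>e. group \<lparr>carrier = univ M, mult = (\<lambda>a b. fun_int M pl [a, b]), one = e\<rparr>) \<and>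
     (\<forall>a b. (a, b) \<in> less_rel M lt \<longrightarrow> (\<forall>c\<in>univ M.
        (fun_int M pl [a, c], fun_int M pl [b, c]) \<in> less_rel M lt \<and>
        (fun_int M pl [c, a], fun_int M pl [c, b]) \<in> less_rel M lt))"

text \<open>Open intervals with end points in \<open>M \<union> {-\<infinity>, +\<infinity>}\<close>; \<open>None\<close> stands for an infinite end point.\<close>

definition open_interval ::
  "('f, 'r, 'a) struct \<Rightarrow> 'r \<Rightarrow> 'a option \<Rightarrow> 'a option \<Rightarrow> 'a set" where
  "open_interval M lt l u =
     {c \<in> univ M. (\<forall>a. l = Some a \<longrightarrow> (a, c) \<in> less_rel M lt) \<and>
                  (\<forall>b. u = Some b \<longrightarrow> (c, b) \<in> less_rel M lt)}"

definition o_minimal :: "('f, 'r) language \<Rightarrow> ('f, 'r, 'a) struct \<Rightarrow> 'r \<Rightarrow> bool" where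
  "o_minimal L M lt \<longleftrightarrow>
     is_structure L M \<and> rel_arity L lt = 2 \<and>
     strict_linear_order_on (univ M) (less_rel M lt) \<and>
     (\<forall>p. \<forall>\<phi>\<in>formulas L (Suc p). \<forall>b\<in>nlists p (univ M).
        \<exists>F. finite F \<and>
            F \<subseteq> {{a} | a. a \<in> univ M} \<union>
                {open_interval M lt l u | l u. set_option l \<subseteq> univ M \<and> set_option u \<subseteq> univ M} \<and>
            {a \<in> univ M. sat M (a # b) \<phi>} = \<Union>F)"


section \<open>Local modularity\<close>

definition acl :: "('f, 'r) language \<Rightarrow> ('f, 'r, 'a) struct \<Rightarrow> 'a set \<Rightarrow> 'a set" where
  "acl L M A =
     {c \<in> univ M. \<exists>p. \<exists>\<phi>\<in>formulas L (Suc p). \<exists>b\<in>nlists p A.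
        sat M (c # b) \<phi> \<and> finite {d \<in> univ M. sat M (d # b) \<phi>}}"

definition acl_closed :: "('f, 'r) language \<Rightarrow> ('f, 'r, 'a) struct \<Rightarrow> 'a set \<Rightarrow> bool" where
  "acl_closed L M A \<longleftrightarrow> A \<subseteq> univ M \<and> acl L M A = A"

definition acl_independent :: "('f, 'r) language \<Rightarrow> ('f, 'r, 'a) struct \<Rightarrow> 'a set \<Rightarrow> bool" where
  "acl_independent L M X \<longleftrightarrow> (\<forall>c\<in>X. c \<notin> acl L M (X - {c}))"

definition acl_basis :: "('f, 'r) language \<Rightarrow> ('f, 'r, 'a) struct \<Rightarrow> 'a set \<Rightarrow> 'a set \<Rightarrow> bool" where
  "acl_basis L M X A \<longleftrightarrow> X \<subseteq> A \<and> acl_independent L M X \<and> A \<subseteq> acl L M X"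

definition finite_dimensional :: "('f, 'r) language \<Rightarrow> ('f, 'r, 'a) struct \<Rightarrow> 'a set \<Rightarrow> bool" where
  "finite_dimensional L M A \<longleftrightarrow> (\<exists>X. finite X \<and> acl_basis L M X A)"

text \<open>
  The dimension is meaningful when \<open>acl\<close> is a pregeometry, that is, has the exchange property (which it
  has in every model of the theory of an o-minimal structure): all bases then have the same cardinality.
  It is only used for finite-dimensional sets. The set \<open>A\<close> need not be closed, so that
  \<open>acl_dim L M (A \<union> B)\<close> makes sense; it is the dimension of the closure of \<open>A \<union> B\<close>.
\<close>

definition acl_dim :: "('f, 'r) language \<Rightarrow> ('f, 'r, 'a) struct \<Rightarrow> 'a set \<Rightarrow> nat" where
  "acl_dim L M A = card (SOME X. acl_basis L M X A)"

definition acl_locally_modular :: "('f, 'r) language \<Rightarrow> ('f, 'r, 'a) struct \<Rightarrow> bool" where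
  "acl_locally_modular L M \<longleftrightarrow>
     (\<forall>A B. acl_closed L M A \<longrightarrow> acl_closed L M B \<longrightarrow>
        finite_dimensional L M A \<longrightarrow> finite_dimensional L M B \<longrightarrow> 0 < acl_dim L M (A \<inter> B) \<longrightarrow>
        acl_dim L M (A \<union> B) + acl_dim L M (A \<inter> B) = acl_dim L M A + acl_dim L M B)"

text \<open>
  HOL cannot quantify over the types of the universes of models, so the models considered are those
  whose universe is a subset of the type \<open>'u\<close>. If \<open>'u\<close> is infinite and has at least as many elements as
  the language has formulas, this is no restriction (for theories whose models have exchange): if \<open>A\<close>
  and \<open>B\<close> violate the modular law in a model \<open>N\<close>, then they do so in any elementary submodel of \<open>N\<close> which contains finite bases of \<open>A\<close>, \<open>B\<close> and
  \<open>A \<inter> B\<close> (\<open>acl\<close> of a subset of an elementary submodel is the same in both), and by the downward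
  Loewenheim-Skolem theorem there is such a submodel with at most as many elements as there are
  formulas.
\<close>

definition locally_modular_theory ::
  "'u itself \<Rightarrow> ('f, 'r) language \<Rightarrow> ('f, 'r) fm set \<Rightarrow> bool" where
  "locally_modular_theory _ L T \<longleftrightarrow>
     (\<forall>N :: ('f, 'r, 'u) struct. is_model L N T \<longrightarrow> acl_locally_modular L N)"

text \<open>
  A universe type for the models of the theory of a structure over \<open>'a\<close>. With \<open>\<kappa>\<close> the cardinality of
  the formulas together with \<open>'a\<close>, it has \<open>2\<^sup>\<kappa>\<close> elements: besides being large enough in the above sense,
  it has room for \<open>\<kappa>\<^sup>+\<close>-saturated elementary extensions of the structure.
\<close>

type_synonym ('f, 'r, 'a) model_universe = "(('f, 'r) fm + 'a) set"


section \<open>Distal cell decompositions\<close>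

definition crossed ::
  "('f, 'r, 'a) struct \<Rightarrow> nat \<Rightarrow> ('f, 'r) fm set \<Rightarrow> 'a list set \<Rightarrow> 'a list set \<Rightarrow> bool" where
  "crossed M m \<Phi> B X \<longleftrightarrow>
     (\<exists>\<phi>\<in>\<Phi>. \<exists>b\<in>B. X \<inter> solutions M m \<phi> b \<noteq> {} \<and> X - solutions M m \<phi> b \<noteq> {})"

text \<open>The data \<open>k\<close>, \<open>\<Psi>(x; y\<^sub>1, \<dots>, y\<^sub>k)\<close> and \<open>\<theta>\<^sub>\<psi>(y; y\<^sub>1, \<dots>, y\<^sub>k)\<close> for \<open>\<psi> \<in> \<Psi>\<close>.\<close>

record ('f, 'r) cell_data =
  num_params :: nat
  cell_fms :: "('f, 'r) fm set"
  excl_fm :: "('f, 'r) fm \<Rightarrow> ('f, 'r) fm"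

text \<open>The set \<open>\<T>(B)\<close>, where \<open>m = |x|\<close>; the list \<open>bs\<close> consists of the tuples \<open>b\<^sub>1, \<dots>, b\<^sub>k\<close>.\<close>

definition cells ::
  "('f, 'r, 'a) struct \<Rightarrow> nat \<Rightarrow> ('f, 'r) cell_data \<Rightarrow> 'a list set \<Rightarrow> 'a list set set" where
  "cells M m T B =
     {solutions M m \<psi> (concat bs) | \<psi> bs.
        \<psi> \<in> cell_fms T \<and> bs \<in> nlists (num_params T) B \<and>
        \<not> (\<exists>b\<in>B. sat M (b @ concat bs) (excl_fm T \<psi>))}"

definition distal_cell_decomposition ::
  "('f, 'r) language \<Rightarrow> ('f, 'r, 'a) struct \<Rightarrow> nat \<Rightarrow> nat \<Rightarrow> ('f, 'r) fm set \<Rightarrow>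
   ('f, 'r) cell_data \<Rightarrow> bool" where
  "distal_cell_decomposition L M m n \<Phi> T \<longleftrightarrow>
     finite (cell_fms T) \<and>
     cell_fms T \<subseteq> formulas L (m + num_params T * n) \<and>
     (\<forall>\<psi>\<in>cell_fms T. excl_fm T \<psi> \<in> formulas L (n + num_params T * n)) \<and>
     (\<forall>B. finite B \<longrightarrow> B \<noteq> {} \<longrightarrow> B \<subseteq> nlists n (univ M) \<longrightarrow>
        \<Union>(cells M m T B) = nlists m (univ M) \<and>
        (\<forall>\<Delta>\<in>cells M m T B. \<not> crossed M m \<Phi> B \<Delta>))"

definition has_exponent ::
  "('f, 'r, 'a) struct \<Rightarrow> nat \<Rightarrow> nat \<Rightarrow> ('f, 'r) cell_data \<Rightarrow> real \<Rightarrow> bool" where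
  "has_exponent M m n T r \<longleftrightarrow>
     (\<exists>C::real. \<forall>B. finite B \<longrightarrow> B \<noteq> {} \<longrightarrow> B \<subseteq> nlists n (univ M) \<longrightarrow>
        real (card (cells M m T B)) \<le> C * real (card B) powr r)"

end

theory Submission imports Defs
begin

text \<open>
  Uniform finiteness makes o-minimality a property of the theory, so that one can pass to an elementary
  extension. There let \<open>c\<close> be definable from tuples \<open>a, b\<close>, and let \<open>e\<close> and then \<open>t\<close> be larger than
  everything definable from \<open>a, b\<close> and from \<open>a, b, e\<close>. Local modularity, applied to the closures of
  \<open>a, e, t\<close> and \<open>b, e, t + c\<close>, yields a point \<open>H(a, t, e) = H'(b, t + c, e)\<close> which is not algebraic over
  \<open>b, e\<close>. The germ of \<open>H'(b, s, e)\<close> at infinity is monotone in \<open>s\<close>, hence \<open>c < x\<close> is equivalent to an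
  inequality between the germs of \<open>H(a, s - x, e)\<close> and \<open>H'(b, s, e)\<close>. As germs at infinity are linearly
  ordered and the second germ depends on \<open>b\<close> only, the solution sets of this inequality form a chain when
  \<open>b\<close> varies. Thus the chain formulas decide all cuts, and so, adding one coordinate at a time, the type
  of \<open>(a, b)\<close>. By compactness every \<open>\<phi>(x; y)\<close> is determined by finitely many chain formulas.

  A distal cell is cut out by the least member of each chain that contains it and the greatest one that
  does not. The nonempty cells over \<open>B\<close> are the types over \<open>B\<close>, of which there are \<open>O(|B|\<^sup>m)\<close>, since a point
  of the line has the type of a boundary point or of its right germ, and the boundary points number \<open>O(|B|)\<close>.
\<close>

section \<open>Renaming variables\<close>

text \<open>The aim is to separate variables: a comparison of \<open>x\<close> with a function of
  \<open>(a, b)\<close> has to become a comparison of something computed from \<open>(x, a)\<close>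
  with something computed from \<open>b\<close> alone. Local modularity yields such a separation
  only when the two closed sets share a nonalgebraic point, and the point \<open>e\<close> is there
  to provide one; \<open>t\<close> is the independent point that makes the common part grow. Neither
  may occur in the final formulas, so both are chosen generic at infinity, where truth at a point is
  the same as truth for all large points, and are then quantified away. The other obstacle is
  uniformity. The hypothesis bounds the number of intervals for each parameter separately, whereas
  the argument takes place in an ultrapower, which is not known to be o-minimal. The bound is proved
  for families with one parameter, and a tuple is reached by adjoining its entries one at a time to
  an elementary substructure that is o-minimal. Finally, a cell has two parameters for each chain,
  so counting parameters would give far too large an exponent; the exponent comes from counting
  types instead.\<close>

primrec tren :: "(nat \<Rightarrow> nat) \<Rightarrow> 'f tm \<Rightarrow> 'f tm" where
  "tren \<sigma> (Var i) = Var (\<sigma> i)"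
| "tren \<sigma> (App f ts) = App f (map (tren \<sigma>) ts)"

primrec ren :: "(nat \<Rightarrow> nat) \<Rightarrow> ('f, 'r) fm \<Rightarrow> ('f, 'r) fm" where
  "ren \<sigma> (Eq s t) = Eq (tren \<sigma> s) (tren \<sigma> t)"
| "ren \<sigma> (Rel R ts) = Rel R (map (tren \<sigma>) ts)"
| "ren \<sigma> (Neg \<phi>) = Neg (ren \<sigma> \<phi>)"
| "ren \<sigma> (Conj \<phi> \<psi>) = Conj (ren \<sigma> \<phi>) (ren \<sigma> \<psi>)"
| "ren \<sigma> (Ex \<phi>) = Ex (ren (case_nat 0 (\<lambda>i. Suc (\<sigma> i))) \<phi>)"

lemma is_term_tren: "is_term L n t \<Longrightarrow> (\<And>i. i < n \<Longrightarrow> \<sigma> i < k) \<Longrightarrow> is_term L k (tren \<sigma> t)"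
  by (induction t) auto

lemma is_formula_ren: "is_formula L n \<phi> \<Longrightarrow> (\<And>i. i < n \<Longrightarrow> \<sigma> i < k) \<Longrightarrow> is_formula L k (ren \<sigma> \<phi>)"
proof (induction \<phi> arbitrary: n k \<sigma>)
  case (Ex \<phi>)
  have "is_formula L (Suc k) (ren (case_nat 0 (\<lambda>i. Suc (\<sigma> i))) \<phi>)"
    by (rule Ex.IH[of "Suc n"]) (use Ex.prems in \<open>auto split: nat.splits\<close>)
  then show ?case by simp
qed (auto intro: is_term_tren)

lemma eval_tren: "is_term L n t \<Longrightarrow> (\<And>i. i < n \<Longrightarrow> e' ! i = e ! \<sigma> i) \<Longrightarrow> eval M e (tren \<sigma> t) = eval M e' t"
proof (induction t)
  case (App f ts)
  then have "map (\<lambda>t. eval M e (tren \<sigma> t)) ts = map (eval M e') ts" by auto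
  then show ?case by (simp only: tren.simps eval.simps map_map o_def)
qed auto

lemma sat_ren:
  "is_formula L n \<phi> \<Longrightarrow> (\<And>i. i < n \<Longrightarrow> e' ! i = e ! \<sigma> i) \<Longrightarrow> sat M e (ren \<sigma> \<phi>) \<longleftrightarrow> sat M e' \<phi>"
proof (induction \<phi> arbitrary: n e e' \<sigma>)
  case (Rel R ts)
  then have "map (\<lambda>t. eval M e (tren \<sigma> t)) ts = map (eval M e') ts" by (auto intro: eval_tren)
  then show ?case by (simp only: ren.simps sat.simps map_map o_def)
next
  case (Ex \<phi>)
  have "sat M (c # e) (ren (case_nat 0 (\<lambda>i. Suc (\<sigma> i))) \<phi>) \<longleftrightarrow> sat M (c # e') \<phi>" for c
    by (rule Ex.IH[of "Suc n"]) (use Ex.prems in \<open>auto simp: nth_Cons split: nat.splits\<close>)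
  then show ?case by simp
next
  case (Eq s t)
  then show ?case using eval_tren[of L n s e' e \<sigma> M] eval_tren[of L n t e' e \<sigma> M] by auto
next
  case (Conj \<phi> \<psi>)
  then show ?case by (metis is_formula.simps(4) ren.simps(4) sat.simps(4))
next
  case (Neg \<phi>)
  then show ?case by (metis is_formula.simps(3) ren.simps(3) sat.simps(3))
qed

text \<open>Padding, permuting and identifying variables are all given by a list of targets, so this
  is the only form of renaming needed further on.\<close>

definition sub :: "nat list \<Rightarrow> ('f, 'r) fm \<Rightarrow> ('f, 'r) fm" where
  "sub vs = ren (\<lambda>i. vs ! i)"

lemma sub_formulas: "\<phi> \<in> formulas L (length vs) \<Longrightarrow> (\<And>v. v \<in> set vs \<Longrightarrow> v < k) \<Longrightarrow> sub vs \<phi> \<in> formulas L k"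
  unfolding formulas_def sub_def by (auto intro!: is_formula_ren)

lemma sat_sub: "\<phi> \<in> formulas L (length vs) \<Longrightarrow> sat M e (sub vs \<phi>) \<longleftrightarrow> sat M (map ((!) e) vs) \<phi>"
  unfolding formulas_def sub_def by (auto intro!: sat_ren)

lemma sat_sub':
  assumes "\<phi> \<in> formulas L (length vs)" "length e' = length vs" "\<And>i. i < length vs \<Longrightarrow> e ! (vs ! i) = e' ! i"
  shows "sat M e (sub vs \<phi>) \<longleftrightarrow> sat M e' \<phi>"
proof -
  have "map ((!) e) vs = e'" using assms by (auto intro!: nth_equalityI)
  then show ?thesis using sat_sub[OF assms(1), of M e] by simp
qed

section \<open>Derived connectives and blocks of quantifiers\<close>

abbreviation All :: "('f, 'r) fm \<Rightarrow> ('f, 'r) fm" where "All \<phi> \<equiv> Neg (Ex (Neg \<phi>))"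
abbreviation Disj :: "('f, 'r) fm \<Rightarrow> ('f, 'r) fm \<Rightarrow> ('f, 'r) fm" where
  "Disj \<phi> \<psi> \<equiv> Neg (Conj (Neg \<phi>) (Neg \<psi>))"
abbreviation Imp :: "('f, 'r) fm \<Rightarrow> ('f, 'r) fm \<Rightarrow> ('f, 'r) fm" where
  "Imp \<phi> \<psi> \<equiv> Neg (Conj \<phi> (Neg \<psi>))"
abbreviation Iff :: "('f, 'r) fm \<Rightarrow> ('f, 'r) fm \<Rightarrow> ('f, 'r) fm" where
  "Iff \<phi> \<psi> \<equiv> Conj (Imp \<phi> \<psi>) (Imp \<psi> \<phi>)"
abbreviation Tr :: "('f, 'r) fm" where "Tr \<equiv> Ex (Eq (Var 0) (Var 0))"

definition Conjs :: "('f, 'r) fm list \<Rightarrow> ('f, 'r) fm" where "Conjs \<phi>s = foldr Conj \<phi>s (All (Eq (Var 0) (Var 0)))"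

lemma sat_Conjs: "sat M e (Conjs \<phi>s) \<longleftrightarrow> (\<forall>\<phi>\<in>set \<phi>s. sat M e \<phi>)"
  unfolding Conjs_def by (induction \<phi>s) auto

lemma Conjs_formulas: "set \<phi>s \<subseteq> formulas L n \<Longrightarrow> Conjs \<phi>s \<in> formulas L n"
  unfolding Conjs_def formulas_def by (induction \<phi>s) auto

primrec Exs :: "nat \<Rightarrow> ('f, 'r) fm \<Rightarrow> ('f, 'r) fm" where
  "Exs 0 \<phi> = \<phi>" | "Exs (Suc k) \<phi> = Exs k (Ex \<phi>)"

abbreviation Alls :: "nat \<Rightarrow> ('f, 'r) fm \<Rightarrow> ('f, 'r) fm" where "Alls k \<phi> \<equiv> Neg (Exs k (Neg \<phi>))"

lemma sat_Exs: "sat M e (Exs k \<phi>) \<longleftrightarrow> (\<exists>xs\<in>nlists k (univ M). sat M (xs @ e) \<phi>)"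
proof (induction k arbitrary: \<phi>)
  case (Suc k)
  have "sat M e (Exs (Suc k) \<phi>) \<longleftrightarrow> (\<exists>xs\<in>nlists k (univ M). \<exists>c\<in>univ M. sat M (c # xs @ e) \<phi>)"
    by (simp add: Suc.IH)
  also have "\<dots> \<longleftrightarrow> (\<exists>xs\<in>nlists (Suc k) (univ M). sat M (xs @ e) \<phi>)"
    by (simp add: nlists_Suc) blast
  finally show ?case .
qed auto

lemma Exs_formulas: "\<phi> \<in> formulas L (k + n) \<Longrightarrow> Exs k \<phi> \<in> formulas L n"
  by (induction k arbitrary: \<phi>) (auto simp: formulas_def)

lemma Exs_inject: "Exs k \<phi> = Exs k \<psi> \<longleftrightarrow> \<phi> = \<psi>"
  by (induction k arbitrary: \<phi> \<psi>) auto

lemma formulas_simps [simp]: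
  "Neg \<phi> \<in> formulas L n \<longleftrightarrow> \<phi> \<in> formulas L n"
  "Conj \<phi> \<psi> \<in> formulas L n \<longleftrightarrow> \<phi> \<in> formulas L n \<and> \<psi> \<in> formulas L n"
  "Ex \<phi> \<in> formulas L n \<longleftrightarrow> \<phi> \<in> formulas L (Suc n)"
  "Eq s t \<in> formulas L n \<longleftrightarrow> is_term L n s \<and> is_term L n t"
  "Rel R ts \<in> formulas L n \<longleftrightarrow> length ts = rel_arity L R \<and> (\<forall>t\<in>set ts. is_term L n t)"
  by (auto simp: formulas_def)

section \<open>Definable predicates\<close>

text \<open>
  A predicate on variable assignments \<open>nat \<Rightarrow> 'a\<close> is definable over \<open>A\<close> if it is given by a formula
  each of whose variables is replaced by a variable or by a parameter from \<open>A\<close>.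
\<close>

locale str =
  fixes L :: "('f, 'r) language" and S :: "('f, 'r, 'a) struct"
  assumes is_str: "is_structure L S"
begin

abbreviation U :: "'a set" where "U \<equiv> univ S"

definition env :: "(nat \<Rightarrow> 'a) \<Rightarrow> bool" where "env e \<longleftrightarrow> (\<forall>i. e i \<in> U)"

definition vl :: "(nat \<Rightarrow> 'a) \<Rightarrow> nat + 'a \<Rightarrow> 'a" where
  "vl e v = (case v of Inl i \<Rightarrow> e i | Inr a \<Rightarrow> a)"

lemma vl_simps [simp]: "vl e (Inl i) = e i" "vl e (Inr a) = a"
  by (auto simp: vl_def)

definition Def :: "'a set \<Rightarrow> ((nat \<Rightarrow> 'a) \<Rightarrow> bool) \<Rightarrow> bool" where
  "Def A P \<longleftrightarrow> (\<exists>vs \<phi>. \<phi> \<in> formulas L (length vs) \<and> (\<forall>a. Inr a \<in> set vs \<longrightarrow> a \<in> A) \<and>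
      (\<forall>e. env e \<longrightarrow> P e = sat S (map (vl e) vs) \<phi>))"

lemma env_nth: "env e \<Longrightarrow> e i \<in> U" by (auto simp: env_def)

lemma env_case_nat: "env (case_nat c e) \<longleftrightarrow> c \<in> U \<and> env e"
proof
  assume "env (case_nat c e)"
  then have "case_nat c e 0 \<in> U" "case_nat c e (Suc i) \<in> U" for i unfolding env_def by blast+
  then show "c \<in> U \<and> env e" by (auto simp: env_def)
qed (auto simp: env_def split: nat.splits)

lemma env_Suc: "env e \<Longrightarrow> env (\<lambda>i. e (Suc i))" by (auto simp: env_def)

lemma U_ne: "U \<noteq> {}" using is_str by (auto simp: is_structure_def)

lemma DefI: "\<phi> \<in> formulas L (length vs) \<Longrightarrow> (\<And>a. Inr a \<in> set vs \<Longrightarrow> a \<in> A) \<Longrightarrow>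
   (\<And>e. env e \<Longrightarrow> P e = sat S (map (vl e) vs) \<phi>) \<Longrightarrow> Def A P"
  unfolding Def_def by blast

lemma DefE: assumes "Def A P"
  obtains \<phi> vs where "\<phi> \<in> formulas L (length vs)" "\<forall>a. Inr a \<in> set vs \<longrightarrow> a \<in> A"
   "\<forall>e. env e \<longrightarrow> P e = sat S (map (vl e) vs) \<phi>"
  using assms unfolding Def_def by blast

lemma Def_cong: "Def A P \<Longrightarrow> (\<And>e. env e \<Longrightarrow> P e = Q e) \<Longrightarrow> Def A Q"
  unfolding Def_def by fastforce

lemma Def_sat: assumes "\<phi> \<in> formulas L (length vs)" "\<And>a. Inr a \<in> set vs \<Longrightarrow> a \<in> A"
  shows "Def A (\<lambda>e. sat S (map (vl e) vs) \<phi>)"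
  using assms unfolding Def_def by blast

lemma Def_mono: "Def A P \<Longrightarrow> A \<subseteq> B \<Longrightarrow> Def B P"
  unfolding Def_def by fastforce

lemma Def_params: assumes "Def A P" obtains xs where "set xs \<subseteq> A" "Def (set xs) P"
proof -
  obtain vs \<phi> where *: "\<phi> \<in> formulas L (length vs)" "\<forall>a. Inr a \<in> set vs \<longrightarrow> a \<in> A"
   "\<forall>e. env e \<longrightarrow> P e = sat S (map (vl e) vs) \<phi>" using assms by (rule DefE) (rule that)
  have f: "finite {a. Inr a \<in> set vs}" by (rule finite_subset[of _ "projr ` set vs"]) force+
  then obtain xs where xs: "set xs = {a. Inr a \<in> set vs}" using finite_list by blast
  show thesis by (rule that[of xs]) (use * xs in \<open>auto intro!: DefI[of \<phi> vs]\<close>)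
qed

lemma Def_not: "Def A P \<Longrightarrow> Def A (\<lambda>e. \<not> P e)"
  by (erule DefE) (rule DefI[of "Neg _"], auto)

lemma Def_conj: assumes "Def A P" "Def A Q" shows "Def A (\<lambda>e. P e \<and> Q e)"
proof -
  obtain vs \<phi> where 1: "\<phi> \<in> formulas L (length vs)" "\<forall>a. Inr a \<in> set vs \<longrightarrow> a \<in> A"
   "\<forall>e. env e \<longrightarrow> P e = sat S (map (vl e) vs) \<phi>" using assms(1) by (rule DefE) (rule that)
  obtain ws \<psi> where 2: "\<psi> \<in> formulas L (length ws)" "\<forall>a. Inr a \<in> set ws \<longrightarrow> a \<in> A"
   "\<forall>e. env e \<longrightarrow> Q e = sat S (map (vl e) ws) \<psi>" using assms(2) by (rule DefE) (rule that)
  let ?a = "sub [0..<length vs] \<phi>" and ?b = "sub [length vs..<length vs + length ws] \<psi>"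
  have a: "sat S (map (vl e) (vs @ ws)) ?a = sat S (map (vl e) vs) \<phi>" for e
    by (rule sat_sub') (use 1 in \<open>auto simp: nth_append\<close>)
  have b: "sat S (map (vl e) (vs @ ws)) ?b = sat S (map (vl e) ws) \<psi>" for e
    by (rule sat_sub') (use 2 in \<open>auto simp: nth_append\<close>)
  show ?thesis
  proof (rule DefI[of "Conj ?a ?b" "vs @ ws"])
    show "Conj ?a ?b \<in> formulas L (length (vs @ ws))"
      using 1 2 by (auto intro!: sub_formulas)
  qed (use 1 2 in \<open>auto simp only: sat.simps a b set_append\<close>)
qed

text \<open>A variable may stand at several positions of \<open>vs\<close> or at none, so every
  position that holds variable 0 is redirected to the newly bound variable.\<close>

lemma Def_ex: assumes "Def A (\<lambda>e. P (\<lambda>i. e (Suc i)) (e 0))" shows "Def A (\<lambda>e. \<exists>c\<in>U. P e c)"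
proof -
  obtain vs \<phi> where 1: "\<phi> \<in> formulas L (length vs)" "\<forall>a. Inr a \<in> set vs \<longrightarrow> a \<in> A"
   "\<forall>e. env e \<longrightarrow> P (\<lambda>i. e (Suc i)) (e 0) = sat S (map (vl e) vs) \<phi>" using assms by (rule DefE) (rule that)
  \<comment> \<open>At the positions of variable 0 the entry \<open>Inl (0 - 1)\<close>, that is
    \<open>Inl 0\<close>, is a dummy: \<open>us\<close> sends these positions to the bound variable
    instead.\<close>
  define vs' where "vs' = map (\<lambda>v. case v of Inl i \<Rightarrow> Inl (i - 1) | Inr a \<Rightarrow> Inr a) vs"
  define us where "us = map (\<lambda>i. if vs ! i = Inl 0 then 0 else Suc i) [0..<length vs]"
  have s: "sat S (c # map (vl e) vs') (sub us \<phi>) \<longleftrightarrow> sat S (map (vl (case_nat c e)) vs) \<phi>" for c e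
  proof (rule sat_sub')
    fix i assume i: "i < length us"
    show "(c # map (vl e) vs') ! (us ! i) = map (vl (case_nat c e)) vs ! i"
      using i by (cases "vs ! i") (auto simp: us_def vs'_def split: nat.splits)
  qed (use 1 in \<open>auto simp: us_def\<close>)
  show ?thesis
  proof (rule DefI[of "Ex (sub us \<phi>)" vs'])
    show "Ex (sub us \<phi>) \<in> formulas L (length vs')"
      using 1 by (auto intro!: sub_formulas simp: us_def vs'_def split: if_splits)
    show "a \<in> A" if "Inr a \<in> set vs'" for a using that 1(2) by (auto simp: vs'_def split: sum.splits)
    fix e assume e: "env e"
    have "P e c = sat S (map (vl (case_nat c e)) vs) \<phi>" if "c \<in> U" for c
      using 1(3)[rule_format, of "case_nat c e"] e that by (simp add: env_case_nat)
    then show "(\<exists>c\<in>U. P e c) = sat S (map (vl e) vs') (Ex (sub us \<phi>))" using s by auto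
  qed
qed

lemma Def_reindex: assumes "Def A P" shows "Def A (\<lambda>e. P (\<lambda>i. e (\<sigma> i)))"
proof -
  obtain vs \<phi> where 1: "\<phi> \<in> formulas L (length vs)" "\<forall>a. Inr a \<in> set vs \<longrightarrow> a \<in> A"
   "\<forall>e. env e \<longrightarrow> P e = sat S (map (vl e) vs) \<phi>" using assms by (rule DefE) (rule that)
  let ?vs = "map (map_sum \<sigma> id) vs"
  have m: "map (vl e) ?vs = map (vl (\<lambda>i. e (\<sigma> i))) vs" for e
    by (auto simp: vl_def split: sum.splits)
  show ?thesis
  proof (rule DefI[of \<phi> ?vs])
    show "a \<in> A" if "Inr a \<in> set ?vs" for a
    proof -
      from that obtain v where v: "v \<in> set vs" "Inr a = map_sum \<sigma> id v" by auto
      from v(2) have "v = Inr a" by (cases v) auto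
      then show ?thesis using 1(2) v by blast
    qed
    show "P (\<lambda>i. e (\<sigma> i)) = sat S (map (vl e) ?vs) \<phi>" if "env e" for e
      using 1(3)[rule_format, of "\<lambda>i. e (\<sigma> i)"] that unfolding m by (auto simp: env_def)
  qed (use 1 in auto)
qed

lemma Def_True [simp]: "Def A (\<lambda>e. True)"
  by (rule DefI[of Tr "[]"]) (use U_ne in auto)

lemma Def_const: "Def A (\<lambda>e. b)"
  using Def_not[OF Def_True, of A] Def_True[of A] by (cases b) simp_all

lemma Def_disj: "Def A P \<Longrightarrow> Def A Q \<Longrightarrow> Def A (\<lambda>e. P e \<or> Q e)"
  using Def_not[OF Def_conj[OF Def_not[of A P] Def_not[of A Q]]] by simp

lemma Def_imp: "Def A P \<Longrightarrow> Def A Q \<Longrightarrow> Def A (\<lambda>e. P e \<longrightarrow> Q e)"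
  using Def_disj[OF Def_not[of A P], of Q] unfolding imp_conv_disj .

lemma Def_iff: "Def A P \<Longrightarrow> Def A Q \<Longrightarrow> Def A (\<lambda>e. P e = Q e)"
  by (rule Def_cong[of A "\<lambda>e. (P e \<longrightarrow> Q e) \<and> (Q e \<longrightarrow> P e)"])
    (rule Def_conj Def_imp | assumption | blast)+

lemma Def_all: assumes "Def A (\<lambda>e. P (\<lambda>i. e (Suc i)) (e 0))" shows "Def A (\<lambda>e. \<forall>c\<in>U. P e c)"
proof -
  have "Def A (\<lambda>e. \<not> P (\<lambda>i. e (Suc i)) (e 0))" by (rule Def_not) (rule assms)
  then have "Def A (\<lambda>e. \<exists>c\<in>U. \<not> P e c)" by (rule Def_ex[of A "\<lambda>e c. \<not> P e c"])
  from Def_not[OF this] show ?thesis by simp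
qed

section \<open>Definable functions\<close>

text \<open>The graph has the value in variable 0 and the arguments behind it, so that
  \<open>Def_ex\<close> can bind the value when a function is substituted into a predicate.\<close>

definition T :: "'a set \<Rightarrow> ((nat \<Rightarrow> 'a) \<Rightarrow> 'a) \<Rightarrow> bool" where
  "T A t \<longleftrightarrow> (\<forall>e. env e \<longrightarrow> t e \<in> U) \<and> Def A (\<lambda>e. e 0 = t (\<lambda>i. e (Suc i)))"

lemma T_in: "T A t \<Longrightarrow> env e \<Longrightarrow> t e \<in> U" by (auto simp: T_def)

lemma T_var: "T A (\<lambda>e. e k)"
  unfolding T_def by (auto intro!: DefI[of "Eq (Var 0) (Var 1)" "[Inl 0, Inl (Suc k)]"] simp: env_nth)

lemma T_const: "c \<in> A \<Longrightarrow> c \<in> U \<Longrightarrow> T A (\<lambda>e. c)"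
  unfolding T_def by (auto intro!: DefI[of "Eq (Var 0) (Var 1)" "[Inl 0, Inr c]"])

text \<open>Substitution is existential quantification over the graph. With this rule and the
  following ones definability is read off from the shape of a predicate, and hardly any formula has
  to be written out.\<close>

lemma Def_subst1: assumes "Def A (\<lambda>e. P (e 0))" "T A s" shows "Def A (\<lambda>e. P (s e))"
proof -
  have "Def A (\<lambda>e. \<exists>x\<in>U. x = s e \<and> P x)"
    using assms(2)[unfolded T_def] by (intro Def_ex Def_conj assms(1)) blast
  then show ?thesis by (rule Def_cong) (use T_in[OF assms(2)] in auto)
qed

lemma T_lift: assumes "T A s" shows "T A (\<lambda>e. s (\<lambda>i. e (\<sigma> i)))"
proof -
  have "Def A (\<lambda>e. e 0 = s (\<lambda>i. e (Suc (\<sigma> i))))"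
    using Def_reindex[of A "\<lambda>e. e 0 = s (\<lambda>i. e (Suc i))" "case_nat 0 (\<lambda>i. Suc (\<sigma> i))"] assms
    by (simp add: T_def)
  then show ?thesis using assms by (auto simp: T_def env_def)
qed

lemma Def_subst2: assumes "Def A (\<lambda>e. P (e 0) (e 1))" "T A s" "T A t" shows "Def A (\<lambda>e. P (s e) (t e))"
proof -
  have "Def A (\<lambda>e. \<exists>x\<in>U. x = s e \<and> (\<exists>y\<in>U. y = t e \<and> P x y))"
  proof (intro Def_ex Def_conj)
    show "Def A (\<lambda>e. e 0 = s (\<lambda>i. e (Suc i)))" using assms(2) by (simp add: T_def)
    show "Def A (\<lambda>e. e 0 = t (\<lambda>i. e (Suc (Suc i))))"
      using Def_reindex[of A "\<lambda>e. e 0 = t (\<lambda>i. e (Suc i))" "case_nat 0 (\<lambda>i. Suc (Suc i))"] assms(3)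
      by (simp add: T_def)
    show "Def A (\<lambda>e. P (e (Suc 0)) (e 0))"
      using Def_reindex[OF assms(1), of "case_nat 1 (\<lambda>_. 0)"] by simp
  qed
  then show ?thesis by (rule Def_cong) (use T_in[OF assms(2)] T_in[OF assms(3)] in auto)
qed

lemma Def_subst3: assumes "Def A (\<lambda>e. P (e 0) (e 1) (e 2))" "T A s" "T A t" "T A u"
  shows "Def A (\<lambda>e. P (s e) (t e) (u e))"
proof -
  have "Def A (\<lambda>e. \<exists>x\<in>U. x = s e \<and> (\<exists>y\<in>U. y = t e \<and> (\<exists>z\<in>U. z = u e \<and> P x y z)))"
  proof (intro Def_ex Def_conj)
    show "Def A (\<lambda>e. e 0 = s (\<lambda>i. e (Suc i)))" using assms(2) by (simp add: T_def)
    show "Def A (\<lambda>e. e 0 = t (\<lambda>i. e (Suc (Suc i))))"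
      using Def_reindex[of A "\<lambda>e. e 0 = t (\<lambda>i. e (Suc i))" "case_nat 0 (\<lambda>i. Suc (Suc i))"] assms(3)
      by (simp add: T_def)
    show "Def A (\<lambda>e. e 0 = u (\<lambda>i. e (Suc (Suc (Suc i)))))"
      using Def_reindex[of A "\<lambda>e. e 0 = u (\<lambda>i. e (Suc i))" "case_nat 0 (\<lambda>i. Suc (Suc (Suc i)))"] assms(4)
      by (simp add: T_def)
    show "Def A (\<lambda>e. P (e (Suc (Suc 0))) (e (Suc 0)) (e 0))"
      using Def_reindex[OF assms(1), of "\<lambda>i. if i = 0 then 2 else if i = 1 then 1 else 0"]
      by (simp add: numeral_2_eq_2)
  qed
  then show ?thesis by (rule Def_cong) (use T_in[OF assms(2)] T_in[OF assms(3)] T_in[OF assms(4)] in auto)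
qed

lemma Def_eq: "T A s \<Longrightarrow> T A t \<Longrightarrow> Def A (\<lambda>e. s e = t e)"
  by (rule Def_subst2[of A "\<lambda>x y. x = y" s t]) (rule DefI[of "Eq (Var 0) (Var 1)" "[Inl 0, Inl 1]"], auto)

lemma T_the: assumes "Def A (\<lambda>e. P (\<lambda>i. e (Suc i)) (e 0))" "\<And>e. env e \<Longrightarrow> t e \<in> U \<and> (\<forall>y\<in>U. P e y \<longleftrightarrow> y = t e)"
  shows "T A t"
proof -
  have "Def A (\<lambda>e. e 0 = t (\<lambda>i. e (Suc i)))"
    by (rule Def_cong[OF assms(1)]) (use assms(2) env_Suc env_nth in blast)
  then show ?thesis using assms(2) by (simp add: T_def)
qed

lemma Def_ball: "finite I \<Longrightarrow> (\<And>i. i \<in> I \<Longrightarrow> Def A (P i)) \<Longrightarrow> Def A (\<lambda>e. \<forall>i\<in>I. P i e)"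
proof (induction I rule: finite_induct)
  case (insert i I)
  have "Def A (\<lambda>e. P i e \<and> (\<forall>i\<in>I. P i e))" by (rule Def_conj) (use insert in auto)
  then show ?case by simp
qed simp

text \<open>Trades a parameter for a variable, so that a fact about one parameter becomes a family
  indexed by it. Both \<open>Def_drop_dcl\<close> and \<open>exchange\<close> depend on
  this.\<close>

lemma Def_insert: assumes "Def (insert c A) P" "c \<in> U"
  obtains Q where "Def A Q" "\<And>e. env e \<Longrightarrow> P e \<longleftrightarrow> Q (case_nat c e)"
proof -
  obtain vs \<phi> where 1: "\<phi> \<in> formulas L (length vs)" "\<forall>a. Inr a \<in> set vs \<longrightarrow> a \<in> insert c A"
   "\<forall>e. env e \<longrightarrow> P e = sat S (map (vl e) vs) \<phi>" using assms(1) by (rule DefE) (rule that)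
  let ?g = "\<lambda>v. case v of Inl i \<Rightarrow> Inl (Suc i) | Inr a \<Rightarrow> if a = c then Inl 0 else Inr a"
  have m: "map (vl (case_nat c e)) (map ?g vs) = map (vl e) vs" for e
    by (auto split: sum.splits)
  show thesis
  proof (rule that[of "\<lambda>e. sat S (map (vl e) (map ?g vs)) \<phi>"])
    show "Def A (\<lambda>e. sat S (map (vl e) (map ?g vs)) \<phi>)"
    proof (rule Def_sat)
      fix a assume "Inr a \<in> set (map ?g vs)"
      then obtain v where v: "v \<in> set vs" "Inr a = ?g v" by auto
      then have "v = Inr a" "a \<noteq> c" by (auto split: sum.splits if_splits)
      then show "a \<in> A" using 1(2) v by blast
    qed (use 1 in auto)
    show "P e \<longleftrightarrow> sat S (map (vl (case_nat c e)) (map ?g vs)) \<phi>" if "env e" for e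
      unfolding m using 1(3) that by simp
  qed
qed

section \<open>Definable closure\<close>

text \<open>Takes the place of algebraic closure: in the presence of an order every element of a
  finite definable set is definable, so the two closures agree (\<open>acl_dcl\<close>).\<close>

definition dcl :: "'a set \<Rightarrow> 'a set" where "dcl A = {c \<in> U. Def A (\<lambda>e. e 0 = c)}"

lemma dcl_T: "c \<in> dcl A \<Longrightarrow> T A (\<lambda>e. c)"
  by (auto simp: dcl_def T_def)

lemma dcl_mono: "A \<subseteq> B \<Longrightarrow> dcl A \<subseteq> dcl B"
  by (auto simp: dcl_def intro: Def_mono)

lemma dcl_extensive: "A \<subseteq> U \<Longrightarrow> A \<subseteq> dcl A"
  unfolding dcl_def by (auto intro!: DefI[of "Eq (Var 0) (Var 1)" "[Inl 0, Inr _]"])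

lemma dcl_U: "dcl A \<subseteq> U" by (auto simp: dcl_def)

text \<open>A definable parameter is turned into a variable, and this variable is bound together
  with its definition.\<close>

lemma Def_drop_dcl: "finite C \<Longrightarrow> C \<subseteq> dcl A \<Longrightarrow> Def (C \<union> A) P \<Longrightarrow> Def A P"
proof (induction C arbitrary: P rule: finite_induct)
  case (insert c C)
  then have c: "c \<in> U" "Def A (\<lambda>e. e 0 = c)" by (auto simp: dcl_def)
  obtain Q where Q: "Def (C \<union> A) Q" "\<And>e. env e \<Longrightarrow> P e \<longleftrightarrow> Q (case_nat c e)"
    using Def_insert[of c "C \<union> A" P] insert.prems c by auto
  have "Def A Q" using insert Q(1) by auto
  moreover have "(case_nat (e 0) (\<lambda>i. e (Suc i))) = e" for e :: "nat \<Rightarrow> 'a" by (auto split: nat.splits)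
  ultimately have "Def A (\<lambda>e. \<exists>x\<in>U. x = c \<and> Q (case_nat x e))"
    using c(2) by (intro Def_ex Def_conj) auto
  then show ?case by (rule Def_cong) (use Q c in auto)
qed auto

lemma Def_dcl: assumes "Def (dcl A) P" shows "Def A P"
proof -
  obtain xs where "set xs \<subseteq> dcl A" "Def (set xs) P" using assms by (rule Def_params)
  then show ?thesis using Def_drop_dcl[of "set xs" A P] Def_mono[of "set xs" P "set xs \<union> A"] by auto
qed

lemma dcl_idem: "dcl (dcl A) = dcl A"
proof
  show "dcl A \<subseteq> dcl (dcl A)" by (rule dcl_extensive) (rule dcl_U)
  show "dcl (dcl A) \<subseteq> dcl A"
  proof
    fix c assume "c \<in> dcl (dcl A)"
    then have "c \<in> U" and d: "Def (dcl A) (\<lambda>e. e 0 = c)" unfolding dcl_def[of "dcl A"] by blast+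
    then show "c \<in> dcl A" using Def_dcl[OF d] unfolding dcl_def[of A] by simp
  qed
qed

lemma Def_sat_params: assumes "\<phi> \<in> formulas L (Suc (length xs))" "set xs \<subseteq> A"
  shows "Def A (\<lambda>e. sat S (e 0 # xs) \<phi>)"
proof -
  have "map (vl e) (Inl 0 # map Inr xs) = e 0 # xs" for e by (induction xs) auto
  then show ?thesis using Def_sat[of \<phi> "Inl 0 # map Inr xs" A] assms by auto
qed

text \<open>The way back from \<open>Def\<close> to syntax with the parameters in a prescribed
  order, needed whenever a property has to be expressed for other parameters or in another
  structure.\<close>

lemma Def_params_formula: assumes "Def (set xs) (\<lambda>e. P (e 0))"
  obtains \<phi> where "\<phi> \<in> formulas L (Suc (length xs))" "\<forall>u\<in>U. P u \<longleftrightarrow> sat S (u # xs) \<phi>"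
proof -
  obtain vs \<phi> where 1: "\<phi> \<in> formulas L (length vs)" "\<forall>a. Inr a \<in> set vs \<longrightarrow> a \<in> set xs"
   "\<forall>e. env e \<longrightarrow> P (e 0) = sat S (map (vl e) vs) \<phi>" using assms by (rule DefE) (rule that)
  have "\<forall>a\<in>{a. Inr a \<in> set vs}. \<exists>i. i < length xs \<and> xs ! i = a"
    using 1(2) by (simp add: in_set_conv_nth)
  then obtain ix where "\<forall>a\<in>{a. Inr a \<in> set vs}. ix a < length xs \<and> xs ! (ix a) = a" by (rule bchoice[THEN exE])
  then have ix: "\<And>a. Inr a \<in> set vs \<Longrightarrow> ix a < length xs \<and> xs ! (ix a) = a" by simp
  define us where "us = map (\<lambda>v. case v of Inl i \<Rightarrow> 0 | Inr a \<Rightarrow> Suc (ix a)) vs"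
  show thesis
  proof (rule that[of "sub us \<phi>"])
    show "sub us \<phi> \<in> formulas L (Suc (length xs))"
      using 1(1) ix by (auto intro!: sub_formulas simp: us_def split: sum.splits)
    show "\<forall>u\<in>U. P u \<longleftrightarrow> sat S (u # xs) (sub us \<phi>)"
    proof
    fix u assume u: "u \<in> U"
    have "sat S (u # xs) (sub us \<phi>) \<longleftrightarrow> sat S (map (vl (\<lambda>_. u)) vs) \<phi>"
    proof (rule sat_sub')
      fix i assume i: "i < length us"
      then have m: "vs ! i \<in> set vs" by (auto simp: us_def)
      show "(u # xs) ! (us ! i) = map (vl (\<lambda>_. u)) vs ! i"
      proof (cases "vs ! i")
        case (Inr a)
        then have "xs ! ix a = a" using ix m by simp
        then show ?thesis using i Inr by (simp add: us_def)
      qed (use i in \<open>simp add: us_def\<close>)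
    qed (use 1 in \<open>auto simp: us_def\<close>)
    also have "\<dots> = P u" using 1(3)[rule_format, of "\<lambda>_. u"] u by (auto simp: env_def)
    finally show "P u \<longleftrightarrow> sat S (u # xs) (sub us \<phi>)" by simp
    qed
  qed
qed

text \<open>The representing formula may mention variables on which \<open>P\<close> does not
  depend. All of them are identified with one variable, which is bound existentially; the value is
  irrelevant and exists because the universe is nonempty.\<close>

lemma Def_formula: assumes "Def {} P" "\<And>e e'. env e \<Longrightarrow> env e' \<Longrightarrow> (\<And>i. i < n \<Longrightarrow> e i = e' i) \<Longrightarrow> P e = P e'"
  obtains \<phi> where "\<phi> \<in> formulas L n"
    "\<forall>xs e. xs \<in> nlists n U \<longrightarrow> env e \<longrightarrow> (\<forall>i<n. e i = xs ! i) \<longrightarrow> (P e \<longleftrightarrow> sat S xs \<phi>)"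
proof -
  obtain vs \<phi> where 1: "\<phi> \<in> formulas L (length vs)" "\<forall>a. Inr a \<in> set vs \<longrightarrow> a \<in> {}"
   "\<forall>e. env e \<longrightarrow> P e = sat S (map (vl e) vs) \<phi>" using assms(1) by (rule DefE) (rule that)
  define us where "us = map (\<lambda>v. if projl v < n then Suc (projl v) else 0) vs"
  show thesis
  proof (rule that[of "Ex (sub us \<phi>)"])
    show "Ex (sub us \<phi>) \<in> formulas L n"
      using 1(1) by (auto intro!: sub_formulas simp: us_def split: if_splits)
    show "\<forall>xs e. xs \<in> nlists n U \<longrightarrow> env e \<longrightarrow> (\<forall>i<n. e i = xs ! i) \<longrightarrow> (P e \<longleftrightarrow> sat S xs (Ex (sub us \<phi>)))"
    proof (intro allI impI)
    fix xs e assume xs: "xs \<in> nlists n U" and e: "env e" and "\<forall>i<n. e i = xs ! i"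
    then have eq: "\<And>i. i < n \<Longrightarrow> e i = xs ! i" by blast
    have "sat S (c # xs) (sub us \<phi>) \<longleftrightarrow> P e" if c: "c \<in> U" for c
    proof -
      let ?e = "\<lambda>i. if i < n then e i else c"
      have "env ?e" using e c by (auto simp: env_def)
      have "sat S (c # xs) (sub us \<phi>) \<longleftrightarrow> sat S (map (vl ?e) vs) \<phi>"
      proof (rule sat_sub')
        fix i assume i: "i < length us"
        then have m: "vs ! i \<in> set vs" by (auto simp: us_def)
        show "(c # xs) ! (us ! i) = map (vl ?e) vs ! i"
          using i eq 1(2) m by (cases "vs ! i") (auto simp: us_def)
      qed (use 1 in \<open>auto simp: us_def\<close>)
      also have "\<dots> = P ?e" using 1(3) \<open>env ?e\<close> by simp
      also have "\<dots> = P e" by (rule assms(2)) (use e \<open>env ?e\<close> in auto)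
      finally show ?thesis .
    qed
    then show "P e \<longleftrightarrow> sat S xs (Ex (sub us \<phi>))" using U_ne by auto
    qed
  qed
qed

end

section \<open>Ordered groups\<close>

text \<open>
  The order of the structure is extended to the whole type, so that the reasoning about linear orders
  needs no membership assumptions.
\<close>

locale og = linorder le less + str L S
  for le :: "'a \<Rightarrow> 'a \<Rightarrow> bool" (infix "\<preceq>" 50) and less :: "'a \<Rightarrow> 'a \<Rightarrow> bool" (infix "\<prec>" 50)
    and L :: "('f, 'r) language" and S :: "('f, 'r, 'a) struct" +
  fixes ltr :: 'r and pl :: 'f and zr :: 'a and ng :: "'a \<Rightarrow> 'a"
  assumes ltr_arity: "rel_arity L ltr = 2" and pl_arity: "fun_arity L pl = 2"
    and ltr_iff: "x \<in> U \<Longrightarrow> y \<in> U \<Longrightarrow> rel_int S ltr [x, y] \<longleftrightarrow> x \<prec> y"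
    and zr_in: "zr \<in> U" and ng_in: "x \<in> U \<Longrightarrow> ng x \<in> U"
    and zr_left: "x \<in> U \<Longrightarrow> fun_int S pl [zr, x] = x" and zr_right: "x \<in> U \<Longrightarrow> fun_int S pl [x, zr] = x"
    and ng_left: "x \<in> U \<Longrightarrow> fun_int S pl [ng x, x] = zr" and ng_right: "x \<in> U \<Longrightarrow> fun_int S pl [x, ng x] = zr"
    and pl_assoc: "x \<in> U \<Longrightarrow> y \<in> U \<Longrightarrow> z \<in> U \<Longrightarrow>
      fun_int S pl [fun_int S pl [x, y], z] = fun_int S pl [x, fun_int S pl [y, z]]"
    and pl_mono_left: "x \<in> U \<Longrightarrow> y \<in> U \<Longrightarrow> z \<in> U \<Longrightarrow> x \<prec> y \<Longrightarrow> fun_int S pl [z, x] \<prec> fun_int S pl [z, y]"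
    and pl_mono_right: "x \<in> U \<Longrightarrow> y \<in> U \<Longrightarrow> z \<in> U \<Longrightarrow> x \<prec> y \<Longrightarrow> fun_int S pl [x, z] \<prec> fun_int S pl [y, z]"
    and nontrivial: "\<exists>x\<in>U. x \<noteq> zr"
begin

definition add :: "'a \<Rightarrow> 'a \<Rightarrow> 'a" (infixl "\<oplus>" 65) where "x \<oplus> y = fun_int S pl [x, y]"

lemma pair_nlists: "x \<in> U \<Longrightarrow> y \<in> U \<Longrightarrow> [x, y] \<in> nlists (fun_arity L pl) U"
  unfolding pl_arity nlists_def by simp

lemma add_in [simp]: "x \<in> U \<Longrightarrow> y \<in> U \<Longrightarrow> x \<oplus> y \<in> U"
  using pair_nlists is_str unfolding is_structure_def add_def by meson

declare zr_in [simp] ng_in [simp]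
lemmas zr_left' [simp] = zr_left[folded add_def] and zr_right' [simp] = zr_right[folded add_def]
lemmas ng_left' [simp] = ng_left[folded add_def] and ng_right' [simp] = ng_right[folded add_def]
lemmas assoc = pl_assoc[folded add_def]
lemmas mono_left = pl_mono_left[folded add_def] and mono_right = pl_mono_right[folded add_def]

lemma add_ng [simp]: "x \<in> U \<Longrightarrow> y \<in> U \<Longrightarrow> x \<oplus> (ng x \<oplus> y) = y" "x \<in> U \<Longrightarrow> y \<in> U \<Longrightarrow> ng x \<oplus> (x \<oplus> y) = y"
  "x \<in> U \<Longrightarrow> y \<in> U \<Longrightarrow> y \<oplus> x \<oplus> ng x = y" "x \<in> U \<Longrightarrow> y \<in> U \<Longrightarrow> y \<oplus> ng x \<oplus> x = y"
  by (simp_all add: assoc[symmetric]) (simp_all add: assoc)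

lemma left_less [simp]: "x \<in> U \<Longrightarrow> y \<in> U \<Longrightarrow> z \<in> U \<Longrightarrow> z \<oplus> x \<prec> z \<oplus> y \<longleftrightarrow> x \<prec> y"
  using mono_left[of x y z] mono_left[of y x z] by (cases x y rule: linorder_cases) auto

lemma right_less [simp]: "x \<in> U \<Longrightarrow> y \<in> U \<Longrightarrow> z \<in> U \<Longrightarrow> x \<oplus> z \<prec> y \<oplus> z \<longleftrightarrow> x \<prec> y"
  using mono_right[of x y z] mono_right[of y x z] by (cases x y rule: linorder_cases) auto

lemma less_add [simp]: "x \<in> U \<Longrightarrow> d \<in> U \<Longrightarrow> x \<prec> x \<oplus> d \<longleftrightarrow> zr \<prec> d"
  using left_less[of zr d x] by simp

lemma less_diff: "x \<in> U \<Longrightarrow> y \<in> U \<Longrightarrow> zr \<prec> ng x \<oplus> y \<longleftrightarrow> x \<prec> y"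
  using left_less[of x y "ng x"] by simp

lemma diff_less: "x \<in> U \<Longrightarrow> d \<in> U \<Longrightarrow> x \<oplus> ng d \<prec> x \<longleftrightarrow> zr \<prec> d"
  using right_less[of "x \<oplus> ng d" x d] by simp

lemma add_mono2: "x \<in> U \<Longrightarrow> x' \<in> U \<Longrightarrow> y \<in> U \<Longrightarrow> y' \<in> U \<Longrightarrow> x \<prec> x' \<Longrightarrow> y \<prec> y' \<Longrightarrow> x \<oplus> y \<prec> x' \<oplus> y'"
  using less_trans[of "x \<oplus> y" "x' \<oplus> y" "x' \<oplus> y'"] by simp

lemma ex_pos: "\<exists>d\<in>U. zr \<prec> d"
proof -
  obtain x where x: "x \<in> U" "x \<noteq> zr" using nontrivial by blast
  have "zr \<prec> x \<or> zr \<prec> ng x" using x right_less[of x zr "ng x"] by (cases "zr \<prec> x") auto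
  then show ?thesis using x ng_in by blast
qed

lemma ex_greater: "x \<in> U \<Longrightarrow> \<exists>y\<in>U. x \<prec> y"
  using ex_pos add_in less_add by blast

lemma ex_less: "x \<in> U \<Longrightarrow> \<exists>y\<in>U. y \<prec> x"
  using ex_pos add_in diff_less ng_in by blast

lemma Def_less: assumes "T A s" "T A t" shows "Def A (\<lambda>e. s e \<prec> t e)"
proof (rule Def_subst2[of A "\<lambda>x y. x \<prec> y" s t])
  show "Def A (\<lambda>e. e 0 \<prec> e 1)"
    by (rule DefI[of "Rel ltr [Var 0, Var 1]" "[Inl 0, Inl 1]"])
      (auto simp: ltr_arity nth_Cons' ltr_iff env_nth)
qed (use assms in auto)

lemma Def_le: assumes "T A s" "T A t" shows "Def A (\<lambda>e. s e \<preceq> t e)"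
  using Def_not[OF Def_less[OF assms(2,1)]] by (simp add: not_less)

lemma T_add: assumes "T A s" "T A t" shows "T A (\<lambda>e. s e \<oplus> t e)"
proof -
  have b: "Def A (\<lambda>e. e 0 = e 1 \<oplus> e 2)"
    by (rule DefI[of "Eq (Var 0) (App pl [Var 1, Var 2])" "[Inl 0, Inl 1, Inl 2]"])
      (auto simp: pl_arity nth_Cons' add_def)
  have "Def A (\<lambda>e. e 0 = s (\<lambda>i. e (Suc i)) \<oplus> t (\<lambda>i. e (Suc i)))"
    by (rule Def_subst3[of A "\<lambda>x y z. x = y \<oplus> z" "\<lambda>e. e 0" "\<lambda>e. s (\<lambda>i. e (Suc i))" "\<lambda>e. t (\<lambda>i. e (Suc i))"])
      (intro b T_var T_lift[of A _ Suc] assms)+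
  then show ?thesis using T_in[OF assms(1)] T_in[OF assms(2)] by (simp add: T_def)
qed

text \<open>The language has a symbol for addition only; zero is definable as the one
  idempotent.\<close>

lemma T_zr: "T A (\<lambda>e. zr)"
proof (rule T_the[of A "\<lambda>e x. x \<oplus> x = x"])
  show "Def A (\<lambda>e. e 0 \<oplus> e 0 = e 0)" by (intro Def_eq T_add T_var)
  show "zr \<in> U \<and> (\<forall>y\<in>U. (y \<oplus> y = y) = (y = zr))" for e :: "nat \<Rightarrow> 'a"
    using left_less by (metis add_ng(1) zr_in zr_right' ng_in ng_left' assoc)
qed

lemma T_ng: assumes "T A s" shows "T A (\<lambda>e. ng (s e))"
proof (rule T_the[of A "\<lambda>e x. x \<oplus> s e = zr"])
  show "Def A (\<lambda>e. e 0 \<oplus> s (\<lambda>i. e (Suc i)) = zr)"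
    by (intro Def_eq T_add T_var T_zr T_lift[of A s Suc] assms)
  show "ng (s e) \<in> U \<and> (\<forall>y\<in>U. (y \<oplus> s e = zr) = (y = ng (s e)))" if "env e" for e :: "nat \<Rightarrow> 'a"
    using T_in[OF assms that] by (metis add_ng(3) ng_in ng_left' zr_left')
qed

lemmas dfs = Def_conj Def_disj Def_imp Def_not Def_iff Def_ex Def_all Def_less Def_le Def_eq
  T_var T_add T_ng T_zr

section \<open>Truth for all large elements\<close>

definition ev :: "('a \<Rightarrow> bool) \<Rightarrow> bool" where "ev P \<longleftrightarrow> (\<exists>b\<in>U. \<forall>x\<in>U. b \<prec> x \<longrightarrow> P x)"

lemma Def_ev: assumes "Def A (\<lambda>e. P (\<lambda>i. e (Suc i)) (e 0))" shows "Def A (\<lambda>e. ev (P e))"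
proof -
  have "Def A (\<lambda>e. P (\<lambda>i. e (Suc (Suc i))) (e 0))"
    using Def_reindex[OF assms, of "case_nat 0 (\<lambda>i. Suc (Suc i))"] by simp
  then show ?thesis unfolding ev_def by (intro dfs)
qed

lemma ev_mono: "ev P \<Longrightarrow> (\<And>x. x \<in> U \<Longrightarrow> P x \<Longrightarrow> Q x) \<Longrightarrow> ev Q"
  unfolding ev_def by blast

lemma ev_conj: assumes "ev P" "ev Q" shows "ev (\<lambda>x. P x \<and> Q x)"
proof -
  obtain b c where b: "b \<in> U" "\<forall>x\<in>U. b \<prec> x \<longrightarrow> P x" and c: "c \<in> U" "\<forall>x\<in>U. c \<prec> x \<longrightarrow> Q x"
    using assms unfolding ev_def by blast
  show ?thesis
  proof (cases "b \<prec> c")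
    case True
    then show ?thesis unfolding ev_def using b c less_trans by blast
  next
    case False
    then show ?thesis unfolding ev_def using b c le_less_trans by (meson not_less)
  qed
qed

lemma ev_ex: "ev P \<Longrightarrow> \<exists>x\<in>U. P x"
  unfolding ev_def using ex_greater by blast

lemma ev_gt: "b \<in> U \<Longrightarrow> ev (\<lambda>x. b \<prec> x)" unfolding ev_def by blast

lemma ev_const [simp]: "ev (\<lambda>x. c) \<longleftrightarrow> c"
  using ev_ex unfolding ev_def using U_ne by blast

lemma ev_shift: assumes "ev P" "d \<in> U" shows "ev (\<lambda>x. P (x \<oplus> d))"
proof -
  obtain b where b: "b \<in> U" "\<forall>x\<in>U. b \<prec> x \<longrightarrow> P x" using assms unfolding ev_def by blast
  have "P (x \<oplus> d)" if "x \<in> U" "b \<oplus> ng d \<prec> x" for x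
  proof -
    have "b \<prec> x \<oplus> d" using that right_less[of "b \<oplus> ng d" x d] b assms by simp
    then show ?thesis using b that assms by simp
  qed
  then show ?thesis unfolding ev_def using b(1) assms(2) ng_in add_in by blast
qed

lemma ev_shift_iff: assumes "d \<in> U" shows "ev (\<lambda>x. P (x \<oplus> d)) \<longleftrightarrow> ev P"
proof
  assume "ev (\<lambda>x. P (x \<oplus> d))"
  from ev_shift[OF this, of "ng d"] have "ev (\<lambda>x. P (x \<oplus> ng d \<oplus> d))" using assms by simp
  then show "ev P" by (rule ev_mono) (use assms in simp)
qed (rule ev_shift, use assms in auto)

section \<open>Predicates with finitely many breaks\<close>

text \<open>A form of "finite union of points and intervals" that mentions no intervals: the truth
  value may change only where a point of \<open>F\<close> lies in the closed interval between two
  arguments. Unbounded pieces need no separate treatment, and the condition on \<open>F\<close> is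
  first-order (\<open>tamef\<close>).\<close>

definition breaks :: "'a set \<Rightarrow> ('a \<Rightarrow> bool) \<Rightarrow> bool" where
  "breaks F P \<longleftrightarrow> (\<forall>x\<in>U. \<forall>y\<in>U. x \<prec> y \<longrightarrow> (\<forall>c\<in>F. \<not> (x \<preceq> c \<and> c \<preceq> y)) \<longrightarrow> P x = P y)"

definition tame :: "('a \<Rightarrow> bool) \<Rightarrow> bool" where
  "tame P \<longleftrightarrow> (\<exists>F. finite F \<and> F \<subseteq> U \<and> breaks F P)"

lemma bounded_finite: "finite F \<Longrightarrow> F \<subseteq> U \<Longrightarrow> \<exists>b\<in>U. \<forall>x\<in>F. x \<prec> b"
proof (induction F rule: finite_induct)
  case (insert x F)
  then obtain b where b: "b \<in> U" "\<forall>x\<in>F. x \<prec> b" by blast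
  obtain c d where c: "c \<in> U" "b \<prec> c" "d \<in> U" "x \<prec> d" using b insert ex_greater by (meson insert_subset)
  show ?case
  proof (cases "c \<prec> d")
    case True
    then have "\<forall>y\<in>insert x F. y \<prec> d" using b c by (auto intro: less_trans)
    then show ?thesis using c by blast
  next
    case False
    then have "\<forall>y\<in>insert x F. y \<prec> c" using b c by (auto intro: less_trans less_le_trans)
    then show ?thesis using c by blast
  qed
qed (use U_ne in auto)

lemma tame_ev: assumes "tame P" shows "ev P \<or> ev (\<lambda>x. \<not> P x)"
proof -
  obtain F where F: "finite F" "F \<subseteq> U" "breaks F P" using assms by (auto simp: tame_def)
  obtain b where b: "b \<in> U" "\<forall>x\<in>F. x \<prec> b" using bounded_finite F by blast
  obtain b' where b': "b' \<in> U" "b \<prec> b'" using ex_greater b by blast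
  have "P x = P b'" if "x \<in> U" "b' \<prec> x" for x
  proof -
    have "\<not> (b' \<preceq> c \<and> c \<preceq> x)" if "c \<in> F" for c using b b' that by (meson less_asym less_le_trans not_less)
    then show ?thesis using F(3) that b'(1) unfolding breaks_def by metis
  qed
  then show ?thesis unfolding ev_def using b'(1) by metis
qed

lemma finite_least: "finite F \<Longrightarrow> F \<noteq> {} \<Longrightarrow> \<exists>m\<in>F. \<forall>x\<in>F. m \<preceq> x"
proof (induction F rule: finite_ne_induct)
  case (insert x F)
  then obtain m where "m \<in> F" "\<forall>x\<in>F. m \<preceq> x" by blast
  then show ?case by (cases "m \<preceq> x") (auto intro: order_trans)
qed auto

lemma finite_greatest: "finite F \<Longrightarrow> F \<noteq> {} \<Longrightarrow> \<exists>m\<in>F. \<forall>x\<in>F. x \<preceq> m"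
proof (induction F rule: finite_ne_induct)
  case (insert x F)
  then obtain m where "m \<in> F" "\<forall>x\<in>F. x \<preceq> m" by blast
  then show ?case by (cases "x \<preceq> m") (auto intro: order_trans)
qed auto

text \<open>The density of the order: otherwise the set of all \<open>x \<oplus> x\<close> would be neither eventually true nor eventually false.\<close>

lemma tame_dense: assumes t: "tame (\<lambda>x. \<exists>y\<in>U. x = y \<oplus> y)" and x: "x \<in> U" "y \<in> U" "x \<prec> y"
  shows "\<exists>z\<in>U. x \<prec> z \<and> z \<prec> y"
proof (rule ccontr)
  assume nd: "\<not> ?thesis"
  define u where "u = ng x \<oplus> y"
  have u: "u \<in> U" "zr \<prec> u" using x by (auto simp: u_def less_diff)
  have least: "u \<preceq> v" if "v \<in> U" "zr \<prec> v" for v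
  proof (rule ccontr)
    assume "\<not> u \<preceq> v"
    then have "v \<prec> u" by simp
    then have "x \<oplus> v \<prec> y" using left_less[of v u x] that x u by (simp add: u_def)
    moreover have "x \<prec> x \<oplus> v" using that x by simp
    ultimately show False using nd that x add_in by blast
  qed
  \<comment> \<open>Conjugation preserves positivity, so both conjugates of the least positive
    element \<open>u\<close> are at least \<open>u\<close>, which gives the two inequalities.
    Commutativity of the group is not among the assumptions.\<close>
  have comm: "u \<oplus> w = w \<oplus> u" if w: "w \<in> U" for w
  proof (rule order.antisym)
    have "zr \<prec> ng w \<oplus> (u \<oplus> w)" using less_diff[of w "u \<oplus> w"] right_less[of zr u w] u w by simp
    then have "u \<preceq> ng w \<oplus> (u \<oplus> w)" using least w u by simp
    then show "w \<oplus> u \<preceq> u \<oplus> w" using left_less[of "ng w \<oplus> (u \<oplus> w)" u w] w u by (simp add: not_less[symmetric] del: left_less)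
    have "zr \<prec> w \<oplus> u \<oplus> ng w" using right_less[of w "w \<oplus> u" "ng w"] u w by simp
    then have "u \<preceq> w \<oplus> u \<oplus> ng w" using least w u by simp
    then show "u \<oplus> w \<preceq> w \<oplus> u" using right_less[of "w \<oplus> u \<oplus> ng w" u w] w u by (simp add: not_less[symmetric] del: right_less)
  qed
  have unb: "\<exists>z\<in>U. b \<prec> z \<and> (\<exists>y\<in>U. z = y \<oplus> y)" if b: "b \<in> U" for b
  proof -
    obtain d where d: "d \<in> U" "b \<prec> d" "zr \<prec> d" using bounded_finite[of "{b, zr}"] b by auto
    then have "d \<prec> d \<oplus> d" by simp
    then show ?thesis using d add_in less_trans by blast
  qed
  then have "\<not> ev (\<lambda>x. \<not> (\<exists>y\<in>U. x = y \<oplus> y))" unfolding ev_def by blast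
  then have "ev (\<lambda>x. \<exists>y\<in>U. x = y \<oplus> y)" using tame_ev[OF t] by blast
  then obtain b where b: "b \<in> U" "\<forall>x\<in>U. b \<prec> x \<longrightarrow> (\<exists>y\<in>U. x = y \<oplus> y)" unfolding ev_def by blast
  obtain y where y: "y \<in> U" "b \<prec> y \<oplus> y" using unb[OF b(1)] by blast
  have yu: "y \<oplus> y \<prec> y \<oplus> y \<oplus> u" using y u by simp
  have "b \<prec> y \<oplus> y \<oplus> u" using y(2) yu by (rule less_trans)
  then obtain w where w: "w \<in> U" "y \<oplus> y \<oplus> u = w \<oplus> w"
    using b(2)[rule_format, of "y \<oplus> y \<oplus> u"] y u by auto
  \<comment> \<open>No double lies strictly between \<open>y \<oplus> y\<close> and
    \<open>y \<oplus> y \<oplus> u \<oplus> u\<close>: an element above \<open>y\<close> is at least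
    \<open>y \<oplus> u\<close>, and \<open>u\<close> is central. This excludes the double
    \<open>y \<oplus> y \<oplus> u\<close>.\<close>
  have "y \<prec> w"
  proof (rule ccontr)
    assume "\<not> y \<prec> w"
    then have "w \<oplus> w \<preceq> y \<oplus> y" using w y add_mono2[of w y w y] by (cases w y rule: linorder_cases) auto
    then show False using yu w by simp
  qed
  then have "u \<preceq> ng y \<oplus> w" using least less_diff y w by simp
  then have "y \<oplus> u \<preceq> w" using left_less[of "ng y \<oplus> w" u y] y w u by (simp add: not_less[symmetric] del: left_less)
  then have "(y \<oplus> u) \<oplus> (y \<oplus> u) \<preceq> w \<oplus> w" using add_mono2[of "y \<oplus> u" w "y \<oplus> u" w] w y u by (cases "y \<oplus> u" w rule: linorder_cases) auto
  moreover have "(y \<oplus> u) \<oplus> (y \<oplus> u) = y \<oplus> y \<oplus> u \<oplus> u"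
    using comm[of y] comm[of "y \<oplus> u"] y u by (simp add: assoc)
  moreover have "w \<oplus> w \<prec> y \<oplus> y \<oplus> u \<oplus> u" using w y u by (metis add_in less_add)
  ultimately show False by simp
qed

end

section \<open>O-minimality and uniform finiteness\<close>

locale ogd = og +
  assumes dense: "x \<in> U \<Longrightarrow> y \<in> U \<Longrightarrow> x \<prec> y \<Longrightarrow> \<exists>z\<in>U. x \<prec> z \<and> z \<prec> y"
begin

definition ival :: "'a \<Rightarrow> 'a \<Rightarrow> 'a set" where "ival l r = {x \<in> U. l \<prec> x \<and> x \<prec> r}"

lemma ivalI: "x \<in> U \<Longrightarrow> l \<prec> x \<Longrightarrow> x \<prec> r \<Longrightarrow> x \<in> ival l r" by (simp add: ival_def)
lemma ivalD: "x \<in> ival l r \<Longrightarrow> x \<in> U" "x \<in> ival l r \<Longrightarrow> l \<prec> x" "x \<in> ival l r \<Longrightarrow> x \<prec> r" by (simp_all add: ival_def)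

lemma infinite_ival: assumes "l \<in> U" "r \<in> U" "l \<prec> r" shows "infinite (ival l r)"
proof
  assume f: "finite (ival l r)"
  have "ival l r \<noteq> {}" using dense[OF assms] by (auto simp: ival_def)
  then obtain m where m: "m \<in> ival l r" "\<forall>x\<in>ival l r. m \<preceq> x" using finite_least[OF f] by blast
  then obtain z where z: "z \<in> U" "l \<prec> z" "z \<prec> m" using dense[of l m] assms(1) by (auto simp: ival_def)
  then have "z \<in> ival l r" using m(1) by (auto simp: ival_def intro: less_trans)
  then show False using m(2) z(3) by (meson not_less)
qed

lemma ival_sub: "l \<preceq> l' \<Longrightarrow> r' \<preceq> r \<Longrightarrow> ival l' r' \<subseteq> ival l r"
  unfolding ival_def by (auto intro: le_less_trans less_le_trans)

lemma halving: assumes "q \<in> U" "zr \<prec> q" shows "\<exists>h\<in>U. zr \<prec> h \<and> h \<oplus> h \<prec> q"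
proof -
  obtain k where k: "k \<in> U" "zr \<prec> k" "k \<prec> q" using dense[of zr q] assms by auto
  define d where "d = ng k \<oplus> q"
  have d: "d \<in> U" "zr \<prec> d" "k \<oplus> d = q" using k assms by (auto simp: d_def less_diff)
  obtain h where h: "h \<in> U" "zr \<prec> h" "h \<prec> k" "h \<prec> d"
  proof (cases "k \<prec> d")
    case True
    obtain h where "h \<in> U" "zr \<prec> h" "h \<prec> k" using dense[of zr k] k by auto
    then show ?thesis using that True less_trans by blast
  next
    case False
    obtain h where "h \<in> U" "zr \<prec> h" "h \<prec> d" using dense[of zr d] d by auto
    then show ?thesis using that False by (meson less_le_trans not_less)
  qed
  then have "h \<oplus> h \<prec> k \<oplus> d" using add_mono2[of h k h d] k d by simp
  then show ?thesis using h d by auto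
qed

lemma nbhd_inter:
  assumes "x \<in> U" "l \<in> U" "l \<prec> x" "r \<in> U" "x \<prec> r" "l' \<in> U" "l' \<prec> x" "r' \<in> U" "x \<prec> r'"
  obtains a b where "a \<in> U" "a \<prec> x" "b \<in> U" "x \<prec> b" "ival a b \<subseteq> ival l r" "ival a b \<subseteq> ival l' r'"
proof -
  let ?a = "if l \<prec> l' then l' else l" and ?b = "if r \<prec> r' then r else r'"
  show thesis
  proof (rule that[of ?a ?b])
    show "ival ?a ?b \<subseteq> ival l r" by (rule ival_sub) auto
    show "ival ?a ?b \<subseteq> ival l' r'" by (rule ival_sub) auto
  qed (use assms in auto)
qed

lemma near: assumes "finite F" "F \<subseteq> U" "x \<in> U"
  shows "\<exists>l\<in>U. \<exists>r\<in>U. l \<prec> x \<and> x \<prec> r \<and> (\<forall>c\<in>F. c \<noteq> x \<longrightarrow> c \<notin> ival l r)"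
  using assms(1,2)
proof (induction F rule: finite_induct)
  case empty
  then show ?case using ex_less[OF assms(3)] ex_greater[OF assms(3)] by blast
next
  case (insert c F)
  then obtain l r where lr: "l \<in> U" "r \<in> U" "l \<prec> x" "x \<prec> r" "\<forall>c\<in>F. c \<noteq> x \<longrightarrow> c \<notin> ival l r" by blast
  obtain a b where ab: "a \<in> U" "a \<prec> x" "b \<in> U" "x \<prec> b" "c \<noteq> x \<longrightarrow> c \<notin> ival a b"
  proof (cases c x rule: linorder_cases)
    case less
    then show ?thesis using that[of c r] insert lr by (auto simp: ival_def)
  next
    case greater
    then show ?thesis using that[of l c] insert lr by (auto simp: ival_def)
  qed (use that lr in auto)
  obtain a' b' where "a' \<in> U" "a' \<prec> x" "b' \<in> U" "x \<prec> b'" "ival a' b' \<subseteq> ival l r" "ival a' b' \<subseteq> ival a b"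
    using nbhd_inter[of x l r a b] lr ab assms(3) by blast
  then show ?case using lr(5) ab(5) by blast
qed

lemma breaks_ival: assumes "breaks F P" "\<forall>c\<in>F. c \<notin> ival l r" "x \<in> ival l r" "y \<in> ival l r" "F \<subseteq> U"
  shows "P x = P y"
proof -
  have *: "P x = P y" if "x \<in> ival l r" "y \<in> ival l r" "x \<prec> y" for x y
  proof -
    have "\<not> (x \<preceq> c \<and> c \<preceq> y)" if c: "c \<in> F" for c
    proof
      assume "x \<preceq> c \<and> c \<preceq> y"
      then have "c \<in> ival l r" using \<open>x \<in> ival l r\<close> \<open>y \<in> ival l r\<close> c assms(5)
        unfolding ival_def by (auto intro: less_le_trans le_less_trans)
      then show False using assms(2) c by blast
    qed
    then show ?thesis using assms(1) that unfolding breaks_def by (simp add: ival_def)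
  qed
  show ?thesis
  proof (cases x y rule: linorder_cases)
    case less
    then show ?thesis using *[of x y] assms(3,4) by blast
  next
    case greater
    then show ?thesis using *[of y x] assms(3,4) by blast
  qed simp
qed

lemma tame_ival: assumes "tame P" "infinite {x \<in> U. P x}"
  obtains l r where "l \<in> U" "r \<in> U" "l \<prec> r" "\<forall>x\<in>ival l r. P x"
proof -
  obtain F where F: "finite F" "F \<subseteq> U" "breaks F P" using assms by (auto simp: tame_def)
  obtain x where x: "x \<in> U" "P x" "x \<notin> F"
    using assms(2) F(1) by (metis (mono_tags, lifting) finite_subset mem_Collect_eq subsetI)
  obtain l r where lr: "l \<in> U" "r \<in> U" "l \<prec> x" "x \<prec> r" "\<forall>c\<in>F. c \<noteq> x \<longrightarrow> c \<notin> ival l r"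
    using near[OF F(1,2) x(1)] by blast
  have "\<forall>c\<in>F. c \<notin> ival l r" using lr(5) x(3) by metis
  moreover have "x \<in> ival l r" using lr x by (simp add: ival_def)
  ultimately have "\<forall>y\<in>ival l r. P y"
    using breaks_ival[OF F(3) _ _ _ F(2)] x(2) by blast
  moreover have "l \<prec> r" using lr(3,4) by (rule less_trans)
  ultimately show thesis using that lr(1,2) by blast
qed

text \<open>Definable connectedness of intervals. The induction is on the number of break points in
  the interval: local constancy at a break point \<open>c\<close> carries the value of
  \<open>P\<close> at \<open>c\<close> to points slightly to its left and right, and the two
  remaining intervals no longer contain \<open>c\<close>.\<close>

lemma breaks_connected:
  assumes "finite F" "F \<subseteq> U" "breaks F P" "a \<in> U" "b \<in> U" "a \<preceq> b"
    "\<And>x. x \<in> U \<Longrightarrow> a \<preceq> x \<Longrightarrow> x \<preceq> b \<Longrightarrow> \<exists>l\<in>U. \<exists>r\<in>U. l \<prec> x \<and> x \<prec> r \<and> (\<forall>y\<in>ival l r. a \<preceq> y \<longrightarrow> y \<preceq> b \<longrightarrow> P y = P x)"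
  shows "P a = P b"
  using assms(4-7)
proof (induction "card {c \<in> F. a \<preceq> c \<and> c \<preceq> b}" arbitrary: a b rule: less_induct)
  case less
  show ?case
  proof (cases "\<exists>c\<in>F. a \<preceq> c \<and> c \<preceq> b")
    case False
    then show ?thesis using assms(3) less.prems(1-3) unfolding breaks_def by (cases "a = b") auto
  next
    case True
    then obtain c where c: "c \<in> F" "a \<preceq> c" "c \<preceq> b" by blast
    then have cU: "c \<in> U" using assms(2) by auto
    obtain l r where lr: "l \<in> U" "r \<in> U" "l \<prec> c" "c \<prec> r" "\<forall>y\<in>ival l r. a \<preceq> y \<longrightarrow> y \<preceq> b \<longrightarrow> P y = P c"
      using less.prems(4)[OF cU c(2,3)] by blast
    have fin: "finite {c \<in> F. a \<preceq> c \<and> c \<preceq> b}" using assms(1) by auto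
    have 1: "P a = P c"
    proof (cases "a = c")
      case False
      then have "a \<prec> c" using c by simp
      then obtain m where m: "m \<in> U" "a \<preceq> m" "m \<prec> c" "l \<prec> m"
        using dense[of a c] dense[of l c] lr(1,3) cU less.prems(1)
        by (metis le_less_linear less_imp_le less_trans order_refl)
      have lt: "card {d \<in> F. a \<preceq> d \<and> d \<preceq> m} < card {c \<in> F. a \<preceq> c \<and> c \<preceq> b}"
      proof (rule psubset_card_mono[OF fin])
        have "c \<notin> {d \<in> F. a \<preceq> d \<and> d \<preceq> m}" using m(3) by auto
        moreover have "{d \<in> F. a \<preceq> d \<and> d \<preceq> m} \<subseteq> {c \<in> F. a \<preceq> c \<and> c \<preceq> b}" using m(3) c(3) by (auto intro: order_trans)
        ultimately show "{d \<in> F. a \<preceq> d \<and> d \<preceq> m} \<subset> {c \<in> F. a \<preceq> c \<and> c \<preceq> b}" using c by blast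
      qed
      have mb: "m \<preceq> b" using m(3) c(3) by auto
      have "P a = P m"
      proof (rule less.hyps[OF lt less.prems(1) m(1,2)])
        fix x assume x: "x \<in> U" "a \<preceq> x" "x \<preceq> m"
        show "\<exists>l\<in>U. \<exists>r\<in>U. l \<prec> x \<and> x \<prec> r \<and> (\<forall>y\<in>ival l r. a \<preceq> y \<longrightarrow> y \<preceq> m \<longrightarrow> P y = P x)"
          using less.prems(4)[of x] x mb order_trans by meson
      qed
      moreover have "P m = P c" using lr(5) m mb lr(4) by (auto simp: ival_def)
      ultimately show ?thesis by simp
    qed simp
    have 2: "P b = P c"
    proof (cases "b = c")
      case False
      then have "c \<prec> b" using c by simp
      then obtain m where m: "m \<in> U" "m \<preceq> b" "c \<prec> m" "m \<prec> r"
        using dense[of c b] dense[of c r] lr(2,4) cU less.prems(2)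
        by (metis le_less_linear less_imp_le less_trans order_refl)
      have lt: "card {d \<in> F. m \<preceq> d \<and> d \<preceq> b} < card {c \<in> F. a \<preceq> c \<and> c \<preceq> b}"
      proof (rule psubset_card_mono[OF fin])
        have "c \<notin> {d \<in> F. m \<preceq> d \<and> d \<preceq> b}" using m(3) by auto
        moreover have "{d \<in> F. m \<preceq> d \<and> d \<preceq> b} \<subseteq> {c \<in> F. a \<preceq> c \<and> c \<preceq> b}"
          using m(3) c(2) by (auto dest: less_imp_le intro: order_trans)
        ultimately show "{d \<in> F. m \<preceq> d \<and> d \<preceq> b} \<subset> {c \<in> F. a \<preceq> c \<and> c \<preceq> b}" using c by blast
      qed
      have am: "a \<preceq> m" using m(3) c(2) by auto
      have "P m = P b"
      proof (rule less.hyps[OF lt m(1) less.prems(2) m(2)])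
        fix x assume x: "x \<in> U" "m \<preceq> x" "x \<preceq> b"
        show "\<exists>l\<in>U. \<exists>r\<in>U. l \<prec> x \<and> x \<prec> r \<and> (\<forall>y\<in>ival l r. m \<preceq> y \<longrightarrow> y \<preceq> b \<longrightarrow> P y = P x)"
          using less.prems(4)[of x] x am order_trans by meson
      qed
      moreover have "P m = P c" using lr(5) m am lr(3) by (auto simp: ival_def)
      ultimately show ?thesis by simp
    qed simp
    show ?thesis using 1 2 by simp
  qed
qed

lemma tame_connected:
  assumes "tame P" "a \<in> U" "b \<in> U" "a \<preceq> b"
    "\<And>x. x \<in> U \<Longrightarrow> a \<preceq> x \<Longrightarrow> x \<preceq> b \<Longrightarrow> \<exists>l\<in>U. \<exists>r\<in>U. l \<prec> x \<and> x \<prec> r \<and> (\<forall>y\<in>ival l r. a \<preceq> y \<longrightarrow> y \<preceq> b \<longrightarrow> P y = P x)"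
  shows "P a = P b"
proof -
  obtain F where F: "finite F" "F \<subseteq> U" "breaks F P" using assms(1) by (auto simp: tame_def)
  show ?thesis by (rule breaks_connected[OF F assms(2-4)]) (rule assms(5))
qed

text \<open>Replaces Dedekind completeness. By connectedness some point \<open>s\<close> has no
  neighbourhood on which \<open>Q\<close> is constant, and for an upward closed \<open>Q\<close>
  such a point must be the cut.\<close>

lemma tame_cut: assumes "tame Q" "\<And>x y. x \<in> U \<Longrightarrow> y \<in> U \<Longrightarrow> x \<prec> y \<Longrightarrow> Q x \<Longrightarrow> Q y" "y0 \<in> U" "Q y0" "x0 \<in> U" "\<not> Q x0"
  obtains s where "s \<in> U" "\<forall>y\<in>U. y \<prec> s \<longrightarrow> \<not> Q y" "\<forall>y\<in>U. s \<prec> y \<longrightarrow> Q y"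
proof -
  have le: "x0 \<preceq> y0" using assms(2)[OF assms(3,5)] assms(4,6) by (meson not_less)
  have "\<exists>x\<in>U. \<not> (\<exists>l\<in>U. \<exists>r\<in>U. l \<prec> x \<and> x \<prec> r \<and> (\<forall>y\<in>ival l r. x0 \<preceq> y \<longrightarrow> y \<preceq> y0 \<longrightarrow> Q y = Q x))"
    using tame_connected[OF assms(1,5,3) le] assms(4,6) by blast
  then obtain s where s: "s \<in> U" "\<And>l r. l \<in> U \<Longrightarrow> r \<in> U \<Longrightarrow> l \<prec> s \<Longrightarrow> s \<prec> r \<Longrightarrow> \<exists>y\<in>ival l r. Q y \<noteq> Q s" by blast
  show thesis
  proof (rule that[OF s(1)]; intro ballI impI)
    fix y assume y: "y \<in> U" "y \<prec> s"
    show "\<not> Q y"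
    proof
      assume "Q y"
      obtain r where r: "r \<in> U" "s \<prec> r" using ex_greater s(1) by blast
      obtain z where z: "z \<in> ival y r" "Q z \<noteq> Q s" using s(2)[OF y(1) r(1) y(2) r(2)] by blast
      have "Q z" "Q s" using assms(2)[of y] z(1) y s(1) \<open>Q y\<close> by (auto simp: ival_def)
      then show False using z by simp
    qed
  next
    fix y assume y: "y \<in> U" "s \<prec> y"
    show "Q y"
    proof (rule ccontr)
      assume "\<not> Q y"
      obtain r where r: "r \<in> U" "r \<prec> s" using ex_less s(1) by blast
      obtain z where z: "z \<in> ival r y" "Q z \<noteq> Q s" using s(2)[OF r(1) y(1) r(2) y(2)] by blast
      have "\<not> Q z" "\<not> Q s" using assms(2)[of _ y] z(1) y s(1) \<open>\<not> Q y\<close> by (auto simp: ival_def)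
      then show False using z by simp
    qed
  qed
qed

end

locale omin = ogd +
  assumes tame_Def: "Def U (\<lambda>e. P (e 0)) \<Longrightarrow> tame P"
begin

lemma T_U: "c \<in> U \<Longrightarrow> T U (\<lambda>e. c)" by (rule T_const)

lemma Def_ival: assumes "T A s" "T A l" "T A r" shows "Def A (\<lambda>e. s e \<in> ival (l e) (r e))"
proof (rule Def_cong)
  show "Def A (\<lambda>e. l e \<prec> s e \<and> s e \<prec> r e)" by (intro Def_conj Def_less assms)
  show "(l e \<prec> s e \<and> s e \<prec> r e) = (s e \<in> ival (l e) (r e))" if "env e" for e
    using T_in[OF assms(1) that] by (simp add: ival_def)
qed

lemma Def_infinite_ival: assumes "Def U (\<lambda>e. P (e 0))" "infinite {x \<in> U. P x}"
  obtains l r where "l \<in> U" "r \<in> U" "l \<prec> r" "\<forall>x\<in>ival l r. P x"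
  using tame_ival[OF tame_Def[OF assms(1)] assms(2)] by blast

lemma Def_sub_ival: assumes D: "Def U (\<lambda>e. P (e 0))" and lr: "l \<in> U" "r \<in> U" "infinite {x \<in> ival l r. P x}"
  obtains l' r' where "l' \<in> U" "r' \<in> U" "l' \<prec> r'" "ival l' r' \<subseteq> ival l r" "\<forall>x\<in>ival l' r'. P x"
proof -
  have D': "Def U (\<lambda>e. e 0 \<in> ival l r \<and> P (e 0))"
    by (intro Def_conj Def_ival D T_var T_U lr)
  have i: "infinite {x \<in> U. x \<in> ival l r \<and> P x}"
    using lr(3) by (rule contrapos_nn) (erule finite_subset[rotated], auto simp: ival_def)
  show thesis using Def_infinite_ival[OF D' i] that by (metis subsetI)
qed

text \<open>
  If all the sets \<open>{z. Q \<eta> z}\<close> were finite, then their least elements would fill an interval; but the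
  set having the least element \<open>y\<close> contains all larger elements of this interval.
\<close>

lemma uniform_eta:
  assumes D: "Def U (\<lambda>e. Q (e 0) (e 1))" and lr: "l \<in> U" "r \<in> U" "l \<prec> r"
    and ex: "\<And>z. z \<in> ival l r \<Longrightarrow> \<exists>\<eta>\<in>U. zr \<prec> \<eta> \<and> Q \<eta> z"
    and anti: "\<And>\<eta> \<eta>' z. \<eta> \<in> U \<Longrightarrow> \<eta>' \<in> U \<Longrightarrow> zr \<prec> \<eta>' \<Longrightarrow> \<eta>' \<prec> \<eta> \<Longrightarrow> z \<in> ival l r \<Longrightarrow> Q \<eta> z \<Longrightarrow> Q \<eta>' z"
  obtains \<eta> l' r' where "\<eta> \<in> U" "zr \<prec> \<eta>" "l' \<in> U" "r' \<in> U" "l' \<prec> r'" "ival l' r' \<subseteq> ival l r" "\<forall>z\<in>ival l' r'. Q \<eta> z"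
proof (cases "\<exists>\<eta>\<in>U. zr \<prec> \<eta> \<and> infinite {z \<in> ival l r. Q \<eta> z}")
  case True
  then obtain \<eta> where \<eta>: "\<eta> \<in> U" "zr \<prec> \<eta>" "infinite {z \<in> ival l r. Q \<eta> z}" by blast
  have D1: "Def U (\<lambda>e. Q \<eta> (e 0))" by (rule Def_subst2[OF D]) (intro T_var T_U \<eta>)+
  show ?thesis using Def_sub_ival[OF D1 lr(1,2) \<eta>(3)] that \<eta>(1,2) by metis
next
  case False
  then have fin: "finite {z \<in> ival l r. Q \<eta> z}" if "\<eta> \<in> U" "zr \<prec> \<eta>" for \<eta> using that by blast
  define Y where "Y y \<longleftrightarrow> y \<in> ival l r \<and> (\<exists>\<eta>\<in>U. zr \<prec> \<eta> \<and> Q \<eta> y \<and> (\<forall>z\<in>U. z \<in> ival l r \<longrightarrow> Q \<eta> z \<longrightarrow> y \<preceq> z))" for y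
  note Q = Def_subst2[of U Q, OF D]
  have DY: "Def U (\<lambda>e. Y (e 0))" unfolding Y_def by (intro dfs Def_ival Q T_U lr)
  have least: "\<exists>y. Y y \<and> y \<preceq> z" if z: "z \<in> ival l r" for z
  proof -
    obtain \<eta> where \<eta>: "\<eta> \<in> U" "zr \<prec> \<eta>" "Q \<eta> z" using ex[OF z] by blast
    then have "{z \<in> ival l r. Q \<eta> z} \<noteq> {}" using z by blast
    then obtain y where "y \<in> ival l r" "Q \<eta> y" "\<forall>z\<in>ival l r. Q \<eta> z \<longrightarrow> y \<preceq> z"
      using finite_least[OF fin[OF \<eta>(1,2)]] by blast
    then show ?thesis unfolding Y_def using \<eta> z by blast
  qed
  \<comment> \<open>There is no smallest \<open>y\<close> with \<open>Y y\<close>: a point of the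
    interval below it belongs to one of the sets, and the least element of that set is smaller
    still.\<close>
  have "infinite {y \<in> U. Y y}"
  proof
    assume f: "finite {y \<in> U. Y y}"
    obtain z where "z \<in> U" "l \<prec> z" "z \<prec> r" using dense[OF lr] by blast
    then have "{y \<in> U. Y y} \<noteq> {}" using least[of z] by (auto simp: ival_def Y_def)
    then obtain m where m: "m \<in> U" "Y m" "\<And>y. y \<in> U \<Longrightarrow> Y y \<Longrightarrow> m \<preceq> y" using finite_least[OF f] by blast
    then have mi: "m \<in> ival l r" by (simp add: Y_def)
    then obtain z where z: "z \<in> U" "l \<prec> z" "z \<prec> m" using dense[of l m] lr m(1) by (auto simp: ival_def)
    then have "z \<in> ival l r" using mi by (auto simp: ival_def intro: less_trans)
    then obtain y where "Y y" "y \<preceq> z" using least by blast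
    moreover have "y \<in> U" using \<open>Y y\<close> by (simp add: Y_def ival_def)
    ultimately show False using m(3) z(3) by (meson le_less_trans not_less)
  qed
  then obtain p q where pq: "p \<in> U" "q \<in> U" "p \<prec> q" "\<forall>y\<in>ival p q. Y y" using Def_infinite_ival[OF DY] by blast
  obtain y where y: "y \<in> U" "p \<prec> y" "y \<prec> q" using dense[OF pq(1-3)] by blast
  then have "Y y" using pq by (simp add: ival_def)
  then obtain \<eta> where \<eta>: "\<eta> \<in> U" "zr \<prec> \<eta>" "Q \<eta> y" "y \<in> ival l r" unfolding Y_def by blast
  have "Q \<eta> z" "z \<in> ival l r" if z: "z \<in> ival y q" for z
  proof -
    have "z \<in> ival p q" using z y unfolding ival_def by (auto intro: less_trans)
    then have "Y z" using pq by blast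
    then obtain \<eta>' where \<eta>': "\<eta>' \<in> U" "zr \<prec> \<eta>'" "Q \<eta>' z" "\<forall>w\<in>U. w \<in> ival l r \<longrightarrow> Q \<eta>' w \<longrightarrow> z \<preceq> w" and zi: "z \<in> ival l r"
      unfolding Y_def by blast
    show "z \<in> ival l r" by fact
    \<comment> \<open>The set for \<open>\<eta>'\<close> begins at \<open>z\<close>, which lies
      above \<open>y\<close>, so it omits \<open>y\<close>; the set for \<open>\<eta>\<close>
      contains \<open>y\<close>. As the sets shrink when the index grows, this decides the order of
      the indices.\<close>
    have "\<eta> \<prec> \<eta>'"
    proof (rule ccontr)
      assume "\<not> \<eta> \<prec> \<eta>'"
      then have "Q \<eta>' y" using anti[OF \<eta>(1) \<eta>'(1,2) _ \<eta>(4,3)] \<eta>(3) by (cases "\<eta>' = \<eta>") auto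
      then have "z \<preceq> y" using \<eta>'(4) y \<eta>(4) by blast
      then show False using z by (auto simp: ival_def)
    qed
    then show "Q \<eta> z" using anti[OF \<eta>'(1) \<eta>(1,2) _ zi \<eta>'(3)] by blast
  qed
  then show ?thesis using that[of \<eta> y q] \<eta> y pq by blast
qed

text \<open>Stands in for the continuity of definable functions. Either one value is taken
  infinitely often, or the values fill an interval, which may be cut down to length
  \<open>\<epsilon>\<close>; in the second case the points with a value in the short interval are
  infinitely many, since each point has only finitely many values.\<close>

lemma small_values:
  assumes D: "Def U (\<lambda>e. R (e 0) (e 1))" and lr: "l \<in> U" "r \<in> U" "l \<prec> r"
    and ex: "\<And>x. x \<in> ival l r \<Longrightarrow> \<exists>y\<in>U. R x y" and fin: "\<And>x. x \<in> ival l r \<Longrightarrow> finite {y \<in> U. R x y}"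
    and eps: "\<epsilon> \<in> U" "zr \<prec> \<epsilon>"
  obtains l' r' p q where "l' \<in> U" "r' \<in> U" "l' \<prec> r'" "ival l' r' \<subseteq> ival l r" "p \<in> U" "q \<in> U" "q \<preceq> p \<oplus> \<epsilon>"
    "\<forall>x\<in>ival l' r'. \<exists>y\<in>ival p q. R x y"
proof -
  note R = Def_subst2[of U R, OF D]
  show thesis
  proof (cases "\<exists>y\<in>U. infinite {x \<in> ival l r. R x y}")
    case True
    then obtain y where y: "y \<in> U" "infinite {x \<in> ival l r. R x y}" by blast
    have D1: "Def U (\<lambda>e. R (e 0) y)" by (intro R T_var T_U y)
    obtain h where h: "h \<in> U" "zr \<prec> h" "h \<oplus> h \<prec> \<epsilon>" using halving[OF eps] by blast
    obtain l' r' where l': "l' \<in> U" "r' \<in> U" "l' \<prec> r'" "ival l' r' \<subseteq> ival l r" "\<forall>x\<in>ival l' r'. R x y"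
      using Def_sub_ival[OF D1 lr(1,2) y(2)] by blast
    have "y \<oplus> h = y \<oplus> ng h \<oplus> (h \<oplus> h)" using y h by (simp add: assoc)
    also have "\<dots> \<prec> y \<oplus> ng h \<oplus> \<epsilon>" using y h eps by simp
    finally have "y \<oplus> h \<preceq> y \<oplus> ng h \<oplus> \<epsilon>" by simp
    moreover have "y \<in> ival (y \<oplus> ng h) (y \<oplus> h)" using y h by (simp add: ival_def diff_less)
    ultimately show thesis using that[of l' r' "y \<oplus> ng h" "y \<oplus> h"] l' y h by auto
  next
    case False
    then have fin2: "finite {x \<in> ival l r. R x y}" if "y \<in> U" for y using that by blast
    define Y where "Y y \<longleftrightarrow> (\<exists>x\<in>U. x \<in> ival l r \<and> R x y)" for y
    have DY: "Def U (\<lambda>e. Y (e 0))" unfolding Y_def by (intro dfs Def_ival R T_U lr)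
    have "infinite {y \<in> U. Y y}"
    proof
      assume f: "finite {y \<in> U. Y y}"
      have "ival l r \<subseteq> (\<Union>y\<in>{y \<in> U. Y y}. {x \<in> ival l r. R x y})"
      proof
        fix x assume x: "x \<in> ival l r"
        then obtain y where "y \<in> U" "R x y" using ex by blast
        then show "x \<in> (\<Union>y\<in>{y \<in> U. Y y}. {x \<in> ival l r. R x y})" using x by (auto simp: Y_def ival_def)
      qed
      moreover have "finite (\<Union>y\<in>{y \<in> U. Y y}. {x \<in> ival l r. R x y})" using f fin2 by auto
      ultimately show False using infinite_ival[OF lr] finite_subset by blast
    qed
    then obtain p0 q0 where pq0: "p0 \<in> U" "q0 \<in> U" "p0 \<prec> q0" "\<forall>y\<in>ival p0 q0. Y y" using Def_infinite_ival[OF DY] by blast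
    obtain p where p: "p \<in> U" "p0 \<prec> p" "p \<prec> q0" using dense[OF pq0(1-3)] by blast
    define q where "q = (if p \<oplus> \<epsilon> \<prec> q0 then p \<oplus> \<epsilon> else q0)"
    have q: "q \<in> U" "p \<prec> q" "q \<preceq> p \<oplus> \<epsilon>" "q \<preceq> q0" using p pq0 eps by (auto simp: q_def)
    have sub: "ival p q \<subseteq> ival p0 q0" by (rule ival_sub) (use p q in auto)
    define X where "X x \<longleftrightarrow> (\<exists>y\<in>U. y \<in> ival p q \<and> R x y)" for x
    have DX: "Def U (\<lambda>e. X (e 0))" unfolding X_def by (intro dfs Def_ival R T_U p q)
    have "infinite {x \<in> ival l r. X x}"
    proof
      assume f: "finite {x \<in> ival l r. X x}"
      have "ival p q \<subseteq> (\<Union>x\<in>{x \<in> ival l r. X x}. {y \<in> U. R x y})"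
      proof
        fix y assume y: "y \<in> ival p q"
        then have "Y y" using sub pq0 by blast
        then obtain x where "x \<in> ival l r" "R x y" unfolding Y_def by blast
        then show "y \<in> (\<Union>x\<in>{x \<in> ival l r. X x}. {y \<in> U. R x y})" using y unfolding X_def by (auto simp: ival_def)
      qed
      moreover have "finite (\<Union>x\<in>{x \<in> ival l r. X x}. {y \<in> U. R x y})" using f fin by auto
      ultimately show False using infinite_ival[OF p(1) q(1,2)] finite_subset by blast
    qed
    then obtain l' r' where l': "l' \<in> U" "r' \<in> U" "l' \<prec> r'" "ival l' r' \<subseteq> ival l r" "\<forall>x\<in>ival l' r'. X x"
      using Def_sub_ival[OF DX lr(1,2)] by blast
    show thesis using that[OF l'(1-4) p(1) q(1,3)] l'(5) unfolding X_def by blast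
  qed
qed

text \<open>The order makes counting first-order: a finite set has more than \<open>k\<close>
  elements iff one of its elements has at least \<open>k\<close> elements of the set above
  it.\<close>

lemma Def_card:
  assumes D: "Def A (\<lambda>e. P (\<lambda>i. e (Suc i)) (e 0))" and fin: "\<And>e. env e \<Longrightarrow> finite {u \<in> U. P e u}"
  shows "Def A (\<lambda>e. k \<le> card {u \<in> U. P e u})"
proof -
  have step: "Suc k \<le> card X \<longleftrightarrow> (\<exists>w\<in>X. k \<le> card {u \<in> X. w \<prec> u})" if X: "finite X" for X :: "'a set" and k
  proof
    assume k: "Suc k \<le> card X"
    then have "X \<noteq> {}" by auto
    then obtain w where w: "w \<in> X" "\<forall>x\<in>X. w \<preceq> x" using finite_least[OF X] by blast
    then have "{u \<in> X. w \<prec> u} = X - {w}" by (auto simp: le_less)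
    then show "\<exists>w\<in>X. k \<le> card {u \<in> X. w \<prec> u}" using w k X by (auto intro!: bexI[of _ w])
  next
    assume "\<exists>w\<in>X. k \<le> card {u \<in> X. w \<prec> u}"
    then obtain w where w: "w \<in> X" "k \<le> card {u \<in> X. w \<prec> u}" by blast
    have "card (insert w {u \<in> X. w \<prec> u}) \<le> card X" using X w by (intro card_mono) auto
    then show "Suc k \<le> card X" using w X by simp
  qed
  \<comment> \<open>The induction carries a lower bound in variable 0, because the chosen element
    \<open>w\<close> is the lower bound for the remaining elements.\<close>
  have C: "Def A (\<lambda>e. k \<le> card {u \<in> U. e 0 \<prec> u \<and> P (\<lambda>i. e (Suc i)) u})" for k
  proof (induction k)
    case (Suc k)
    have D1: "Def A (\<lambda>e. k \<le> card {u \<in> U. e 0 \<prec> u \<and> P (\<lambda>i. e (Suc (Suc i))) u})"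
      using Def_reindex[OF Suc, of "case_nat 0 (\<lambda>i. Suc (Suc i))"] by simp
    have D2: "Def A (\<lambda>e. P (\<lambda>i. e (Suc (Suc i))) (e 0))"
      using Def_reindex[OF D, of "case_nat 0 (\<lambda>i. Suc (Suc i))"] by simp
    have "Def A (\<lambda>e. \<exists>w\<in>U. e 0 \<prec> w \<and> P (\<lambda>i. e (Suc i)) w \<and> k \<le> card {u \<in> U. w \<prec> u \<and> P (\<lambda>i. e (Suc i)) u})"
      by (rule Def_ex[of A "\<lambda>e w. e 0 \<prec> w \<and> P (\<lambda>i. e (Suc i)) w \<and> k \<le> card {u \<in> U. w \<prec> u \<and> P (\<lambda>i. e (Suc i)) u}"])
        (intro Def_conj Def_less T_var D1 D2)
    then show ?case
    proof (rule Def_cong)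
      fix e assume "env e"
      then have f: "finite {u \<in> U. e 0 \<prec> u \<and> P (\<lambda>i. e (Suc i)) u}"
        using fin[of "\<lambda>i. e (Suc i)"] env_Suc by (auto intro: finite_subset[rotated])
      have eq: "{u \<in> {u \<in> U. e 0 \<prec> u \<and> P (\<lambda>i. e (Suc i)) u}. w \<prec> u} = {u \<in> U. w \<prec> u \<and> P (\<lambda>i. e (Suc i)) u}"
        if "e 0 \<prec> w" for w using that by (auto intro: less_trans)
      show "(\<exists>w\<in>U. e 0 \<prec> w \<and> P (\<lambda>i. e (Suc i)) w \<and> k \<le> card {u \<in> U. w \<prec> u \<and> P (\<lambda>i. e (Suc i)) u}) =
        (Suc k \<le> card {u \<in> U. e 0 \<prec> u \<and> P (\<lambda>i. e (Suc i)) u})"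
        unfolding step[OF f] using eq by auto
    qed
  qed (simp add: Def_const)
  show ?thesis
  proof (cases k)
    case (Suc k')
    have "Def A (\<lambda>e. \<exists>w\<in>U. P e w \<and> k' \<le> card {u \<in> U. w \<prec> u \<and> P e u})"
      by (rule Def_ex[of A "\<lambda>e w. P e w \<and> k' \<le> card {u \<in> U. w \<prec> u \<and> P e u}"]) (intro Def_conj D C)
    then show ?thesis
    proof (rule Def_cong)
      fix e assume e: "env e"
      have eq: "{u \<in> {u \<in> U. P e u}. w \<prec> u} = {u \<in> U. w \<prec> u \<and> P e u}" for w by auto
      show "(\<exists>w\<in>U. P e w \<and> k' \<le> card {u \<in> U. w \<prec> u \<and> P e u}) = (k \<le> card {u \<in> U. P e u})"
        unfolding Suc step[OF fin[OF e]] eq by auto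
    qed
  qed (simp add: Def_const)
qed

end

section \<open>Uniform finiteness for families with one parameter\<close>

context omin
begin

text \<open>Call \<open>z\<close> good if, for all parameters near it, the points of a fibre are at
  least \<open>\<epsilon> \<oplus> \<epsilon>\<close> apart while any two fibres match up to
  \<open>\<epsilon>\<close>. The matching is then injective in both directions, so the size of the
  fibre is locally constant at good points. Good points occur in every interval, hence only finitely
  many points are not good, and the size is constant on the pieces between them.\<close>

lemma uniform_card:
  assumes D: "Def U (\<lambda>e. E (e 0) (e 1))" and fin: "\<And>z. z \<in> U \<Longrightarrow> finite {u \<in> U. E z u}"
  shows "\<exists>K. \<forall>z\<in>U. card {u \<in> U. E z u} \<le> K"
proof -
  note E = Def_subst2[of U E, OF D]
  define near where "near \<epsilon> u v \<longleftrightarrow> u \<prec> v \<oplus> \<epsilon> \<and> v \<prec> u \<oplus> \<epsilon>" for \<epsilon> u v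
  \<comment> \<open>Twice \<open>\<epsilon>\<close>, because two points matched with the same point
    of another fibre are less than \<open>\<epsilon> \<oplus> \<epsilon>\<close> apart.\<close>
  define gap where "gap \<epsilon> z \<longleftrightarrow> (\<forall>u\<in>U. \<forall>v\<in>U. E z u \<longrightarrow> E z v \<longrightarrow> u \<prec> v \<longrightarrow> u \<oplus> \<epsilon> \<oplus> \<epsilon> \<preceq> v)" for \<epsilon> z
  define mt where "mt \<epsilon> z z' \<longleftrightarrow> (\<forall>u\<in>U. E z u \<longrightarrow> (\<exists>v\<in>U. E z' v \<and> near \<epsilon> u v))" for \<epsilon> z z'
  define good where "good z \<longleftrightarrow> (\<exists>l\<in>U. \<exists>r\<in>U. l \<prec> z \<and> z \<prec> r \<and> (\<exists>\<epsilon>\<in>U. zr \<prec> \<epsilon> \<and>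
    (\<forall>z1\<in>U. z1 \<in> ival l r \<longrightarrow> gap \<epsilon> z1) \<and> (\<forall>z1\<in>U. \<forall>z2\<in>U. z1 \<in> ival l r \<longrightarrow> z2 \<in> ival l r \<longrightarrow> mt \<epsilon> z1 z2)))" for z
  have Dgood: "Def U (\<lambda>e. good (e 0))"
    unfolding good_def gap_def mt_def near_def by (intro dfs Def_ival E)
  have sub: "\<exists>z\<in>ival l r. good z" if lr: "l \<in> U" "r \<in> U" "l \<prec> r" for l r
  proof -
    have Dgap: "Def U (\<lambda>e. gap (e 0) (e 1))" unfolding gap_def by (intro dfs E)
    obtain \<epsilon> l1 r1 where \<epsilon>: "\<epsilon> \<in> U" "zr \<prec> \<epsilon>" and 1: "l1 \<in> U" "r1 \<in> U" "l1 \<prec> r1" "ival l1 r1 \<subseteq> ival l r" "\<forall>z\<in>ival l1 r1. gap \<epsilon> z"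
    proof (rule uniform_eta[of gap l r, OF Dgap lr])
      fix z assume "z \<in> ival l r"
      then have fz: "finite {u \<in> U. E z u}" using fin by (simp add: ival_def)
      define G where "G = (\<lambda>(u, v). ng u \<oplus> v) ` {(u, v) \<in> {u \<in> U. E z u} \<times> {u \<in> U. E z u}. u \<prec> v}"
      have fG: "finite G" unfolding G_def
        by (rule finite_imageI, rule finite_subset[OF _ finite_cartesian_product[OF fz fz]]) auto
      have GU: "g \<in> U \<and> zr \<prec> g" if "g \<in> G" for g using that by (auto simp: less_diff G_def)
      have memG: "ng u \<oplus> v \<in> G" if "u \<in> U" "v \<in> U" "E z u" "E z v" "u \<prec> v" for u v
        unfolding G_def using that by force
      \<comment> \<open>Keeps the set of gaps nonempty when the fibre has at most one point.\<close>
      obtain d where d: "d \<in> U" "zr \<prec> d" using ex_pos by blast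
      obtain m where m: "m \<in> insert d G" "\<forall>x\<in>insert d G. m \<preceq> x" 
        using finite_least[OF finite.insertI[OF fG] insert_not_empty] by (rule bexE) (rule that)
      have mU: "m \<in> U" "zr \<prec> m" using m(1) GU d by auto
      obtain h where h: "h \<in> U" "zr \<prec> h" "h \<oplus> h \<prec> m" using halving[OF mU] by blast
      have "gap h z" unfolding gap_def
      proof (intro ballI impI)
        fix u v assume uv: "u \<in> U" "v \<in> U" "E z u" "E z v" "u \<prec> v"
        then have "ng u \<oplus> v \<in> G" by (rule memG)
        then have "h \<oplus> h \<prec> ng u \<oplus> v" using m(2) h(3) by (meson insertCI less_le_trans)
        then have "u \<oplus> (h \<oplus> h) \<prec> u \<oplus> (ng u \<oplus> v)" using uv h by (simp del: add_ng)
        then show "u \<oplus> h \<oplus> h \<preceq> v" using uv h by (simp add: assoc)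
      qed
      then show "\<exists>\<eta>\<in>U. zr \<prec> \<eta> \<and> gap \<eta> z" using h by blast
    next
      fix \<eta> \<eta>' z assume a: "\<eta> \<in> U" "\<eta>' \<in> U" "zr \<prec> \<eta>'" "\<eta>' \<prec> \<eta>" "z \<in> ival l r" "gap \<eta> z"
      show "gap \<eta>' z" unfolding gap_def
      proof (intro ballI impI)
        fix u v assume uv: "u \<in> U" "v \<in> U" "E z u" "E z v" "u \<prec> v"
        have "u \<oplus> \<eta>' \<oplus> \<eta>' \<prec> u \<oplus> \<eta> \<oplus> \<eta>" by (rule add_mono2) (use a uv in auto)
        then show "u \<oplus> \<eta>' \<oplus> \<eta>' \<preceq> v" using a(6) uv unfolding gap_def by (meson less_imp_le less_le_trans)
      qed
    qed blast
    define bad where "bad z \<longleftrightarrow> (\<forall>a\<in>U. \<forall>b\<in>U. a \<prec> z \<longrightarrow> z \<prec> b \<longrightarrow> (\<exists>z'\<in>U. z' \<in> ival a b \<and> \<not> mt \<epsilon> z z'))" for z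
    have Dbad: "Def U (\<lambda>e. bad (e 0))" unfolding bad_def mt_def near_def by (intro dfs Def_ival E T_U \<epsilon>)
    have "finite {z \<in> ival l1 r1. bad z}"
    proof (rule ccontr)
      assume inf: "infinite {z \<in> ival l1 r1. bad z}"
      obtain l2 r2 where 2: "l2 \<in> U" "r2 \<in> U" "l2 \<prec> r2" "\<forall>z\<in>ival l2 r2. bad z"
        using Def_sub_ival[OF Dbad 1(1,2) inf] by metis
      \<comment> \<open>A single point \<open>u\<close> of the fibre can be blamed for the failure
        at \<open>z\<close>: if each of the finitely many points had a neighbourhood of
        \<open>z\<close> in which it is always matched, the intersection of these neighbourhoods
        would show that \<open>z\<close> is not bad.\<close>
      define R where "R z u \<longleftrightarrow> E z u \<and> (\<forall>a\<in>U. \<forall>b\<in>U. a \<prec> z \<longrightarrow> z \<prec> b \<longrightarrow>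
        (\<exists>z'\<in>U. z' \<in> ival a b \<and> \<not> (\<exists>v\<in>U. E z' v \<and> near \<epsilon> u v)))" for z u
      have DR: "Def U (\<lambda>e. R (e 0) (e 1))" unfolding R_def near_def by (intro dfs Def_ival E T_U \<epsilon>)
      have exR: "\<exists>u\<in>U. R z u" if z: "z \<in> ival l2 r2" for z
      proof (rule ccontr)
        assume n: "\<not> ?thesis"
        have zU: "z \<in> U" using z by (simp add: ival_def)
        have "\<exists>a\<in>U. \<exists>b\<in>U. a \<prec> z \<and> z \<prec> b \<and> (\<forall>z'\<in>ival a b. \<forall>u\<in>X. \<exists>v\<in>U. E z' v \<and> near \<epsilon> u v)"
          if "finite X" "X \<subseteq> {u \<in> U. E z u}" for X
          using that
        proof (induction X rule: finite_induct)
          case empty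
          then show ?case using ex_less[OF zU] ex_greater[OF zU] by blast
        next
          case (insert u X)
          then obtain a b where ab: "a \<in> U" "b \<in> U" "a \<prec> z" "z \<prec> b" "\<forall>z'\<in>ival a b. \<forall>u\<in>X. \<exists>v\<in>U. E z' v \<and> near \<epsilon> u v"
            by blast
          have u: "u \<in> U" "E z u" using insert by auto
          then obtain c d where cd: "c \<in> U" "d \<in> U" "c \<prec> z" "z \<prec> d" "\<forall>z'\<in>ival c d. \<exists>v\<in>U. E z' v \<and> near \<epsilon> u v"
            using n unfolding R_def by (metis ivalD(1))
          obtain a' b' where "a' \<in> U" "a' \<prec> z" "b' \<in> U" "z \<prec> b'" "ival a' b' \<subseteq> ival a b" "ival a' b' \<subseteq> ival c d"
            by (rule nbhd_inter[OF zU ab(1,3,2,4) cd(1,3,2,4)])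
          then show ?case using ab(5) cd(5) by blast
        qed
        from this[OF fin[OF zU]] have "\<exists>a\<in>U. \<exists>b\<in>U. a \<prec> z \<and> z \<prec> b \<and> (\<forall>z'\<in>ival a b. mt \<epsilon> z z')"
          unfolding mt_def by blast
        then show False using 2(4) z unfolding bad_def by blast
      qed
      have finR: "finite {u \<in> U. R z u}" if "z \<in> ival l2 r2" for z
        by (rule finite_subset[OF _ fin[of z]]) (use that in \<open>auto simp: R_def ival_def\<close>)
      obtain l3 r3 p q where 3: "l3 \<in> U" "r3 \<in> U" "l3 \<prec> r3" "ival l3 r3 \<subseteq> ival l2 r2" "p \<in> U" "q \<in> U" "q \<preceq> p \<oplus> \<epsilon>"
        "\<forall>x\<in>ival l3 r3. \<exists>y\<in>ival p q. R x y"
        using small_values[of R, OF DR 2(1-3) exR finR \<epsilon>] by blast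
      have close: "u \<prec> v \<oplus> \<epsilon>" if "u \<in> ival p q" "v \<in> ival p q" for u v
      proof -
        have "u \<prec> p \<oplus> \<epsilon>" using that 3(7) by (auto simp: ival_def intro: less_le_trans)
        also have "\<dots> \<prec> v \<oplus> \<epsilon>" using that 3 \<epsilon> by (simp add: ival_def)
        finally show ?thesis .
      qed
      \<comment> \<open>Over the new interval all parameters have a blamed point in one box of
        height \<open>\<epsilon>\<close>. The blamed point of \<open>z'\<close> lies in the fibre of
        \<open>z'\<close> and is close to that of \<open>z\<close>, so it is the match said not to
        exist.\<close>
      obtain z where z: "z \<in> U" "l3 \<prec> z" "z \<prec> r3" using dense[OF 3(1-3)] by blast
      then obtain u where u: "u \<in> ival p q" "R z u" using 3(8) by (auto simp: ival_def)
      then obtain z' where z': "z' \<in> ival l3 r3" "\<not> (\<exists>v\<in>U. E z' v \<and> near \<epsilon> u v)" using z 3(1,2) unfolding R_def by blast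
      then obtain v where "v \<in> ival p q" "E z' v" using 3(8) unfolding R_def by blast
      then show False using z'(2) close[of u v] close[of v u] u(1) unfolding near_def by (meson ivalD(1))
    qed
    then have "infinite (ival l1 r1 - {z \<in> ival l1 r1. bad z})"
      using infinite_ival[OF 1(1-3)] by (rule Diff_infinite_finite)
    then have "infinite {z \<in> ival l1 r1. \<not> bad z}" by (rule contrapos_nn) (erule rev_finite_subset, blast)
    then obtain l2 r2 where 2: "l2 \<in> U" "r2 \<in> U" "l2 \<prec> r2" "ival l2 r2 \<subseteq> ival l1 r1" "\<forall>z\<in>ival l2 r2. \<not> bad z"
      using Def_sub_ival[OF Def_not[OF Dbad] 1(1,2)] by metis
    \<comment> \<open>Each \<open>z\<close> that is not bad matches all parameters in some
      neighbourhood, whose size depends on \<open>z\<close>. Once a size \<open>\<eta>\<close> works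
      uniformly, any two points of an interval of length at most \<open>\<eta>\<close> match each
      other in both directions.\<close>
    define Q where "Q \<eta> z \<longleftrightarrow> (\<forall>z'\<in>U. z \<prec> z' \<oplus> \<eta> \<longrightarrow> z' \<prec> z \<oplus> \<eta> \<longrightarrow> mt \<epsilon> z z')" for \<eta> z
    have DQ: "Def U (\<lambda>e. Q (e 0) (e 1))" unfolding Q_def mt_def near_def by (intro dfs E T_U \<epsilon>)
    obtain \<eta> l3 r3 where \<eta>: "\<eta> \<in> U" "zr \<prec> \<eta>" and 3: "l3 \<in> U" "r3 \<in> U" "l3 \<prec> r3" "ival l3 r3 \<subseteq> ival l2 r2" "\<forall>z\<in>ival l3 r3. Q \<eta> z"
    proof (rule uniform_eta[of Q l2 r2, OF DQ 2(1-3)])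
      fix z assume z: "z \<in> ival l2 r2"
      then obtain a b where ab: "a \<in> U" "b \<in> U" "a \<prec> z" "z \<prec> b" "\<forall>z'\<in>ival a b. mt \<epsilon> z z'" and zU: "z \<in> U"
        using 2(5) unfolding bad_def by (metis ivalD(1))
      define h where "h = (if ng a \<oplus> z \<prec> ng z \<oplus> b then ng a \<oplus> z else ng z \<oplus> b)"
      have h: "h \<in> U" "zr \<prec> h" "h \<preceq> ng a \<oplus> z" "h \<preceq> ng z \<oplus> b" using ab zU by (auto simp: h_def less_diff)
      have "Q h z" unfolding Q_def
      proof (intro ballI impI)
        fix z' assume z': "z' \<in> U" "z \<prec> z' \<oplus> h" "z' \<prec> z \<oplus> h"
        have "z \<oplus> h \<preceq> z \<oplus> (ng z \<oplus> b)" using h zU ab by (simp add: not_less[symmetric] del: add_ng)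
        then have "z' \<prec> b" using z' zU ab by (auto intro: less_le_trans)
        moreover have "a \<oplus> h \<preceq> a \<oplus> (ng a \<oplus> z)" using h zU ab by (simp add: not_less[symmetric] del: add_ng)
        then have "a \<oplus> h \<prec> z' \<oplus> h" using z' zU ab by (auto intro: le_less_trans)
        then have "a \<prec> z'" using ab h z' by simp
        ultimately show "mt \<epsilon> z z'" using ab z' by (simp add: ival_def)
      qed
      then show "\<exists>\<eta>\<in>U. zr \<prec> \<eta> \<and> Q \<eta> z" using h by blast
    next
      fix \<eta> \<eta>' z assume a: "\<eta> \<in> U" "\<eta>' \<in> U" "zr \<prec> \<eta>'" "\<eta>' \<prec> \<eta>" "z \<in> ival l2 r2" "Q \<eta> z"
      show "Q \<eta>' z" unfolding Q_def
      proof (intro ballI impI)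
        fix z' assume z': "z' \<in> U" "z \<prec> z' \<oplus> \<eta>'" "z' \<prec> z \<oplus> \<eta>'"
        have "z' \<oplus> \<eta>' \<prec> z' \<oplus> \<eta>" "z \<oplus> \<eta>' \<prec> z \<oplus> \<eta>" using a z' by (simp_all add: ival_def)
        then show "mt \<epsilon> z z'" using a(6) z' unfolding Q_def by (meson less_trans)
      qed
    qed blast
    obtain p where p: "p \<in> U" "l3 \<prec> p" "p \<prec> r3" using dense[OF 3(1-3)] by blast
    define q where "q = (if p \<oplus> \<eta> \<prec> r3 then p \<oplus> \<eta> else r3)"
    have q: "q \<in> U" "p \<prec> q" "q \<preceq> p \<oplus> \<eta>" "q \<preceq> r3" using p 3 \<eta> by (auto simp: q_def)
    have s3: "ival p q \<subseteq> ival l3 r3" by (rule ival_sub) (use p q in auto)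
    obtain z where z: "z \<in> U" "p \<prec> z" "z \<prec> q" using dense[OF p(1) q(1,2)] by blast
    have close: "u \<prec> v \<oplus> \<eta>" if "u \<in> ival p q" "v \<in> ival p q" for u v
    proof -
      have "u \<prec> p \<oplus> \<eta>" using that q(3) by (auto simp: ival_def intro: less_le_trans)
      also have "\<dots> \<prec> v \<oplus> \<eta>" using that p \<eta> by (simp add: ival_def)
      finally show ?thesis .
    qed
    have "mt \<epsilon> z1 z2" if "z1 \<in> ival p q" "z2 \<in> ival p q" for z1 z2
    proof -
      have "Q \<eta> z1" using 3(5) s3 that by blast
      then show ?thesis using close[of z1 z2] close[of z2 z1] that unfolding Q_def by (meson ivalD(1))
    qed
    moreover have "gap \<epsilon> z1" if "z1 \<in> ival p q" for z1 using 1(5) 2(4) 3(4) s3 that by blast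
    ultimately have "good z" unfolding good_def using p(1) q(1) z \<epsilon> by blast
    moreover have "z \<in> ival l r" using z s3 3(4) 2(4) 1(4) by (auto simp: ival_def)
    ultimately show ?thesis by blast
  qed
  define N where "N z = card {u \<in> U. E z u}" for z
  have loc: "\<exists>l\<in>U. \<exists>r\<in>U. l \<prec> z \<and> z \<prec> r \<and> (\<forall>z'\<in>ival l r. N z' = N z)" if g: "good z" and zU: "z \<in> U" for z
  proof -
    obtain l r \<epsilon> where lr: "l \<in> U" "r \<in> U" "l \<prec> z" "z \<prec> r" and \<epsilon>: "\<epsilon> \<in> U" "zr \<prec> \<epsilon>"
      and gp: "\<And>z1. z1 \<in> ival l r \<Longrightarrow> gap \<epsilon> z1" and m: "\<And>z1 z2. z1 \<in> ival l r \<Longrightarrow> z2 \<in> ival l r \<Longrightarrow> mt \<epsilon> z1 z2"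
      using g unfolding good_def by (metis ivalD(1))
    have le: "N z1 \<le> N z2" if z12: "z1 \<in> ival l r" "z2 \<in> ival l r" for z1 z2
    proof -
      have "\<forall>u\<in>{u \<in> U. E z1 u}. \<exists>v. v \<in> U \<and> E z2 v \<and> near \<epsilon> u v" using m[OF z12] unfolding mt_def by blast
      then obtain f where f: "\<forall>u\<in>{u \<in> U. E z1 u}. f u \<in> U \<and> E z2 (f u) \<and> near \<epsilon> u (f u)" by (rule bchoice[THEN exE])
      have no: False if "u \<in> U" "u' \<in> U" "E z1 u" "E z1 u'" "u \<prec> u'" "f u = f u'" for u u'
      proof -
        have "u' \<prec> f u \<oplus> \<epsilon>" using f that unfolding near_def by auto
        also have "f u \<oplus> \<epsilon> \<prec> u \<oplus> \<epsilon> \<oplus> \<epsilon>" using f that \<epsilon> unfolding near_def by auto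
        also have "\<dots> \<preceq> u'" using gp[OF z12(1)] that unfolding gap_def by blast
        finally show False by simp
      qed
      have "inj_on f {u \<in> U. E z1 u}"
      proof (rule inj_onI)
        fix u u' assume "u \<in> {u \<in> U. E z1 u}" "u' \<in> {u \<in> U. E z1 u}" "f u = f u'"
        then show "u = u'" using no[of u u'] no[of u' u] by (cases u u' rule: linorder_cases) auto
      qed
      then show ?thesis unfolding N_def using f fin[of z2] z12(2)
        by (intro card_inj_on_le[of f]) (auto simp: ival_def)
    qed
    have "z \<in> ival l r" using lr zU by (simp add: ival_def)
    then show ?thesis using lr le by (metis order_class.order.antisym)
  qed
  have finB: "finite {z \<in> U. \<not> good z}"
  proof (rule ccontr)
    assume i: "infinite {z \<in> U. \<not> good z}"
    obtain l r where "l \<in> U" "r \<in> U" "l \<prec> r" "\<forall>x\<in>ival l r. \<not> good x"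
      by (rule Def_infinite_ival[of "\<lambda>z. \<not> good z", OF Def_not[OF Dgood] i])
    then show False using sub[of l r] by blast
  qed
  let ?B = "{z \<in> U. \<not> good z}"
  have DN: "Def U (\<lambda>e. k \<le> N (e 0))" for k
    unfolding N_def by (rule Def_card[of U "\<lambda>e u. E (e 0) u"]) (intro E T_var, use fin env_nth in blast)
  have const: "N a = N b" if ab: "a \<in> U" "b \<in> U" "a \<preceq> b" "\<And>c. c \<in> U \<Longrightarrow> a \<preceq> c \<Longrightarrow> c \<preceq> b \<Longrightarrow> good c" for a b
  proof -
    have "(k \<le> N a) = (k \<le> N b)" for k
    proof (rule tame_connected[OF tame_Def[OF DN] ab(1-3)])
      fix x assume x: "x \<in> U" "a \<preceq> x" "x \<preceq> b"
      then show "\<exists>l\<in>U. \<exists>r\<in>U. l \<prec> x \<and> x \<prec> r \<and> (\<forall>y\<in>ival l r. a \<preceq> y \<longrightarrow> y \<preceq> b \<longrightarrow> (k \<le> N y) = (k \<le> N x))"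
        using loc[OF ab(4) x(1)] by metis
    qed
    from this[of "N a"] this[of "N b"] show ?thesis by simp
  qed
  have same: "N a = N b" if "a \<in> U" "b \<in> U" "good a" "good b" "{c \<in> ?B. c \<prec> a} = {c \<in> ?B. c \<prec> b}" for a b
  proof -
    have *: "N a = N b" if ab: "a \<in> U" "b \<in> U" "good a" "good b" "{c \<in> ?B. c \<prec> a} = {c \<in> ?B. c \<prec> b}" "a \<preceq> b" for a b
    proof (rule const[OF ab(1,2,6)], rule ccontr)
      fix c assume c: "c \<in> U" "a \<preceq> c" "c \<preceq> b" "\<not> good c"
      then have "c \<noteq> b" using ab by blast
      then have "c \<in> {c \<in> ?B. c \<prec> b}" using c by auto
      then have "c \<prec> a" using ab(5) by blast
      then show False using c by auto
    qed
    show ?thesis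
    proof (cases "a \<preceq> b")
      case True
      show ?thesis by (rule *[OF that True])
    next
      case False
      then show ?thesis using *[OF that(2,1,4,3) that(5)[symmetric]] by simp
    qed
  qed
  have "finite (N ` {z \<in> U. good z})"
  proof -
    \<comment> \<open>At good points the size of the fibre depends only on the set of exceptional
      points below, and there are finitely many such sets.\<close>
    define h where "h G = N (SOME z. z \<in> U \<and> good z \<and> {c \<in> ?B. c \<prec> z} = G)" for G
    have "N z = h {c \<in> ?B. c \<prec> z}" if "z \<in> U" "good z" for z
      unfolding h_def
    proof (rule someI2[of _ z])
      show "z \<in> U \<and> good z \<and> {c \<in> ?B. c \<prec> z} = {c \<in> ?B. c \<prec> z}" using that by blast
      fix y assume y: "y \<in> U \<and> good y \<and> {c \<in> ?B. c \<prec> y} = {c \<in> ?B. c \<prec> z}"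
      show "N z = N y" by (rule same) (use that y in blast)+
    qed
    then have "N ` {z \<in> U. good z} \<subseteq> h ` Pow ?B" by blast
    then show ?thesis using finB finite_subset by blast
  qed
  then have "finite (N ` {z \<in> U. good z} \<union> N ` ?B)" using finB by blast
  moreover have "N ` U \<subseteq> N ` {z \<in> U. good z} \<union> N ` ?B" by blast
  ultimately have "finite (N ` U)" using finite_subset by blast
  then obtain K where "\<forall>k\<in>N ` U. k \<le> K" unfolding finite_nat_set_iff_bounded_le by blast
  then show ?thesis unfolding N_def by blast
qed

text \<open>The points at which \<open>P\<close> is not locally constant form a definable family of
  finite sets, to which \<open>uniform_card\<close> applies; by connectedness these points are all
  the breaks that are needed.\<close>

lemma uniform_breaks:
  assumes D: "Def U (\<lambda>e. P (e 0) (e 1))"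
  shows "\<exists>K. \<forall>z\<in>U. \<exists>F. finite F \<and> F \<subseteq> U \<and> card F \<le> K \<and> breaks F (\<lambda>u. P u z)"
proof -
  note P = Def_subst2[of U P, OF D]
  define bd where "bd z u \<longleftrightarrow> (\<forall>l\<in>U. \<forall>r\<in>U. l \<prec> u \<longrightarrow> u \<prec> r \<longrightarrow> (\<exists>x\<in>U. x \<in> ival l r \<and> P x z \<noteq> P u z))" for z u
  have Dbd: "Def U (\<lambda>e. bd (e 0) (e 1))" unfolding bd_def by (intro dfs Def_ival P)
  have DP: "Def U (\<lambda>e. P (e 0) z)" if "z \<in> U" for z by (intro P T_var T_U that)
  have fin: "finite {u \<in> U. bd z u}" if z: "z \<in> U" for z
  proof -
    obtain F where F: "finite F" "F \<subseteq> U" "breaks F (\<lambda>u. P u z)" using tame_Def[OF DP[OF z]] by (auto simp: tame_def)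
    have "u \<in> F" if u: "u \<in> U" "bd z u" for u
    proof (rule ccontr)
      assume uF: "u \<notin> F"
      obtain l r where lr: "l \<in> U" "r \<in> U" "l \<prec> u" "u \<prec> r" "\<forall>c\<in>F. c \<noteq> u \<longrightarrow> c \<notin> ival l r" using near[OF F(1,2) u(1)] by blast
      then have "\<forall>c\<in>F. c \<notin> ival l r" using uF by metis
      then have "P x z = P u z" if "x \<in> ival l r" for x
        using breaks_ival[OF F(3) _ that _ F(2), of u] lr u by (simp add: ival_def)
      then show False using u(2) lr unfolding bd_def by blast
    qed
    then have "{u \<in> U. bd z u} \<subseteq> F" by blast
    then show ?thesis using F(1) by (rule finite_subset)
  qed
  obtain K where K: "\<forall>z\<in>U. card {u \<in> U. bd z u} \<le> K" using uniform_card[of bd, OF Dbd fin] by blast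
  have "breaks {u \<in> U. bd z u} (\<lambda>u. P u z)" if z: "z \<in> U" for z
    unfolding breaks_def
  proof (intro ballI impI)
    fix a b assume ab: "a \<in> U" "b \<in> U" "a \<prec> b" "\<forall>c\<in>{u \<in> U. bd z u}. \<not> (a \<preceq> c \<and> c \<preceq> b)"
    show "P a z = P b z"
    proof (rule tame_connected[OF tame_Def[OF DP[OF z]] ab(1,2)])
      fix x assume x: "x \<in> U" "a \<preceq> x" "x \<preceq> b"
      then have "\<not> bd z x" using ab(4) by blast
      then show "\<exists>l\<in>U. \<exists>r\<in>U. l \<prec> x \<and> x \<prec> r \<and> (\<forall>y\<in>ival l r. a \<preceq> y \<longrightarrow> y \<preceq> b \<longrightarrow> P y z = P x z)"
        unfolding bd_def by (meson ivalD(1))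
    qed (use ab in auto)
  qed
  then have "finite {u \<in> U. bd z u} \<and> {u \<in> U. bd z u} \<subseteq> U \<and> card {u \<in> U. bd z u} \<le> K \<and> breaks {u \<in> U. bd z u} (\<lambda>u. P u z)"
    if "z \<in> U" for z using K fin that by blast
  then show ?thesis by meson
qed

end

section \<open>Elementary substructures\<close>

text \<open>Under the two universal quantifiers the variables 1 and 0 are the two arguments
  \<open>x\<close> and \<open>y\<close> of \<open>breaks\<close>, the variables
  \<open>2, ..., K + 1\<close> are the break points, and the parameters follow. Break points may be
  repeated, so \<open>K\<close> is only an upper bound for their number.\<close>

definition tamef :: "'r \<Rightarrow> nat \<Rightarrow> nat \<Rightarrow> ('f, 'r) fm \<Rightarrow> ('f, 'r) fm" where
  "tamef lt K p \<phi> = Exs K (All (All (Imp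
     (Conj (Rel lt [Var 1, Var 0])
       (Conjs (map (\<lambda>i. Neg (Conj (Neg (Rel lt [Var (i + 2), Var 1])) (Neg (Rel lt [Var 0, Var (i + 2)])))) [0..<K])))
     (Iff (sub (1 # [K + 2..<K + 2 + p]) \<phi>) (sub (0 # [K + 2..<K + 2 + p]) \<phi>)))))"

lemma tamef_formulas: assumes "rel_arity L lt = 2" "\<phi> \<in> formulas L (Suc p)" shows "tamef lt K p \<phi> \<in> formulas L p"
proof -
  have len: "length (v # [K + 2..<K + 2 + p]) = Suc p" for v :: nat
    by (simp only: list.size length_upt)
  have "sub (v # [K + 2..<K + 2 + p]) \<phi> \<in> formulas L (Suc (Suc (K + p)))" if "v < 2" for v
  proof (rule sub_formulas)
    show "\<phi> \<in> formulas L (length (v # [K + 2..<K + 2 + p]))" unfolding len by (rule assms(2))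
  qed (use that in auto)
  then show ?thesis unfolding tamef_def
    by (intro Exs_formulas) (use assms(1) in \<open>auto intro!: Conjs_formulas simp del: upt_Suc\<close>)
qed

context og
begin

lemma breaks_mono: "breaks F P \<Longrightarrow> F \<subseteq> G \<Longrightarrow> breaks G P"
  unfolding breaks_def by blast

lemma sat_tamef: assumes "\<phi> \<in> formulas L (Suc p)" "m \<in> nlists p U"
  shows "sat S m (tamef ltr K p \<phi>) \<longleftrightarrow> (\<exists>F. finite F \<and> F \<subseteq> U \<and> card F \<le> K \<and> breaks F (\<lambda>u. sat S (u # m) \<phi>))"
proof -
  have lm: "length m = p" using assms(2) by simp
  have gen: "sat S (y # x # cs @ m) (sub (v # [K + 2..<K + 2 + p]) \<phi>) \<longleftrightarrow> sat S (w # m) \<phi>"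
    if "length cs = K" "(y # x # cs @ m) ! v = w" for x y cs v w
  proof (rule sat_sub')
    show "\<phi> \<in> formulas L (length (v # [K + 2..<K + 2 + p]))"
      unfolding list.size length_upt using assms(1) by simp
    show "length (w # m) = length (v # [K + 2..<K + 2 + p])"
      unfolding list.size length_upt using lm by simp
    fix i assume "i < length (v # [K + 2..<K + 2 + p])"
    then have "i < Suc p" unfolding list.size length_upt by simp
    then show "(y # x # cs @ m) ! ((v # [K + 2..<K + 2 + p]) ! i) = (w # m) ! i"
      using that by (cases i) (auto simp: nth_append simp del: upt_Suc)
  qed
  have s1: "sat S (y # x # cs @ m) (sub (1 # [K + 2..<K + 2 + p]) \<phi>) \<longleftrightarrow> sat S (x # m) \<phi>"
    and s0: "sat S (y # x # cs @ m) (sub (0 # [K + 2..<K + 2 + p]) \<phi>) \<longleftrightarrow> sat S (y # m) \<phi>"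
    if "length cs = K" for x y cs
    by (rule gen; use that in simp)+
  have "sat S m (tamef ltr K p \<phi>) \<longleftrightarrow> (\<exists>cs\<in>nlists K U. breaks (set cs) (\<lambda>u. sat S (u # m) \<phi>))"
    unfolding tamef_def sat_Exs
  proof (rule bex_cong[OF refl])
    fix cs assume cs: "cs \<in> nlists K U"
    have csU: "cs ! i \<in> U" if "i < K" for i using cs that by (rule nlistsE_nth_in)
    have c: "sat S (y # x # cs @ m) (Conj (Rel ltr [Var 1, Var 0])
       (Conjs (map (\<lambda>i. Neg (Conj (Neg (Rel ltr [Var (i + 2), Var 1])) (Neg (Rel ltr [Var 0, Var (i + 2)])))) [0..<K])))
      \<longleftrightarrow> x \<prec> y \<and> (\<forall>c\<in>set cs. \<not> (x \<preceq> c \<and> c \<preceq> y))" if xy: "x \<in> U" "y \<in> U" for x y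
    proof -
      have "(\<forall>i<K. \<not> (\<not> rel_int S ltr [cs ! i, x] \<and> \<not> rel_int S ltr [y, cs ! i])) \<longleftrightarrow> (\<forall>c\<in>set cs. \<not> (x \<preceq> c \<and> c \<preceq> y))" (is "_ = ?r")
        using cs csU xy by (simp add: ltr_iff all_set_conv_all_nth not_less)
      then have "(\<forall>i\<in>{0..<K}. rel_int S ltr [cs ! i, x] \<or> rel_int S ltr [y, cs ! i]) = ?r" by auto
      moreover have "length cs = K" using cs by simp
      ultimately show ?thesis using xy by (simp add: sat_Conjs ltr_iff nth_append)
    qed
    show "sat S (cs @ m) (All (All (Imp
     (Conj (Rel ltr [Var 1, Var 0])
       (Conjs (map (\<lambda>i. Neg (Conj (Neg (Rel ltr [Var (i + 2), Var 1])) (Neg (Rel ltr [Var 0, Var (i + 2)])))) [0..<K])))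
     (Iff (sub (1 # [K + 2..<K + 2 + p]) \<phi>) (sub (0 # [K + 2..<K + 2 + p]) \<phi>))))) \<longleftrightarrow>
      breaks (set cs) (\<lambda>u. sat S (u # m) \<phi>)"
      unfolding breaks_def sat.simps(3,5) sat.simps(4)[of S "_ # _ # _" "Conj _ _" "Neg (Conj _ _)"] c[symmetric]
      using cs c s0 s1 by (simp del: sat.simps(2)) blast
  qed
  also have "\<dots> \<longleftrightarrow> (\<exists>F. finite F \<and> F \<subseteq> U \<and> card F \<le> K \<and> breaks F (\<lambda>u. sat S (u # m) \<phi>))"
  proof
    assume "\<exists>cs\<in>nlists K U. breaks (set cs) (\<lambda>u. sat S (u # m) \<phi>)"
    then obtain cs where cs: "cs \<in> nlists K U" "breaks (set cs) (\<lambda>u. sat S (u # m) \<phi>)" by blast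
    then have "finite (set cs)" "set cs \<subseteq> U" "card (set cs) \<le> K" using card_length[of cs] by simp_all
    then show "\<exists>F. finite F \<and> F \<subseteq> U \<and> card F \<le> K \<and> breaks F (\<lambda>u. sat S (u # m) \<phi>)"
      using cs(2) by blast
  next
    assume "\<exists>F. finite F \<and> F \<subseteq> U \<and> card F \<le> K \<and> breaks F (\<lambda>u. sat S (u # m) \<phi>)"
    then obtain F where F: "finite F" "F \<subseteq> U" "card F \<le> K" "breaks F (\<lambda>u. sat S (u # m) \<phi>)" by blast
    obtain fs where fs: "set fs = F" "distinct fs" using F(1) finite_distinct_list by blast
    \<comment> \<open>The formula asks for a list of exactly \<open>K\<close> points. Padding with
      zero is harmless, since additional break points preserve \<open>breaks\<close>.\<close>
    let ?cs = "fs @ replicate (K - length fs) zr"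
    have "length fs \<le> K" using fs F(3) distinct_card[OF fs(2)] by simp
    then have "length ?cs = K" by simp
    moreover have "set ?cs \<subseteq> insert zr F" using fs by auto
    then have "set ?cs \<subseteq> U" using F(2) zr_in by blast
    ultimately have "?cs \<in> nlists K U" by (rule nlistsI)
    moreover have "breaks (set ?cs) (\<lambda>u. sat S (u # m) \<phi>)" using breaks_mono[OF F(4)] fs by auto
    ultimately show "\<exists>cs\<in>nlists K U. breaks (set cs) (\<lambda>u. sat S (u # m) \<phi>)" by (rule bexI[rotated])
  qed
  finally show ?thesis .
qed

end

section \<open>Densely ordered groups as a theory\<close>

text \<open>The neutral element is bound existentially because the language has no constant for it.
  Density is one of the axioms, so that every structure satisfying the sentence can be seen as an
  instance of \<open>ogd\<close>.\<close>

definition og_ax :: "'r \<Rightarrow> 'f \<Rightarrow> ('f, 'r) fm" where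
  "og_ax lt pl = (let R = (\<lambda>i j. Rel lt [Var i, Var j]); P = (\<lambda>s t. App pl [s, t]) in
    Conjs [All (Neg (R 0 0)), All (All (All (Imp (R 2 1) (Imp (R 1 0) (R 2 0))))),
      All (All (Disj (Eq (Var 0) (Var 1)) (Disj (R 1 0) (R 0 1)))),
      All (All (Imp (R 1 0) (Ex (Conj (R 2 0) (R 0 1))))),
      All (All (All (Eq (P (P (Var 2) (Var 1)) (Var 0)) (P (Var 2) (P (Var 1) (Var 0)))))),
      All (All (All (Imp (R 2 1) (Conj (Rel lt [P (Var 0) (Var 2), P (Var 0) (Var 1)]) (Rel lt [P (Var 2) (Var 0), P (Var 1) (Var 0)]))))),
      Ex (Conj (Conj (All (Conj (Eq (P (Var 1) (Var 0)) (Var 0)) (Eq (P (Var 0) (Var 1)) (Var 0))))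
           (All (Ex (Conj (Eq (P (Var 0) (Var 1)) (Var 2)) (Eq (P (Var 1) (Var 0)) (Var 2))))))
         (Ex (Neg (Eq (Var 0) (Var 1)))))])"

lemma og_ax_formulas: "rel_arity L lt = 2 \<Longrightarrow> fun_arity L pl = 2 \<Longrightarrow> og_ax lt pl \<in> formulas L 0"
  unfolding og_ax_def Let_def by (auto intro!: Conjs_formulas)

lemma sat_og_ax:
  fixes S :: "('f, 'r, 'a) struct" and lt :: 'r and pl :: 'f
  defines "R \<equiv> \<lambda>x y. rel_int S lt [x, y]" and "P \<equiv> \<lambda>x y. fun_int S pl [x, y]"
  shows "sat S [] (og_ax lt pl) \<longleftrightarrow>
    (\<forall>x\<in>univ S. \<not> R x x) \<and> (\<forall>x\<in>univ S. \<forall>y\<in>univ S. \<forall>z\<in>univ S. R x y \<longrightarrow> R y z \<longrightarrow> R x z) \<and>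
    (\<forall>x\<in>univ S. \<forall>y\<in>univ S. y = x \<or> R x y \<or> R y x) \<and>
    (\<forall>x\<in>univ S. \<forall>y\<in>univ S. R x y \<longrightarrow> (\<exists>z\<in>univ S. R x z \<and> R z y)) \<and>
    (\<forall>x\<in>univ S. \<forall>y\<in>univ S. \<forall>z\<in>univ S. P (P x y) z = P x (P y z)) \<and>
    (\<forall>x\<in>univ S. \<forall>y\<in>univ S. \<forall>z\<in>univ S. R x y \<longrightarrow> R (P z x) (P z y) \<and> R (P x z) (P y z)) \<and>
    (\<exists>e\<in>univ S. (\<forall>x\<in>univ S. P e x = x \<and> P x e = x) \<and> (\<forall>x\<in>univ S. \<exists>y\<in>univ S. P y x = e \<and> P x y = e) \<and> (\<exists>x\<in>univ S. x \<noteq> e))"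
  unfolding og_ax_def Let_def sat_Conjs R_def P_def
  by (simp add: numeral_2_eq_2)

lemma ex_linorder_extension:
  fixes R :: "'a \<Rightarrow> 'a \<Rightarrow> bool"
  assumes "\<forall>x\<in>V. \<not> R x x" "\<forall>x\<in>V. \<forall>y\<in>V. \<forall>z\<in>V. R x y \<longrightarrow> R y z \<longrightarrow> R x z" "\<forall>x\<in>V. \<forall>y\<in>V. y = x \<or> R x y \<or> R y x"
  obtains le less where "class.linorder le less" "\<And>x y. x \<in> V \<Longrightarrow> y \<in> V \<Longrightarrow> less x y \<longleftrightarrow> R x y"
proof -
  obtain W :: "'a rel" where W: "well_order_on UNIV W" using well_order_on by blast
  then have lin: "refl W" "trans W" "antisym W" "total W"
    by (auto simp: well_order_on_def linear_order_on_def partial_order_on_def preorder_on_def)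
  \<comment> \<open>The elements outside \<open>V\<close> are placed above \<open>V\<close> and
    ordered among themselves by a well-order of the type.\<close>
  define less where "less x y \<longleftrightarrow> x \<in> V \<and> y \<in> V \<and> R x y \<or> x \<in> V \<and> y \<notin> V \<or> x \<notin> V \<and> y \<notin> V \<and> (x, y) \<in> W \<and> x \<noteq> y" for x y
  define le where "le x y \<longleftrightarrow> less x y \<or> x = y" for x y
  have irr: "\<not> less x x" for x using assms(1) by (auto simp: less_def)
  have tr: "less x z" if "less x y" "less y z" for x y z
    using that assms(2) transD[OF lin(2), of x y z] antisymD[OF lin(3), of x y] unfolding less_def by metis
  have tot: "x = y \<or> less x y \<or> less y x" for x y
    using assms(3) lin(4) unfolding less_def total_on_def by blast
  have "class.linorder le less"
    by unfold_locales (use irr tr tot in \<open>unfold le_def, blast+\<close>)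
  then show thesis by (rule that) (auto simp: less_def)
qed

lemma ex_ogd:
  assumes S: "is_structure L S" and ar: "rel_arity L lt = 2" "fun_arity L pl = 2" and ax: "sat S [] (og_ax lt pl)"
  obtains le less zr ng where "ogd le less L S lt pl zr ng"
proof -
  define R where "R x y = rel_int S lt [x, y]" for x y
  define P where "P x y = fun_int S pl [x, y]" for x y
  note b1 = ax[unfolded sat_og_ax, folded R_def P_def]
  note a1 = conjunct1[OF b1] and b2 = conjunct2[OF b1]
  note a2 = conjunct1[OF b2] and b3 = conjunct2[OF b2]
  note a3 = conjunct1[OF b3] and b4 = conjunct2[OF b3]
  note a4 = conjunct1[OF b4] and b5 = conjunct2[OF b4]
  note a5 = conjunct1[OF b5] and b6 = conjunct2[OF b5]
  note a6 = conjunct1[OF b6] and a7 = conjunct2[OF b6]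
  obtain le less where le: "class.linorder le less" "\<And>x y. x \<in> univ S \<Longrightarrow> y \<in> univ S \<Longrightarrow> less x y \<longleftrightarrow> R x y"
    by (rule ex_linorder_extension[OF a1 a2 a3]) (rule that)
  obtain zr where zr: "zr \<in> univ S" "\<forall>x\<in>univ S. P zr x = x \<and> P x zr = x" "\<forall>x\<in>univ S. \<exists>y\<in>univ S. P y x = zr \<and> P x y = zr" "\<exists>x\<in>univ S. x \<noteq> zr"
    using a7 by blast
  obtain ng where ng: "\<forall>x\<in>univ S. ng x \<in> univ S \<and> P (ng x) x = zr \<and> P x (ng x) = zr" using zr(3) by metis
  have cl: "P x y \<in> univ S" if "x \<in> univ S" "y \<in> univ S" for x y
  proof -
    have "[x, y] \<in> nlists (fun_arity L pl) (univ S)" unfolding ar nlists_def using that by simp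
    then show ?thesis using S unfolding is_structure_def P_def by meson
  qed
  interpret linorder le less by (rule le(1))
  have "ogd le less L S lt pl zr ng"
  proof unfold_locales
    fix x y z
    show "is_structure L S" "rel_arity L lt = 2" "fun_arity L pl = 2" "zr \<in> univ S" by fact+
    show "\<exists>x\<in>univ S. x \<noteq> zr" by fact
    assume x: "x \<in> univ S"
    show "ng x \<in> univ S" "fun_int S pl [zr, x] = x" "fun_int S pl [x, zr] = x"
      "fun_int S pl [ng x, x] = zr" "fun_int S pl [x, ng x] = zr" using zr(2) ng x unfolding P_def by blast+
    assume y: "y \<in> univ S"
    show "rel_int S lt [x, y] = less x y" using le(2) x y unfolding R_def by simp
    show "\<exists>z\<in>univ S. less x z \<and> less z y" if "less x y"
    proof -
      have "R x y" using le(2) x y that by simp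
      then obtain z where "z \<in> univ S" "R x z" "R z y" using a4 x y by blast
      then show ?thesis using le(2) x y by blast
    qed
    assume z: "z \<in> univ S"
    show "fun_int S pl [fun_int S pl [x, y], z] = fun_int S pl [x, fun_int S pl [y, z]]"
      using a5 x y z unfolding P_def by blast
    assume l: "less x y"
    have "R (P z x) (P z y) \<and> R (P x z) (P y z)" using a6 x y z l le(2) by blast
    then show "less (fun_int S pl [z, x]) (fun_int S pl [z, y])" "less (fun_int S pl [x, z]) (fun_int S pl [y, z])"
      using le(2) cl x y z unfolding P_def by blast+
  qed
  then show thesis by (rule that)
qed

text \<open>Recovers o-minimality from its first-order traces. Here the bound \<open>K\<close> may
  still depend on the parameters \<open>m\<close>.\<close>

lemma (in ogd) omin_tamef:
  assumes "\<And>p \<phi> m. \<phi> \<in> formulas L (Suc p) \<Longrightarrow> m \<in> nlists p U \<Longrightarrow> \<exists>K. sat S m (tamef ltr K p \<phi>)"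
  shows "omin le less L S ltr pl zr ng"
proof unfold_locales
  fix P assume "Def U (\<lambda>e. P (e 0))"
  then obtain xs where xs: "set xs \<subseteq> U" "Def (set xs) (\<lambda>e. P (e 0))" by (rule Def_params)
  obtain \<phi> where \<phi>: "\<phi> \<in> formulas L (Suc (length xs))" "\<forall>u\<in>U. P u \<longleftrightarrow> sat S (u # xs) \<phi>"
    by (rule Def_params_formula[of xs P, OF xs(2)]) (rule that)
  have x: "xs \<in> nlists (length xs) U" using xs(1) by (intro nlistsI) auto
  obtain K where "sat S xs (tamef ltr K (length xs) \<phi>)" using assms[OF \<phi>(1) x] by (rule exE) (rule that)
  then obtain F where F: "finite F" "F \<subseteq> U" "breaks F (\<lambda>u. sat S (u # xs) \<phi>)"
    unfolding sat_tamef[OF \<phi>(1) x] by (elim exE conjE) (rule that)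
  have "breaks F P" using F(3) \<phi>(2) unfolding breaks_def by simp
  then show "tame P" unfolding tame_def using F(1,2) by blast
qed

text \<open>Elementary substructures, characterised by the Tarski--Vaught test.\<close>

definition elem_sub :: "('f, 'r) language \<Rightarrow> ('f, 'r, 'a) struct \<Rightarrow> 'a set \<Rightarrow> bool" where
  "elem_sub L N V \<longleftrightarrow> V \<subseteq> univ N \<and> V \<noteq> {} \<and> (\<forall>p. \<forall>\<phi>\<in>formulas L (Suc p). \<forall>m\<in>nlists p V.
     (\<exists>u\<in>univ N. sat N (u # m) \<phi>) \<longrightarrow> (\<exists>u\<in>V. sat N (u # m) \<phi>))"

lemma eval_univ: "eval (N\<lparr>univ := V\<rparr>) e t = eval N e t"
  by (induction t) (auto cong: map_cong)

lemma elem_sub_sat: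
  assumes "elem_sub L N V"
  shows "\<phi> \<in> formulas L n \<Longrightarrow> e \<in> nlists n V \<Longrightarrow> sat (N\<lparr>univ := V\<rparr>) e \<phi> \<longleftrightarrow> sat N e \<phi>"
proof (induction \<phi> arbitrary: n e)
  case (Ex \<phi>)
  have "sat (N\<lparr>univ := V\<rparr>) e (Ex \<phi>) \<longleftrightarrow> (\<exists>c\<in>V. sat N (c # e) \<phi>)"
    using Ex.IH[of "Suc n"] Ex.prems by simp
  also have "\<dots> \<longleftrightarrow> (\<exists>c\<in>univ N. sat N (c # e) \<phi>)"
  proof -
    have "\<phi> \<in> formulas L (Suc n)" using Ex.prems by simp
    then show ?thesis using assms Ex.prems(2) unfolding elem_sub_def by blast
  qed
  finally show ?case by simp
next
  case (Eq s t)
  then show ?case by (simp add: eval_univ)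
next
  case (Rel r ts)
  have "eval (N\<lparr>univ := V\<rparr>) e = eval N e" by (rule ext) (rule eval_univ)
  then show ?case by simp
next
  case (Neg \<phi>)
  then show ?case by simp
next
  case (Conj \<phi>1 \<phi>2)
  then have "\<phi>1 \<in> formulas L n" "\<phi>2 \<in> formulas L n" by auto
  then show ?case using Conj by simp
qed

lemma elem_sub_structure:
  assumes N: "is_structure L N" and V: "elem_sub L N V"
  shows "is_structure L (N\<lparr>univ := V\<rparr>)"
proof -
  have "fun_int N f as \<in> V" if as: "as \<in> nlists (fun_arity L f) V" for f as
  proof -
    let ?k = "fun_arity L f"
    \<comment> \<open>Closure under the function symbol \<open>f\<close> is the Tarski--Vaught
      condition for the equation whose only solution is the value of \<open>f\<close>.\<close>
    let ?\<phi> = "Eq (Var 0) (App f (map Var [1..<Suc ?k]))"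
    have f: "?\<phi> \<in> formulas L (Suc ?k)" by auto
    have l: "length as = ?k" using as by simp
    have "map (eval N (u # as)) (map Var [1..<Suc ?k]) = as" for u
      by (rule nth_equalityI) (auto simp: l simp del: upt_Suc)
    then have e: "sat N (u # as) ?\<phi> \<longleftrightarrow> u = fun_int N f as" for u by (simp add: o_def)
    have "as \<in> nlists ?k (univ N)" using as V nlists_mono[of V "univ N" ?k] unfolding elem_sub_def by blast
    then have "fun_int N f as \<in> univ N" using N unfolding is_structure_def by blast
    then have "\<exists>u\<in>V. sat N (u # as) ?\<phi>" using V f as e unfolding elem_sub_def by blast
    then show ?thesis using e by auto
  qed
  then show ?thesis using V unfolding is_structure_def elem_sub_def by simp
qed

section \<open>Boundary points and definable choice\<close>

context ogd
begin

text \<open>The least element of a finite definable set is definable, and without it the set is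
  smaller and still definable.\<close>

lemma finite_Def_dcl: "Def A (\<lambda>e. X (e 0)) \<Longrightarrow> finite {u \<in> U. X u} \<Longrightarrow> {u \<in> U. X u} \<subseteq> dcl A"
proof (induction "card {u \<in> U. X u}" arbitrary: X rule: less_induct)
  case less
  show ?case
  proof (cases "{u \<in> U. X u} = {}")
    case False
    note X = Def_subst1[of A X, OF less.prems(1)]
    obtain m where m: "m \<in> U" "X m" "\<forall>y\<in>U. X y \<longrightarrow> m \<preceq> y" using finite_least[OF less.prems(2) False] by blast
    have "Def A (\<lambda>e. X (e 0) \<and> (\<forall>y\<in>U. X y \<longrightarrow> e 0 \<preceq> y))" by (intro dfs X)
    then have "Def A (\<lambda>e. e 0 = m)"
      by (rule Def_cong) (use m env_nth in \<open>metis order.antisym\<close>)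
    then have md: "m \<in> dcl A" using m(1) by (simp add: dcl_def)
    let ?X = "\<lambda>u. X u \<and> (\<exists>y\<in>U. X y \<and> y \<prec> u)"
    have D: "Def A (\<lambda>e. ?X (e 0))" by (intro dfs X)
    have sub: "{u \<in> U. ?X u} \<subseteq> {u \<in> U. X u}" by blast
    have "m \<notin> {u \<in> U. ?X u}" using m(3) by auto
    then have "{u \<in> U. ?X u} \<subset> {u \<in> U. X u}" using sub m by blast
    then have "card {u \<in> U. ?X u} < card {u \<in> U. X u}" by (rule psubset_card_mono[OF less.prems(2)])
    then have "{u \<in> U. ?X u} \<subseteq> dcl A" using less.hyps[of ?X] D finite_subset[OF sub less.prems(2)] by blast
    moreover have "{u \<in> U. X u} \<subseteq> insert m {u \<in> U. ?X u}"
    proof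
      fix u assume "u \<in> {u \<in> U. X u}"
      then show "u \<in> insert m {u \<in> U. ?X u}" using m le_less by auto
    qed
    ultimately show ?thesis using md by blast
  qed (simp only: empty_subsetI)
qed

lemma dcl_add: "a \<in> dcl A \<Longrightarrow> b \<in> dcl A \<Longrightarrow> a \<oplus> b \<in> dcl A"
  using T_add[OF dcl_T dcl_T, of a A b] dcl_U by (auto simp: T_def dcl_def)

lemma dcl_ng: "a \<in> dcl A \<Longrightarrow> ng a \<in> dcl A"
  using T_ng[OF dcl_T, of a A] dcl_U by (auto simp: T_def dcl_def)

definition bdry :: "('a \<Rightarrow> bool) \<Rightarrow> 'a \<Rightarrow> bool" where
  "bdry X u \<longleftrightarrow> (\<forall>l\<in>U. \<forall>r\<in>U. l \<prec> u \<longrightarrow> u \<prec> r \<longrightarrow> (\<exists>x\<in>U. l \<prec> x \<and> x \<prec> r \<and> X x \<noteq> X u))"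

lemma Def_bdry: assumes "Def A (\<lambda>e. X (e 0))" shows "Def A (\<lambda>e. bdry X (e 0))"
proof -
  note X = Def_subst1[of A X, OF assms]
  show ?thesis unfolding bdry_def by (intro dfs X)
qed

lemma bdry_subset:
  assumes F: "finite F" "F \<subseteq> U" "breaks F X"
  shows "{u \<in> U. bdry X u} \<subseteq> F"
proof -
  have "u \<in> F" if u: "u \<in> U" "bdry X u" for u
  proof (rule ccontr)
    assume uF: "u \<notin> F"
    obtain l r where lr: "l \<in> U" "r \<in> U" "l \<prec> u" "u \<prec> r" "\<forall>c\<in>F. c \<noteq> u \<longrightarrow> c \<notin> ival l r" using near[OF F(1,2) u(1)] by blast
    then have "\<forall>c\<in>F. c \<notin> ival l r" using uF by metis
    then have "X x = X u" if "x \<in> ival l r" for x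
      using breaks_ival[OF F(3) _ that _ F(2), of u] lr u by (simp add: ival_def)
    then show False using u(2) lr unfolding bdry_def by (metis ivalI)
  qed
  then show ?thesis by blast
qed

lemma finite_bdry: assumes "tame X" shows "finite {u \<in> U. bdry X u}"
proof -
  obtain F where F: "finite F" "F \<subseteq> U" "breaks F X" using assms by (auto simp: tame_def)
  show ?thesis by (rule finite_subset[OF bdry_subset[OF F] F(1)])
qed

lemma breaks_bdry: assumes "tame X" shows "breaks {u \<in> U. bdry X u} X"
  unfolding breaks_def
proof (intro ballI impI)
  fix a b assume ab: "a \<in> U" "b \<in> U" "a \<prec> b" "\<forall>c\<in>{u \<in> U. bdry X u}. \<not> (a \<preceq> c \<and> c \<preceq> b)"
  show "X a = X b"
  proof (rule tame_connected[OF assms ab(1,2)])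
    fix x assume x: "x \<in> U" "a \<preceq> x" "x \<preceq> b"
    then have "\<not> bdry X x" using ab(4) by blast
    then show "\<exists>l\<in>U. \<exists>r\<in>U. l \<prec> x \<and> x \<prec> r \<and> (\<forall>y\<in>ival l r. a \<preceq> y \<longrightarrow> y \<preceq> b \<longrightarrow> X y = X x)"
      unfolding bdry_def by (meson ivalD)
  qed (use ab in auto)
qed

text \<open>Definable choice needs a definable point strictly between two definable points. Exact
  halves are not at hand, but the upward closed set of all \<open>y\<close> with
  \<open>d \<preceq> y \<oplus> y\<close> has a cut, and the cut is definable.\<close>

lemma half_dcl:
  assumes tm: "\<And>P. Def A (\<lambda>e. P (e 0)) \<Longrightarrow> tame P" and d: "d \<in> dcl A" "zr \<prec> d"
  obtains h where "h \<in> dcl A" "zr \<prec> h" "h \<prec> d"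
proof -
  have dU: "d \<in> U" using d dcl_U by blast
  let ?Q = "\<lambda>y. d \<preceq> y \<oplus> y"
  have DQ: "Def A (\<lambda>e. ?Q (e 0))" by (intro dfs dcl_T d)
  obtain h where h: "h \<in> U" "zr \<prec> h" "h \<oplus> h \<prec> d" using halving[OF dU d(2)] by blast
  have mono: "?Q y" if "x \<in> U" "y \<in> U" "x \<prec> y" "?Q x" for x y
    using that add_mono2[of x y x y] by (meson less_imp_le order_trans)
  have dd: "?Q d" using less_add[OF dU dU] d(2) by simp
  have nh: "\<not> ?Q h" using h by simp
  obtain s where s: "s \<in> U" "\<forall>y\<in>U. y \<prec> s \<longrightarrow> \<not> ?Q y" "\<forall>y\<in>U. s \<prec> y \<longrightarrow> ?Q y"
    by (rule tame_cut[of ?Q d h, OF tm[OF DQ] mono dU dd h(1) nh])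
  have hs: "h \<preceq> s" using s(3) h(1) nh by (meson not_less)
  have "s \<prec> d"
  proof -
    \<comment> \<open>Since \<open>h \<oplus> h\<close> is below \<open>d\<close>, \<open>h\<close>
      is below \<open>?y\<close>; so \<open>?y \<oplus> ?y\<close> exceeds
      \<open>?y \<oplus> h = d\<close>. This puts the cut at or below \<open>?y\<close>, and hence
      strictly below \<open>d\<close>.\<close>
    let ?y = "d \<oplus> ng h"
    have yU: "?y \<in> U" using dU h by simp
    have yd: "?y \<prec> d" using diff_less dU h by simp
    have "h \<oplus> h \<oplus> ng h \<prec> ?y" using right_less[of "h \<oplus> h" d "ng h"] h dU by simp
    then have "h \<prec> ?y" using h by simp
    then have "?y \<oplus> h \<prec> ?y \<oplus> ?y" using h yU by simp
    then have "?Q ?y" using h dU by simp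
    then have "s \<preceq> ?y" using s(2) yU by (meson not_less)
    then show ?thesis using yd by (rule le_less_trans)
  qed
  moreover have "zr \<prec> s" using h(2) hs by (rule less_le_trans)
  moreover have "s \<in> dcl A"
  proof -
    have "Def A (\<lambda>e. (\<forall>y\<in>U. y \<prec> e 0 \<longrightarrow> \<not> d \<preceq> y \<oplus> y) \<and> (\<forall>y\<in>U. e 0 \<prec> y \<longrightarrow> d \<preceq> y \<oplus> y))"
      by (intro dfs dcl_T d)
    then have "Def A (\<lambda>e. e 0 = s)"
    proof (rule Def_cong)
      fix e assume "env e"
      then have e: "e 0 \<in> U" by (rule env_nth)
      show "((\<forall>y\<in>U. y \<prec> e 0 \<longrightarrow> \<not> d \<preceq> y \<oplus> y) \<and> (\<forall>y\<in>U. e 0 \<prec> y \<longrightarrow> d \<preceq> y \<oplus> y)) = (e 0 = s)"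
      proof
        assume *: "(\<forall>y\<in>U. y \<prec> e 0 \<longrightarrow> \<not> d \<preceq> y \<oplus> y) \<and> (\<forall>y\<in>U. e 0 \<prec> y \<longrightarrow> d \<preceq> y \<oplus> y)"
        show "e 0 = s"
        proof (cases "e 0" s rule: linorder_cases)
          case less
          then obtain y where "y \<in> U" "e 0 \<prec> y" "y \<prec> s" using dense e s(1) by blast
          then show ?thesis using * s by blast
        next
          case greater
          then obtain y where "y \<in> U" "s \<prec> y" "y \<prec> e 0" using dense e s(1) by blast
          then show ?thesis using * s by blast
        qed
      qed (use s in blast)
    qed
    then show ?thesis using s(1) by (simp add: dcl_def)
  qed
  ultimately show thesis using that by blast
qed

text \<open>
  A point of \<open>X\<close> which is not on its boundary can be moved within the interval between the
  neighbouring boundary points to a point that is definable from these.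
\<close>

lemma definable_choice:
  assumes tm: "\<And>P. Def A (\<lambda>e. P (e 0)) \<Longrightarrow> tame P" and v1: "v1 \<in> dcl A" "zr \<prec> v1"
    and X: "Def A (\<lambda>e. X (e 0))" "x \<in> U" "X x"
  obtains c where "c \<in> dcl A" "X c"
proof (cases "bdry X x")
  case True
  have "x \<in> dcl A" using finite_Def_dcl[OF Def_bdry[OF X(1)] finite_bdry[OF tm[OF X(1)]]] True X(2) by blast
  then show ?thesis using that X(3) by blast
next
  case False
  let ?B = "{u \<in> U. bdry X u}"
  have B: "finite ?B" by (rule finite_bdry[OF tm[OF X(1)]])
  have Bd: "?B \<subseteq> dcl A" by (rule finite_Def_dcl[OF Def_bdry[OF X(1)] B])
  have key: "X c" if c: "c \<in> U" "\<And>b. b \<in> ?B \<Longrightarrow> b \<prec> x \<Longrightarrow> b \<prec> c" "\<And>b. b \<in> ?B \<Longrightarrow> x \<prec> b \<Longrightarrow> c \<prec> b" for c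
  proof -
    have "\<not> (x \<preceq> b \<and> b \<preceq> c)" "\<not> (c \<preceq> b \<and> b \<preceq> x)" if b: "b \<in> ?B" for b
    proof -
      have "b \<noteq> x" using b False by blast
      then have "b \<prec> x \<and> b \<prec> c \<or> x \<prec> b \<and> c \<prec> b" using c(2,3)[OF b] by (cases b x rule: linorder_cases) auto
      then show "\<not> (x \<preceq> b \<and> b \<preceq> c)" "\<not> (c \<preceq> b \<and> b \<preceq> x)" by (auto simp: not_less[symmetric])
    qed
    then have *: "x \<prec> c \<Longrightarrow> X x = X c" "c \<prec> x \<Longrightarrow> X c = X x"
      using breaks_bdry[OF tm[OF X(1)]] X(2) c(1) unfolding breaks_def by blast+
    show ?thesis
    proof (cases x c rule: linorder_cases)
      case less
      then show ?thesis using *(1) X(3) by blast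
    next
      case equal
      then show ?thesis using X(3) by simp
    next
      case greater
      then show ?thesis using *(2) X(3) by blast
    qed
  qed
  let ?L = "{b \<in> ?B. b \<prec> x}" and ?R = "{b \<in> ?B. x \<prec> b}"
  have fin: "finite ?L" "finite ?R" by (rule finite_subset[OF _ B], blast)+
  have v1U: "v1 \<in> U" using v1 dcl_U by blast
  \<comment> \<open>The step \<open>v1\<close> serves the unbounded pieces: it leads beyond the last
    boundary point on one side, or is itself the chosen point if there are no boundary points at
    all. The bounded piece is treated by \<open>half_dcl\<close>.\<close>
  show ?thesis
  proof (cases "?L = {}"; cases "?R = {}")
    assume e: "?L = {}" "?R = {}"
    have "X v1" by (rule key) (use e v1U in blast)+
    then show ?thesis using that v1 by blast
  next
    assume e: "?L = {}" "?R \<noteq> {}"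
    obtain q where q: "q \<in> ?R" "\<forall>b\<in>?R. q \<preceq> b" using finite_least[OF fin(2) e(2)] by blast
    have qd: "q \<in> dcl A" "q \<in> U" using q Bd by auto
    have lt: "q \<oplus> ng v1 \<prec> q" using diff_less qd v1U v1 by simp
    have "X (q \<oplus> ng v1)"
    proof (rule key)
      show "q \<oplus> ng v1 \<in> U" using qd v1U by simp
      show "b \<prec> q \<oplus> ng v1" if "b \<in> ?B" "b \<prec> x" for b using e(1) that by blast
      show "q \<oplus> ng v1 \<prec> b" if "b \<in> ?B" "x \<prec> b" for b using q(2) that lt by (blast intro: less_le_trans)
    qed
    then show ?thesis using that dcl_add[OF qd(1) dcl_ng[OF v1(1)]] by blast
  next
    assume e: "?L \<noteq> {}" "?R = {}"
    obtain q where q: "q \<in> ?L" "\<forall>b\<in>?L. b \<preceq> q" using finite_greatest[OF fin(1) e(1)] by blast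
    have qd: "q \<in> dcl A" "q \<in> U" using q Bd by auto
    have lt: "q \<prec> q \<oplus> v1" using qd v1U v1 by simp
    have "X (q \<oplus> v1)"
    proof (rule key)
      show "q \<oplus> v1 \<in> U" using qd v1U by simp
      show "b \<prec> q \<oplus> v1" if "b \<in> ?B" "b \<prec> x" for b using q(2) that lt by (blast intro: le_less_trans)
      show "q \<oplus> v1 \<prec> b" if "b \<in> ?B" "x \<prec> b" for b using e(2) that by blast
    qed
    then show ?thesis using that dcl_add[OF qd(1) v1(1)] by blast
  next
    assume e: "?L \<noteq> {}" "?R \<noteq> {}"
    obtain p where p: "p \<in> ?L" "\<forall>b\<in>?L. b \<preceq> p" using finite_greatest[OF fin(1) e(1)] by blast
    obtain q where q: "q \<in> ?R" "\<forall>b\<in>?R. q \<preceq> b" using finite_least[OF fin(2) e(2)] by blast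
    have pd: "p \<in> dcl A" "p \<in> U" "q \<in> dcl A" "q \<in> U" using p q Bd by auto
    have "p \<prec> q" using p q by (auto intro: less_trans)
    then have d: "ng p \<oplus> q \<in> dcl A" "zr \<prec> ng p \<oplus> q" using pd by (auto simp: less_diff intro: dcl_add dcl_ng)
    obtain h where h: "h \<in> dcl A" "zr \<prec> h" "h \<prec> ng p \<oplus> q" by (rule half_dcl[OF tm d])
    have hU: "h \<in> U" using h dcl_U by blast
    have l1: "p \<prec> p \<oplus> h" using h hU pd by simp
    have l2: "p \<oplus> h \<prec> q" using left_less[of h "ng p \<oplus> q" p] h hU pd by simp
    have "X (p \<oplus> h)"
    proof (rule key)
      show "p \<oplus> h \<in> U" using pd hU by simp
      show "b \<prec> p \<oplus> h" if "b \<in> ?B" "b \<prec> x" for b using p(2) that l1 by (blast intro: le_less_trans)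
      show "p \<oplus> h \<prec> b" if "b \<in> ?B" "x \<prec> b" for b using q(2) that l2 by (blast intro: less_le_trans)
    qed
    then show ?thesis using that dcl_add[OF pd(1) h(1)] by blast
  qed
qed

end

section \<open>Elementary extensions by one element\<close>

text \<open>An elementary substructure that is o-minimal, formulated inside an ambient structure
  \<open>N\<close> about which nothing of the kind is known.\<close>

definition tame_sub :: "('f, 'r) language \<Rightarrow> ('f, 'r, 'a) struct \<Rightarrow> 'r \<Rightarrow> 'a set \<Rightarrow> bool" where
  "tame_sub L N lt V \<longleftrightarrow> elem_sub L N V \<and>
     (\<forall>p. \<forall>\<phi>\<in>formulas L (Suc p). \<forall>m\<in>nlists p V. \<exists>K. sat N m (tamef lt K p \<phi>))"

text \<open>Seen as a structure, \<open>V\<close> is o-minimal, so \<open>uniform_breaks\<close>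
  bounds the breaks uniformly in one more variable ranging over \<open>V\<close>. For a fixed
  \<open>K\<close> this is a first-order property of \<open>m\<close>, so in \<open>N\<close> it
  holds for all values of the variable, including those outside \<open>V\<close>.\<close>

lemma tame_sub_uniform:
  assumes N: "is_structure L N" and ar: "rel_arity L lt = 2" "fun_arity L pl = 2" and ax: "sat N [] (og_ax lt pl)"
    and V: "tame_sub L N lt V" and \<phi>: "\<phi> \<in> formulas L (Suc (Suc p))" and m: "m \<in> nlists p V"
  shows "\<exists>K. sat N m (All (tamef lt K (Suc p) \<phi>))"
proof -
  have es: "elem_sub L N V" and tm: "\<And>p \<phi> m. \<phi> \<in> formulas L (Suc p) \<Longrightarrow> m \<in> nlists p V \<Longrightarrow> \<exists>K. sat N m (tamef lt K p \<phi>)"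
    using V unfolding tame_sub_def by blast+
  let ?S = "N\<lparr>univ := V\<rparr>"
  have S: "is_structure L ?S" by (rule elem_sub_structure[OF N es])
  have axS: "sat ?S [] (og_ax lt pl)"
    using elem_sub_sat[OF es og_ax_formulas[OF ar], of "[]"] ax by simp
  obtain le less zr ng where "ogd le less L ?S lt pl zr ng" by (rule ex_ogd[OF S ar axS])
  then interpret S: ogd le less L ?S lt pl zr ng .
  have "omin le less L ?S lt pl zr ng"
  proof (rule S.omin_tamef)
    fix p \<phi> m assume *: "\<phi> \<in> formulas L (Suc p)" "m \<in> nlists p (univ ?S)"
    then have mV: "m \<in> nlists p V" by simp
    obtain K where "sat N m (tamef lt K p \<phi>)" using tm[OF *(1) mV] by (rule exE) (rule that)
    then have "sat ?S m (tamef lt K p \<phi>)" using elem_sub_sat[OF es tamef_formulas[OF ar(1) *(1)] mV] by blast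
    then show "\<exists>K. sat ?S m (tamef lt K p \<phi>)" by (rule exI)
  qed
  then interpret S: omin le less L ?S lt pl zr ng .
  have U: "univ ?S = V" by simp
  have mm: "map (S.vl e) (Inl 0 # Inl 1 # map Inr m) = e 0 # e 1 # m" for e by (simp add: o_def)
  have lm: "length m = p" using m by simp
  have "S.Def (univ ?S) (\<lambda>e. sat ?S (map (S.vl e) (Inl 0 # Inl 1 # map Inr m)) \<phi>)"
  proof (rule S.Def_sat)
    show "\<phi> \<in> formulas L (length (Inl 0 # Inl 1 # map Inr m))" using \<phi> lm by simp
    show "a \<in> univ ?S" if "Inr a \<in> set (Inl 0 # Inl 1 # map Inr m)" for a 
    proof -
      have "a \<in> set m" using that by auto
      then show ?thesis using nlistsE_set[OF m] by (simp add: subsetD)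
    qed
  qed
  then have "S.Def (univ ?S) (\<lambda>e. sat ?S (e 0 # e 1 # m) \<phi>)" unfolding mm .
  from S.uniform_breaks[of "\<lambda>u z. sat ?S (u # z # m) \<phi>", OF this]
  obtain K where K: "\<forall>z\<in>univ ?S. \<exists>F. finite F \<and> F \<subseteq> univ ?S \<and> card F \<le> K \<and> S.breaks F (\<lambda>u. sat ?S (u # z # m) \<phi>)"
    by (rule exE) (rule that)
  have "sat ?S (z # m) (tamef lt K (Suc p) \<phi>)" if z: "z \<in> V" for z
  proof -
    have "z # m \<in> nlists (Suc p) (univ ?S)" using z m by simp
    then show ?thesis using S.sat_tamef[OF \<phi>, of "z # m" K] K[rule_format, of z] z by simp
  qed
  then have "sat ?S m (All (tamef lt K (Suc p) \<phi>))" by simp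
  moreover have "All (tamef lt K (Suc p) \<phi>) \<in> formulas L p" using tamef_formulas[OF ar(1) \<phi>] by simp
  ultimately have "sat N m (All (tamef lt K (Suc p) \<phi>))" using elem_sub_sat[OF es _ m] by blast
  then show ?thesis by (rule exI)
qed

text \<open>The extension is the definable closure of \<open>V\<close> and \<open>c\<close>. By
  \<open>tame_sub_uniform\<close> predicates with these parameters are tame in \<open>N\<close>, and
  definable choice then supplies the witnesses for the Tarski--Vaught test.\<close>

lemma tame_sub_extend:
  assumes N: "is_structure L N" and ar: "rel_arity L lt = 2" "fun_arity L pl = 2" and ax: "sat N [] (og_ax lt pl)"
    and V: "tame_sub L N lt V" and c: "c \<in> univ N"
  obtains V' where "tame_sub L N lt V'" "V \<subseteq> V'" "c \<in> V'"
proof -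
  have es: "elem_sub L N V" and VN: "V \<subseteq> univ N" using V unfolding tame_sub_def elem_sub_def by blast+
  obtain le less zr ng where "ogd le less L N lt pl zr ng" by (rule ex_ogd[OF N ar ax])
  then interpret N: ogd le less L N lt pl zr ng .
  let ?A = "insert c V"
  have AN: "?A \<subseteq> univ N" using VN c by blast
  obtain v0 where v0: "v0 \<in> V" using es unfolding elem_sub_def by blast
  have tmA: "N.tame P" if P: "N.Def ?A (\<lambda>e. P (e 0))" for P
  proof -
    obtain xs where xs: "set xs \<subseteq> ?A" "N.Def (set xs) (\<lambda>e. P (e 0))" using P by (rule N.Def_params)
    obtain \<phi> where \<phi>: "\<phi> \<in> formulas L (Suc (length xs))" "\<forall>u\<in>univ N. P u \<longleftrightarrow> sat N (u # xs) \<phi>"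
      by (rule N.Def_params_formula[of xs P, OF xs(2)]) (rule that)
    \<comment> \<open>Occurrences of \<open>c\<close> among the parameters are overwritten by a
      dummy from \<open>V\<close> and redirected by \<open>us\<close> to variable 1, so that
      \<open>c\<close> becomes the one parameter outside \<open>V\<close>.\<close>
    let ?m = "map (\<lambda>x. if x = c then v0 else x) xs"
    define us where "us = 0 # map (\<lambda>i. if xs ! i = c then 1 else i + 2) [0..<length xs]"
    have lus: "length us = Suc (length xs)" by (simp add: us_def)
    have m: "?m \<in> nlists (length xs) V" by (rule nlistsI) (use xs(1) v0 in auto)
    have \<phi>': "sub us \<phi> \<in> formulas L (Suc (Suc (length xs)))"
      by (rule sub_formulas) (use \<phi>(1) lus in \<open>simp, auto simp: us_def split: if_splits\<close>)
    have s: "sat N (u # c # ?m) (sub us \<phi>) \<longleftrightarrow> sat N (u # xs) \<phi>" for u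
    proof (rule sat_sub')
      show "\<phi> \<in> formulas L (length us)" "length (u # xs) = length us" using \<phi>(1) lus by simp_all
      fix i assume "i < length us"
      then show "(u # c # ?m) ! (us ! i) = (u # xs) ! i" using lus by (cases i) (auto simp: us_def)
    qed
    obtain K where "sat N ?m (All (tamef lt K (Suc (length xs)) (sub us \<phi>)))"
      using tame_sub_uniform[OF N ar ax V \<phi>' m] by (rule exE) (rule that)
    then have t: "sat N (c # ?m) (tamef lt K (Suc (length xs)) (sub us \<phi>))" using c by simp
    have "?m \<in> nlists (length xs) (univ N)" using m VN nlists_mono by blast
    then have cm: "c # ?m \<in> nlists (Suc (length xs)) (univ N)" using c by simp
    obtain F where F: "finite F" "F \<subseteq> univ N" "N.breaks F (\<lambda>u. sat N (u # c # ?m) (sub us \<phi>))"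
      using t unfolding N.sat_tamef[OF \<phi>' cm] by (elim exE conjE) (rule that)
    have "N.breaks F P" using F(3) \<phi>(2) unfolding N.breaks_def s by simp
    then show ?thesis unfolding N.tame_def using F(1,2) by blast
  qed
  obtain v1 where v1: "v1 \<in> V" "less zr v1"
  proof -
    \<comment> \<open>An element is positive iff it is smaller than its double, which says so
      without a constant for zero and can therefore be reflected from \<open>N\<close> to
      \<open>V\<close>.\<close>
    let ?p = "Rel lt [Var 0, App pl [Var 0, Var 0]]"
    have p: "?p \<in> formulas L (Suc 0)" using ar by simp
    obtain d where d: "d \<in> univ N" "less zr d" using N.ex_pos by blast
    then have "less d (N.add d d)" by simp
    then have "sat N [d] ?p" using d N.ltr_iff[of d "N.add d d"] N.add_in[of d d] by (simp add: N.add_def)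
    then have "\<exists>u\<in>univ N. sat N [u] ?p" using d by (intro bexI)
    moreover have "\<forall>m\<in>nlists 0 V. (\<exists>u\<in>univ N. sat N (u # m) ?p) \<longrightarrow> (\<exists>u\<in>V. sat N (u # m) ?p)"
      using es p unfolding elem_sub_def by blast
    ultimately have "\<exists>u\<in>V. sat N [u] ?p" by simp
    then obtain u where u: "u \<in> V" "sat N [u] ?p" by (rule bexE) (rule that)
    then have uN: "u \<in> univ N" using VN by blast
    then have "less u (N.add u u)" using u(2) N.ltr_iff[of u "N.add u u"] N.add_in[of u u] by (simp add: N.add_def)
    then show thesis using that u(1) uN by simp
  qed
  let ?V = "N.dcl ?A"
  have sub: "?A \<subseteq> ?V" by (rule N.dcl_extensive[OF AN])
  have DX: "N.Def ?A (\<lambda>e. sat N (e 0 # m) \<phi>)" if "\<phi> \<in> formulas L (Suc p)" "m \<in> nlists p ?V" for \<phi> p m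
  proof (rule N.Def_dcl, rule N.Def_sat_params)
    show "\<phi> \<in> formulas L (Suc (length m))" using that by simp
    show "set m \<subseteq> ?V" using that(2) by (rule nlistsE_set)
  qed
  have VU: "?V \<subseteq> univ N" by (rule N.dcl_U)
  have "elem_sub L N ?V"
    unfolding elem_sub_def
  proof (intro conjI allI ballI impI)
    show "?V \<subseteq> univ N" by fact
    show "?V \<noteq> {}" using sub by blast
    fix p \<phi> m assume \<phi>: "\<phi> \<in> formulas L (Suc p)" and m: "m \<in> nlists p ?V" and "\<exists>u\<in>univ N. sat N (u # m) \<phi>"
    then obtain x where x: "x \<in> univ N" "sat N (x # m) \<phi>" by blast
    have v1d: "v1 \<in> ?V" using v1 sub by blast
    show "\<exists>u\<in>?V. sat N (u # m) \<phi>"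
    proof (rule N.definable_choice[of ?A v1 "\<lambda>u. sat N (u # m) \<phi>" x])
      show "N.tame P" if "N.Def ?A (\<lambda>e. P (e 0))" for P using that by (rule tmA)
      show "N.Def ?A (\<lambda>e. sat N (e 0 # m) \<phi>)" by (rule DX[OF \<phi> m])
      show "v1 \<in> ?V" "less zr v1" "x \<in> univ N" "sat N (x # m) \<phi>" by fact+
      fix u assume "u \<in> ?V" "sat N (u # m) \<phi>"
      then show "\<exists>u\<in>?V. sat N (u # m) \<phi>" by (rule bexI[rotated])
    qed
  qed
  moreover have "\<exists>K. sat N m (tamef lt K p \<phi>)" if \<phi>: "\<phi> \<in> formulas L (Suc p)" and m: "m \<in> nlists p ?V" for \<phi> p m
  proof -
    have mN: "m \<in> nlists p (univ N)" using m VU nlists_mono by blast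
    have "N.tame (\<lambda>u. sat N (u # m) \<phi>)" by (rule tmA[of "\<lambda>u. sat N (u # m) \<phi>", OF DX[OF \<phi> m]])
    then obtain F where F: "finite F" "F \<subseteq> univ N" "N.breaks F (\<lambda>u. sat N (u # m) \<phi>)"
      unfolding N.tame_def by (elim exE conjE) (rule that)
    have "sat N m (tamef lt (card F) p \<phi>)"
      unfolding N.sat_tamef[OF \<phi> mN] by (rule exI[of _ F]) (intro conjI F order.refl)
    then show ?thesis by (rule exI)
  qed
  ultimately have "tame_sub L N lt ?V" unfolding tame_sub_def by blast
  then show thesis using that sub by blast
qed

lemma tame_sub_extend_list:
  assumes N: "is_structure L N" and ar: "rel_arity L lt = 2" "fun_arity L pl = 2" and ax: "sat N [] (og_ax lt pl)"
    and V: "tame_sub L N lt V"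
  shows "set v \<subseteq> univ N \<Longrightarrow> \<exists>V'. tame_sub L N lt V' \<and> V \<subseteq> V' \<and> set v \<subseteq> V'"
proof (induction v)
  case Nil
  then show ?case using V by auto
next
  case (Cons c v)
  then obtain W where W: "tame_sub L N lt W" "V \<subseteq> W" "set v \<subseteq> W" by auto
  have c: "c \<in> univ N" using Cons.prems by simp
  obtain W' where "tame_sub L N lt W'" "W \<subseteq> W'" "c \<in> W'" by (rule tame_sub_extend[OF N ar ax W(1) c])
  then show ?case using W by auto
qed

section \<open>Ultrapowers\<close>

definition fip :: "'i set set \<Rightarrow> bool" where
  "fip W \<longleftrightarrow> (\<forall>H. finite H \<longrightarrow> H \<subseteq> W \<longrightarrow> \<Inter>H \<noteq> {})"

lemma ex_ultrafilter:
  fixes G :: "'i set set"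
  assumes "fip G"
  obtains W where "G \<subseteq> W" "{} \<notin> W" "\<forall>X Y. X \<in> W \<longrightarrow> Y \<in> W \<longrightarrow> X \<inter> Y \<in> W"
    "\<forall>X Y. X \<in> W \<longrightarrow> X \<subseteq> Y \<longrightarrow> Y \<in> W" "\<forall>X. X \<in> W \<or> - X \<in> W"
proof -
  have "\<exists>W\<in>{W. G \<subseteq> W \<and> fip W}. \<forall>X\<in>{W. G \<subseteq> W \<and> fip W}. W \<subseteq> X \<longrightarrow> X = W"
  proof (rule subset_Zorn_nonempty)
    show "{W. G \<subseteq> W \<and> fip W} \<noteq> {}" using assms by blast
    fix C assume C: "C \<noteq> {}" "subset.chain {W. G \<subseteq> W \<and> fip W} C"
    have "fip (\<Union>C)" unfolding fip_def
    proof (intro allI impI)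
      fix H assume H: "finite H" "H \<subseteq> \<Union>C"
      obtain B where "B \<in> C" "H \<subseteq> B" by (rule finite_subset_Union_chain[OF H C])
      then show "\<Inter>H \<noteq> {}" using H(1) C(2) unfolding subset.chain_def fip_def by blast
    qed
    then show "\<Union>C \<in> {W. G \<subseteq> W \<and> fip W}" using C unfolding subset.chain_def by blast
  qed
  then obtain W where "W \<in> {W. G \<subseteq> W \<and> fip W}" and mx: "\<forall>X\<in>{W. G \<subseteq> W \<and> fip W}. W \<subseteq> X \<longrightarrow> X = W"
    by (rule bexE) (rule that)
  then have W: "G \<subseteq> W" "fip W" by simp_all
  have max: "X = W" if "G \<subseteq> X" "fip X" "W \<subseteq> X" for X using mx that by simp
  \<comment> \<open>The form in which maximality is used: a set outside \<open>W\<close> is disjoint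
    from a finite intersection of members.\<close>
  have out: "\<exists>H. finite H \<and> H \<subseteq> W \<and> \<Inter>H \<inter> X = {}" if X: "X \<notin> W" for X
  proof -
    have "\<not> fip (insert X W)" using max[of "insert X W"] W X by blast
    then obtain H where H: "finite H" "H \<subseteq> insert X W" "\<Inter>H = {}" unfolding fip_def by blast
    have "finite (H - {X})" "H - {X} \<subseteq> W" "\<Inter>(H - {X}) \<inter> X = {}" using H by blast+
    then show ?thesis by blast
  qed
  have empty: "\<Inter>H \<noteq> {}" if "finite H" "H \<subseteq> W" for H using W(2) that unfolding fip_def by blast
  have em: "X \<in> W \<or> - X \<in> W" for X
  proof (rule ccontr)
    assume "\<not> ?thesis"
    then obtain H H' where H: "finite H" "H \<subseteq> W" "\<Inter>H \<inter> X = {}" "finite H'" "H' \<subseteq> W" "\<Inter>H' \<inter> - X = {}"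
      using out[of X] out[of "- X"] by blast
    have "\<Inter>(H \<union> H') = {}" using H(3,6) by blast
    then show False using empty[of "H \<union> H'"] H by blast
  qed
  have up: "Y \<in> W" if "X \<in> W" "X \<subseteq> Y" for X Y
  proof (rule ccontr)
    assume "Y \<notin> W"
    then have "- Y \<in> W" using em by blast
    then show False using empty[of "{X, - Y}"] that by auto
  qed
  have int: "X \<inter> Y \<in> W" if "X \<in> W" "Y \<in> W" for X Y
  proof (rule ccontr)
    assume "X \<inter> Y \<notin> W"
    then have "- (X \<inter> Y) \<in> W" using em by blast
    then show False using empty[of "{X, Y, - (X \<inter> Y)}"] that by auto
  qed
  have "{} \<notin> W" using empty[of "{{}}"] by auto
  then show thesis using that W(1) int up em by blast
qed

text \<open>The theorem of Los. The elements of the ultrapower are codes in the prescribed type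
  \<open>'u\<close> instead of equivalence classes, because local modularity is assumed only for
  models over one particular universe type.\<close>

lemma los:
  fixes L :: "('f, 'r) language" and M :: "('f, 'r, 'a) struct" and W :: "'i set set" and enc :: "('i \<Rightarrow> 'a) \<Rightarrow> 'u"
  assumes M: "is_structure L M" and enc: "inj enc"
    and ultra: "{} \<notin> W" "\<forall>X Y. X \<in> W \<longrightarrow> Y \<in> W \<longrightarrow> X \<inter> Y \<in> W"
      "\<forall>X Y. X \<in> W \<longrightarrow> X \<subseteq> Y \<longrightarrow> Y \<in> W" "\<forall>X. X \<in> W \<or> - X \<in> W"
  obtains N :: "('f, 'r, 'u) struct" and q where "is_structure L N"
    "univ N = q ` {f. \<forall>i. f i \<in> univ M}"
    "\<forall>n \<phi> fs. \<phi> \<in> formulas L n \<longrightarrow> length fs = n \<longrightarrow> (\<forall>f\<in>set fs. \<forall>i. f i \<in> univ M) \<longrightarrow>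
       (sat N (map q fs) \<phi> \<longleftrightarrow> {i. sat M (map (\<lambda>f. f i) fs) \<phi>} \<in> W)"
proof -
  note W = ultra(1) ultra(2,3,4)[rule_format]
  have UW: "UNIV \<in> W" using W(1) W(4)[of UNIV] by auto
  let ?Fn = "{f. \<forall>i. f i \<in> univ M}"
  \<comment> \<open>Functions that agree on a set in \<open>W\<close> present the same predicate to
    \<open>SOME\<close>, so they get the same representative and the same code. Conversely,
    \<open>d\<close> picks a function with a given code.\<close>
  define q where "q f = enc (SOME g. g \<in> ?Fn \<and> {i. f i = g i} \<in> W)" for f
  define d where "d x = (SOME f. f \<in> ?Fn \<and> q f = x)" for x
  define N :: "('f, 'r, 'u) struct" where "N = \<lparr>univ = q ` ?Fn,
    fun_int = (\<lambda>F xs. q (\<lambda>i. fun_int M F (map (\<lambda>x. d x i) xs))),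
    rel_int = (\<lambda>R xs. {i. rel_int M R (map (\<lambda>x. d x i) xs)} \<in> W)\<rparr>"
  have rep: "(SOME g. g \<in> ?Fn \<and> {i. f i = g i} \<in> W) \<in> ?Fn \<and> {i. f i = (SOME g. g \<in> ?Fn \<and> {i. f i = g i} \<in> W) i} \<in> W"
    if f: "f \<in> ?Fn" for f
    by (rule someI[of "\<lambda>g. g \<in> ?Fn \<and> {i. f i = g i} \<in> W" f]) (use f UW in simp)
  have qeq: "q f = q g \<longleftrightarrow> {i. f i = g i} \<in> W" if f: "f \<in> ?Fn" and g: "g \<in> ?Fn" for f g
  proof
    assume "q f = q g"
    then have e: "(SOME h. h \<in> ?Fn \<and> {i. f i = h i} \<in> W) = (SOME h. h \<in> ?Fn \<and> {i. g i = h i} \<in> W)"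
      unfolding q_def by (rule injD[OF enc])
    have "{i. f i = (SOME h. h \<in> ?Fn \<and> {i. f i = h i} \<in> W) i} \<inter> {i. g i = (SOME h. h \<in> ?Fn \<and> {i. f i = h i} \<in> W) i} \<in> W"
      by (rule W(2)) (use rep[OF f] rep[OF g] e in simp_all)
    then show "{i. f i = g i} \<in> W" by (rule W(3)) auto
  next
    assume fg: "{i. f i = g i} \<in> W"
    have "{i. f i = h i} \<in> W \<longleftrightarrow> {i. g i = h i} \<in> W" for h
    proof
      assume "{i. f i = h i} \<in> W"
      from W(2)[OF fg this] show "{i. g i = h i} \<in> W" by (rule W(3)) auto
    next
      assume "{i. g i = h i} \<in> W"
      from W(2)[OF fg this] show "{i. f i = h i} \<in> W" by (rule W(3)) auto
    qed
    then show "q f = q g" unfolding q_def by simp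
  qed
  have d: "d (q f) \<in> ?Fn" "{i. d (q f) i = f i} \<in> W" if f: "f \<in> ?Fn" for f
  proof -
    have *: "d (q f) \<in> ?Fn \<and> q (d (q f)) = q f" unfolding d_def[of "q f"]
      by (rule someI[of "\<lambda>g. g \<in> ?Fn \<and> q g = q f" f]) (use f in simp)
    then show "d (q f) \<in> ?Fn" by blast
    show "{i. d (q f) i = f i} \<in> W" using * qeq[of "d (q f)" f] f by blast
  qed
  have dl: "{i. map (\<lambda>x. d x i) (map q fs) = map (\<lambda>f. f i) fs} \<in> W" if "set fs \<subseteq> ?Fn" for fs
    using that
  proof (induction fs)
    case (Cons f fs)
    have "{i. d (q f) i = f i} \<inter> {i. map (\<lambda>x. d x i) (map q fs) = map (\<lambda>f. f i) fs} \<in> W"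
      by (rule W(2)) (use d(2)[of f] Cons in auto)
    then show ?case by (rule W(3)) auto
  qed (use UW in simp)
  have ev: "eval M e t \<in> univ M" if "is_term L n t" "e \<in> nlists n (univ M)" for e t n
    using that(1)
  proof (induction t)
    case (App F ts)
    then have "map (eval M e) ts \<in> nlists (fun_arity L F) (univ M)" by (intro nlistsI) auto
    then show ?case using M unfolding is_structure_def by simp
  qed (use that(2) nlistsE_nth_in in auto)
  have nl: "map (\<lambda>f. f i) fs \<in> nlists n (univ M)" if "length fs = n" "set fs \<subseteq> ?Fn" for fs i n
    by (rule nlistsI) (use that in auto)
  have tm: "eval N (map q fs) t = q (\<lambda>i. eval M (map (\<lambda>f. f i) fs) t)" if "is_term L n t" "length fs = n" "set fs \<subseteq> ?Fn" for t n fs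
    using that(1)
  proof (induction t)
    case (Var k)
    then show ?case using that by simp
  next
    case (App F ts)
    let ?gs = "map (\<lambda>t i. eval M (map (\<lambda>f. f i) fs) t) ts"
    have gs: "set ?gs \<subseteq> ?Fn" using App.prems ev nl[OF that(2,3)] by auto
    have m: "map (eval N (map q fs)) ts = map q ?gs" using App by simp
    have mg: "map (\<lambda>g. g i) ?gs = map (eval M (map (\<lambda>f. f i) fs)) ts" for i by simp
    have ar: "length ts = fun_arity L F" using App.prems by simp
    have "eval N (map q fs) (App F ts) = q (\<lambda>i. fun_int M F (map (\<lambda>x. d x i) (map q ?gs)))"
      unfolding eval.simps m by (simp add: N_def)
    also have "\<dots> = q (\<lambda>i. eval M (map (\<lambda>f. f i) fs) (App F ts))"
    proof (subst qeq)
      have "map (\<lambda>x. d x i) (map q ?gs) \<in> nlists (fun_arity L F) (univ M)" for i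
      proof (rule nlistsI)
        show "length (map (\<lambda>x. d x i) (map q ?gs)) = fun_arity L F" using ar by simp
        show "set (map (\<lambda>x. d x i) (map q ?gs)) \<subseteq> univ M" using d(1) gs by fastforce
      qed
      then show "(\<lambda>i. fun_int M F (map (\<lambda>x. d x i) (map q ?gs))) \<in> ?Fn" using M unfolding is_structure_def by blast
      show "(\<lambda>i. eval M (map (\<lambda>f. f i) fs) (App F ts)) \<in> ?Fn" using ev[OF App.prems] nl[OF that(2,3)] by blast
      show "{i. fun_int M F (map (\<lambda>x. d x i) (map q ?gs)) = eval M (map (\<lambda>f. f i) fs) (App F ts)} \<in> W"
        using dl[OF gs]
      proof (rule W(3), intro subsetI CollectI)
        fix i assume "i \<in> {i. map (\<lambda>x. d x i) (map q ?gs) = map (\<lambda>g. g i) ?gs}"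
        then have "map (\<lambda>x. d x i) (map q ?gs) = map (eval M (map (\<lambda>f. f i) fs)) ts" unfolding mg by blast
        then show "fun_int M F (map (\<lambda>x. d x i) (map q ?gs)) = eval M (map (\<lambda>f. f i) fs) (App F ts)"
          by (simp only: eval.simps)
      qed
    qed
    finally show ?case .
  qed
  have sat: "sat N (map q fs) \<phi> \<longleftrightarrow> {i. sat M (map (\<lambda>f. f i) fs) \<phi>} \<in> W"
    if "\<phi> \<in> formulas L n" "length fs = n" "set fs \<subseteq> ?Fn" for \<phi> n fs
    using that
  proof (induction \<phi> arbitrary: n fs)
    case (Eq s t)
    then have st: "is_term L n s" "is_term L n t" by simp_all
    have "(\<lambda>i. eval M (map (\<lambda>f. f i) fs) s) \<in> ?Fn" "(\<lambda>i. eval M (map (\<lambda>f. f i) fs) t) \<in> ?Fn"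
      using ev[OF st(1)] ev[OF st(2)] nl[OF Eq(2,3)] by blast+
    from qeq[OF this] show ?case by (simp add: tm[OF st(1) Eq(2,3)] tm[OF st(2) Eq(2,3)])
  next
    case (Rel R ts)
    let ?gs = "map (\<lambda>t i. eval M (map (\<lambda>f. f i) fs) t) ts"
    have ts: "is_term L n t" if "t \<in> set ts" for t using Rel(1) that by simp
    have gs: "set ?gs \<subseteq> ?Fn"
    proof
      fix g assume "g \<in> set ?gs"
      then obtain t where t: "t \<in> set ts" "g = (\<lambda>i. eval M (map (\<lambda>f. f i) fs) t)" by auto
      show "g \<in> ?Fn" using ev[OF ts[OF t(1)] nl[OF Rel(2,3)]] t(2) by simp
    qed
    have "eval N (map q fs) t = q (\<lambda>i. eval M (map (\<lambda>f. f i) fs) t)" if "t \<in> set ts" for t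
      by (rule tm[OF ts[OF that] Rel(2,3)])
    then have m: "map (eval N (map q fs)) ts = map q ?gs" by simp
    have mg: "map (\<lambda>g. g i) ?gs = map (eval M (map (\<lambda>f. f i) fs)) ts" for i by simp
    have "sat N (map q fs) (Rel R ts) \<longleftrightarrow> {i. rel_int M R (map (\<lambda>x. d x i) (map q ?gs))} \<in> W"
      unfolding sat.simps m by (simp add: N_def)
    also have "\<dots> \<longleftrightarrow> {i. rel_int M R (map (\<lambda>g. g i) ?gs)} \<in> W"
    proof
      assume "{i. rel_int M R (map (\<lambda>x. d x i) (map q ?gs))} \<in> W"
      from W(2)[OF this dl[OF gs]] show "{i. rel_int M R (map (\<lambda>g. g i) ?gs)} \<in> W"
      proof (rule W(3), intro subsetI CollectI, elim IntE CollectE)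
        fix i assume "rel_int M R (map (\<lambda>x. d x i) (map q ?gs))" "map (\<lambda>x. d x i) (map q ?gs) = map (\<lambda>g. g i) ?gs"
        then show "rel_int M R (map (\<lambda>g. g i) ?gs)" by (simp only:)
      qed
    next
      assume "{i. rel_int M R (map (\<lambda>g. g i) ?gs)} \<in> W"
      from W(2)[OF this dl[OF gs]] show "{i. rel_int M R (map (\<lambda>x. d x i) (map q ?gs))} \<in> W"
      proof (rule W(3), intro subsetI CollectI, elim IntE CollectE)
        fix i assume "rel_int M R (map (\<lambda>g. g i) ?gs)" "map (\<lambda>x. d x i) (map q ?gs) = map (\<lambda>g. g i) ?gs"
        then show "rel_int M R (map (\<lambda>x. d x i) (map q ?gs))" by (simp only:)
      qed
    qed
    finally show ?case unfolding mg by simp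
  next
    case (Neg \<phi>)
    have "\<phi> \<in> formulas L n" using Neg.prems(1) by simp
    then have "sat N (map q fs) \<phi> \<longleftrightarrow> {i. sat M (map (\<lambda>f. f i) fs) \<phi>} \<in> W" by (rule Neg.IH[OF _ Neg.prems(2,3)])
    moreover have "X \<notin> W \<longleftrightarrow> - X \<in> W" for X using W(4)[of X] W(2)[of X "- X"] W(1) by auto
    moreover have "- {i. sat M (map (\<lambda>f. f i) fs) \<phi>} = {i. sat M (map (\<lambda>f. f i) fs) (Neg \<phi>)}" by auto
    ultimately show ?case by simp
  next
    case (Conj \<phi> \<psi>)
    let ?a = "{i. sat M (map (\<lambda>f. f i) fs) \<phi>}" and ?b = "{i. sat M (map (\<lambda>f. f i) fs) \<psi>}"
    have c: "\<phi> \<in> formulas L n" "\<psi> \<in> formulas L n" using Conj.prems(1) by simp_all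
    have "sat N (map q fs) \<phi> \<longleftrightarrow> ?a \<in> W" by (rule Conj.IH(1)[OF c(1) Conj.prems(2,3)])
    moreover have "sat N (map q fs) \<psi> \<longleftrightarrow> ?b \<in> W" by (rule Conj.IH(2)[OF c(2) Conj.prems(2,3)])
    moreover have "?a \<inter> ?b \<in> W \<longleftrightarrow> ?a \<in> W \<and> ?b \<in> W" using W(2)[of ?a ?b] W(3)[of "?a \<inter> ?b"] by blast
    moreover have "?a \<inter> ?b = {i. sat M (map (\<lambda>f. f i) fs) (Conj \<phi> \<psi>)}" by auto
    ultimately show ?case by simp
  next
    case (Ex \<phi>)
    have \<phi>: "\<phi> \<in> formulas L (Suc n)" using Ex.prems(1) by simp
    have IH: "sat N (q g # map q fs) \<phi> \<longleftrightarrow> {i. sat M (g i # map (\<lambda>f. f i) fs) \<phi>} \<in> W" if "g \<in> ?Fn" for g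
    proof -
      have "length (g # fs) = Suc n" "set (g # fs) \<subseteq> ?Fn" using Ex.prems(2,3) that by simp_all
      from Ex.IH[OF \<phi> this] show ?thesis by simp
    qed
    have "sat N (map q fs) (Ex \<phi>) \<longleftrightarrow> (\<exists>g\<in>?Fn. {i. sat M (g i # map (\<lambda>f. f i) fs) \<phi>} \<in> W)"
      using IH by (auto simp: N_def)
    also have "\<dots> \<longleftrightarrow> {i. sat M (map (\<lambda>f. f i) fs) (Ex \<phi>)} \<in> W"
    proof
      assume "\<exists>g\<in>?Fn. {i. sat M (g i # map (\<lambda>f. f i) fs) \<phi>} \<in> W"
      then obtain g where g: "g \<in> ?Fn" "{i. sat M (g i # map (\<lambda>f. f i) fs) \<phi>} \<in> W" by blast
      show "{i. sat M (map (\<lambda>f. f i) fs) (Ex \<phi>)} \<in> W" by (rule W(3)[OF g(2)]) (use g(1) in auto)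
    next
      assume w: "{i. sat M (map (\<lambda>f. f i) fs) (Ex \<phi>)} \<in> W"
      obtain a0 where a0: "a0 \<in> univ M" using M unfolding is_structure_def by blast
      define g where "g i = (if sat M (map (\<lambda>f. f i) fs) (Ex \<phi>) then SOME c. c \<in> univ M \<and> sat M (c # map (\<lambda>f. f i) fs) \<phi> else a0)" for i
      have g: "g i \<in> univ M \<and> sat M (g i # map (\<lambda>f. f i) fs) \<phi>" if s: "sat M (map (\<lambda>f. f i) fs) (Ex \<phi>)" for i
      proof -
        have "\<exists>c. c \<in> univ M \<and> sat M (c # map (\<lambda>f. f i) fs) \<phi>" using s by auto
        from someI_ex[OF this] show ?thesis using s by (simp add: g_def)
      qed
      have "g i \<in> univ M" for i using g[of i] a0 by (cases "sat M (map (\<lambda>f. f i) fs) (Ex \<phi>)") (simp_all add: g_def)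
      then have gF: "g \<in> ?Fn" by blast
      have "{i. sat M (g i # map (\<lambda>f. f i) fs) \<phi>} \<in> W" by (rule W(3)[OF w]) (use g in blast)
      then show "\<exists>g\<in>?Fn. {i. sat M (g i # map (\<lambda>f. f i) fs) \<phi>} \<in> W" using gF by blast
    qed
    finally show ?case .
  qed
  have "is_structure L N"
    unfolding is_structure_def
  proof (intro conjI allI ballI)
    have "?Fn \<noteq> {}" using M unfolding is_structure_def by auto
    then show "univ N \<noteq> {}" by (simp add: N_def)
    fix F xs assume xs: "xs \<in> nlists (fun_arity L F) (univ N)"
    have dx: "d x \<in> ?Fn" if "x \<in> univ N" for x using that d(1) by (auto simp: N_def)
    have "map (\<lambda>x. d x i) xs \<in> nlists (fun_arity L F) (univ M)" for i
    proof (rule nlistsI)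
      show "length (map (\<lambda>x. d x i) xs) = fun_arity L F" using xs by simp
      show "set (map (\<lambda>x. d x i) xs) \<subseteq> univ M" using nlistsE_set[OF xs] dx by fastforce
    qed
    then have "(\<lambda>i. fun_int M F (map (\<lambda>x. d x i) xs)) \<in> ?Fn" using M unfolding is_structure_def by blast
    then show "fun_int N F xs \<in> univ N" by (simp add: N_def)
  qed
  moreover have "univ N = q ` ?Fn" by (simp add: N_def)
  moreover have "\<forall>n \<phi> fs. \<phi> \<in> formulas L n \<longrightarrow> length fs = n \<longrightarrow> (\<forall>f\<in>set fs. \<forall>i. f i \<in> univ M) \<longrightarrow>
       (sat N (map q fs) \<phi> \<longleftrightarrow> {i. sat M (map (\<lambda>f. f i) fs) \<phi>} \<in> W)"
    using sat by blast
  ultimately show thesis by (rule that)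
qed

section \<open>Compactness and uniform finiteness for tuples\<close>

text \<open>A function is coded by its graph. The sum of the formulas with \<open>'a\<close> is
  infinite and so equinumerous with its square, which allows a pair of argument and value to be
  coded by one element.\<close>

lemma ex_encoding: "\<exists>enc :: (('f, 'r) fm \<Rightarrow> 'a) \<Rightarrow> ('f, 'r, 'a) model_universe. inj enc"
proof -
  have "inj (\<lambda>n::nat. Inl (Eq (Var n) (Var 0)) :: ('f, 'r) fm + 'a)" by (rule injI) simp
  then have inf: "infinite (UNIV :: (('f, 'r) fm + 'a) set)"
    using finite_imageD[of "\<lambda>n::nat. Inl (Eq (Var n) (Var 0)) :: ('f, 'r) fm + 'a" UNIV] finite_subset[OF subset_UNIV]
    by (metis infinite_UNIV_nat)
  obtain h where h: "bij_betw h ((UNIV :: (('f, 'r) fm + 'a) set) \<times> (UNIV :: (('f, 'r) fm + 'a) set)) (UNIV :: (('f, 'r) fm + 'a) set)"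
    using card_of_Times_same_infinite[OF inf] card_of_ordIso by blast
  then have inj: "inj h" by (simp add: bij_betw_def)
  let ?enc = "\<lambda>f :: ('f, 'r) fm \<Rightarrow> 'a. range (\<lambda>i. h (Inl i, Inr (f i)))"
  have "inj ?enc"
  proof (rule injI, rule ext)
    fix f g :: "('f, 'r) fm \<Rightarrow> 'a" and i assume e: "?enc f = ?enc g"
    have "h (Inl i, Inr (f i)) \<in> ?enc g" unfolding e[symmetric] by (rule rangeI)
    then obtain i' where "h (Inl i, Inr (f i)) = h (Inl i', Inr (g i'))" by (rule rangeE)
    then have "(Inl i :: ('f, 'r) fm + 'a, Inr (f i) :: ('f, 'r) fm + 'a) = (Inl i', Inr (g i'))" by (rule injD[OF inj])
    then show "f i = g i" by auto
  qed
  then show ?thesis by (rule exI[of inj ?enc])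
qed

primrec conjuncts :: "('f, 'r) fm \<Rightarrow> ('f, 'r) fm set" where
  "conjuncts (Eq s t) = {}" | "conjuncts (Rel R ts) = {}" | "conjuncts (Neg \<phi>) = {}"
| "conjuncts (Conj \<phi> \<psi>) = insert \<phi> (conjuncts \<psi>)" | "conjuncts (Ex \<phi>) = {}"

lemma finite_conjuncts: "finite (conjuncts \<phi>)"
  by (induction \<phi>) auto

lemma ex_conjuncts: "finite H \<Longrightarrow> \<exists>\<phi>. conjuncts \<phi> = H"
proof (induction H rule: finite_induct)
  case empty
  show ?case by (rule exI[of _ Tr]) simp
next
  case (insert \<sigma> H)
  then obtain \<phi> where "conjuncts \<phi> = H" by blast
  then show ?case by (intro exI[of _ "Conj \<sigma> \<phi>"]) simp
qed

text \<open>An ultrapower whose index set is the set of formulas, viewed as finite conjunctions.\<close>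

lemma compactness:
  fixes L :: "('f, 'r) language" and M :: "('f, 'r, 'a) struct"
  assumes M: "is_structure L M" and \<Sigma>: "\<Sigma> \<subseteq> formulas L r"
    and fin: "\<forall>H. finite H \<longrightarrow> H \<subseteq> \<Sigma> \<longrightarrow> (\<exists>v\<in>nlists r (univ M). \<forall>\<sigma>\<in>H. sat M v \<sigma>)"
  obtains N :: "('f, 'r, ('f, 'r, 'a) model_universe) struct" and v j where
    "is_structure L N" "v \<in> nlists r (univ N)" "\<forall>\<sigma>\<in>\<Sigma>. sat N v \<sigma>" "\<forall>a\<in>univ M. j a \<in> univ N"
    "\<forall>n \<phi> e. \<phi> \<in> formulas L n \<longrightarrow> e \<in> nlists n (univ M) \<longrightarrow> sat N (map j e) \<phi> = sat M e \<phi>"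
proof -
  obtain enc :: "(('f, 'r) fm \<Rightarrow> 'a) \<Rightarrow> ('f, 'r, 'a) model_universe" where enc: "inj enc"
    using ex_encoding by (rule exE) (rule that)
  let ?G = "(\<lambda>\<sigma>. {i. \<sigma> \<in> conjuncts i}) ` \<Sigma>"
  have "fip ?G" unfolding fip_def
  proof (intro allI impI)
    fix H assume H: "finite H" "H \<subseteq> ?G"
    obtain H' where H': "H' \<subseteq> \<Sigma>" "finite H'" "H = (\<lambda>\<sigma>. {i. \<sigma> \<in> conjuncts i}) ` H'"
      using finite_subset_image[OF H] by (elim exE conjE) (rule that)
    obtain i where "conjuncts i = H'" using ex_conjuncts[OF H'(2)] by (rule exE) (rule that)
    then have "i \<in> \<Inter>H" unfolding H'(3) by simp
    then show "\<Inter>H \<noteq> {}" by blast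
  qed
  then obtain W where GW: "?G \<subseteq> W" and W': "{} \<notin> W" "\<forall>X Y. X \<in> W \<longrightarrow> Y \<in> W \<longrightarrow> X \<inter> Y \<in> W"
    "\<forall>X Y. X \<in> W \<longrightarrow> X \<subseteq> Y \<longrightarrow> Y \<in> W" "\<forall>X. X \<in> W \<or> - X \<in> W"
    by (rule ex_ultrafilter) (rule that)
  note W = W'(1) W'(2,3,4)[rule_format]
  have UW: "UNIV \<in> W" using W(1) W(4)[of UNIV] by auto
  obtain N :: "('f, 'r, ('f, 'r, 'a) model_universe) struct" and q where N: "is_structure L N"
    "univ N = q ` {f. \<forall>i. f i \<in> univ M}"
    "\<forall>n \<phi> fs. \<phi> \<in> formulas L n \<longrightarrow> length fs = n \<longrightarrow> (\<forall>f\<in>set fs. \<forall>i. f i \<in> univ M) \<longrightarrow>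
       (sat N (map q fs) \<phi> \<longleftrightarrow> {i. sat M (map (\<lambda>f. f i) fs) \<phi>} \<in> W)"
    by (rule los[OF M enc W']) (rule that)
  have "\<forall>i. \<exists>v. v \<in> nlists r (univ M) \<and> (\<forall>\<sigma>\<in>conjuncts i \<inter> \<Sigma>. sat M v \<sigma>)"
  proof
    fix i
    have "finite (conjuncts i \<inter> \<Sigma>)" using finite_conjuncts by blast
    with fin show "\<exists>v. v \<in> nlists r (univ M) \<and> (\<forall>\<sigma>\<in>conjuncts i \<inter> \<Sigma>. sat M v \<sigma>)" by blast
  qed
  then obtain w where w: "\<forall>i. w i \<in> nlists r (univ M) \<and> (\<forall>\<sigma>\<in>conjuncts i \<inter> \<Sigma>. sat M (w i) \<sigma>)" by (rule choice[THEN exE])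
  \<comment> \<open>The tuple is formed coordinatewise: at the index \<open>i\<close> it is
    \<open>w i\<close>, which satisfies all the formulas of \<open>\<Sigma>\<close> listed in
    \<open>i\<close>.\<close>
  define fs where "fs = map (\<lambda>k i. w i ! k) [0..<r]"
  have lfs: "length fs = r" by (simp add: fs_def)
  have fsU: "\<forall>f\<in>set fs. \<forall>i. f i \<in> univ M"
  proof (intro ballI allI)
    fix f i assume "f \<in> set fs"
    then obtain k where "k < r" "f = (\<lambda>i. w i ! k)" unfolding fs_def by auto
    moreover have "w i \<in> nlists r (univ M)" using w by blast
    ultimately show "f i \<in> univ M" by (simp add: nlistsE_nth_in)
  qed
  have mfs: "map (\<lambda>f. f i) fs = w i" for i
  proof (rule nth_equalityI)
    have "length (w i) = r" using w nlistsE_length by blast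
    then show "length (map (\<lambda>f. f i) fs) = length (w i)" using lfs by simp
    show "map (\<lambda>f. f i) fs ! k = w i ! k" if "k < length (map (\<lambda>f. f i) fs)" for k
      using that by (simp add: fs_def)
  qed
  have jU: "\<forall>a\<in>univ M. q (\<lambda>_. a) \<in> univ N" unfolding N(2) by simp
  show thesis
  proof (rule that[of N "map q fs" "\<lambda>a. q (\<lambda>_. a)"])
    show "is_structure L N" by (rule N(1))
    show "map q fs \<in> nlists r (univ N)"
    proof (rule nlistsI)
      show "length (map q fs) = r" using lfs by simp
      show "set (map q fs) \<subseteq> univ N" unfolding N(2) using fsU by auto
    qed
    show "\<forall>\<sigma>\<in>\<Sigma>. sat N (map q fs) \<sigma>"
    proof
      fix \<sigma> assume \<sigma>: "\<sigma> \<in> \<Sigma>"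
      have "{i. \<sigma> \<in> conjuncts i} \<in> W" using GW \<sigma> by blast
      then have "{i. sat M (w i) \<sigma>} \<in> W" by (rule W(3)) (use w \<sigma> in blast)
      then have "{i. sat M (map (\<lambda>f. f i) fs) \<sigma>} \<in> W" unfolding mfs .
      moreover have "\<sigma> \<in> formulas L r" using \<sigma> \<Sigma> by blast
      ultimately show "sat N (map q fs) \<sigma>" using N(3) lfs fsU by blast
    qed
    show "\<forall>a\<in>univ M. q (\<lambda>_. a) \<in> univ N" by (rule jU)
    show "\<forall>n \<phi> e. \<phi> \<in> formulas L n \<longrightarrow> e \<in> nlists n (univ M) \<longrightarrow> sat N (map (\<lambda>a. q (\<lambda>_. a)) e) \<phi> = sat M e \<phi>"
    proof (intro allI impI)
      fix n \<phi> e assume \<phi>: "\<phi> \<in> formulas L n" and e: "e \<in> nlists n (univ M)"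
      let ?fs = "map (\<lambda>a _. a) e"
      have "length ?fs = n" using e by simp
      moreover have "\<forall>f\<in>set ?fs. \<forall>i. f i \<in> univ M" using nlistsE_set[OF e] by auto
      ultimately have "sat N (map q ?fs) \<phi> \<longleftrightarrow> {i. sat M (map (\<lambda>f. f i) ?fs) \<phi>} \<in> W" using N(3) \<phi> by blast
      moreover have m1: "map q ?fs = map (\<lambda>a. q (\<lambda>_. a)) e" by simp
      moreover have m2: "map (\<lambda>f. f i) ?fs = e" for i by (simp add: o_def)
      ultimately have "sat N (map (\<lambda>a. q (\<lambda>_. a)) e) \<phi> \<longleftrightarrow> {i :: ('f, 'r) fm. sat M e \<phi>} \<in> W"
        by (simp only: m1 m2)
      then show "sat N (map (\<lambda>a. q (\<lambda>_. a)) e) \<phi> = sat M e \<phi>" using UW W(1) by (cases "sat M e \<phi>") simp_all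
    qed
  qed
qed

section \<open>Uniform finiteness for tuples of parameters\<close>

text \<open>If no bound worked for all tuples, compactness would give a tuple \<open>v\<close> in an
  elementary extension for which every bound fails. But the copy of \<open>M\<close> there is a
  \<open>tame_sub\<close> and can be enlarged until it contains \<open>v\<close>, and then some
  bound holds for \<open>v\<close>.\<close>

lemma uniform_tame:
  fixes L :: "('f, 'r) language" and M :: "('f, 'r, 'a) struct"
  assumes M: "is_structure L M" and ar: "rel_arity L lt = 2" "fun_arity L pl = 2" and ax: "sat M [] (og_ax lt pl)"
    and tm: "\<And>p \<phi> m. \<phi> \<in> formulas L (Suc p) \<Longrightarrow> m \<in> nlists p (univ M) \<Longrightarrow> \<exists>K. sat M m (tamef lt K p \<phi>)"
    and \<phi>: "\<phi> \<in> formulas L (Suc p)"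
  shows "\<exists>K. sat M [] (Alls p (tamef lt K p \<phi>))"
proof (rule ccontr)
  assume "\<not> ?thesis"
  then have no: "\<exists>z\<in>nlists p (univ M). \<not> sat M z (tamef lt K p \<phi>)" for K by (simp add: sat_Exs)
  obtain le less zr ng where "ogd le less L M lt pl zr ng" by (rule ex_ogd[OF M ar ax])
  then interpret M: ogd le less L M lt pl zr ng .
  have mono: "sat M z (tamef lt K' p \<phi>)" if "sat M z (tamef lt K p \<phi>)" "K \<le> K'" "z \<in> nlists p (univ M)" for z K K'
    using that M.sat_tamef[OF \<phi> that(3)] by (meson le_trans)
  let ?\<Sigma> = "range (\<lambda>K. Neg (tamef lt K p \<phi>))"
  have \<Sigma>: "?\<Sigma> \<subseteq> formulas L p" using tamef_formulas[OF ar(1) \<phi>] by auto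
  have fin: "\<forall>H. finite H \<longrightarrow> H \<subseteq> ?\<Sigma> \<longrightarrow> (\<exists>v\<in>nlists p (univ M). \<forall>\<sigma>\<in>H. sat M v \<sigma>)"
  proof (intro allI impI)
    fix H assume H: "finite H" "H \<subseteq> ?\<Sigma>"
    obtain I where I: "finite I" "H = (\<lambda>K. Neg (tamef lt K p \<phi>)) ` I" using finite_subset_image[OF H] by blast
    obtain K where K: "\<forall>k\<in>I. k \<le> K" using I(1) unfolding finite_nat_set_iff_bounded_le by blast
    obtain z where z: "z \<in> nlists p (univ M)" "\<not> sat M z (tamef lt K p \<phi>)" using no by blast
    have "\<not> sat M z (tamef lt k p \<phi>)" if "k \<in> I" for k using mono[of z k K] K that z by blast
    then show "\<exists>v\<in>nlists p (univ M). \<forall>\<sigma>\<in>H. sat M v \<sigma>" unfolding I(2) using z(1) by (intro bexI[of _ z]) auto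
  qed
  obtain N :: "('f, 'r, ('f, 'r, 'a) model_universe) struct" and v j where N:
    "is_structure L N" "v \<in> nlists p (univ N)" "\<forall>\<sigma>\<in>?\<Sigma>. sat N v \<sigma>" "\<forall>a\<in>univ M. j a \<in> univ N"
    "\<forall>n \<phi> e. \<phi> \<in> formulas L n \<longrightarrow> e \<in> nlists n (univ M) \<longrightarrow> sat N (map j e) \<phi> = sat M e \<phi>"
    by (rule compactness[OF M \<Sigma> fin]) (rule that)
  have el: "sat N (map j e) \<phi> = sat M e \<phi>" if "\<phi> \<in> formulas L n" "e \<in> nlists n (univ M)" for \<phi> n e
    using N(5) that by blast
  have jU: "j ` univ M \<subseteq> univ N" using N(4) by blast
  have pre: "\<exists>e\<in>nlists n (univ M). m = map j e" if m: "m \<in> nlists n (j ` univ M)" for m n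
  proof -
    have "\<forall>x\<in>set m. \<exists>a\<in>univ M. x = j a" using nlistsE_set[OF m] by blast
    then obtain e where "set e \<subseteq> univ M" "m = map j e"
    proof (induction m arbitrary: thesis)
      case (Cons x m)
      then obtain e a where "set e \<subseteq> univ M" "m = map j e" "a \<in> univ M" "x = j a" by (metis list.set_intros(1) list.set_intros(2))
      then show ?case using Cons.prems(1)[of "a # e"] by simp
    qed simp
    moreover from this have "length e = n" using nlistsE_length[OF m] by simp
    ultimately show ?thesis by (intro bexI[of _ e] nlistsI)
  qed
  have axN: "sat N [] (og_ax lt pl)" using el[OF og_ax_formulas[OF ar], of "[]"] ax by simp
  have "elem_sub L N (j ` univ M)"
    unfolding elem_sub_def
  proof (intro conjI allI ballI impI)
    show "j ` univ M \<subseteq> univ N" by (rule jU)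
    show "j ` univ M \<noteq> {}" using M.U_ne by simp
    fix n \<psi> m assume \<psi>: "\<psi> \<in> formulas L (Suc n)" and m: "m \<in> nlists n (j ` univ M)" and ex: "\<exists>u\<in>univ N. sat N (u # m) \<psi>"
    obtain e where e: "e \<in> nlists n (univ M)" "m = map j e" using pre[OF m] by blast
    have "sat N m (Ex \<psi>)" using ex by simp
    then have "sat M e (Ex \<psi>)" using el[of "Ex \<psi>" n e] \<psi> e by simp
    then obtain a where a: "a \<in> univ M" "sat M (a # e) \<psi>" by auto
    then have "sat N (j a # m) \<psi>" using el[OF \<psi>, of "a # e"] e by simp
    then show "\<exists>u\<in>j ` univ M. sat N (u # m) \<psi>" using a(1) by blast
  qed
  moreover have "\<exists>K. sat N m (tamef lt K n \<psi>)" if \<psi>: "\<psi> \<in> formulas L (Suc n)" and m: "m \<in> nlists n (j ` univ M)" for \<psi> n m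
  proof -
    obtain e where e: "e \<in> nlists n (univ M)" "m = map j e" using pre[OF m] by blast
    obtain K where "sat M e (tamef lt K n \<psi>)" using tm[OF \<psi> e(1)] by blast
    then show ?thesis using el[OF tamef_formulas[OF ar(1) \<psi>] e(1)] e(2) by blast
  qed
  ultimately have V: "tame_sub L N lt (j ` univ M)" unfolding tame_sub_def by blast
  obtain V' where V': "tame_sub L N lt V'" "set v \<subseteq> V'"
    using tame_sub_extend_list[OF N(1) ar axN V nlistsE_set[OF N(2)]] by blast
  have vV: "v \<in> nlists p V'" using V'(2) N(2) by (intro nlistsI) auto
  obtain K where "sat N v (tamef lt K p \<phi>)" using V'(1) vV \<phi> unfolding tame_sub_def by blast
  then show False using N(3) by auto
qed

lemma ex_omin_model:
  fixes L :: "('f, 'r) language" and M :: "('f, 'r, 'a) struct" and N :: "('f, 'r, 'b) struct"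
  assumes M: "is_structure L M" and ar: "rel_arity L lt = 2" "fun_arity L pl = 2" and ax: "sat M [] (og_ax lt pl)"
    and tm: "\<And>p \<phi> m. \<phi> \<in> formulas L (Suc p) \<Longrightarrow> m \<in> nlists p (univ M) \<Longrightarrow> \<exists>K. sat M m (tamef lt K p \<phi>)"
    and N: "is_model L N (Th L M)"
  obtains le less zr ng where "omin le less L N lt pl zr ng"
proof -
  have th: "sat N [] \<sigma>" if "\<sigma> \<in> formulas L 0" "sat M [] \<sigma>" for \<sigma>
    using N that unfolding is_model_def Th_def by blast
  have NS: "is_structure L N" using N unfolding is_model_def by blast
  obtain le less zr ng where "ogd le less L N lt pl zr ng"
    by (rule ex_ogd[OF NS ar th[OF og_ax_formulas[OF ar] ax]])
  then interpret N: ogd le less L N lt pl zr ng .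
  have "omin le less L N lt pl zr ng"
  proof (rule N.omin_tamef)
    fix p \<phi> m assume \<phi>: "\<phi> \<in> formulas L (Suc p)" and m: "m \<in> nlists p (univ N)"
    obtain K where K: "sat M [] (Alls p (tamef lt K p \<phi>))"
      using uniform_tame[OF M ar ax tm \<phi>] by blast
    have "Alls p (tamef lt K p \<phi>) \<in> formulas L 0"
      using tamef_formulas[OF ar(1) \<phi>] by (auto intro!: Exs_formulas)
    from th[OF this K] have "sat N m (tamef lt K p \<phi>)" using m by (auto simp: sat_Exs)
    then show "\<exists>K. sat N m (tamef lt K p \<phi>)" by (rule exI)
  qed
  then show thesis by (rule that)
qed

section \<open>Dimension and local modularity\<close>

context omin
begin

lemma acl_dcl: assumes A: "A \<subseteq> U" shows "acl L S A = dcl A"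
proof
  show "acl L S A \<subseteq> dcl A"
  proof
    fix c assume "c \<in> acl L S A"
    then obtain p \<phi> b where c: "c \<in> U" "\<phi> \<in> formulas L (Suc p)" "b \<in> nlists p A" "sat S (c # b) \<phi>"
      "finite {d \<in> U. sat S (d # b) \<phi>}" unfolding acl_def by blast
    have "Def A (\<lambda>e. sat S (e 0 # b) \<phi>)"
    proof (rule Def_sat_params)
      show "\<phi> \<in> formulas L (Suc (length b))" using c(2,3) by simp
      show "set b \<subseteq> A" using c(3) by (rule nlistsE_set)
    qed
    from finite_Def_dcl[of A "\<lambda>u. sat S (u # b) \<phi>", OF this c(5)] c(1,4) show "c \<in> dcl A" by blast
  qed
  show "dcl A \<subseteq> acl L S A"
  proof
    fix c assume "c \<in> dcl A"
    then have c: "c \<in> U" "Def A (\<lambda>e. e 0 = c)" by (simp_all add: dcl_def)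
    obtain xs where xs: "set xs \<subseteq> A" "Def (set xs) (\<lambda>e. e 0 = c)" using c(2) by (rule Def_params)
    obtain \<phi> where \<phi>: "\<phi> \<in> formulas L (Suc (length xs))" "\<forall>u\<in>U. u = c \<longleftrightarrow> sat S (u # xs) \<phi>"
      by (rule Def_params_formula[of xs "\<lambda>u. u = c", OF xs(2)]) (rule that)
    have "{d \<in> U. sat S (d # xs) \<phi>} = {c}" using \<phi>(2) c(1) by blast
    then have "finite {d \<in> U. sat S (d # xs) \<phi>}" by simp
    moreover have "xs \<in> nlists (length xs) A" using xs(1) by (intro nlistsI) auto
    moreover have "sat S (c # xs) \<phi>" using \<phi>(2) c(1) by blast
    ultimately show "c \<in> acl L S A" unfolding acl_def using c(1) \<phi>(1) by blast
  qed
qed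

text \<open>Let \<open>R\<close> be the graph of an \<open>A\<close>-definable partial function with
  value \<open>c\<close> at \<open>a\<close>. If \<open>a\<close> is not definable from
  \<open>c\<close>, the fibre over \<open>c\<close> is infinite and contains an interval. Only
  finitely many values \<open>y\<close> have such a fibre: the function is locally constant on it,
  and local constancy (\<open>LC\<close>) has finitely many breaks. So \<open>c\<close> lies in a
  finite \<open>A\<close>-definable set.\<close>

lemma exchange:
  assumes a: "a \<in> U" and c: "c \<in> dcl (insert a A)" "c \<notin> dcl A" and A: "A \<subseteq> U"
  shows "a \<in> dcl (insert c A)"
proof (rule ccontr)
  assume na: "a \<notin> dcl (insert c A)"
  have cU: "c \<in> U" and Dc: "Def (insert a A) (\<lambda>e. e 0 = c)" using c(1) by (simp_all add: dcl_def)
  obtain Q where Q: "Def A Q" "\<And>e. env e \<Longrightarrow> e 0 = c \<longleftrightarrow> Q (case_nat a e)"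
    using Def_insert[OF Dc a] by metis
  \<comment> \<open>For arguments other than \<open>a\<close> the relation \<open>Q\<close> need not
    be functional; only arguments with exactly one value are kept.\<close>
  define R where "R x y \<longleftrightarrow> Q (case_nat x (\<lambda>_. y)) \<and> (\<forall>w\<in>U. Q (case_nat x (\<lambda>_. w)) \<longrightarrow> w = y)" for x y
  have DQ: "Def A (\<lambda>e. Q (case_nat (e 0) (\<lambda>_. e 1)))"
  proof -
    have "(\<lambda>i. e (case_nat 0 (\<lambda>_. 1) i)) = case_nat (e 0) (\<lambda>_. e 1)" for e :: "nat \<Rightarrow> 'a" by (rule ext) (simp split: nat.split)
    then show ?thesis using Def_reindex[OF Q(1), of "case_nat 0 (\<lambda>_. 1)"] by simp
  qed
  note DQ' = Def_subst2[of A "\<lambda>x y. Q (case_nat x (\<lambda>_. y))", OF DQ]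
  have DR: "Def A (\<lambda>e. R (e 0) (e 1))" unfolding R_def by (intro dfs DQ')
  note R = Def_subst2[of A R, OF DR] and RU = Def_subst2[of U R, OF Def_mono[OF DR A]]
  have RI: "Def (insert c A) (\<lambda>e. R (e 0) c)"
    by (rule Def_subst2[of "insert c A" R, OF Def_mono[OF DR subset_insertI]]) (intro T_var T_const cU insertI1)+
  have fn: "y = y'" if "R x y" "R x y'" "y \<in> U" "y' \<in> U" for x y y' using that unfolding R_def by blast
  have qa: "Q (case_nat a (\<lambda>_. y)) \<longleftrightarrow> y = c" if "y \<in> U" for y
    using Q(2)[of "\<lambda>_. y"] that by (simp add: env_def)
  have Rac: "R a c" unfolding R_def using qa cU by blast
  have inf: "infinite {x \<in> U. R x c}"
  proof
    assume "finite {x \<in> U. R x c}"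
    from finite_Def_dcl[of "insert c A" "\<lambda>x. R x c", OF RI this] show False using na Rac a by blast
  qed
  define V where "V y \<longleftrightarrow> (\<exists>l\<in>U. \<exists>r\<in>U. l \<prec> r \<and> (\<forall>x\<in>U. x \<in> ival l r \<longrightarrow> R x y))" for y
  have DV: "Def A (\<lambda>e. V (e 0))" unfolding V_def by (intro dfs Def_ival R)
  have Vc: "V c"
  proof -
    have "Def U (\<lambda>e. R (e 0) c)" by (intro RU T_var T_U cU)
    from Def_infinite_ival[of "\<lambda>x. R x c", OF this inf] show ?thesis unfolding V_def by metis
  qed
  define LC where "LC x \<longleftrightarrow> (\<exists>y\<in>U. \<exists>l\<in>U. \<exists>r\<in>U. l \<prec> x \<and> x \<prec> r \<and> (\<forall>x'\<in>U. x' \<in> ival l r \<longrightarrow> R x' y))" for x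
  have "Def U (\<lambda>e. LC (e 0))" unfolding LC_def by (intro dfs Def_ival RU)
  then obtain F where F: "finite F" "F \<subseteq> U" "breaks F LC" using tame_Def unfolding tame_def by blast
  have "\<forall>y\<in>{y \<in> U. V y}. \<exists>x. x \<in> U \<and> x \<notin> F \<and> R x y \<and> LC x"
  proof
    fix y assume y: "y \<in> {y \<in> U. V y}"
    then obtain l r where lr: "l \<in> U" "r \<in> U" "l \<prec> r" "\<forall>x\<in>U. x \<in> ival l r \<longrightarrow> R x y" unfolding V_def by blast
    have "\<not> ival l r \<subseteq> F" using infinite_ival[OF lr(1-3)] F(1) finite_subset by blast
    then obtain x where x: "x \<in> ival l r" "x \<notin> F" by blast
    have "LC x" unfolding LC_def using lr x(1) y by (intro bexI[of _ y] bexI[of _ l] bexI[of _ r]) (auto simp: ival_def)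
    then show "\<exists>x. x \<in> U \<and> x \<notin> F \<and> R x y \<and> LC x" using x lr(4) ivalD(1)[OF x(1)] by blast
  qed
  then obtain f where f: "\<forall>y\<in>{y \<in> U. V y}. f y \<in> U \<and> f y \<notin> F \<and> R (f y) y \<and> LC (f y)" by (rule bchoice[THEN exE])
  have main: "y = y'" if y: "y \<in> U" "V y" and y': "y' \<in> U" "V y'" and eq: "{d \<in> F. d \<prec> f y} = {d \<in> F. d \<prec> f y'}" and le: "f y \<preceq> f y'" for y y'
  proof -
    have fy: "f y \<in> U" "f y \<notin> F" "R (f y) y" "LC (f y)" and fy': "f y' \<in> U" "f y' \<notin> F" "R (f y') y'" using f y y' by blast+
    have nof: "\<not> (f y \<preceq> d \<and> d \<preceq> f y')" if d: "d \<in> F" for d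
    proof
      assume *: "f y \<preceq> d \<and> d \<preceq> f y'"
      then have "d \<prec> f y'" using fy'(2) d by (cases "d = f y'") auto
      then have "d \<in> {d \<in> F. d \<prec> f y'}" using d by blast
      then have "d \<prec> f y" using eq by blast
      then show False using * by auto
    qed
    have LCz: "LC z" if z: "z \<in> U" "f y \<preceq> z" "z \<preceq> f y'" for z
    proof (cases "f y = z")
      case False
      then have lt: "f y \<prec> z" using z by auto
      have "\<forall>d\<in>F. \<not> (f y \<preceq> d \<and> d \<preceq> z)" using nof z(3) order_trans by blast
      then have "LC (f y) = LC z" using F(3) fy(1) z(1) lt unfolding breaks_def by blast
      then show ?thesis using fy(4) by simp
    qed (use fy in simp)
    have "R (f y) y = R (f y') y"
    proof (rule tame_connected[of "\<lambda>z. R z y"])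
      have "Def U (\<lambda>e. R (e 0) y)" by (intro RU T_var T_U y)
      then show "tame (\<lambda>z. R z y)" by (rule tame_Def[of "\<lambda>z. R z y"])
      fix z assume z: "z \<in> U" "f y \<preceq> z" "z \<preceq> f y'"
      obtain w l r where w: "w \<in> U" "l \<in> U" "r \<in> U" "l \<prec> z" "z \<prec> r" "\<forall>x'\<in>U. x' \<in> ival l r \<longrightarrow> R x' w"
        using LCz[OF z] unfolding LC_def by blast
      have "R x y \<longleftrightarrow> y = w" if "x \<in> ival l r" for x using w(6) that fn[of x y w] y(1) w(1) ivalD(1)[OF that] by blast
      moreover have "z \<in> ival l r" using w z by (simp add: ival_def)
      ultimately have "\<forall>x\<in>ival l r. R x y = R z y" by blast
      then show "\<exists>l\<in>U. \<exists>r\<in>U. l \<prec> z \<and> z \<prec> r \<and> (\<forall>x\<in>ival l r. f y \<preceq> x \<longrightarrow> x \<preceq> f y' \<longrightarrow> R x y = R z y)"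
        using w(2-5) by blast
    qed (use fy fy' le in auto)
    then show ?thesis using fn[of "f y'" y y'] fy fy' y y' by blast
  qed
  \<comment> \<open>The position of \<open>f y\<close> relative to the finite set \<open>F\<close>
    determines \<open>y\<close>, so there are at most as many such values as subsets of
    \<open>F\<close>.\<close>
  have "inj_on (\<lambda>y. {d \<in> F. d \<prec> f y}) {y \<in> U. V y}"
  proof (rule inj_onI)
    fix y y' assume y: "y \<in> {y \<in> U. V y}" "y' \<in> {y \<in> U. V y}" and eq: "{d \<in> F. d \<prec> f y} = {d \<in> F. d \<prec> f y'}"
    show "y = y'"
    proof (cases "f y \<preceq> f y'")
      case True
      then show ?thesis using main[of y y'] y eq by blast
    next
      case False
      then have "f y' \<preceq> f y" by simp
      then show ?thesis using main[of y' y] y eq by blast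
    qed
  qed
  moreover have "(\<lambda>y. {d \<in> F. d \<prec> f y}) ` {y \<in> U. V y} \<subseteq> Pow F" by blast
  ultimately have "finite {y \<in> U. V y}" using F(1) by (meson finite_Pow_iff inj_on_finite)
  from finite_Def_dcl[of A V, OF DV this] show False using Vc cU c(2) by blast
qed

section \<open>Bases and dimension\<close>

definition indep :: "'a set \<Rightarrow> bool" where "indep X \<longleftrightarrow> X \<subseteq> U \<and> (\<forall>c\<in>X. c \<notin> dcl (X - {c}))"

lemma dcl_least: "A \<subseteq> dcl B \<Longrightarrow> dcl A \<subseteq> dcl B"
  using dcl_mono[of A "dcl B"] dcl_idem by blast

lemma indep_mono: "indep X \<Longrightarrow> Y \<subseteq> X \<Longrightarrow> indep Y"
proof -
  assume X: "indep X" and Y: "Y \<subseteq> X"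
  have "c \<notin> dcl (Y - {c})" if "c \<in> Y" for c
  proof -
    have "Y - {c} \<subseteq> X - {c}" using Y by blast
    then show ?thesis using X Y that dcl_mono unfolding indep_def by blast
  qed
  then show "indep Y" using X Y unfolding indep_def by blast
qed

lemma indep_insert: assumes X: "indep X" and y: "y \<in> U" "y \<notin> dcl X" shows "indep (insert y X)"
  unfolding indep_def
proof (intro conjI ballI)
  have XU: "X \<subseteq> U" using X by (simp add: indep_def)
  then show "insert y X \<subseteq> U" using y by blast
  have yX: "y \<notin> X" using dcl_extensive[OF XU] y(2) by blast
  fix c assume c: "c \<in> insert y X"
  show "c \<notin> dcl (insert y X - {c})"
  proof (cases "c = y")
    case True
    then show ?thesis using y yX by simp
  next
    case False
    then have cX: "c \<in> X" using c by blast
    have e: "insert y X - {c} = insert y (X - {c})" using False by blast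
    show ?thesis
    proof
      assume "c \<in> dcl (insert y X - {c})"
      then have "c \<in> dcl (insert y (X - {c}))" unfolding e .
      moreover have "c \<notin> dcl (X - {c})" using X cX by (simp add: indep_def)
      moreover have "X - {c} \<subseteq> U" using XU by blast
      ultimately have "y \<in> dcl (insert c (X - {c}))" using exchange[OF y(1)] by blast
      then show False using y(2) cX by (simp add: insert_absorb)
    qed
  qed
qed

text \<open>Steinitz replacement: an element \<open>x\<close> of \<open>X\<close> outside
  \<open>Y\<close> is exchanged for some \<open>y\<close> in \<open>Y\<close> that is not definable
  from the rest of \<open>X\<close>. The size of \<open>X\<close> is kept while \<open>X - Y\<close>
  shrinks.\<close>

lemma steinitz: "finite X \<Longrightarrow> indep X \<Longrightarrow> finite Y \<Longrightarrow> Y \<subseteq> U \<Longrightarrow> X \<subseteq> dcl Y \<Longrightarrow> card X \<le> card Y"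
proof (induction "card (X - Y)" arbitrary: X)
  case 0
  then have "X \<subseteq> Y" by simp
  then show ?case using 0 by (intro card_mono)
next
  case (Suc k)
  then obtain x where x: "x \<in> X" "x \<notin> Y" by (metis Diff_eq_empty_iff card.empty nat.distinct(1) subsetI)
  have XU: "X \<subseteq> U" using Suc.prems(2) by (simp add: indep_def)
  have "\<not> Y \<subseteq> dcl (X - {x})"
  proof
    assume "Y \<subseteq> dcl (X - {x})"
    then have "x \<in> dcl (X - {x})" using dcl_least[of Y "X - {x}"] Suc.prems(5) x(1) by blast
    then show False using Suc.prems(2) x(1) by (simp add: indep_def)
  qed
  then obtain y where y: "y \<in> Y" "y \<notin> dcl (X - {x})" by blast
  have yU: "y \<in> U" using y Suc.prems(4) by blast
  have yX: "y \<notin> X - {x}" using dcl_extensive[of "X - {x}"] XU y(2) by blast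
  let ?X = "insert y (X - {x})"
  have i: "indep ?X" by (rule indep_insert[OF indep_mono[OF Suc.prems(2)] yU y(2)]) blast
  have c: "card ?X = card X" 
    using card_Suc_Diff1[OF Suc.prems(1) x(1)] card_insert_disjoint[OF _ yX] Suc.prems(1) by simp
  have s: "?X \<subseteq> dcl Y" using Suc.prems(5) dcl_extensive[OF Suc.prems(4)] y(1) by blast
  have "?X - Y = (X - Y) - {x}" using y(1) by blast
  then have k: "k = card (?X - Y)" using Suc.hyps(2) x Suc.prems(1) by simp
  have "card ?X \<le> card Y" by (rule Suc.hyps(1)[OF k _ i Suc.prems(3,4) s]) (use Suc.prems(1) in simp)
  then show ?case using c by simp
qed

definition basis :: "'a set \<Rightarrow> 'a set \<Rightarrow> bool" where
  "basis X A \<longleftrightarrow> X \<subseteq> A \<and> indep X \<and> A \<subseteq> dcl X"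

lemma acl_basis_iff: assumes "A \<subseteq> U" shows "acl_basis L S X A \<longleftrightarrow> basis X A"
proof (cases "X \<subseteq> A")
  case True
  then have XU: "X \<subseteq> U" using assms by blast
  have "acl L S (X - {c}) = dcl (X - {c})" for c by (rule acl_dcl) (use XU in blast)
  then show ?thesis unfolding acl_basis_def basis_def acl_independent_def indep_def using XU acl_dcl[OF XU] by auto
next
  case False
  then show ?thesis unfolding acl_basis_def basis_def by blast
qed

lemma basis_card: assumes A: "A \<subseteq> U" and X: "basis X A" "finite X" and Y: "basis Y A"
  shows "card Y = card X"
proof -
  have ind: "indep X" "indep Y" and sub: "X \<subseteq> dcl Y" "Y \<subseteq> dcl X" and U: "X \<subseteq> U" "Y \<subseteq> U"
    using X Y A unfolding basis_def by blast+
  have fY: "finite Y"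
  proof (rule ccontr)
    assume "infinite Y"
    then obtain Z where Z: "Z \<subseteq> Y" "finite Z" "card Z = Suc (card X)" using infinite_arbitrarily_large by blast
    have "card Z \<le> card X" by (rule steinitz[OF Z(2) indep_mono[OF ind(2) Z(1)] X(2) U(1)]) (use Z(1) sub(2) in blast)
    then show False using Z(3) by simp
  qed
  show ?thesis using steinitz[OF X(2) ind(1) fY U(2) sub(1)] steinitz[OF fY ind(2) X(2) U(1) sub(2)] by simp
qed

lemma acl_dim_basis: assumes A: "A \<subseteq> U" and X: "basis X A" "finite X" shows "acl_dim L S A = card X"
proof -
  have "acl_basis L S X A" using X(1) acl_basis_iff[OF A] by blast
  then have "acl_basis L S (SOME X. acl_basis L S X A) A" by (rule someI)
  then show ?thesis unfolding acl_dim_def using basis_card[OF A X] acl_basis_iff[OF A] by blast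
qed

text \<open>Independent subsets of \<open>A\<close> have at most \<open>card Y\<close> elements by
  \<open>steinitz\<close>, so there is one of largest size, and by \<open>indep_insert\<close> it
  must span \<open>A\<close>.\<close>

lemma ex_basis: assumes A: "A \<subseteq> dcl Y" and Y: "finite Y" "Y \<subseteq> U"
  obtains X where "finite X" "basis X A"
proof -
  have AU: "A \<subseteq> U" using A dcl_U by blast
  let ?P = "\<lambda>k. \<exists>X. finite X \<and> X \<subseteq> A \<and> indep X \<and> card X = k"
  have "?P 0" by (rule exI[of _ "{}"]) (simp add: indep_def)
  moreover have "\<forall>k. ?P k \<longrightarrow> k \<le> card Y"
  proof (intro allI impI)
    fix k assume "?P k"
    then obtain X where X: "finite X" "X \<subseteq> A" "indep X" "card X = k" by blast
    show "k \<le> card Y" using steinitz[OF X(1,3) Y] A X by blast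
  qed
  ultimately have "\<exists>k. ?P k \<and> (\<forall>k'. ?P k' \<longrightarrow> k' \<le> k)" by (rule Nat.ex_has_greatest_nat)
  then obtain k where "?P k \<and> (\<forall>k'. ?P k' \<longrightarrow> k' \<le> k)" by (rule exE)
  then have k: "?P k" "\<forall>k'. ?P k' \<longrightarrow> k' \<le> k" by (rule conjunct1, rule conjunct2)
  obtain X where X: "finite X" "X \<subseteq> A" "indep X" "card X = k" using k(1) by blast
  have "A \<subseteq> dcl X"
  proof (rule ccontr)
    assume "\<not> A \<subseteq> dcl X"
    then obtain y where y: "y \<in> A" "y \<notin> dcl X" by blast
    have yU: "y \<in> U" using y AU by blast
    have "y \<notin> X" using dcl_extensive[of X] X(2) AU y(2) by blast
    then have "card (insert y X) = Suc k" using X by simp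
    moreover have "indep (insert y X)" by (rule indep_insert[OF X(3) yU y(2)])
    ultimately have "?P (Suc k)" using X(1,2) y(1) by (intro exI[of _ "insert y X"]) simp
    then show False using k(2) by fastforce
  qed
  then show thesis using that X unfolding basis_def by blast
qed

text \<open>A basis of \<open>A\<close> together with \<open>t\<close> is a basis of
  \<open>A'\<close>. The finite set \<open>Y\<close> guarantees that such a basis exists;
  \<open>A\<close> itself need not be closed, so the lemma also applies to joins.\<close>

lemma acl_dim_insert:
  assumes A: "A \<subseteq> dcl Y" and Y: "finite Y" "Y \<subseteq> U" and t: "t \<in> A'" "t \<notin> dcl A" and A': "A \<subseteq> A'" "A' \<subseteq> dcl (insert t A)"
  shows "acl_dim L S A' = Suc (acl_dim L S A)"
proof -
  obtain X where X: "finite X" "basis X A" by (rule ex_basis[OF A Y])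
  have AU: "A \<subseteq> U" "A' \<subseteq> U" using A A'(2) dcl_U by blast+
  have XA: "X \<subseteq> A" "indep X" "A \<subseteq> dcl X" using X(2) unfolding basis_def by blast+
  have tU: "t \<in> U" using t(1) AU by blast
  have tX: "t \<notin> dcl X" using t(2) dcl_mono[OF XA(1)] by blast
  have tnX: "t \<notin> X" using dcl_extensive[of X] XA(1) AU tX by blast
  have iU: "insert t X \<subseteq> U" using tU XA(1) AU by blast
  have "A \<subseteq> dcl (insert t X)" using XA(3) dcl_mono[of X "insert t X"] by blast
  then have "insert t A \<subseteq> dcl (insert t X)" using dcl_extensive[OF iU] by blast
  then have "A' \<subseteq> dcl (insert t X)" using dcl_least[of "insert t A" "insert t X"] A'(2) by blast
  then have "basis (insert t X) A'"
    unfolding basis_def using XA(1) A'(1) t(1) indep_insert[OF XA(2) tU tX] by blast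
  then have "acl_dim L S A' = card (insert t X)" by (rule acl_dim_basis[OF AU(2)]) (use X(1) in simp)
  then show ?thesis using acl_dim_basis[OF AU(1) X(2,1)] tnX X(1) by simp
qed

section \<open>Consequences of local modularity\<close>

text \<open>The common point \<open>e\<close> outside the closure of the empty set forces every
  basis of the intersection to be nonempty, which is the positivity required in the definition of
  local modularity.\<close>

lemma modular_law:
  assumes lm: "acl_locally_modular L S" and X: "finite X" "X \<subseteq> U" and Y: "finite Y" "Y \<subseteq> U"
    and e: "e \<in> dcl X" "e \<in> dcl Y" "e \<notin> dcl {}"
  shows "acl_dim L S (dcl X \<union> dcl Y) + acl_dim L S (dcl X \<inter> dcl Y) = acl_dim L S (dcl X) + acl_dim L S (dcl Y)"
proof -
  have closed: "acl_closed L S (dcl Z)" for Z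
    unfolding acl_closed_def using acl_dcl[OF dcl_U] dcl_idem dcl_U by simp
  have fd: "finite_dimensional L S (dcl Z)" if Z: "finite Z" "Z \<subseteq> U" for Z
  proof -
    obtain W where "finite W" "basis W (dcl Z)" by (rule ex_basis[OF subset_refl Z]) (rule that)
    then show ?thesis unfolding finite_dimensional_def using acl_basis_iff[OF dcl_U] by blast
  qed
  obtain W where W: "finite W" "basis W (dcl X \<inter> dcl Y)" by (rule ex_basis[OF Int_lower1 X]) (rule that)
  have "dcl X \<inter> dcl Y \<subseteq> U" using dcl_U by blast
  then have "acl_dim L S (dcl X \<inter> dcl Y) = card W" using W by (intro acl_dim_basis)
  moreover have "W \<noteq> {}" using W(2) e unfolding basis_def by blast
  ultimately have "0 < acl_dim L S (dcl X \<inter> dcl Y)" using W(1) by (simp add: card_gt_0_iff)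
  then show ?thesis using lm closed[of X] closed[of Y] fd[OF X] fd[OF Y] unfolding acl_locally_modular_def by blast
qed

text \<open>
  Local modularity compares the closures of \<open>A, e, t\<close> and \<open>B, e, t \<oplus> c\<close> with those of \<open>A, e\<close> and \<open>B, e\<close>:
  each time the dimension grows by one, also for the join, since \<open>c\<close> lies in the closure of \<open>A, B\<close>.
\<close>

lemma modular_point:
  assumes lm: "acl_locally_modular L S" and A: "finite A" "A \<subseteq> U" and B: "finite B" "B \<subseteq> U"
    and c: "c \<in> dcl (A \<union> B)" and e: "e \<in> U" "e \<notin> dcl {}" and t: "t \<in> U" "t \<notin> dcl (insert e (A \<union> B))"
  obtains d where "d \<in> dcl (insert t (insert e A))" "d \<in> dcl (insert (t \<oplus> c) (insert e B))" "d \<notin> dcl (insert e B)"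
proof -
  have cU: "c \<in> U" using c dcl_U by blast
  define s where "s = t \<oplus> c"
  have sU: "s \<in> U" using t cU by (simp add: s_def)
  let ?A0 = "insert e A" and ?B0 = "insert e B"
  let ?A1 = "insert t ?A0" and ?B1 = "insert s ?B0"
  have f: "finite ?A0" "?A0 \<subseteq> U" "finite ?B0" "?B0 \<subseteq> U" "finite ?A1" "?A1 \<subseteq> U" "finite ?B1" "?B1 \<subseteq> U"
    using A B e t sU by auto
  let ?C = "insert e (A \<union> B)"
  have C: "finite ?C" "?C \<subseteq> U" using A B e by auto
  have sub: "dcl ?A0 \<union> dcl ?B0 \<subseteq> dcl ?C" using dcl_mono[of ?A0 ?C] dcl_mono[of ?B0 ?C] by blast
  have cC: "c \<in> dcl ?C" using c dcl_mono[of "A \<union> B" ?C] by blast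
  have tC: "t \<notin> dcl ?C" by (rule t(2))
  have sC: "s \<notin> dcl ?C"
  proof
    assume "s \<in> dcl ?C"
    then have "s \<oplus> ng c \<in> dcl ?C" using cC by (intro dcl_add dcl_ng)
    then show False using tC t(1) cU by (simp add: s_def)
  qed
  have ext: "Z \<subseteq> dcl Z" if "Z \<subseteq> U" for Z using that by (rule dcl_extensive)
  have mono1: "dcl Z \<subseteq> dcl (insert x Z)" for x Z by (rule dcl_mono) blast
  have 1: "acl_dim L S (dcl ?A1) = Suc (acl_dim L S (dcl ?A0))"
  proof (rule acl_dim_insert[OF _ f(1,2)])
    show "t \<in> dcl ?A1" using ext[OF f(6)] by blast
    show "t \<notin> dcl (dcl ?A0)" using tC sub dcl_idem by blast
    show "dcl ?A1 \<subseteq> dcl (insert t (dcl ?A0))" using ext[OF f(2)] by (intro dcl_mono) blast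
  qed (rule subset_refl mono1)+
  have 2: "acl_dim L S (dcl ?B1) = Suc (acl_dim L S (dcl ?B0))"
  proof (rule acl_dim_insert[OF _ f(3,4)])
    show "s \<in> dcl ?B1" using ext[OF f(8)] by blast
    show "s \<notin> dcl (dcl ?B0)" using sC sub dcl_idem by blast
    show "dcl ?B1 \<subseteq> dcl (insert s (dcl ?B0))" using ext[OF f(4)] by (intro dcl_mono) blast
  qed (rule subset_refl mono1)+
  have 3: "acl_dim L S (dcl ?A1 \<union> dcl ?B1) = Suc (acl_dim L S (dcl ?A0 \<union> dcl ?B0))"
  proof (rule acl_dim_insert[OF sub C])
    show "t \<in> dcl ?A1 \<union> dcl ?B1" using ext[OF f(6)] by blast
    show "t \<notin> dcl (dcl ?A0 \<union> dcl ?B0)" using tC dcl_least[OF sub] by blast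
    show "dcl ?A0 \<union> dcl ?B0 \<subseteq> dcl ?A1 \<union> dcl ?B1" using mono1 by blast
    let ?D = "insert t (dcl ?A0 \<union> dcl ?B0)"
    have DU: "?D \<subseteq> U" using t(1) dcl_U by blast
    have a: "?A0 \<union> ?B0 \<subseteq> ?D" using ext[OF f(2)] ext[OF f(4)] by blast
    then have "?A1 \<subseteq> dcl ?D" using ext[OF DU] by blast
    moreover have "c \<in> dcl ?D" using c dcl_mono[of "A \<union> B" ?D] a by blast
    then have "s \<in> dcl ?D" unfolding s_def using ext[OF DU] by (intro dcl_add) blast+
    then have "?B1 \<subseteq> dcl ?D" using a ext[OF DU] by blast
    ultimately show "dcl ?A1 \<union> dcl ?B1 \<subseteq> dcl ?D" using dcl_least by blast
  qed
  have e0: "e \<in> dcl ?A0" "e \<in> dcl ?B0" using ext[OF f(2)] ext[OF f(4)] by blast+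
  then have e1: "e \<in> dcl ?A1" "e \<in> dcl ?B1" using mono1 by blast+
  \<comment> \<open>The dimensions of both sides and of the join have grown by one. Comparing the
    modular laws before and after, the dimension of the intersection must have grown by one as
    well.\<close>
  have ne: "acl_dim L S (dcl ?A1 \<inter> dcl ?B1) \<noteq> acl_dim L S (dcl ?A0 \<inter> dcl ?B0)"
    using modular_law[OF lm f(1-4) e0 e(2)] modular_law[OF lm f(5-8) e1 e(2)] 1 2 3 by simp
  have sub1: "dcl ?A0 \<inter> dcl ?B0 \<subseteq> dcl ?A1 \<inter> dcl ?B1" by (rule Int_mono) (rule mono1)+
  have "\<not> dcl ?A1 \<inter> dcl ?B1 \<subseteq> dcl ?A0 \<inter> dcl ?B0"
  proof
    assume "dcl ?A1 \<inter> dcl ?B1 \<subseteq> dcl ?A0 \<inter> dcl ?B0"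
    then have "dcl ?A1 \<inter> dcl ?B1 = dcl ?A0 \<inter> dcl ?B0" using sub1 by (rule subset_antisym)
    then show False using ne by simp
  qed
  then obtain d where d: "d \<in> dcl ?A1" "d \<in> dcl ?B1" "d \<notin> dcl ?A0 \<or> d \<notin> dcl ?B0" by blast
  \<comment> \<open>A point new only on the side of \<open>A\<close> is impossible: by exchange
    \<open>t\<close> would be definable from \<open>d\<close>, \<open>e\<close> and
    \<open>A\<close>, while \<open>d\<close>, lying in the closure of \<open>e\<close> and
    \<open>B\<close>, adds nothing to \<open>?C\<close>.\<close>
  have "d \<notin> dcl ?B0"
  proof
    assume dB: "d \<in> dcl ?B0"
    then have "d \<notin> dcl ?A0" using d(3) by blast
    then have "t \<in> dcl (insert d ?A0)" using exchange[OF t(1) d(1)] f(2) by blast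
    moreover have "insert d ?A0 \<subseteq> dcl ?C" using dB sub ext[OF f(2)] by blast
    ultimately show False using tC dcl_least by blast
  qed
  then show thesis using that d unfolding s_def by blast
qed

end

section \<open>Germs at infinity\<close>

context omin
begin

text \<open>Terms are substituted one at a time. The first term becomes a variable placed behind the
  remaining terms, which is why the formula has to be rotated.\<close>

lemma Def_sat_terms:
  "\<phi> \<in> formulas L (length \<tau>s + length vs) \<Longrightarrow> (\<And>\<tau>. \<tau> \<in> set \<tau>s \<Longrightarrow> T A \<tau>) \<Longrightarrow> (\<And>a. Inr a \<in> set vs \<Longrightarrow> a \<in> A) \<Longrightarrow>
   Def A (\<lambda>e. sat S (map (\<lambda>\<tau>. \<tau> e) \<tau>s @ map (vl e) vs) \<phi>)"
proof (induction "length \<tau>s" arbitrary: \<tau>s vs \<phi>)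
  case 0
  then show ?case using Def_sat[of \<phi> vs A] by simp
next
  case (Suc k)
  then obtain \<tau> \<tau>r where t: "\<tau>s = \<tau> # \<tau>r" by (cases \<tau>s) auto
  have lk: "length \<tau>r = k" using Suc.hyps(2) t by simp
  \<comment> \<open>Position 0 of the old list is found at position \<open>k\<close> of the new one;
    the other \<open>k\<close> terms move one place to the front and the entries of
    \<open>vs\<close> keep their places.\<close>
  define us where "us = k # [0..<k] @ [Suc k..<Suc k + length vs]"
  define \<phi>' where "\<phi>' = sub us \<phi>"
  let ?\<tau>s = "map (\<lambda>\<tau> e. \<tau> (\<lambda>i. e (Suc i))) \<tau>r"
  let ?vs = "Inl 0 # map (\<lambda>v. case v of Inl i \<Rightarrow> Inl (Suc i) | Inr a \<Rightarrow> Inr a) vs"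
  have lus: "length us = Suc k + length vs"
    unfolding us_def list.size length_append length_upt by arith
  have \<phi>0: "\<phi> \<in> formulas L (length us)" using Suc.prems(1) t lk lus by simp
  have \<phi>': "\<phi>' \<in> formulas L (length ?\<tau>s + length ?vs)"
    unfolding \<phi>'_def using \<phi>0 lk by (intro sub_formulas) (auto simp: us_def)
  have rot: "sat S (X @ p # Y) \<phi>' \<longleftrightarrow> sat S (p # X @ Y) \<phi>" if "length X = k" "length Y = length vs" for X Y p
    unfolding \<phi>'_def
  proof (rule sat_sub'[OF \<phi>0])
    show "length (p # X @ Y) = length us" using lus that by simp
    fix i assume i: "i < length us"
    show "(X @ p # Y) ! (us ! i) = (p # X @ Y) ! i"
    proof (cases i)
      case 0
      then show ?thesis using that by (simp add: us_def nth_append)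
    next
      case (Suc j)
      show ?thesis
      proof (cases "j < k")
        case True
        then show ?thesis using Suc that by (simp add: us_def nth_append)
      next
        case False
        then have "us ! i = Suc j" using Suc i lus by (simp add: us_def nth_append del: upt_Suc)
        then show ?thesis using Suc that False by (simp add: nth_append nth_Cons')
      qed
    qed
  qed
  have D0: "Def A (\<lambda>e. sat S (map (\<lambda>\<tau>. \<tau> e) ?\<tau>s @ map (vl e) ?vs) \<phi>')"
  proof (rule Suc.hyps(1)[OF _ \<phi>'])
    show "T A \<tau>'" if \<tau>': "\<tau>' \<in> set ?\<tau>s" for \<tau>'
    proof -
      obtain \<tau>0 where "\<tau>0 \<in> set \<tau>r" "\<tau>' = (\<lambda>e. \<tau>0 (\<lambda>i. e (Suc i)))" using \<tau>' by auto
      then show ?thesis using T_lift[of A \<tau>0 Suc] Suc.prems(2) t by simp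
    qed
    show "a \<in> A" if a: "Inr a \<in> set ?vs" for a
    proof -
      obtain v where v: "v \<in> set vs" "Inr a = (case v of Inl i \<Rightarrow> Inl (Suc i) | Inr a \<Rightarrow> Inr a)" using a by auto
      from v(2) have "v = Inr a" by (cases v) auto
      then show ?thesis using Suc.prems(3) v(1) by blast
    qed
  qed (use lk in simp)
  have m1: "map (vl e) ?vs = e 0 # map (vl (\<lambda>i. e (Suc i))) vs" for e
    by (auto simp: vl_def split: sum.splits)
  have m2: "map (\<lambda>\<tau>. \<tau> e) ?\<tau>s = map (\<lambda>\<tau>. \<tau> (\<lambda>i. e (Suc i))) \<tau>r" for e by simp
  have D: "Def A (\<lambda>e. sat S (e 0 # map (\<lambda>\<tau>. \<tau> (\<lambda>i. e (Suc i))) \<tau>r @ map (vl (\<lambda>i. e (Suc i))) vs) \<phi>)"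
    using D0 unfolding m1 m2 by (simp only: rot length_map lk)
  have T\<tau>: "T A \<tau>" using Suc.prems(2) t by simp
  have "Def A (\<lambda>e. \<exists>p\<in>U. p = \<tau> e \<and> sat S (p # map (\<lambda>\<tau>. \<tau> e) \<tau>r @ map (vl e) vs) \<phi>)"
    by (rule Def_ex[of A "\<lambda>e p. p = \<tau> e \<and> sat S (p # map (\<lambda>\<tau>. \<tau> e) \<tau>r @ map (vl e) vs) \<phi>"])
      (intro Def_conj D Def_eq T_var T_lift[of A \<tau> Suc] T\<tau>)
  then show ?case by (rule Def_cong) (use T_in[OF T\<tau>] t in auto)
qed

lemma Def_sat_vars:
  assumes "\<phi> \<in> formulas L (Suc (Suc (Suc k)))" "T A s1" "T A s2" "T A s3"
  shows "Def A (\<lambda>e. sat S (s1 e # s2 e # s3 e # map (\<lambda>i. e (f i)) [0..<k]) \<phi>)"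
proof -
  have "Def A (\<lambda>e. sat S (map (\<lambda>\<tau>. \<tau> e) [s1, s2, s3] @ map (vl e) (map (\<lambda>i. Inl (f i)) [0..<k])) \<phi>)"
    by (rule Def_sat_terms) (use assms in auto)
  then show ?thesis by (simp add: o_def)
qed

lemma Def_sat_const:
  assumes "\<phi> \<in> formulas L (Suc (Suc (Suc (length a))))" "set a \<subseteq> A" "T A s1" "T A s2" "T A s3"
  shows "Def A (\<lambda>e. sat S (s1 e # s2 e # s3 e # a) \<phi>)"
proof -
  have "Def A (\<lambda>e. sat S (map (\<lambda>\<tau>. \<tau> e) [s1, s2, s3] @ map (vl e) (map Inr a)) \<phi>)"
    by (rule Def_sat_terms) (use assms in auto)
  then show ?thesis by (simp add: o_def)
qed

section \<open>Monotone germs\<close>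

text \<open>An Archimedean principle for definable sets. The upper bounds of \<open>X\<close> have a
  cut \<open>s\<close>; some element of \<open>X\<close> lies above \<open>s \<oplus> ng u\<close>,
  and its translate by \<open>u\<close> lies above \<open>s\<close>.\<close>

lemma bounded_shift:
  assumes D: "Def U (\<lambda>e. X (e 0))" and x: "x \<in> U" "X x" and b: "b \<in> U" "\<And>y. y \<in> U \<Longrightarrow> X y \<Longrightarrow> y \<preceq> b"
    and u: "u \<in> U" "zr \<prec> u" and sh: "\<And>y. y \<in> U \<Longrightarrow> X y \<Longrightarrow> X (y \<oplus> u)"
  shows False
proof -
  note X = Def_subst1[of U X, OF D]
  let ?Q = "\<lambda>y. \<forall>z\<in>U. X z \<longrightarrow> z \<preceq> y"
  have DQ: "Def U (\<lambda>e. ?Q (e 0))" by (intro dfs X)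
  obtain l where l: "l \<in> U" "l \<prec> x" using ex_less x(1) by blast
  have nl: "\<not> ?Q l" using l x by (meson not_less)
  have Qb: "?Q b" using b by blast
  obtain s where s: "s \<in> U" "\<forall>y\<in>U. y \<prec> s \<longrightarrow> \<not> ?Q y" "\<forall>y\<in>U. s \<prec> y \<longrightarrow> ?Q y"
  proof (rule tame_cut[of ?Q b l])
    show "tame ?Q" by (rule tame_Def[OF DQ])
    show "?Q y'" if "y \<in> U" "y' \<in> U" "y \<prec> y'" "?Q y" for y y' using that by (meson less_imp_le order_trans)
  qed (use b(1) Qb l(1) nl in blast)+
  have "s \<oplus> ng u \<prec> s" using diff_less s(1) u by simp
  then have "\<not> ?Q (s \<oplus> ng u)" using s(1,2) u(1) by simp
  then obtain z where z: "z \<in> U" "X z" "s \<oplus> ng u \<prec> z" by (meson not_less)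
  have "s \<oplus> ng u \<oplus> u \<prec> z \<oplus> u" using z s(1) u(1) by (simp del: add_ng)
  then have "s \<prec> z \<oplus> u" using s(1) u(1) by simp
  then obtain y where y: "y \<in> U" "s \<prec> y" "y \<prec> z \<oplus> u" using dense[of s "z \<oplus> u"] s(1) z(1) u(1) by auto
  have "z \<oplus> u \<preceq> y" using s(3) y(1,2) sh[OF z(1,2)] z(1) u(1) by simp
  then show False using y(3) by simp
qed

text \<open>One of the two predicates holds for all large elements, so the other one is bounded. If
  the bounded one held at a positive \<open>u\<close>, it would be closed under adding
  \<open>u\<close>, against \<open>bounded_shift\<close>.\<close>

lemma positive_dichotomy:
  assumes D: "Def U (\<lambda>e. I (e 0))" "Def U (\<lambda>e. J (e 0))"
    and or: "\<And>u. u \<in> U \<Longrightarrow> zr \<prec> u \<Longrightarrow> I u \<or> J u" and both: "\<And>u. u \<in> U \<Longrightarrow> I u \<Longrightarrow> \<not> J u"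
    and add: "\<And>u v. u \<in> U \<Longrightarrow> v \<in> U \<Longrightarrow> I u \<Longrightarrow> I v \<Longrightarrow> I (u \<oplus> v)" "\<And>u v. u \<in> U \<Longrightarrow> v \<in> U \<Longrightarrow> J u \<Longrightarrow> J v \<Longrightarrow> J (u \<oplus> v)"
  shows "(\<forall>u\<in>U. zr \<prec> u \<longrightarrow> I u) \<or> (\<forall>u\<in>U. zr \<prec> u \<longrightarrow> J u)"
proof -
  have *: "\<forall>u\<in>U. zr \<prec> u \<longrightarrow> I u"
    if DJ: "Def U (\<lambda>e. J (e 0))" and or: "\<And>u. u \<in> U \<Longrightarrow> zr \<prec> u \<Longrightarrow> I u \<or> J u" and both: "\<And>u. u \<in> U \<Longrightarrow> I u \<Longrightarrow> \<not> J u"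
      and add: "\<And>u v. u \<in> U \<Longrightarrow> v \<in> U \<Longrightarrow> J u \<Longrightarrow> J v \<Longrightarrow> J (u \<oplus> v)" and evI: "ev I" for I J
  proof (rule ccontr)
    assume "\<not> ?thesis"
    then obtain u where u: "u \<in> U" "zr \<prec> u" "J u" using or by blast
    obtain b where b: "b \<in> U" "\<forall>x\<in>U. b \<prec> x \<longrightarrow> I x" using evI unfolding ev_def by blast
    show False
    proof (rule bounded_shift[of J u b u])
      show "y \<preceq> b" if "y \<in> U" "J y" for y using b both that by (meson not_less)
      show "J (y \<oplus> u)" if "y \<in> U" "J y" for y by (rule add[OF that(1) u(1) that(2) u(3)])
    qed (use DJ u b in auto)
  qed
  have "ev I \<or> ev (\<lambda>u. \<not> I u)" by (rule tame_ev[OF tame_Def[OF D(1)]])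
  then show ?thesis
  proof
    assume "ev I"
    have "\<forall>u\<in>U. zr \<prec> u \<longrightarrow> I u" by (rule *[OF D(2) or both add(2) \<open>ev I\<close>])
    then show ?thesis by blast
  next
    assume "ev (\<lambda>u. \<not> I u)"
    then have "ev (\<lambda>u. \<not> I u \<and> zr \<prec> u)" using ev_conj ev_gt[OF zr_in] by blast
    then have evJ: "ev J" by (rule ev_mono) (use or in blast)
    have "\<forall>u\<in>U. zr \<prec> u \<longrightarrow> J u"
    proof (rule *[OF D(1) _ _ add(1) evJ])
      show "J u \<or> I u" if "u \<in> U" "zr \<prec> u" for u using or that by blast
      show "\<not> I u" if "u \<in> U" "J u" for u using both that by blast
    qed
    then show ?thesis by blast
  qed
qed

text \<open>For each positive shift \<open>u\<close> the values at \<open>s\<close> and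
  \<open>s \<oplus> u\<close> are eventually related in one fixed way. Equality would make a value
  recur along all translates by \<open>u\<close>, which is impossible for a germ that is not
  constant. The shifts for which the germ increases are closed under addition, likewise those for
  which it decreases, so \<open>positive_dichotomy\<close> gives one direction for all shifts. How
  large \<open>s\<close> must be may depend on \<open>u\<close>.\<close>

lemma eventually_monotone:
  assumes D: "Def U (\<lambda>e. G (e 0) (e 1))" and fn: "\<And>s v w. v \<in> U \<Longrightarrow> w \<in> U \<Longrightarrow> G s v \<Longrightarrow> G s w \<Longrightarrow> v = w"
    and total: "ev (\<lambda>s. \<exists>v\<in>U. G s v)" and nconst: "\<not> (\<exists>v\<in>U. ev (\<lambda>s. G s v))"
  shows "(\<forall>u\<in>U. zr \<prec> u \<longrightarrow> ev (\<lambda>s. \<exists>v\<in>U. \<exists>w\<in>U. G s v \<and> G (s \<oplus> u) w \<and> v \<prec> w)) \<or>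
         (\<forall>u\<in>U. zr \<prec> u \<longrightarrow> ev (\<lambda>s. \<exists>v\<in>U. \<exists>w\<in>U. G s v \<and> G (s \<oplus> u) w \<and> w \<prec> v))"
proof -
  note G = Def_subst2[of U G, OF D]
  define C where "C c u s \<longleftrightarrow> (\<exists>v\<in>U. \<exists>w\<in>U. G s v \<and> G (s \<oplus> u) w \<and> c v w)" for c u s
  have tr: "ev (C c (u \<oplus> u'))" if "u \<in> U" "u' \<in> U" "ev (C c u)" "ev (C c u')" and c: "\<And>x y z. c x y \<Longrightarrow> c y z \<Longrightarrow> c x z" for c u u'
  proof -
    have "ev (\<lambda>s. C c u' (s \<oplus> u))" by (rule ev_shift[OF that(4,1)])
    from ev_conj[OF that(3) this] ev_gt[OF zr_in] have "ev (\<lambda>s. C c u s \<and> C c u' (s \<oplus> u))" by blast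
    then show ?thesis
    proof (rule ev_mono)
      fix s assume s: "s \<in> U" "C c u s \<and> C c u' (s \<oplus> u)"
      then obtain v w v' w' where *: "v \<in> U" "w \<in> U" "G s v" "G (s \<oplus> u) w" "c v w" "v' \<in> U" "w' \<in> U" "G (s \<oplus> u) v'" "G (s \<oplus> u \<oplus> u') w'" "c v' w'"
        unfolding C_def by blast
      have "w = v'" using fn * by blast
      then have "c v w'" using c * by blast
      moreover have "s \<oplus> u \<oplus> u' = s \<oplus> (u \<oplus> u')" using s that by (simp add: assoc)
      ultimately show "C c (u \<oplus> u') s" unfolding C_def using * by auto
    qed
  qed
  have DI: "Def U (\<lambda>e. ev (C (\<prec>) (e 0)))" and DJ: "Def U (\<lambda>e. ev (C (\<lambda>x y. y \<prec> x) (e 0)))"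
    unfolding C_def by (intro Def_ev dfs G)+
  have "(\<forall>u\<in>U. zr \<prec> u \<longrightarrow> ev (C (\<prec>) u)) \<or> (\<forall>u\<in>U. zr \<prec> u \<longrightarrow> ev (C (\<lambda>x y. y \<prec> x) u))"
  proof (rule positive_dichotomy[of "\<lambda>u. ev (C (\<prec>) u)" "\<lambda>u. ev (C (\<lambda>x y. y \<prec> x) u)", OF DI DJ])
    fix u assume u: "u \<in> U" "zr \<prec> u"
    show "ev (C (\<prec>) u) \<or> ev (C (\<lambda>x y. y \<prec> x) u)"
    proof (rule ccontr)
      assume no: "\<not> ?thesis"
      have D1: "Def U (\<lambda>e. C (\<prec>) u (e 0))" "Def U (\<lambda>e. C (\<lambda>x y. y \<prec> x) u (e 0))"
        unfolding C_def by (intro dfs G T_U u)+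
      have "ev (\<lambda>s. \<not> C (\<prec>) u s)" using tame_ev[OF tame_Def[of "C (\<prec>) u", OF D1(1)]] no by blast
      moreover have "ev (\<lambda>s. \<not> C (\<lambda>x y. y \<prec> x) u s)" using tame_ev[OF tame_Def[of "C (\<lambda>x y. y \<prec> x) u", OF D1(2)]] no by blast
      ultimately have "ev (\<lambda>s. \<not> C (\<prec>) u s \<and> \<not> C (\<lambda>x y. y \<prec> x) u s)" by (rule ev_conj)
      from ev_conj[OF this ev_conj[OF total ev_shift[OF total u(1)]]]
      have "ev (\<lambda>s. \<exists>v\<in>U. G s v \<and> G (s \<oplus> u) v)"
      proof (rule ev_mono)
        fix s assume "s \<in> U" "(\<not> C (\<prec>) u s \<and> \<not> C (\<lambda>x y. y \<prec> x) u s) \<and> (\<exists>v\<in>U. G s v) \<and> (\<exists>v\<in>U. G (s \<oplus> u) v)"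
        then obtain v w where vw: "v \<in> U" "w \<in> U" "G s v" "G (s \<oplus> u) w" "\<not> v \<prec> w" "\<not> w \<prec> v" unfolding C_def by blast
        then have "v = w" by simp
        then show "\<exists>v\<in>U. G s v \<and> G (s \<oplus> u) v" using vw by blast
      qed
      then obtain b where b: "b \<in> U" "\<forall>s\<in>U. b \<prec> s \<longrightarrow> (\<exists>v\<in>U. G s v \<and> G (s \<oplus> u) v)" unfolding ev_def by blast
      obtain s1 where s1: "s1 \<in> U" "b \<prec> s1" using ex_greater b(1) by blast
      then obtain v where v: "v \<in> U" "G s1 v" using b(2) by blast
      have DG: "Def U (\<lambda>e. G (e 0) v)" by (intro G T_var T_U v)
      have "ev (\<lambda>s. \<not> G s v)" using tame_ev[OF tame_Def[of "\<lambda>s. G s v", OF DG]] nconst v(1) by blast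
      then obtain b1 where b1: "b1 \<in> U" "\<forall>s\<in>U. b1 \<prec> s \<longrightarrow> \<not> G s v" unfolding ev_def by blast
      show False
      \<comment> \<open>Beyond \<open>b\<close> the value \<open>v\<close> recurs after each
        translation by \<open>u\<close>, whereas beyond \<open>b1\<close> it no longer
        occurs.\<close>
      proof (rule bounded_shift[of "\<lambda>s. b \<prec> s \<and> G s v" s1 b1 u])
        show "Def U (\<lambda>e. b \<prec> e 0 \<and> G (e 0) v)" by (intro dfs G T_U b v)
        show "y \<preceq> b1" if "y \<in> U" "b \<prec> y \<and> G y v" for y using b1(2) that by (meson not_less)
        show "b \<prec> y \<oplus> u \<and> G (y \<oplus> u) v" if y: "y \<in> U" "b \<prec> y \<and> G y v" for y
        proof -
          have "y \<prec> y \<oplus> u" using y u by simp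
          then have "b \<prec> y \<oplus> u" using y less_trans by blast
          moreover obtain v' where "v' \<in> U" "G y v'" "G (y \<oplus> u) v'" using b(2) y by blast
          then have "G (y \<oplus> u) v" using fn v(1) y by blast
          ultimately show ?thesis by blast
        qed
      qed (use s1 v b1 u in auto)
    qed
  next
    fix u assume u: "u \<in> U" "ev (C (\<prec>) u)"
    show "\<not> ev (C (\<lambda>x y. y \<prec> x) u)"
    proof
      assume "ev (C (\<lambda>x y. y \<prec> x) u)"
      from ev_ex[OF ev_conj[OF u(2) this]] obtain s where "C (\<prec>) u s" "C (\<lambda>x y. y \<prec> x) u s" by blast
      then show False unfolding C_def using fn by (metis less_asym)
    qed
  next
    show "ev (C (\<prec>) (u \<oplus> v))" if "u \<in> U" "v \<in> U" "ev (C (\<prec>) u)" "ev (C (\<prec>) v)" for u v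
      by (rule tr[OF that]) (rule less_trans)
    show "ev (C (\<lambda>x y. y \<prec> x) (u \<oplus> v))" if "u \<in> U" "v \<in> U" "ev (C (\<lambda>x y. y \<prec> x) u)" "ev (C (\<lambda>x y. y \<prec> x) v)" for u v
      by (rule tr[OF that]) (rule less_trans)
  qed
  then show ?thesis unfolding C_def .
qed

section \<open>Comparison of germs\<close>

text \<open>Reads an arbitrary formula \<open>H\<close> as a partial function of \<open>t\<close>,
  \<open>e\<close> and \<open>a\<close>. Uniqueness of the value is part of the definition, so it
  remains a function for parameters other than those for which \<open>H\<close> was found.\<close>

definition fn_of :: "('b, 'c) fm \<Rightarrow> 'a \<Rightarrow> 'a \<Rightarrow> 'a \<Rightarrow> 'a list \<Rightarrow> bool" where
  "fn_of H u t e a \<longleftrightarrow> sat S (u # t # e # a) H \<and> (\<forall>w\<in>U. sat S (w # t # e # a) H \<longrightarrow> w = u)"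

lemma fn_of_unique: "v \<in> U \<Longrightarrow> w \<in> U \<Longrightarrow> fn_of H v t e a \<Longrightarrow> fn_of H w t e a \<Longrightarrow> v = w"
  unfolding fn_of_def by blast

lemma Def_fn_vars:
  assumes "H \<in> formulas L (Suc (Suc (Suc k)))" "T A s1" "T A s2" "T A s3"
  shows "Def A (\<lambda>e. fn_of H (s1 e) (s2 e) (s3 e) (map (\<lambda>i. e (f i)) [0..<k]))"
  unfolding fn_of_def
  by (intro dfs Def_sat_vars assms T_lift[of A s1 Suc] T_lift[of A s2 Suc] T_lift[of A s3 Suc])

lemma Def_fn_const:
  assumes "H \<in> formulas L (Suc (Suc (Suc (length a))))" "set a \<subseteq> A" "T A s1" "T A s2" "T A s3"
  shows "Def A (\<lambda>e. fn_of H (s1 e) (s2 e) (s3 e) a)"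
  unfolding fn_of_def
  by (intro dfs Def_sat_const assms T_lift[of A s1 Suc] T_lift[of A s2 Suc] T_lift[of A s3 Suc])

text \<open>The equation for the generic points \<open>e\<close> and \<open>t\<close>, with both
  replaced by quantifiers at infinity. The order matters: how large \<open>t\<close> must be depends
  on \<open>e\<close>.\<close>

definition germ_link :: "('b, 'c) fm \<Rightarrow> ('b, 'c) fm \<Rightarrow> 'a \<Rightarrow> 'a list \<Rightarrow> 'a list \<Rightarrow> bool" where
  "germ_link H H' c a b \<longleftrightarrow> ev (\<lambda>e. ev (\<lambda>t. \<exists>u\<in>U. fn_of H u t e a \<and> fn_of H' u (t \<oplus> c) e b))"

definition germ_mono :: "('a \<Rightarrow> 'a \<Rightarrow> bool) \<Rightarrow> ('b, 'c) fm \<Rightarrow> 'a list \<Rightarrow> bool" where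
  "germ_mono cmp H' b \<longleftrightarrow> ev (\<lambda>e. \<forall>u\<in>U. zr \<prec> u \<longrightarrow>
     ev (\<lambda>s. \<exists>v\<in>U. \<exists>w\<in>U. fn_of H' v s e b \<and> fn_of H' w (s \<oplus> u) e b \<and> cmp v w))"

definition germ_cmp :: "('a \<Rightarrow> 'a \<Rightarrow> bool) \<Rightarrow> ('b, 'c) fm \<Rightarrow> ('b, 'c) fm \<Rightarrow> 'a \<Rightarrow> 'a list \<Rightarrow> 'a list \<Rightarrow> bool" where
  "germ_cmp cmp H H' x a b \<longleftrightarrow>
     ev (\<lambda>e. ev (\<lambda>s. \<exists>u\<in>U. \<exists>w\<in>U. fn_of H u (s \<oplus> ng x) e a \<and> fn_of H' w s e b \<and> cmp u w))"

lemma ev2_conj: "ev (\<lambda>e. ev (P e)) \<Longrightarrow> ev (\<lambda>e. ev (Q e)) \<Longrightarrow> ev (\<lambda>e. ev (\<lambda>s. P e s \<and> Q e s))"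
proof -
  assume "ev (\<lambda>e. ev (P e))" "ev (\<lambda>e. ev (Q e))"
  then have "ev (\<lambda>e. ev (P e) \<and> ev (Q e))" by (rule ev_conj)
  then show ?thesis by (rule ev_mono) (blast intro: ev_conj)
qed

lemma ev2_mono: "ev (\<lambda>e. ev (P e)) \<Longrightarrow> (\<And>e s. e \<in> U \<Longrightarrow> s \<in> U \<Longrightarrow> P e s \<Longrightarrow> Q e s) \<Longrightarrow> ev (\<lambda>e. ev (Q e))"
  by (erule ev_mono) (erule ev_mono, blast)

lemma ev2_ex: "ev (\<lambda>e. ev (P e)) \<Longrightarrow> \<exists>e\<in>U. \<exists>s\<in>U. P e s"
  using ev_ex by blast

text \<open>The substitution of \<open>t \<oplus> x\<close> for \<open>s\<close> moves
  \<open>x\<close> to the side of \<open>b\<close>, where it can be compared with the shift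
  \<open>c\<close> of \<open>germ_link\<close>.\<close>

lemma germ_cmp_shift: assumes "x \<in> U"
  shows "germ_cmp cmp H H' x a b \<longleftrightarrow>
     ev (\<lambda>e. ev (\<lambda>t. \<exists>u\<in>U. \<exists>w\<in>U. fn_of H u t e a \<and> fn_of H' w (t \<oplus> x) e b \<and> cmp u w))" (is "_ = ev (\<lambda>e. ev (?P e))")
proof -
  have "ev (\<lambda>s. ?P e (s \<oplus> ng x)) = ev (?P e)" for e
    by (rule ev_shift_iff) (use assms in simp)
  moreover have "ev (\<lambda>s. ?P e (s \<oplus> ng x)) = ev (\<lambda>s. \<exists>u\<in>U. \<exists>w\<in>U. fn_of H u (s \<oplus> ng x) e a \<and> fn_of H' w s e b \<and> cmp u w)" for e
    using assms by (intro iffI; elim ev_mono; simp)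
  ultimately show ?thesis unfolding germ_cmp_def by simp
qed

text \<open>By the link the germ of \<open>H\<close> at \<open>t\<close> is that of
  \<open>H'\<close> at \<open>t \<oplus> c\<close>, and it is compared with \<open>H'\<close> at
  \<open>t \<oplus> x\<close>. Monotonicity settles each of the three cases for \<open>c\<close> and
  \<open>x\<close>; the outcomes exclude one another, so the implications can be reversed.\<close>

lemma germ_cmp_iff:
  assumes c: "c \<in> U" and x: "x \<in> U" and link: "germ_link H H' c a b" and mono: "germ_mono cmp H' b"
    and asym: "\<And>u w. cmp u w \<Longrightarrow> \<not> cmp w u"
  shows "germ_cmp cmp H H' x a b \<longleftrightarrow> c \<prec> x"
    and "germ_cmp (\<lambda>u w. cmp u w \<or> u = w) H H' x a b \<longleftrightarrow> c \<preceq> x"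
proof -
  define P where "P R e t \<longleftrightarrow> (\<exists>u\<in>U. \<exists>w\<in>U. fn_of H u t e a \<and> fn_of H' w (t \<oplus> x) e b \<and> R u w)" for R e t
  have germ: "germ_cmp R H H' x a b \<longleftrightarrow> ev (\<lambda>e. ev (P R e))" for R
    unfolding P_def by (rule germ_cmp_shift[OF x])
  have m: "ev (\<lambda>e. ev (\<lambda>t. \<exists>v\<in>U. \<exists>w\<in>U. fn_of H' v (t \<oplus> y) e b \<and> fn_of H' w (t \<oplus> z) e b \<and> cmp v w))"
    if yz: "y \<in> U" "z \<in> U" "y \<prec> z" for y z
  proof -
    have u: "ng y \<oplus> z \<in> U" "zr \<prec> ng y \<oplus> z" using yz by (simp_all add: less_diff)
    have "ev (\<lambda>e. ev (\<lambda>s. \<exists>v\<in>U. \<exists>w\<in>U. fn_of H' v s e b \<and> fn_of H' w (s \<oplus> (ng y \<oplus> z)) e b \<and> cmp v w))"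
      using mono unfolding germ_mono_def by (rule ev_mono) (use u in blast)
    then show ?thesis
    proof (rule ev_mono)
      fix e assume "ev (\<lambda>s. \<exists>v\<in>U. \<exists>w\<in>U. fn_of H' v s e b \<and> fn_of H' w (s \<oplus> (ng y \<oplus> z)) e b \<and> cmp v w)"
      from ev_shift[OF this yz(1)]
      show "ev (\<lambda>t. \<exists>v\<in>U. \<exists>w\<in>U. fn_of H' v (t \<oplus> y) e b \<and> fn_of H' w (t \<oplus> z) e b \<and> cmp v w)"
        by (rule ev_mono) (use yz in \<open>simp add: assoc\<close>)
    qed
  qed
  have less: "ev (\<lambda>e. ev (P cmp e))" if "c \<prec> x"
  proof (rule ev2_mono[OF ev2_conj[OF link[unfolded germ_link_def] m[OF c x that]]])
    fix e t assume "(\<exists>u\<in>U. fn_of H u t e a \<and> fn_of H' u (t \<oplus> c) e b) \<and>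
      (\<exists>v\<in>U. \<exists>w\<in>U. fn_of H' v (t \<oplus> c) e b \<and> fn_of H' w (t \<oplus> x) e b \<and> cmp v w)"
    then obtain u v w where *: "u \<in> U" "fn_of H u t e a" "fn_of H' u (t \<oplus> c) e b" "v \<in> U" "w \<in> U"
      "fn_of H' v (t \<oplus> c) e b" "fn_of H' w (t \<oplus> x) e b" "cmp v w" by blast
    have "u = v" by (rule fn_of_unique[OF *(1,4,3,6)])
    then show "P cmp e t" unfolding P_def using * by blast
  qed
  have eq: "ev (\<lambda>e. ev (P (=) e))" if "c = x"
    using link unfolding germ_link_def that by (rule ev2_mono) (unfold P_def, blast)
  have gr: "ev (\<lambda>e. ev (P (\<lambda>u w. cmp w u) e))" if "x \<prec> c"
  proof (rule ev2_mono[OF ev2_conj[OF link[unfolded germ_link_def] m[OF x c that]]])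
    fix e t assume "(\<exists>u\<in>U. fn_of H u t e a \<and> fn_of H' u (t \<oplus> c) e b) \<and>
      (\<exists>v\<in>U. \<exists>w\<in>U. fn_of H' v (t \<oplus> x) e b \<and> fn_of H' w (t \<oplus> c) e b \<and> cmp v w)"
    then obtain u v w where *: "u \<in> U" "fn_of H u t e a" "fn_of H' u (t \<oplus> c) e b" "v \<in> U" "w \<in> U"
      "fn_of H' v (t \<oplus> x) e b" "fn_of H' w (t \<oplus> c) e b" "cmp v w" by blast
    have "u = w" by (rule fn_of_unique[OF *(1,5,3,7)])
    then show "P (\<lambda>u w. cmp w u) e t" unfolding P_def using * by blast
  qed
  have clash: False if P: "ev (\<lambda>e. ev (P R e))" "ev (\<lambda>e. ev (P R' e))" and R: "\<And>u w. R u w \<Longrightarrow> R' u w \<Longrightarrow> False" for R R'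
  proof -
    obtain e t where "P R e t" "P R' e t" using ev2_ex[OF ev2_conj[OF P]] by blast
    then obtain u w u' w' where *: "u \<in> U" "w \<in> U" "fn_of H u t e a" "fn_of H' w (t \<oplus> x) e b" "R u w"
      "u' \<in> U" "w' \<in> U" "fn_of H u' t e a" "fn_of H' w' (t \<oplus> x) e b" "R' u' w'" unfolding P_def by blast
    have "u = u'" "w = w'" using fn_of_unique * by blast+
    then show False using R * by blast
  qed
  have mono_P: "ev (\<lambda>e. ev (P R' e))" if P: "ev (\<lambda>e. ev (P R e))" and R: "\<And>u w. R u w \<Longrightarrow> R' u w" for R R'
    using P by (rule ev2_mono) (unfold P_def, use R in blast)
  show "germ_cmp cmp H H' x a b \<longleftrightarrow> c \<prec> x"
    unfolding germ
  proof
    assume g: "ev (\<lambda>e. ev (P cmp e))"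
    show "c \<prec> x"
    proof (cases c x rule: linorder_cases)
      case equal
      show ?thesis using clash[OF g eq[OF equal]] asym by blast
    next
      case greater
      show ?thesis using clash[OF g gr[OF greater]] asym by blast
    qed
  qed (rule less)
  show "germ_cmp (\<lambda>u w. cmp u w \<or> u = w) H H' x a b \<longleftrightarrow> c \<preceq> x"
    unfolding germ
  proof
    assume g: "ev (\<lambda>e. ev (P (\<lambda>u w. cmp u w \<or> u = w) e))"
    show "c \<preceq> x"
    proof (rule ccontr)
      assume "\<not> c \<preceq> x"
      then have "x \<prec> c" by simp
      show False using clash[OF g gr[OF \<open>x \<prec> c\<close>]] asym by blast
    qed
  next
    assume "c \<preceq> x"
    then consider "c \<prec> x" | "c = x" by (auto simp: le_less)
    then show "ev (\<lambda>e. ev (P (\<lambda>u w. cmp u w \<or> u = w) e))"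
    proof cases
      case 1
      show ?thesis by (rule mono_P[OF less[OF 1]]) blast
    next
      case 2
      show ?thesis by (rule mono_P[OF eq[OF 2]]) blast
    qed
  qed
qed

text \<open>The germs belonging to \<open>b\<close> and \<open>b'\<close> are comparable because
  definable predicates are eventually true or eventually false. As \<open>cmp\<close> is monotone in
  its second argument, the comparison does not depend on \<open>x\<close> and
  \<open>a\<close>.\<close>

lemma germ_cmp_chain:
  assumes H': "H' \<in> formulas L (Suc (Suc (Suc n)))" and b: "b \<in> nlists n U" "b' \<in> nlists n U"
    and cmp: "(\<forall>u w w'. cmp u w \<longrightarrow> w \<preceq> w' \<longrightarrow> cmp u w') \<or> (\<forall>u w w'. cmp u w \<longrightarrow> w' \<preceq> w \<longrightarrow> cmp u w')"
  shows "(\<forall>x a. germ_cmp cmp H H' x a b \<longrightarrow> germ_cmp cmp H H' x a b') \<or>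
         (\<forall>x a. germ_cmp cmp H H' x a b' \<longrightarrow> germ_cmp cmp H H' x a b)"
proof -
  define W where "W e s \<longleftrightarrow> (\<exists>w\<in>U. \<exists>w'\<in>U. fn_of H' w s e b \<and> fn_of H' w' s e b' \<and> w \<preceq> w')" for e s
  have lb: "H' \<in> formulas L (Suc (Suc (Suc (length b))))" "H' \<in> formulas L (Suc (Suc (Suc (length b'))))" "set b \<subseteq> U" "set b' \<subseteq> U"
    using H' b by simp_all
  have DW: "Def U (\<lambda>e. ev (W (e 0)))" unfolding W_def by (intro Def_ev dfs Def_fn_const lb)
  have D1: "Def U (\<lambda>e. W x (e 0))" if "x \<in> U" for x unfolding W_def by (intro dfs Def_fn_const lb T_U that)
  have "ev (\<lambda>e. ev (W e)) \<or> ev (\<lambda>e. \<not> ev (W e))" using tame_ev[OF tame_Def[of "\<lambda>e. ev (W e)", OF DW]] .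
  moreover have "ev (\<lambda>s. \<not> W e s)" if "e \<in> U" "\<not> ev (W e)" for e
    using tame_ev[OF tame_Def[of "W e", OF D1[OF that(1)]]] that(2) by blast
  ultimately have or: "ev (\<lambda>e. ev (W e)) \<or> ev (\<lambda>e. ev (\<lambda>s. \<not> W e s))" by (blast intro: ev_mono)
  have up: "germ_cmp cmp H H' x a c'" if g: "germ_cmp cmp H H' x a c"
    and w: "ev (\<lambda>e. ev (\<lambda>s. \<exists>w\<in>U. \<exists>w'\<in>U. fn_of H' w s e c \<and> fn_of H' w' s e c' \<and> R w w'))"
    and R: "\<And>u w w'. cmp u w \<Longrightarrow> R w w' \<Longrightarrow> cmp u w'" for x a c c' R
    unfolding germ_cmp_def
  proof (rule ev2_mono[OF ev2_conj[OF g[unfolded germ_cmp_def] w]])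
    fix e s assume "(\<exists>u\<in>U. \<exists>w\<in>U. fn_of H u (s \<oplus> ng x) e a \<and> fn_of H' w s e c \<and> cmp u w) \<and>
      (\<exists>w\<in>U. \<exists>w'\<in>U. fn_of H' w s e c \<and> fn_of H' w' s e c' \<and> R w w')"
    then obtain u v w w' where *: "u \<in> U" "v \<in> U" "fn_of H u (s \<oplus> ng x) e a" "fn_of H' v s e c" "cmp u v"
      "w \<in> U" "w' \<in> U" "fn_of H' w s e c" "fn_of H' w' s e c'" "R w w'" by blast
    have "v = w" by (rule fn_of_unique[OF *(2,6,4,8)])
    then have "cmp u w'" using R *(5,10) by blast
    then show "\<exists>u\<in>U. \<exists>w\<in>U. fn_of H u (s \<oplus> ng x) e a \<and> fn_of H' w s e c' \<and> cmp u w" using * by blast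
  qed
  have df: "ev (\<lambda>e. ev (\<lambda>s. \<exists>w\<in>U. fn_of H' w s e c))" if "germ_cmp cmp H H' x a c" for x a c
    using that unfolding germ_cmp_def by (rule ev2_mono) blast
  define LE where "LE c c' \<longleftrightarrow> ev (\<lambda>e. ev (\<lambda>s. \<exists>w\<in>U. \<exists>w'\<in>U. fn_of H' w s e c \<and> fn_of H' w' s e c' \<and> w \<preceq> w'))" for c c'
  have main: "(\<forall>x a. germ_cmp cmp H H' x a c \<longrightarrow> germ_cmp cmp H H' x a c') \<or>
         (\<forall>x a. germ_cmp cmp H H' x a c' \<longrightarrow> germ_cmp cmp H H' x a c)" if "LE c c'" for c c'
    using cmp
  proof
    assume m: "\<forall>u w w'. cmp u w \<longrightarrow> w \<preceq> w' \<longrightarrow> cmp u w'"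
    have "germ_cmp cmp H H' x a c'" if "germ_cmp cmp H H' x a c" for x a
      by (rule up[OF that \<open>LE c c'\<close>[unfolded LE_def]]) (use m in blast)
    then show ?thesis by blast
  next
    assume m: "\<forall>u w w'. cmp u w \<longrightarrow> w' \<preceq> w \<longrightarrow> cmp u w'"
    have L: "ev (\<lambda>e. ev (\<lambda>s. \<exists>w\<in>U. \<exists>w'\<in>U. fn_of H' w s e c' \<and> fn_of H' w' s e c \<and> w' \<preceq> w))"
      using \<open>LE c c'\<close> unfolding LE_def by (rule ev2_mono) blast
    have "germ_cmp cmp H H' x a c" if "germ_cmp cmp H H' x a c'" for x a
      by (rule up[OF that L]) (use m in blast)
    then show ?thesis by blast
  qed
  show ?thesis
    using or
  proof
    assume "ev (\<lambda>e. ev (W e))"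
    then have "LE b b'" unfolding LE_def W_def .
    then show ?thesis by (rule main)
  next
    assume nW: "ev (\<lambda>e. ev (\<lambda>s. \<not> W e s))"
    show ?thesis
    \<comment> \<open>The negation of \<open>W\<close> means the reverse inequality only where both
      germs are defined. If one of them is not, nothing compares with it, and the empty set is
      contained in any other.\<close>
    proof (cases "(\<exists>x a. germ_cmp cmp H H' x a b) \<and> (\<exists>x a. germ_cmp cmp H H' x a b')")
      case True
      then have "ev (\<lambda>e. ev (\<lambda>s. \<exists>w\<in>U. fn_of H' w s e b))" "ev (\<lambda>e. ev (\<lambda>s. \<exists>w\<in>U. fn_of H' w s e b'))"
        using df by blast+
      from ev2_conj[OF nW ev2_conj[OF this]] have "LE b' b"
        unfolding LE_def
      proof (rule ev2_mono)
        fix e s assume "\<not> W e s \<and> (\<exists>w\<in>U. fn_of H' w s e b) \<and> (\<exists>w\<in>U. fn_of H' w s e b')"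
        then obtain w w' where w: "w \<in> U" "w' \<in> U" "fn_of H' w s e b" "fn_of H' w' s e b'" "\<not> w \<preceq> w'"
          unfolding W_def by blast
        then have "w' \<preceq> w" by simp
        then show "\<exists>w\<in>U. \<exists>w'\<in>U. fn_of H' w s e b' \<and> fn_of H' w' s e b \<and> w \<preceq> w'" using w by blast
      qed
      then show ?thesis using main by blast
    next
      case False
      then show ?thesis by blast
    qed
  qed
qed

text \<open>\<open>H\<close> and \<open>H'\<close> define the point of \<open>modular_point\<close>
  from the two sides. The hypotheses \<open>ge\<close> and \<open>gt\<close> say that
  \<open>e\<close> and \<open>t\<close> are generic at infinity over the parameters, so what holds
  at them holds eventually. The point is not definable from \<open>e\<close> and \<open>b\<close>;
  hence the germ of \<open>H'\<close> is not constant and so is monotone.\<close>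

lemma ex_germ_link:
  assumes lm: "acl_locally_modular L S" and a: "a \<in> nlists k U" and b: "b \<in> nlists n U"
    and c: "c \<in> dcl (set a \<union> set b)" and e: "e \<in> U" and t: "t \<in> U"
    and ge: "\<And>P. Def (set a \<union> set b) (\<lambda>\<epsilon>. P (\<epsilon> 0)) \<Longrightarrow> P e \<Longrightarrow> ev P"
    and gt: "\<And>P. Def (insert e (set a \<union> set b)) (\<lambda>\<epsilon>. P (\<epsilon> 0)) \<Longrightarrow> P t \<Longrightarrow> ev P"
  obtains H H' where "H \<in> formulas L (Suc (Suc (Suc k)))" "H' \<in> formulas L (Suc (Suc (Suc n)))"
    "germ_link H H' c a b" "germ_mono (\<prec>) H' b \<or> germ_mono (\<lambda>v w. w \<prec> v) H' b"
proof -
  let ?A = "set a" and ?B = "set b"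
  have AU: "finite ?A" "?A \<subseteq> U" "finite ?B" "?B \<subseteq> U" using nlistsE_set[OF a] nlistsE_set[OF b] by simp_all
  have cU: "c \<in> U" using c dcl_U by blast
  have nev: "\<not> ev (\<lambda>x. x = y)" if "y \<in> U" for y
  proof
    assume "ev (\<lambda>x. x = y)"
    from ev_ex[OF ev_conj[OF this ev_gt[OF that]]] show False by blast
  qed
  have e0: "e \<notin> dcl {}"
  proof
    assume "e \<in> dcl {}"
    then have "e \<in> dcl (?A \<union> ?B)" using dcl_mono[of "{}" "?A \<union> ?B"] by blast
    then have "Def (?A \<union> ?B) (\<lambda>\<epsilon>. \<epsilon> 0 = e)" by (simp add: dcl_def)
    from ge[of "\<lambda>x. x = e", OF this refl] show False using nev[OF e] by blast
  qed
  have t0: "t \<notin> dcl (insert e (?A \<union> ?B))"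
  proof
    assume "t \<in> dcl (insert e (?A \<union> ?B))"
    then have "Def (insert e (?A \<union> ?B)) (\<lambda>\<epsilon>. \<epsilon> 0 = t)" by (simp add: dcl_def)
    from gt[of "\<lambda>x. x = t", OF this refl] show False using nev[OF t] by blast
  qed
  obtain d where d: "d \<in> dcl (insert t (insert e ?A))" "d \<in> dcl (insert (t \<oplus> c) (insert e ?B))" "d \<notin> dcl (insert e ?B)"
    by (rule modular_point[OF lm AU c e e0 t t0]) (rule that)
  have dU: "d \<in> U" using d(1) dcl_U by blast
  have "Def (set (t # e # a)) (\<lambda>\<epsilon>. \<epsilon> 0 = d)" using d(1) by (simp add: dcl_def)
  then obtain H where H: "H \<in> formulas L (Suc (length (t # e # a)))" "\<forall>u\<in>U. u = d \<longleftrightarrow> sat S (u # t # e # a) H"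
    by (rule Def_params_formula[of _ "\<lambda>u. u = d"]) (rule that)
  have "Def (set ((t \<oplus> c) # e # b)) (\<lambda>\<epsilon>. \<epsilon> 0 = d)" using d(2) by (simp add: dcl_def)
  then obtain H' where H': "H' \<in> formulas L (Suc (length ((t \<oplus> c) # e # b)))" "\<forall>u\<in>U. u = d \<longleftrightarrow> sat S (u # (t \<oplus> c) # e # b) H'"
    by (rule Def_params_formula[of _ "\<lambda>u. u = d"]) (rule that)
  have fH: "H \<in> formulas L (Suc (Suc (Suc (length a))))" "H' \<in> formulas L (Suc (Suc (Suc (length b))))" using H(1) H'(1) by simp_all
  have hd: "fn_of H d t e a" "fn_of H' d (t \<oplus> c) e b" unfolding fn_of_def using H(2) H'(2) dU by blast+
  let ?C = "?A \<union> ?B"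
  have CU: "?C \<subseteq> U" "insert e ?C \<subseteq> U" using AU e by auto
  have aC: "?A \<subseteq> dcl ?C" "?B \<subseteq> dcl ?C" using dcl_extensive[OF CU(1)] by blast+
  have aE: "?A \<subseteq> dcl (insert e ?C)" "?B \<subseteq> dcl (insert e ?C)" "e \<in> dcl (insert e ?C)" using dcl_extensive[OF CU(2)] by blast+
  have cE: "c \<in> dcl (insert e ?C)" using c dcl_mono[of ?C "insert e ?C"] by blast
  note Tc = T_const[OF _ cU] and Te = T_const[OF _ e]
  have gt': "ev P" if "Def (dcl (insert e ?C)) (\<lambda>\<epsilon>. P (\<epsilon> 0))" "P t" for P
    using gt[of P, OF Def_dcl[OF that(1)] that(2)] .
  have ge': "ev P" if "Def (dcl ?C) (\<lambda>\<epsilon>. P (\<epsilon> 0))" "P e" for P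
    using ge[of P, OF Def_dcl[OF that(1)] that(2)] .
  have evt: "ev (\<lambda>t. \<exists>u\<in>U. fn_of H u t e a \<and> fn_of H' u (t \<oplus> c) e b)"
  proof (rule gt')
    show "Def (dcl (insert e ?C)) (\<lambda>\<epsilon>. \<exists>u\<in>U. fn_of H u (\<epsilon> 0) e a \<and> fn_of H' u (\<epsilon> 0 \<oplus> c) e b)"
      by (intro dfs Def_fn_const fH aE Tc[OF cE] Te[OF aE(3)])
    show "\<exists>u\<in>U. fn_of H u t e a \<and> fn_of H' u (t \<oplus> c) e b" using hd dU by blast
  qed
  have link: "germ_link H H' c a b"
    unfolding germ_link_def
  proof (rule ge')
    show "Def (dcl ?C) (\<lambda>\<epsilon>. ev (\<lambda>t. \<exists>u\<in>U. fn_of H u t (\<epsilon> 0) a \<and> fn_of H' u (t \<oplus> c) (\<epsilon> 0) b))"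
      by (intro Def_ev dfs Def_fn_const fH aC Tc[OF c])
  qed (rule evt)
  have bE: "?B \<subseteq> insert e ?B" "e \<in> insert e ?B" by blast+
  have "(\<forall>u\<in>U. zr \<prec> u \<longrightarrow> ev (\<lambda>s. \<exists>v\<in>U. \<exists>w\<in>U. fn_of H' v s e b \<and> fn_of H' w (s \<oplus> u) e b \<and> v \<prec> w)) \<or>
         (\<forall>u\<in>U. zr \<prec> u \<longrightarrow> ev (\<lambda>s. \<exists>v\<in>U. \<exists>w\<in>U. fn_of H' v s e b \<and> fn_of H' w (s \<oplus> u) e b \<and> w \<prec> v))"
  proof (rule eventually_monotone[of "\<lambda>s v. fn_of H' v s e b"])
    show "Def U (\<lambda>\<epsilon>. fn_of H' (\<epsilon> 1) (\<epsilon> 0) e b)" by (intro Def_fn_const fH AU T_var T_U e)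
    show "v = w" if "v \<in> U" "w \<in> U" "fn_of H' v s e b" "fn_of H' w s e b" for s v w by (rule fn_of_unique[OF that])
    have "ev (\<lambda>t. \<exists>v\<in>U. fn_of H' v (t \<oplus> c) e b)" using evt by (rule ev_mono) blast
    then show "ev (\<lambda>s. \<exists>v\<in>U. fn_of H' v s e b)" using ev_shift_iff[OF cU, of "\<lambda>s. \<exists>v\<in>U. fn_of H' v s e b"] by blast
    \<comment> \<open>An eventually constant value would be definable from \<open>e\<close> and
      \<open>b\<close>. Since \<open>t\<close> is generic it would already be taken at
      \<open>t \<oplus> c\<close>, and then it would be \<open>d\<close>.\<close>
    show "\<not> (\<exists>v\<in>U. ev (\<lambda>s. fn_of H' v s e b))"
    proof
      assume "\<exists>v\<in>U. ev (\<lambda>s. fn_of H' v s e b)"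
      then obtain v where v: "v \<in> U" "ev (\<lambda>s. fn_of H' v s e b)" by blast
      have un: "w = v" if "w \<in> U" "ev (\<lambda>s. fn_of H' w s e b)" for w
        using ev_ex[OF ev_conj[OF that(2) v(2)]] fn_of_unique that(1) v(1) by blast
      have "Def (insert e ?B) (\<lambda>\<epsilon>. ev (\<lambda>s. fn_of H' (\<epsilon> 0) s e b))"
        by (intro Def_ev dfs Def_fn_const fH bE Te[OF bE(2)])
      then have "Def (insert e ?B) (\<lambda>\<epsilon>. \<epsilon> 0 = v)"
        by (rule Def_cong) (use un v env_nth in blast)
      then have vd: "v \<in> dcl (insert e ?B)" using v(1) by (simp add: dcl_def)
      then have vE: "v \<in> dcl (insert e ?C)" using dcl_mono[of "insert e ?B" "insert e ?C"] by blast
      have "fn_of H' v (t \<oplus> c) e b"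
      proof (rule ccontr)
        assume n: "\<not> fn_of H' v (t \<oplus> c) e b"
        have "ev (\<lambda>t. \<not> fn_of H' v (t \<oplus> c) e b)"
        proof (rule gt')
          show "Def (dcl (insert e ?C)) (\<lambda>\<epsilon>. \<not> fn_of H' v (\<epsilon> 0 \<oplus> c) e b)"
            by (intro dfs Def_fn_const fH aE Tc[OF cE] Te[OF aE(3)] T_const[OF vE v(1)])
        qed (rule n)
        from ev_ex[OF ev_conj[OF this ev_shift[OF v(2) cU]]] show False by blast
      qed
      then have "v = d" using fn_of_unique v(1) dU hd(2) by blast
      then show False using vd d(3) by blast
    qed
  qed
  then have "germ_mono (\<prec>) H' b \<or> germ_mono (\<lambda>v w. w \<prec> v) H' b"
  proof
    assume *: "\<forall>u\<in>U. zr \<prec> u \<longrightarrow> ev (\<lambda>s. \<exists>v\<in>U. \<exists>w\<in>U. fn_of H' v s e b \<and> fn_of H' w (s \<oplus> u) e b \<and> v \<prec> w)"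
    have "germ_mono (\<prec>) H' b" unfolding germ_mono_def
    proof (rule ge')
      show "Def (dcl ?C) (\<lambda>\<epsilon>. \<forall>u\<in>U. zr \<prec> u \<longrightarrow> ev (\<lambda>s. \<exists>v\<in>U. \<exists>w\<in>U. fn_of H' v s (\<epsilon> 0) b \<and> fn_of H' w (s \<oplus> u) (\<epsilon> 0) b \<and> v \<prec> w))"
        by (intro Def_ev dfs Def_fn_const fH aC)
    qed (rule *)
    then show ?thesis by blast
  next
    assume *: "\<forall>u\<in>U. zr \<prec> u \<longrightarrow> ev (\<lambda>s. \<exists>v\<in>U. \<exists>w\<in>U. fn_of H' v s e b \<and> fn_of H' w (s \<oplus> u) e b \<and> w \<prec> v)"
    have "germ_mono (\<lambda>v w. w \<prec> v) H' b" unfolding germ_mono_def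
    proof (rule ge')
      show "Def (dcl ?C) (\<lambda>\<epsilon>. \<forall>u\<in>U. zr \<prec> u \<longrightarrow> ev (\<lambda>s. \<exists>v\<in>U. \<exists>w\<in>U. fn_of H' v s (\<epsilon> 0) b \<and> fn_of H' w (s \<oplus> u) (\<epsilon> 0) b \<and> w \<prec> v))"
        by (intro Def_ev dfs Def_fn_const fH aC)
    qed (rule *)
    then show ?thesis by blast
  qed
  moreover have "H \<in> formulas L (Suc (Suc (Suc k)))" "H' \<in> formulas L (Suc (Suc (Suc n)))" using fH a b by simp_all
  ultimately show thesis using that link by blast
qed

end

section \<open>Reduction to chain formulas\<close>

definition chain_fm :: "('f, 'r) language \<Rightarrow> ('f, 'r, 'a) struct \<Rightarrow> nat \<Rightarrow> nat \<Rightarrow> ('f, 'r) fm \<Rightarrow> bool" where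
  "chain_fm L M m n \<chi> \<longleftrightarrow> \<chi> \<in> formulas L (m + n) \<and>
     (\<forall>b\<in>nlists n (univ M). \<forall>b'\<in>nlists n (univ M).
        solutions M m \<chi> b \<subseteq> solutions M m \<chi> b' \<or> solutions M m \<chi> b' \<subseteq> solutions M m \<chi> b)"

text \<open>Serves two purposes: it states by a sentence that a formula is a chain formula, and it
  makes up the exclusion formulas of the cells.\<close>

definition incl_fm :: "nat \<Rightarrow> nat list \<Rightarrow> nat list \<Rightarrow> ('f, 'r) fm \<Rightarrow> ('f, 'r) fm" where
  "incl_fm m vs ws \<chi> = Alls m (Imp (sub ([0..<m] @ map ((+) m) vs) \<chi>) (sub ([0..<m] @ map ((+) m) ws) \<chi>))"

lemma incl_fm_formulas:
  assumes "\<chi> \<in> formulas L (m + n)" "length vs = n" "length ws = n" "\<And>v. v \<in> set vs \<union> set ws \<Longrightarrow> v < k"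
  shows "incl_fm m vs ws \<chi> \<in> formulas L k"
proof -
  have "sub ([0..<m] @ map ((+) m) us) \<chi> \<in> formulas L (m + k)" if "length us = n" "set us \<subseteq> set vs \<union> set ws" for us
    by (rule sub_formulas) (use assms that in auto)
  then show ?thesis unfolding incl_fm_def using assms(2,3) by (auto intro!: Exs_formulas)
qed

lemma sat_incl_fm:
  assumes "\<chi> \<in> formulas L (m + n)" "length vs = n" "length ws = n"
  shows "sat M e (incl_fm m vs ws \<chi>) \<longleftrightarrow> solutions M m \<chi> (map ((!) e) vs) \<subseteq> solutions M m \<chi> (map ((!) e) ws)"
proof -
  have s: "sat M (xs @ e) (sub ([0..<m] @ map ((+) m) us) \<chi>) \<longleftrightarrow> sat M (xs @ map ((!) e) us) \<chi>"
    if "length us = n" "xs \<in> nlists m (univ M)" for us xs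
    by (rule sat_sub') (use assms that in \<open>auto simp: nth_append\<close>)
  show ?thesis unfolding incl_fm_def solutions_def by (auto simp: sat_Exs s assms)
qed

text \<open>Being a chain formula is expressed by a sentence, so the structure and its ultrapower
  have the same chain formulas.\<close>

lemma chain_fm_iff:
  assumes "\<chi> \<in> formulas L (m + n)"
  shows "chain_fm L M m n \<chi> \<longleftrightarrow>
    sat M [] (Alls (n + n) (Disj (incl_fm m [0..<n] [n..<n + n] \<chi>) (incl_fm m [n..<n + n] [0..<n] \<chi>)))" (is "_ \<longleftrightarrow> sat M [] ?C")
proof -
  have m: "map ((!) (b @ b')) [0..<n] = b" "map ((!) (b @ b')) [n..<n + n] = b'" if "length b = n" "length b' = n" for b b' :: "'c list"
    using that by (auto intro!: nth_equalityI simp: nth_append)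
  have l: "length [0..<n] = n" "length [n..<n + n] = n" by simp_all
  have "sat M [] ?C \<longleftrightarrow> (\<forall>xs\<in>nlists (n + n) (univ M). solutions M m \<chi> (map ((!) xs) [0..<n]) \<subseteq> solutions M m \<chi> (map ((!) xs) [n..<n + n]) \<or>
      solutions M m \<chi> (map ((!) xs) [n..<n + n]) \<subseteq> solutions M m \<chi> (map ((!) xs) [0..<n]))"
    by (simp only: sat.simps sat_Exs append_Nil2 sat_incl_fm[OF assms l] sat_incl_fm[OF assms l(2,1)]) blast
  also have "\<dots> \<longleftrightarrow> (\<forall>b\<in>nlists n (univ M). \<forall>b'\<in>nlists n (univ M).
        solutions M m \<chi> b \<subseteq> solutions M m \<chi> b' \<or> solutions M m \<chi> b' \<subseteq> solutions M m \<chi> b)" (is "?l = ?r")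
  proof
    assume l: ?l
    show ?r
    proof (intro ballI)
      fix b b' assume b: "b \<in> nlists n (univ M)" "b' \<in> nlists n (univ M)"
      then have "b @ b' \<in> nlists (n + n) (univ M)" using nlistsE_set[OF b(1)] nlistsE_set[OF b(2)] by (intro nlistsI) auto
      then show "solutions M m \<chi> b \<subseteq> solutions M m \<chi> b' \<or> solutions M m \<chi> b' \<subseteq> solutions M m \<chi> b"
        using l m[of b b'] b by (metis nlistsE_length)
    qed
  next
    assume r: ?r
    show ?l
    proof
      fix xs assume xs: "xs \<in> nlists (n + n) (univ M)"
      have "map ((!) xs) [0..<n] \<in> nlists n (univ M)" "map ((!) xs) [n..<n + n] \<in> nlists n (univ M)"
        using nlistsE_nth_in[OF xs] by (auto intro!: nlistsI)
      then show "solutions M m \<chi> (map ((!) xs) [0..<n]) \<subseteq> solutions M m \<chi> (map ((!) xs) [n..<n + n]) \<or>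
        solutions M m \<chi> (map ((!) xs) [n..<n + n]) \<subseteq> solutions M m \<chi> (map ((!) xs) [0..<n])" using r by blast
    qed
  qed
  finally show ?thesis unfolding chain_fm_def using assms by simp
qed

lemma chain_sentence_formulas:
  "\<chi> \<in> formulas L (m + n) \<Longrightarrow> Alls (n + n) (Disj (incl_fm m [0..<n] [n..<n + n] \<chi>) (incl_fm m [n..<n + n] [0..<n] \<chi>)) \<in> formulas L 0"
  by (auto intro!: Exs_formulas incl_fm_formulas[of \<chi> L m n])

context str
begin

definition envl :: "'a list \<Rightarrow> nat \<Rightarrow> 'a" where
  "envl xs i = (if i < length xs then xs ! i else (SOME x. x \<in> U))"

lemma env_envl: "set xs \<subseteq> U \<Longrightarrow> env (envl xs)"
  unfolding env_def envl_def using U_ne by (auto intro: someI_ex simp: subset_iff some_in_eq)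

text \<open>Turns statements about germs, which are built semantically, into formulas that can be
  evaluated at a second pair of tuples.\<close>

lemma Def_pair_formula:
  assumes "Def {} (\<lambda>e. F (map (\<lambda>i. e i) [0..<k]) (map (\<lambda>i. e (k + i)) [0..<n]))"
  obtains \<chi> where "\<chi> \<in> formulas L (k + n)" "\<forall>a\<in>nlists k U. \<forall>b\<in>nlists n U. F a b \<longleftrightarrow> sat S (a @ b) \<chi>"
proof -
  have dep: "F (map (\<lambda>i. e i) [0..<k]) (map (\<lambda>i. e (k + i)) [0..<n]) = F (map (\<lambda>i. e' i) [0..<k]) (map (\<lambda>i. e' (k + i)) [0..<n])"
    if "\<And>i. i < k + n \<Longrightarrow> e i = e' i" for e e'
  proof -
    have m: "map (\<lambda>i. e i) [0..<k] = map (\<lambda>i. e' i) [0..<k]" "map (\<lambda>i. e (k + i)) [0..<n] = map (\<lambda>i. e' (k + i)) [0..<n]"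
      using that by simp_all
    show ?thesis unfolding m ..
  qed
  obtain \<chi> where \<chi>: "\<chi> \<in> formulas L (k + n)" "\<forall>xs e. xs \<in> nlists (k + n) U \<longrightarrow> env e \<longrightarrow> (\<forall>i<k + n. e i = xs ! i) \<longrightarrow>
      (F (map (\<lambda>i. e i) [0..<k]) (map (\<lambda>i. e (k + i)) [0..<n]) \<longleftrightarrow> sat S xs \<chi>)"
    by (rule Def_formula[OF assms, of "k + n"]) (rule dep, blast, rule that)
  show thesis
  proof (rule that[OF \<chi>(1)], intro ballI)
    fix a b assume ab: "a \<in> nlists k U" "b \<in> nlists n U"
    then have l: "length a = k" "length b = n" by simp_all
    have s: "set (a @ b) \<subseteq> U" using nlistsE_set[OF ab(1)] nlistsE_set[OF ab(2)] by simp
    have x: "a @ b \<in> nlists (k + n) U" by (rule nlistsI) (use l s in simp_all)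
    have m: "map (\<lambda>i. envl (a @ b) i) [0..<k] = a" "map (\<lambda>i. envl (a @ b) (k + i)) [0..<n] = b"
      using l by (auto intro!: nth_equalityI simp: envl_def nth_append)
    have "\<forall>i<k + n. envl (a @ b) i = (a @ b) ! i" using l by (simp add: envl_def)
    then show "F a b \<longleftrightarrow> sat S (a @ b) \<chi>" using \<chi>(2) x env_envl[OF s] m by metis
  qed
qed

lemma Def_triple_formula:
  assumes "Def {} (\<lambda>e. F (e 0) (map (\<lambda>i. e (Suc i)) [0..<k]) (map (\<lambda>i. e (Suc k + i)) [0..<n]))"
  obtains \<chi> where "\<chi> \<in> formulas L (Suc k + n)" "\<forall>x\<in>U. \<forall>a\<in>nlists k U. \<forall>b\<in>nlists n U. F x a b \<longleftrightarrow> sat S (x # a @ b) \<chi>"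
proof -
  have h: "hd (map (\<lambda>i. e i) [0..<Suc k]) = e 0" "tl (map (\<lambda>i. e i) [0..<Suc k]) = map (\<lambda>i. e (Suc i)) [0..<k]" for e :: "nat \<Rightarrow> 'a"
  proof -
    have "[0..<Suc k] = 0 # map Suc [0..<k]" by (simp add: map_Suc_upt upt_conv_Cons del: upt_Suc)
    then show "hd (map (\<lambda>i. e i) [0..<Suc k]) = e 0" "tl (map (\<lambda>i. e i) [0..<Suc k]) = map (\<lambda>i. e (Suc i)) [0..<k]"
      by (simp_all add: o_def del: upt_Suc)
  qed
  have "Def {} (\<lambda>e. F (hd (map (\<lambda>i. e i) [0..<Suc k])) (tl (map (\<lambda>i. e i) [0..<Suc k])) (map (\<lambda>i. e (Suc k + i)) [0..<n]))"
    unfolding h by (rule assms)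
  then obtain \<chi> where \<chi>: "\<chi> \<in> formulas L (Suc k + n)" "\<forall>a\<in>nlists (Suc k) U. \<forall>b\<in>nlists n U. F (hd a) (tl a) b \<longleftrightarrow> sat S (a @ b) \<chi>"
    by (rule Def_pair_formula[of "\<lambda>a. F (hd a) (tl a)"]) (rule that)
  have "F x a b \<longleftrightarrow> sat S (x # a @ b) \<chi>" if "x \<in> U" "a \<in> nlists k U" "b \<in> nlists n U" for x a b
    using \<chi>(2)[rule_format, of "x # a" b] that by simp
  then show thesis using that \<chi>(1) by blast
qed

end

section \<open>Transfer of cuts and types\<close>

context omin
begin

lemma Def_sat_pair:
  assumes "\<phi> \<in> formulas L (Suc (k + n))" "T A s"
  shows "Def A (\<lambda>e. sat S (s e # map (\<lambda>i. e (f i)) [0..<k] @ map (\<lambda>i. e (g i)) [0..<n]) \<phi>)"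
proof -
  have "Def A (\<lambda>e. sat S (map (\<lambda>\<tau>. \<tau> e) [s] @ map (vl e) (map (\<lambda>i. Inl (f i)) [0..<k] @ map (\<lambda>i. Inl (g i)) [0..<n])) \<phi>)"
    by (rule Def_sat_terms) (use assms in auto)
  then show ?thesis by (simp add: o_def)
qed

text \<open>The existence of a point that satisfies \<open>\<delta>\<close> and is linked by the
  same \<open>H\<close> and \<open>H'\<close> is a property of \<open>(a, b)\<close>, so
  \<open>same\<close> gives such a point \<open>w\<close> for \<open>(a', b')\<close>. Germ
  comparisons decide both \<open>c\<close> against \<open>x\<close> and \<open>w\<close> against
  \<open>x'\<close>; they are chain formulas in \<open>(x, a)\<close> and \<open>b\<close>, so
  \<open>chain\<close> identifies the two answers.\<close>

lemma cut_transfer: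
  assumes lm: "acl_locally_modular L S"
    and a: "a \<in> nlists k U" "a' \<in> nlists k U" and b: "b \<in> nlists n U" "b' \<in> nlists n U" and x: "x \<in> U" "x' \<in> U"
    and same: "\<And>\<psi>. \<psi> \<in> formulas L (k + n) \<Longrightarrow> sat S (a @ b) \<psi> = sat S (a' @ b') \<psi>"
    and chain: "\<And>\<chi>. chain_fm L S (Suc k) n \<chi> \<Longrightarrow> sat S (x # a @ b) \<chi> = sat S (x' # a' @ b') \<chi>"
    and e: "e \<in> U" and t: "t \<in> U"
    and ge: "\<And>P. Def (set a \<union> set b) (\<lambda>\<epsilon>. P (\<epsilon> 0)) \<Longrightarrow> P e \<Longrightarrow> ev P"
    and gt: "\<And>P. Def (insert e (set a \<union> set b)) (\<lambda>\<epsilon>. P (\<epsilon> 0)) \<Longrightarrow> P t \<Longrightarrow> ev P"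
    and c: "c \<in> dcl (set a \<union> set b)"
  obtains \<delta> w where "\<delta> \<in> formulas L (Suc (k + n))" "\<forall>u\<in>U. u = c \<longleftrightarrow> sat S (u # a @ b) \<delta>"
    "w \<in> U" "sat S (w # a' @ b') \<delta>" "w \<prec> x' \<longleftrightarrow> c \<prec> x" "w \<preceq> x' \<longleftrightarrow> c \<preceq> x"
proof -
  note concl = that
  have cU: "c \<in> U" using c dcl_U by blast
  obtain H H' where H: "H \<in> formulas L (Suc (Suc (Suc k)))" and H': "H' \<in> formulas L (Suc (Suc (Suc n)))"
    and link: "germ_link H H' c a b" and mono: "germ_mono (\<prec>) H' b \<or> germ_mono (\<lambda>v w. w \<prec> v) H' b"
    by (rule ex_germ_link[OF lm a(1) b(1) c e t ge gt]) (assumption | rule that)+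
  have "Def (set (a @ b)) (\<lambda>\<epsilon>. \<epsilon> 0 = c)" using c by (simp add: dcl_def)
  then obtain \<delta> where \<delta>: "\<delta> \<in> formulas L (Suc (length (a @ b)))" "\<forall>u\<in>U. u = c \<longleftrightarrow> sat S (u # a @ b) \<delta>"
    by (rule Def_params_formula[of _ "\<lambda>u. u = c"]) (rule that)
  have \<delta>f: "\<delta> \<in> formulas L (Suc (k + n))" using \<delta>(1) a b by simp
  \<comment> \<open>Increasing and decreasing germs are treated together, \<open>cmp\<close> being
    the order or its reverse. The version with equality is required to be monotone too, because the
    weak inequality is transferred by a chain formula of its own.\<close>
  have main: thesis if mono: "germ_mono cmp H' b" and asym: "\<And>u w. cmp u w \<Longrightarrow> \<not> cmp w u"
    and Dc: "Def {} (\<lambda>\<epsilon>. cmp (\<epsilon> 0) (\<epsilon> 1))"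
    and mc: "(\<forall>u w w'. cmp u w \<longrightarrow> w \<preceq> w' \<longrightarrow> cmp u w') \<or> (\<forall>u w w'. cmp u w \<longrightarrow> w' \<preceq> w \<longrightarrow> cmp u w')"
    and mc': "(\<forall>u w w'. (cmp u w \<or> u = w) \<longrightarrow> w \<preceq> w' \<longrightarrow> (cmp u w' \<or> u = w')) \<or> (\<forall>u w w'. (cmp u w \<or> u = w) \<longrightarrow> w' \<preceq> w \<longrightarrow> (cmp u w' \<or> u = w'))"
    for cmp
  proof -
    note cmpD = Def_subst2[of "{}" cmp, OF Dc]
    \<comment> \<open>All that \<open>germ_cmp_iff\<close> needs to know about \<open>w\<close>,
      packed into one property of the two tuples.\<close>
    let ?F = "\<lambda>a b. \<exists>w\<in>U. sat S (w # a @ b) \<delta> \<and> germ_link H H' w a b \<and> germ_mono cmp H' b"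
    have "Def {} (\<lambda>\<epsilon>. ?F (map (\<lambda>i. \<epsilon> i) [0..<k]) (map (\<lambda>i. \<epsilon> (k + i)) [0..<n]))"
      unfolding germ_link_def germ_mono_def
      by (intro Def_ev dfs cmpD Def_fn_vars Def_sat_pair H H' \<delta>f)
    then obtain \<psi> where \<psi>: "\<psi> \<in> formulas L (k + n)" "\<forall>a\<in>nlists k U. \<forall>b\<in>nlists n U. ?F a b \<longleftrightarrow> sat S (a @ b) \<psi>"
      by (rule Def_pair_formula[of ?F]) (rule that)
    have "?F a b" using \<delta>(2) cU link mono by blast
    then have "?F a' b'" using \<psi>(2) a b same[OF \<psi>(1)] by blast
    then obtain w where w: "w \<in> U" "sat S (w # a' @ b') \<delta>" "germ_link H H' w a' b'" "germ_mono cmp H' b'" by blast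
    have tr: "germ_cmp R H H' x a b \<longleftrightarrow> germ_cmp R H H' x' a' b'"
      if RD: "\<And>s1 s2. T {} s1 \<Longrightarrow> T {} s2 \<Longrightarrow> Def {} (\<lambda>\<epsilon>. R (s1 \<epsilon>) (s2 \<epsilon>))"
        and Rm: "(\<forall>u w w'. R u w \<longrightarrow> w \<preceq> w' \<longrightarrow> R u w') \<or> (\<forall>u w w'. R u w \<longrightarrow> w' \<preceq> w \<longrightarrow> R u w')" for R
    proof -
      have "Def {} (\<lambda>\<epsilon>. germ_cmp R H H' (\<epsilon> 0) (map (\<lambda>i. \<epsilon> (Suc i)) [0..<k]) (map (\<lambda>i. \<epsilon> (Suc k + i)) [0..<n]))"
        unfolding germ_cmp_def by (intro Def_ev dfs RD Def_fn_vars H H')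
      then obtain \<chi> where \<chi>: "\<chi> \<in> formulas L (Suc k + n)"
        "\<forall>x\<in>U. \<forall>a\<in>nlists k U. \<forall>b\<in>nlists n U. germ_cmp R H H' x a b \<longleftrightarrow> sat S (x # a @ b) \<chi>"
        by (rule Def_triple_formula[of "germ_cmp R H H'"]) (rule that)
      have "chain_fm L S (Suc k) n \<chi>"
        unfolding chain_fm_def
      proof (intro conjI \<chi>(1) ballI)
        fix c c' assume c: "c \<in> nlists n U" "c' \<in> nlists n U"
        have sol: "y \<in> solutions S (Suc k) \<chi> d \<longleftrightarrow> y \<in> nlists (Suc k) U \<and> germ_cmp R H H' (hd y) (tl y) d" if "d \<in> nlists n U" for y d
        proof (cases "y \<in> nlists (Suc k) U")
          case True
          then obtain z zs where y: "y = z # zs" "z \<in> U" "zs \<in> nlists k U" by (auto simp: in_nlists_Suc_iff)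
          then show ?thesis using \<chi>(2) that by (simp add: solutions_def)
        qed (simp add: solutions_def)
        show "solutions S (Suc k) \<chi> c \<subseteq> solutions S (Suc k) \<chi> c' \<or> solutions S (Suc k) \<chi> c' \<subseteq> solutions S (Suc k) \<chi> c"
          using germ_cmp_chain[OF H' c Rm, of H] sol[OF c(1)] sol[OF c(2)] by blast
      qed
      from chain[OF this] show ?thesis using \<chi>(2) a b x by blast
    qed
    have less: "w \<prec> x' \<longleftrightarrow> c \<prec> x"
      using tr[of cmp, OF cmpD mc] germ_cmp_iff(1)[OF cU x(1) link mono asym] germ_cmp_iff(1)[OF w(1) x(2) w(3,4) asym] by blast
    have "Def {} (\<lambda>\<epsilon>. cmp (s1 \<epsilon>) (s2 \<epsilon>) \<or> s1 \<epsilon> = s2 \<epsilon>)" if "T {} s1" "T {} s2" for s1 s2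
      by (intro dfs cmpD that)
    then have leq: "w \<preceq> x' \<longleftrightarrow> c \<preceq> x"
      using tr[of "\<lambda>u w. cmp u w \<or> u = w", OF _ mc'] germ_cmp_iff(2)[OF cU x(1) link mono asym] germ_cmp_iff(2)[OF w(1) x(2) w(3,4) asym] by blast
    show thesis by (rule concl[OF \<delta>f \<delta>(2) w(1,2) less leq])
  qed
  show thesis
    using mono
  proof
    assume m: "germ_mono (\<prec>) H' b"
    show thesis
    proof (rule main[OF m])
      show "Def {} (\<lambda>\<epsilon>. \<epsilon> 0 \<prec> \<epsilon> 1)" by (intro dfs)
    qed (auto intro: less_le_trans)
  next
    assume m: "germ_mono (\<lambda>v w. w \<prec> v) H' b"
    show thesis
    proof (rule main[OF m])
      show "Def {} (\<lambda>\<epsilon>. \<epsilon> 1 \<prec> \<epsilon> 0)" by (intro dfs)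
    qed (auto intro: le_less_trans)
  qed
qed

text \<open>
  If \<open>\<phi>\<close> holds for \<open>x\<close> and fails for \<open>x'\<close>, then by \<open>same\<close> it also fails for some \<open>u\<close> which has the same
  position as \<open>x\<close> relative to the boundary of \<open>\<phi>\<close>, since \<open>x'\<close> has this position for \<open>a', b'\<close>.
\<close>

lemma type_step:
  assumes lm: "acl_locally_modular L S"
    and a: "a \<in> nlists k U" "a' \<in> nlists k U" and b: "b \<in> nlists n U" "b' \<in> nlists n U" and x: "x \<in> U" "x' \<in> U"
    and same: "\<And>\<psi>. \<psi> \<in> formulas L (k + n) \<Longrightarrow> sat S (a @ b) \<psi> = sat S (a' @ b') \<psi>"
    and chain: "\<And>\<chi>. chain_fm L S (Suc k) n \<chi> \<Longrightarrow> sat S (x # a @ b) \<chi> = sat S (x' # a' @ b') \<chi>"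
    and e: "e \<in> U" and t: "t \<in> U"
    and ge: "\<And>P. Def (set a \<union> set b) (\<lambda>\<epsilon>. P (\<epsilon> 0)) \<Longrightarrow> P e \<Longrightarrow> ev P"
    and gt: "\<And>P. Def (insert e (set a \<union> set b)) (\<lambda>\<epsilon>. P (\<epsilon> 0)) \<Longrightarrow> P t \<Longrightarrow> ev P"
    and \<phi>: "\<phi> \<in> formulas L (Suc (k + n))" "sat S (x # a @ b) \<phi>"
  shows "sat S (x' # a' @ b') \<phi>"
proof (rule ccontr)
  assume n\<phi>: "\<not> sat S (x' # a' @ b') \<phi>"
  let ?X = "\<lambda>u. sat S (u # a @ b) \<phi>"
  have AU: "set a \<subseteq> U" "set b \<subseteq> U" using a b nlistsE_set by blast+
  have "Def (set a \<union> set b) (\<lambda>\<epsilon>. ?X (\<epsilon> 0))"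
    by (rule Def_sat_params) (use \<phi>(1) a b in simp_all)
  then have DX: "Def (set a \<union> set b) (\<lambda>\<epsilon>. ?X (\<epsilon> 0))" .
  have tX: "tame ?X" by (rule tame_Def[of ?X, OF Def_mono[OF DX]]) (use AU in blast)
  let ?B = "{u \<in> U. bdry ?X u}"
  have B: "finite ?B" "?B \<subseteq> dcl (set a \<union> set b)"
    using finite_bdry[OF tX] finite_Def_dcl[of _ "bdry ?X", OF Def_bdry[of _ ?X, OF DX] finite_bdry[OF tX]] by blast+
  have "\<forall>c\<in>?B. \<exists>\<delta>. \<delta> \<in> formulas L (Suc (k + n)) \<and> (\<forall>u\<in>U. u = c \<longleftrightarrow> sat S (u # a @ b) \<delta>) \<and>
    (\<exists>w\<in>U. sat S (w # a' @ b') \<delta> \<and> (w \<prec> x' \<longleftrightarrow> c \<prec> x) \<and> (w \<preceq> x' \<longleftrightarrow> c \<preceq> x))"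
  proof
    fix c assume "c \<in> ?B"
    then have c: "c \<in> dcl (set a \<union> set b)" using B(2) by blast
    obtain \<delta> w where *: "\<delta> \<in> formulas L (Suc (k + n))" "\<forall>u\<in>U. u = c \<longleftrightarrow> sat S (u # a @ b) \<delta>"
      "w \<in> U" "sat S (w # a' @ b') \<delta>" "w \<prec> x' \<longleftrightarrow> c \<prec> x" "w \<preceq> x' \<longleftrightarrow> c \<preceq> x"
      by (rule cut_transfer[OF lm a b x same chain e t ge gt c]) (assumption | rule that)+
    then show "\<exists>\<delta>. \<delta> \<in> formulas L (Suc (k + n)) \<and> (\<forall>u\<in>U. u = c \<longleftrightarrow> sat S (u # a @ b) \<delta>) \<and>
      (\<exists>w\<in>U. sat S (w # a' @ b') \<delta> \<and> (w \<prec> x' \<longleftrightarrow> c \<prec> x) \<and> (w \<preceq> x' \<longleftrightarrow> c \<preceq> x))"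
      by (intro exI[of _ \<delta>] conjI bexI[of _ w])
  qed
  then obtain \<delta> where \<delta>: "\<forall>c\<in>?B. \<delta> c \<in> formulas L (Suc (k + n)) \<and> (\<forall>u\<in>U. u = c \<longleftrightarrow> sat S (u # a @ b) (\<delta> c)) \<and>
    (\<exists>w\<in>U. sat S (w # a' @ b') (\<delta> c) \<and> (w \<prec> x' \<longleftrightarrow> c \<prec> x) \<and> (w \<preceq> x' \<longleftrightarrow> c \<preceq> x))" by (rule bchoice[THEN exE])
  let ?F = "\<lambda>a b. \<exists>u\<in>U. \<not> sat S (u # a @ b) \<phi> \<and>
    (\<forall>c\<in>?B. \<exists>w\<in>U. sat S (w # a @ b) (\<delta> c) \<and> (w \<prec> u \<longleftrightarrow> c \<prec> x) \<and> (w \<preceq> u \<longleftrightarrow> c \<preceq> x))"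
  have "Def {} (\<lambda>\<epsilon>. ?F (map (\<lambda>i. \<epsilon> i) [0..<k]) (map (\<lambda>i. \<epsilon> (k + i)) [0..<n]))"
    by (intro Def_ball[OF B(1)] dfs Def_const Def_sat_pair \<phi>(1)) (use \<delta> in blast)
  then obtain \<psi> where \<psi>: "\<psi> \<in> formulas L (k + n)" "\<forall>a\<in>nlists k U. \<forall>b\<in>nlists n U. ?F a b \<longleftrightarrow> sat S (a @ b) \<psi>"
    by (rule Def_pair_formula[of ?F]) (rule that)
  have "?F a' b'" using n\<phi> x(2) \<delta> by (intro bexI[of _ x']) blast+
  then have "?F a b" using \<psi>(2) a b same[OF \<psi>(1)] by blast
  then obtain u where u: "u \<in> U" "\<not> ?X u" and cut: "\<forall>c\<in>?B. \<exists>w\<in>U. sat S (w # a @ b) (\<delta> c) \<and> (w \<prec> u \<longleftrightarrow> c \<prec> x) \<and> (w \<preceq> u \<longleftrightarrow> c \<preceq> x)"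
    by (elim bexE conjE) (rule that)
  have cut': "(c \<prec> u \<longleftrightarrow> c \<prec> x) \<and> (c \<preceq> u \<longleftrightarrow> c \<preceq> x)" if c: "c \<in> ?B" for c
  proof -
    obtain w where w: "w \<in> U" "sat S (w # a @ b) (\<delta> c)" "w \<prec> u \<longleftrightarrow> c \<prec> x" "w \<preceq> u \<longleftrightarrow> c \<preceq> x" using cut c by blast
    have "w = c" using \<delta> c w(1,2) by blast
    then show ?thesis using w by blast
  qed
  note bk = breaks_bdry[OF tX, unfolded breaks_def]
  have "?X u = ?X x"
  proof (cases u x rule: linorder_cases)
    case less
    have "\<not> (u \<preceq> c \<and> c \<preceq> x)" if "c \<in> ?B" for c
      using cut'[OF that] less by (metis le_less less_asym not_less)
    then have "\<forall>c\<in>?B. \<not> (u \<preceq> c \<and> c \<preceq> x)" by (rule ballI)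
    then show ?thesis by (rule mp[OF mp[OF bspec[OF bspec[OF bk u(1)] x(1)] less]])
  next
    case greater
    have "\<not> (x \<preceq> c \<and> c \<preceq> u)" if "c \<in> ?B" for c
      using cut'[OF that] greater by (metis le_less less_asym not_less)
    then have "\<forall>c\<in>?B. \<not> (x \<preceq> c \<and> c \<preceq> u)" by (rule ballI)
    then have "?X x = ?X u" by (rule mp[OF mp[OF bspec[OF bspec[OF bk x(1)] u(1)] greater]])
    then show ?thesis ..
  next
    case equal
    show ?thesis unfolding equal ..
  qed
  then show False using u(2) \<phi>(2) by simp
qed

end

text \<open>Adds a dummy first coordinate, so that agreement on chain formulas for the long tuple
  includes agreement for its tail.\<close>

lemma chain_fm_shift:
  assumes "chain_fm L S k n \<chi>"
  shows "chain_fm L S (Suc k) n (sub [Suc 0..<Suc (k + n)] \<chi>)"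
    and "length a = k \<Longrightarrow> length b = n \<Longrightarrow> sat S (x # a @ b) (sub [Suc 0..<Suc (k + n)] \<chi>) \<longleftrightarrow> sat S (a @ b) \<chi>"
proof -
  have \<chi>: "\<chi> \<in> formulas L (k + n)" using assms by (simp add: chain_fm_def)
  have l: "length [Suc 0..<Suc (k + n)] = k + n" by (simp only: length_upt)
  have s: "sat S (x # a @ b) (sub [Suc 0..<Suc (k + n)] \<chi>) \<longleftrightarrow> sat S (a @ b) \<chi>" if "length a = k" "length b = n" for x a b
    by (rule sat_sub') (use \<chi> that l in \<open>auto simp del: upt_Suc\<close>)
  then show "length a = k \<Longrightarrow> length b = n \<Longrightarrow> sat S (x # a @ b) (sub [Suc 0..<Suc (k + n)] \<chi>) \<longleftrightarrow> sat S (a @ b) \<chi>" .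
  have "sub [Suc 0..<Suc (k + n)] \<chi> \<in> formulas L (Suc k + n)"
    by (rule sub_formulas) (use \<chi> l in \<open>auto simp del: upt_Suc\<close>)
  moreover have "solutions S (Suc k) (sub [Suc 0..<Suc (k + n)] \<chi>) b = {x # a | x a. x \<in> univ S \<and> a \<in> solutions S k \<chi> b}"
    if "b \<in> nlists n (univ S)" for b
  proof -
    have "length b = n" using that by simp
    then have s': "sat S (x # a @ b) (sub [Suc 0..<Suc (k + n)] \<chi>) \<longleftrightarrow> sat S (a @ b) \<chi>" if "a \<in> nlists k (univ S)" for x a
      using s[of a b x] that by simp
    show ?thesis unfolding solutions_def in_nlists_Suc_iff using s' by fastforce
  qed
  ultimately show "chain_fm L S (Suc k) n (sub [Suc 0..<Suc (k + n)] \<chi>)"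
    using assms unfolding chain_fm_def by (auto 0 3 simp: subset_iff)
qed

lemma (in omin) chains_determine_type:
  assumes lm: "acl_locally_modular L S"
    and b: "b \<in> nlists n U" "b' \<in> nlists n U" and e: "e \<in> U" and t: "t \<in> U"
    and a: "a \<in> nlists m U" "a' \<in> nlists m U"
    and chain: "\<And>\<chi>. chain_fm L S m n \<chi> \<Longrightarrow> sat S (a @ b) \<chi> = sat S (a' @ b') \<chi>"
    and ge: "\<And>P. Def (set a \<union> set b) (\<lambda>\<epsilon>. P (\<epsilon> 0)) \<Longrightarrow> P e \<Longrightarrow> ev P"
    and gt: "\<And>P. Def (insert e (set a \<union> set b)) (\<lambda>\<epsilon>. P (\<epsilon> 0)) \<Longrightarrow> P t \<Longrightarrow> ev P"
    and \<phi>: "\<phi> \<in> formulas L (m + n)"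
  shows "sat S (a @ b) \<phi> = sat S (a' @ b') \<phi>"
  using a chain ge gt \<phi>
proof (induction m arbitrary: a a' \<phi>)
  case 0
  \<comment> \<open>There is only one tuple of length 0 and its sets of tuples form a chain, so
    every formula is a chain formula.\<close>
  have "chain_fm L S 0 n \<phi>" unfolding chain_fm_def solutions_def using "0.prems" by auto
  then show ?case by (rule "0.prems")
next
  case (Suc m)
  obtain x c where a: "a = x # c" "x \<in> U" "c \<in> nlists m U" using Suc.prems(1) unfolding in_nlists_Suc_iff by blast
  obtain x' c' where a': "a' = x' # c'" "x' \<in> U" "c' \<in> nlists m U" using Suc.prems(2) unfolding in_nlists_Suc_iff by blast
  have ge: "ev P" if "Def (set c \<union> set b) (\<lambda>\<epsilon>. P (\<epsilon> 0))" "P e" for P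
    by (rule Suc.prems(4)[of P, OF Def_mono[OF that(1)] that(2)]) (auto simp: a(1))
  have gt: "ev P" if "Def (insert e (set c \<union> set b)) (\<lambda>\<epsilon>. P (\<epsilon> 0))" "P t" for P
    by (rule Suc.prems(5)[of P, OF Def_mono[OF that(1)] that(2)]) (auto simp: a(1))
  have chain: "sat S (c @ b) \<chi> = sat S (c' @ b') \<chi>" if \<chi>: "chain_fm L S m n \<chi>" for \<chi>
    using Suc.prems(3)[OF chain_fm_shift(1)[OF \<chi>]] chain_fm_shift(2)[OF \<chi>] a(1,3) a'(1,3) b
    by (simp only: append_Cons nlistsE_length)
  have same: "sat S (c @ b) \<psi> = sat S (c' @ b') \<psi>" if "\<psi> \<in> formulas L (m + n)" for \<psi>
    by (rule Suc.IH[OF a(3) a'(3) chain ge gt that])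
  have chain': "sat S (x # c @ b) \<chi> = sat S (x' # c' @ b') \<chi>" if "chain_fm L S (Suc m) n \<chi>" for \<chi>
    using Suc.prems(3)[OF that] a(1) a'(1) by simp
  have step: "sat S (x' # c' @ b') \<psi>" if "\<psi> \<in> formulas L (Suc (m + n))" "sat S (x # c @ b) \<psi>" for \<psi>
    by (rule type_step[OF lm a(3) a'(3) b a(2) a'(2) same chain' e t ge gt that])
  have "\<phi> \<in> formulas L (Suc (m + n))" using Suc.prems(6) by simp
  \<comment> \<open>The implication for the negation of \<open>\<phi>\<close> gives the
    converse.\<close>
  then show ?case using step[of \<phi>] step[of "Neg \<phi>"] a(1) a'(1) by auto
qed

text \<open>
  If the set defined by \<open>\<delta>\<close> with parameters \<open>ps\<close> is bounded, then the variable \<open>k\<close> lies beyond it.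
\<close>

definition bnd_fm :: "'r \<Rightarrow> nat \<Rightarrow> nat list \<Rightarrow> ('f, 'r) fm \<Rightarrow> ('f, 'r) fm" where
  "bnd_fm lt k ps \<delta> = Imp (Ex (All (Imp (sub (0 # map ((+) 2) ps) \<delta>) (Rel lt [Var 0, Var 1]))))
     (All (Imp (sub (0 # map Suc ps) \<delta>) (Rel lt [Var 0, Var (Suc k)])))"

lemma bnd_fm_formulas:
  assumes "rel_arity L lt = 2" "\<delta> \<in> formulas L (Suc (length ps))" "k < r" "\<And>i. i \<in> set ps \<Longrightarrow> i < r"
  shows "bnd_fm lt k ps \<delta> \<in> formulas L r"
proof -
  have "sub (0 # map ((+) 2) ps) \<delta> \<in> formulas L (Suc (Suc r))" "sub (0 # map Suc ps) \<delta> \<in> formulas L (Suc r)"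
    by (rule sub_formulas; use assms in auto)+
  then show ?thesis unfolding bnd_fm_def using assms(1,3) by simp
qed

lemma (in og) sat_bnd_fm:
  assumes "\<delta> \<in> formulas L (Suc (length ps))" "v \<in> nlists r U" "k < r"
  shows "sat S v (bnd_fm ltr k ps \<delta>) \<longleftrightarrow>
    ((\<exists>z\<in>U. \<forall>x\<in>U. sat S (x # map ((!) v) ps) \<delta> \<longrightarrow> x \<prec> z) \<longrightarrow> (\<forall>x\<in>U. sat S (x # map ((!) v) ps) \<delta> \<longrightarrow> x \<prec> v ! k))"
proof -
  have s: "sat S (x # z # v) (sub (0 # map ((+) 2) ps) \<delta>) \<longleftrightarrow> sat S (x # map ((!) v) ps) \<delta>"
    "sat S (x # v) (sub (0 # map Suc ps) \<delta>) \<longleftrightarrow> sat S (x # map ((!) v) ps) \<delta>" for x z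
    by (rule sat_sub'; use assms in \<open>auto simp: nth_Cons split: nat.splits\<close>)+
  have vk: "v ! k \<in> U" using assms(2,3) by (rule nlistsE_nth_in)
  have r: "sat S (x # z # v) (Rel ltr [Var 0, Var 1]) \<longleftrightarrow> x \<prec> z" "sat S (x # v) (Rel ltr [Var 0, Var (Suc k)]) \<longleftrightarrow> x \<prec> v ! k"
    if "x \<in> U" "z \<in> U" for x z
    using that vk by (simp_all add: ltr_iff)
  show ?thesis unfolding bnd_fm_def sat.simps(3-5) s using r by blast
qed

lemma (in og) beyond_bounded:
  assumes "finite D"
  shows "\<exists>e\<in>U. \<forall>P\<in>D. (\<exists>z\<in>U. \<forall>x\<in>U. P x \<longrightarrow> x \<prec> z) \<longrightarrow> (\<forall>x\<in>U. P x \<longrightarrow> x \<prec> e)"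
  using assms
proof (induction D rule: finite_induct)
  case empty
  then show ?case using U_ne by blast
next
  case (insert P D)
  then obtain e where e: "e \<in> U" "\<forall>P\<in>D. (\<exists>z\<in>U. \<forall>x\<in>U. P x \<longrightarrow> x \<prec> z) \<longrightarrow> (\<forall>x\<in>U. P x \<longrightarrow> x \<prec> e)" by blast
  show ?case
  proof (cases "\<exists>z\<in>U. \<forall>x\<in>U. P x \<longrightarrow> x \<prec> z")
    case True
    then obtain z where z: "z \<in> U" "\<forall>x\<in>U. P x \<longrightarrow> x \<prec> z" by blast
    have "max e z \<in> U" using e(1) z(1) by (simp add: max_def)
    moreover have "x \<prec> e \<or> x \<prec> z \<Longrightarrow> x \<prec> max e z" for x using less_max_iff_disj[of x e z] by simp
    ultimately show ?thesis using e(2) z(2) by (intro bexI[of _ "max e z"]) (simp, blast)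
  next
    case False
    then show ?thesis using e by blast
  qed
qed

text \<open>If \<open>P\<close> is not true for all large elements, then by tameness it is false for
  all large ones, so its set is bounded and \<open>e\<close> lies beyond it; but \<open>P e\<close>
  holds.\<close>

lemma (in omin) ev_beyond_bounded:
  assumes D: "Def (set xs) (\<lambda>\<epsilon>. P (\<epsilon> 0))" and xs: "set xs \<subseteq> U" and e: "e \<in> U" "P e"
    and bd: "\<And>\<delta>. \<delta> \<in> formulas L (Suc (length xs)) \<Longrightarrow> \<exists>z\<in>U. \<forall>x\<in>U. sat S (x # xs) \<delta> \<longrightarrow> x \<prec> z \<Longrightarrow>
      \<forall>x\<in>U. sat S (x # xs) \<delta> \<longrightarrow> x \<prec> e"
  shows "ev P"
proof (rule ccontr)
  assume n: "\<not> ev P"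
  have "tame P" by (rule tame_Def[of P, OF Def_mono[OF D xs]])
  then have "ev (\<lambda>x. \<not> P x)" using tame_ev n by blast
  then obtain b where b: "b \<in> U" "\<forall>x\<in>U. b \<prec> x \<longrightarrow> \<not> P x" unfolding ev_def by blast
  obtain z where z: "z \<in> U" "b \<prec> z" using ex_greater b(1) by blast
  obtain \<delta> where \<delta>: "\<delta> \<in> formulas L (Suc (length xs))" "\<forall>u\<in>U. P u \<longleftrightarrow> sat S (u # xs) \<delta>"
    by (rule Def_params_formula[of xs P, OF D]) (rule that)
  have "\<forall>x\<in>U. sat S (x # xs) \<delta> \<longrightarrow> x \<prec> z"
    using b(2) z \<delta>(2) by (meson le_less_trans not_less)
  then have "\<forall>x\<in>U. sat S (x # xs) \<delta> \<longrightarrow> x \<prec> e" using bd[OF \<delta>(1)] z(1) by blast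
  then have "e \<prec> e" using \<delta>(2) e by blast
  then show False by simp
qed

section \<open>Finitely many chain formulas by compactness\<close>

text \<open>Were no finite set of chain formulas enough, an elementary extension would contain two
  tuples that agree on all chain formulas and differ on \<open>\<phi>\<close>, together with points
  \<open>e\<close> and \<open>t\<close> generic at infinity. This contradicts
  \<open>chains_determine_type\<close>, which applies there because the extension is a model of the
  same theory.\<close>

lemma finite_chains:
  fixes L :: "('f, 'r) language" and M :: "('f, 'r, 'a) struct"
  assumes M: "is_structure L M" and ar: "rel_arity L lt = 2" "fun_arity L pl = 2" and ax: "sat M [] (og_ax lt pl)"
    and tm: "\<And>p \<phi> m. \<phi> \<in> formulas L (Suc p) \<Longrightarrow> m \<in> nlists p (univ M) \<Longrightarrow> \<exists>K. sat M m (tamef lt K p \<phi>)"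
    and lm: "locally_modular_theory TYPE(('f, 'r, 'a) model_universe) L (Th L M)"
    and \<phi>: "\<phi> \<in> formulas L (m + n)"
  shows "\<exists>X. finite X \<and> (\<forall>\<chi>\<in>X. chain_fm L M m n \<chi>) \<and>
    (\<forall>c\<in>nlists (m + n) (univ M). \<forall>c'\<in>nlists (m + n) (univ M).
      (\<forall>\<chi>\<in>X. sat M c \<chi> = sat M c' \<chi>) \<longrightarrow> sat M c \<phi> = sat M c' \<phi>)"
proof (rule ccontr)
  assume no: "\<not> ?thesis"
  have no: "\<exists>c\<in>nlists (m + n) (univ M). \<exists>c'\<in>nlists (m + n) (univ M).
      (\<forall>\<chi>\<in>X. sat M c \<chi> = sat M c' \<chi>) \<and> sat M c \<phi> \<and> \<not> sat M c' \<phi>"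
    if X: "finite X" "\<forall>\<chi>\<in>X. chain_fm L M m n \<chi>" for X
  proof -
    have "\<not> (\<forall>c\<in>nlists (m + n) (univ M). \<forall>c'\<in>nlists (m + n) (univ M).
      (\<forall>\<chi>\<in>X. sat M c \<chi> = sat M c' \<chi>) \<longrightarrow> sat M c \<phi> = sat M c' \<phi>)" using no X by blast
    then obtain c c' where c: "c \<in> nlists (m + n) (univ M)" "c' \<in> nlists (m + n) (univ M)"
      "\<forall>\<chi>\<in>X. sat M c \<chi> = sat M c' \<chi>" "sat M c \<phi> \<noteq> sat M c' \<phi>" by blast
    show ?thesis
    proof (cases "sat M c \<phi>")
      case True
      then show ?thesis using c by (intro bexI[of _ c] bexI[of _ c']) simp_all
    next
      case False
      then show ?thesis using c by (intro bexI[of _ c'] bexI[of _ c]) simp_all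
    qed
  qed
  obtain le less zr ng where "ogd le less L M lt pl zr ng" by (rule ex_ogd[OF M ar ax])
  then interpret M: ogd le less L M lt pl zr ng .
  let ?k = "m + n"
  \<comment> \<open>The variables 0 and 1 are \<open>t\<close> and \<open>e\<close>, followed by the
    blocks \<open>?I\<close> and \<open>?J\<close> for the two tuples. Accordingly \<open>?g\<close>
    places \<open>e\<close> beyond bounded sets with parameters in the first tuple, and
    \<open>?h\<close> places \<open>t\<close> beyond those that may also use
    \<open>e\<close>.\<close>
  let ?I = "[2..<2 + ?k]" and ?J = "[2 + ?k..<2 + ?k + ?k]" and ?r = "2 + ?k + ?k"
  let ?f = "\<lambda>\<chi>. Iff (sub ?I \<chi>) (sub ?J \<chi>) :: ('f, 'r) fm"
  let ?g = "bnd_fm lt 1 ?I :: ('f, 'r) fm \<Rightarrow> ('f, 'r) fm" and ?h = "bnd_fm lt 0 (1 # ?I) :: ('f, 'r) fm \<Rightarrow> ('f, 'r) fm"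
  let ?C = "{\<chi>. chain_fm L M m n \<chi>}" and ?D = "formulas L (Suc ?k)" and ?E = "formulas L (Suc (Suc ?k))"
  let ?\<Sigma> = "{sub ?I \<phi>, Neg (sub ?J \<phi>)} \<union> ?f ` ?C \<union> ?g ` ?D \<union> ?h ` ?E"
  have lI: "length ?I = ?k" "length ?J = ?k" by (simp_all only: length_upt diff_add_inverse)
  have IJ: "set ?I = {2..<2 + ?k}" "set ?J = {2 + ?k..<2 + ?k + ?k}" by (simp_all only: set_upt)
  have CF: "\<chi> \<in> formulas L ?k" if "\<chi> \<in> ?C" for \<chi> using that by (simp add: chain_fm_def)
  have subF: "sub ?I \<chi> \<in> formulas L ?r" "sub ?J \<chi> \<in> formulas L ?r" if "\<chi> \<in> formulas L ?k" for \<chi>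
    by (rule sub_formulas; (unfold lI IJ)?; use that in simp)+
  have "?g \<delta> \<in> formulas L ?r" if "\<delta> \<in> ?D" for \<delta>
    by (rule bnd_fm_formulas[OF ar(1)]) (use that in \<open>unfold lI IJ, simp_all\<close>)
  moreover have "?h \<delta> \<in> formulas L ?r" if "\<delta> \<in> ?E" for \<delta>
    by (rule bnd_fm_formulas[OF ar(1)]) (use that in \<open>unfold list.size lI list.set IJ, auto\<close>)
  moreover have "?f \<chi> \<in> formulas L ?r" if "\<chi> \<in> ?C" for \<chi>
    using subF[OF CF[OF that]] by simp
  ultimately have \<Sigma>: "?\<Sigma> \<subseteq> formulas L ?r"
    using subF[OF \<phi>] formulas_simps(1) by blast
  have mI: "map ((!) (t # e # c @ c')) ?I = c" "map ((!) (t # e # c @ c')) ?J = c'"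
    "map ((!) (t # e # c @ c')) (1 # ?I) = e # c" if "length c = ?k" "length c' = ?k" for t e c and c' :: "'b list"
  proof -
    show *: "map ((!) (t # e # c @ c')) ?I = c"
      by (rule nth_equalityI) (use that in \<open>simp_all add: lI nth_append del: upt_Suc\<close>)
    show "map ((!) (t # e # c @ c')) ?J = c'"
      by (rule nth_equalityI) (use that in \<open>simp_all add: lI nth_append del: upt_Suc\<close>)
    show "map ((!) (t # e # c @ c')) (1 # ?I) = e # c" using * by (simp del: upt_Suc)
  qed
  have fin: "\<forall>H. finite H \<longrightarrow> H \<subseteq> ?\<Sigma> \<longrightarrow> (\<exists>v\<in>nlists ?r (univ M). \<forall>\<sigma>\<in>H. sat M v \<sigma>)"
  proof (intro allI impI)
    fix H assume H: "finite H" "H \<subseteq> ?\<Sigma>"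
    have im: "\<exists>X'. finite X' \<and> X' \<subseteq> X \<and> H \<inter> F ` X = F ` X'" for F :: "('f, 'r) fm \<Rightarrow> ('f, 'r) fm" and X
      using finite_subset_image[of "H \<inter> F ` X" F X] H(1) by blast
    obtain X where X: "finite X" "X \<subseteq> ?C" "H \<inter> ?f ` ?C = ?f ` X" using im[of ?C ?f] by (elim exE conjE) (rule that)
    obtain D where D: "finite D" "D \<subseteq> ?D" "H \<inter> ?g ` ?D = ?g ` D" using im[of ?D ?g] by (elim exE conjE) (rule that)
    obtain E where E: "finite E" "E \<subseteq> ?E" "H \<inter> ?h ` ?E = ?h ` E" using im[of ?E ?h] by (elim exE conjE) (rule that)
    obtain c c' where c: "c \<in> nlists ?k (univ M)" "c' \<in> nlists ?k (univ M)"
      "\<forall>\<chi>\<in>X. sat M c \<chi> = sat M c' \<chi>" "sat M c \<phi>" "\<not> sat M c' \<phi>" using no[OF X(1)] X(2) by blast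
    obtain e where e: "e \<in> univ M" "\<forall>P\<in>(\<lambda>\<delta> x. sat M (x # c) \<delta>) ` D.
      (\<exists>z\<in>univ M. \<forall>x\<in>univ M. P x \<longrightarrow> less x z) \<longrightarrow> (\<forall>x\<in>univ M. P x \<longrightarrow> less x e)"
      using M.beyond_bounded[OF finite_imageI[OF D(1)]] by (rule bexE) (rule that)
    obtain t where t: "t \<in> univ M" "\<forall>P\<in>(\<lambda>\<delta> x. sat M (x # e # c) \<delta>) ` E.
      (\<exists>z\<in>univ M. \<forall>x\<in>univ M. P x \<longrightarrow> less x z) \<longrightarrow> (\<forall>x\<in>univ M. P x \<longrightarrow> less x t)"
      using M.beyond_bounded[OF finite_imageI[OF E(1)]] by (rule bexE) (rule that)
    let ?v = "t # e # c @ c'"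
    have v: "?v \<in> nlists ?r (univ M)"
      using c(1,2) e(1) t(1) nlistsE_set[OF c(1)] nlistsE_set[OF c(2)] by (intro nlistsI) simp_all
    have m: "map ((!) ?v) ?I = c" "map ((!) ?v) ?J = c'" "map ((!) ?v) (1 # ?I) = e # c" by (rule mI; use c(1,2) in simp)+
    have s: "sat M ?v (sub ?I \<chi>) = sat M c \<chi>" "sat M ?v (sub ?J \<chi>) = sat M c' \<chi>" if "\<chi> \<in> formulas L ?k" for \<chi>
      using sat_sub[of \<chi> L ?I M ?v] sat_sub[of \<chi> L ?J M ?v] that unfolding lI m by blast+
    have "sat M ?v (?f \<chi>)" if "\<chi> \<in> X" for \<chi>
      unfolding sat.simps using s[OF CF, of \<chi>] that X(2) c(3) by blast
    moreover have "sat M ?v (?g \<delta>)" if "\<delta> \<in> D" for \<delta>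
    proof -
      have "\<delta> \<in> formulas L (Suc (length ?I))" unfolding lI using that D(2) by blast
      from M.sat_bnd_fm[OF this v, of 1] show ?thesis unfolding m using e(2) that by simp
    qed
    moreover have "sat M ?v (?h \<delta>)" if "\<delta> \<in> E" for \<delta>
    proof -
      have "\<delta> \<in> formulas L (Suc (length (1 # ?I)))" unfolding list.size lI using that E(2) by auto
      from M.sat_bnd_fm[OF this v, of 0] show ?thesis unfolding m using t(2) that by simp
    qed
    moreover have "sat M ?v (sub ?I \<phi>)" "sat M ?v (Neg (sub ?J \<phi>))" using s[OF \<phi>] c(4,5) by simp_all
    ultimately have "sat M ?v \<sigma>" if "\<sigma> \<in> H" for \<sigma>
    proof -
      from that H(2) have "\<sigma> = sub ?I \<phi> \<or> \<sigma> = Neg (sub ?J \<phi>) \<or> \<sigma> \<in> H \<inter> ?f ` ?C \<or> \<sigma> \<in> H \<inter> ?g ` ?D \<or> \<sigma> \<in> H \<inter> ?h ` ?E" by blast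
      then have "\<sigma> = sub ?I \<phi> \<or> \<sigma> = Neg (sub ?J \<phi>) \<or> \<sigma> \<in> ?f ` X \<or> \<sigma> \<in> ?g ` D \<or> \<sigma> \<in> ?h ` E" unfolding X(3) D(3) E(3) .
      then show ?thesis using \<open>\<And>\<chi>. \<chi> \<in> X \<Longrightarrow> sat M ?v (?f \<chi>)\<close> \<open>\<And>\<delta>. \<delta> \<in> D \<Longrightarrow> sat M ?v (?g \<delta>)\<close>
        \<open>\<And>\<delta>. \<delta> \<in> E \<Longrightarrow> sat M ?v (?h \<delta>)\<close> \<open>sat M ?v (sub ?I \<phi>)\<close> \<open>sat M ?v (Neg (sub ?J \<phi>))\<close> by blast
    qed
    then show "\<exists>v\<in>nlists ?r (univ M). \<forall>\<sigma>\<in>H. sat M v \<sigma>" by (intro bexI[OF _ v] ballI)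
  qed
  obtain N :: "('f, 'r, ('f, 'r, 'a) model_universe) struct" and v j where N:
    "is_structure L N" "v \<in> nlists ?r (univ N)" "\<forall>\<sigma>\<in>?\<Sigma>. sat N v \<sigma>" "\<forall>a\<in>univ M. j a \<in> univ N"
    "\<forall>n \<phi> e. \<phi> \<in> formulas L n \<longrightarrow> e \<in> nlists n (univ M) \<longrightarrow> sat N (map j e) \<phi> = sat M e \<phi>"
    by (rule compactness[OF M \<Sigma> fin]) (rule that)
  have el: "sat N [] \<phi> = sat M [] \<phi>" if "\<phi> \<in> formulas L 0" for \<phi>
    using N(5)[rule_format, of \<phi> 0 "[]"] that by simp
  have mod: "is_model L N (Th L M)" unfolding is_model_def Th_def using N(1) el by blast
  then have lmN: "acl_locally_modular L N" using lm unfolding locally_modular_theory_def by blast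
  obtain le' less' zr' ng' where "omin le' less' L N lt pl zr' ng'" by (rule ex_omin_model[OF M ar ax tm mod])
  then interpret N: omin le' less' L N lt pl zr' ng' .
  have lv: "length v = ?r" using N(2) by simp
  obtain t v1 where v1: "v = t # v1" using lv by (cases v) simp_all
  obtain e v2 where v2: "v1 = e # v2" using lv v1 by (cases v1) simp_all
  let ?c = "take ?k v2" and ?c' = "drop ?k v2"
  let ?a = "take m ?c" and ?b = "drop m ?c" and ?a' = "take m ?c'" and ?b' = "drop m ?c'"
  have v: "v = t # e # ?c @ ?c'" using v1 v2 by simp
  have l2: "length v2 = ?k + ?k" using lv v1 v2 by simp
  have lc: "length ?c = ?k" "length ?c' = ?k" using l2 by simp_all
  have sv: "set v \<subseteq> univ N" using N(2) by (rule nlistsE_set)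
  then have et: "t \<in> univ N" "e \<in> univ N" and s2: "set v2 \<subseteq> univ N" unfolding v1 v2 by simp_all
  have sub2: "set ?a \<subseteq> univ N" "set ?b \<subseteq> univ N" "set ?a' \<subseteq> univ N" "set ?b' \<subseteq> univ N" "set ?c \<subseteq> univ N"
    using s2 set_take_subset set_drop_subset by (meson subset_trans)+
  have ab: "?a \<in> nlists m (univ N)" "?a' \<in> nlists m (univ N)" "?b \<in> nlists n (univ N)" "?b' \<in> nlists n (univ N)"
    by (rule nlistsI; use l2 sub2 in simp)+
  have cc: "?a @ ?b = ?c" "?a' @ ?b' = ?c'" by (rule append_take_drop_id)+
  have m: "map ((!) v) ?I = ?c" "map ((!) v) ?J = ?c'" "map ((!) v) (1 # ?I) = e # ?c" by (subst v, rule mI[OF lc])+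
  have s: "sat N v (sub ?I \<chi>) = sat N ?c \<chi>" "sat N v (sub ?J \<chi>) = sat N ?c' \<chi>" if "\<chi> \<in> formulas L ?k" for \<chi>
    using sat_sub[of \<chi> L ?I N v] sat_sub[of \<chi> L ?J N v] that unfolding lI m by blast+
  have vt: "v ! 1 = e" "v ! 0 = t" using v1 v2 by simp_all
  have "sat N (?a @ ?b) \<phi> = sat N (?a' @ ?b') \<phi>"
  proof (rule N.chains_determine_type[OF lmN ab(3,4) et(2,1) ab(1,2) _ _ _ \<phi>])
    fix \<chi> assume \<chi>: "chain_fm L N m n \<chi>"
    then have F: "\<chi> \<in> formulas L ?k" by (simp add: chain_fm_def)
    have "chain_fm L M m n \<chi>" using \<chi> unfolding chain_fm_iff[OF F] el[OF chain_sentence_formulas[OF F]] .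
    then have "sat N v (?f \<chi>)" using N(3) by blast
    then show "sat N (?a @ ?b) \<chi> = sat N (?a' @ ?b') \<chi>" unfolding cc sat.simps s[OF F] by blast
  next
    fix P assume P: "N.Def (set ?a \<union> set ?b) (\<lambda>\<epsilon>. P (\<epsilon> 0))" "P e"
    have D: "N.Def (set ?c) (\<lambda>\<epsilon>. P (\<epsilon> 0))" using P(1) unfolding set_append[symmetric] cc .
    show "N.ev P"
    proof (rule N.ev_beyond_bounded[of ?c P e, OF D sub2(5) et(2) P(2)])
      fix \<delta> assume "\<delta> \<in> formulas L (Suc (length ?c))" and bd: "\<exists>z\<in>univ N. \<forall>x\<in>univ N. sat N (x # ?c) \<delta> \<longrightarrow> less' x z"
      then have \<delta>: "\<delta> \<in> ?D" unfolding lc by simp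
      then have "sat N v (?g \<delta>)" using N(3) by blast
      moreover have "\<delta> \<in> formulas L (Suc (length ?I))" unfolding lI by (rule \<delta>)
      ultimately show "\<forall>x\<in>univ N. sat N (x # ?c) \<delta> \<longrightarrow> less' x e"
        using N.sat_bnd_fm[of \<delta> ?I v ?r 1] N(2) bd unfolding m vt by simp
    qed
  next
    fix P assume P: "N.Def (insert e (set ?a \<union> set ?b)) (\<lambda>\<epsilon>. P (\<epsilon> 0))" "P t"
    have D: "N.Def (set (e # ?c)) (\<lambda>\<epsilon>. P (\<epsilon> 0))" using P(1) unfolding set_append[symmetric] cc by simp
    have su: "set (e # ?c) \<subseteq> univ N" using sub2(5) et by simp
    show "N.ev P"
    proof (rule N.ev_beyond_bounded[of "e # ?c" P t, OF D su et(1) P(2)])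
      fix \<delta> assume "\<delta> \<in> formulas L (Suc (length (e # ?c)))" and bd: "\<exists>z\<in>univ N. \<forall>x\<in>univ N. sat N (x # e # ?c) \<delta> \<longrightarrow> less' x z"
      then have \<delta>: "\<delta> \<in> ?E" unfolding list.size lc by simp
      then have "sat N v (?h \<delta>)" using N(3) by blast
      moreover have "\<delta> \<in> formulas L (Suc (length (1 # ?I)))" unfolding list.size lI using \<delta> by simp
      ultimately show "\<forall>x\<in>univ N. sat N (x # e # ?c) \<delta> \<longrightarrow> less' x t"
        using N.sat_bnd_fm[of \<delta> "1 # ?I" v ?r 0] N(2) bd unfolding m vt by simp
    qed
  qed
  moreover have "sat N v (sub ?I \<phi>)" "sat N v (Neg (sub ?J \<phi>))" using N(3) by blast+
  ultimately show False unfolding cc sat.simps s[OF \<phi>] by blast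
qed

section \<open>Counting types\<close>

context omin
begin

definition rgerm :: "('a \<Rightarrow> bool) \<Rightarrow> 'a \<Rightarrow> bool" where
  "rgerm P \<beta> \<longleftrightarrow> (\<exists>\<gamma>\<in>U. \<beta> \<prec> \<gamma> \<and> (\<forall>u\<in>U. \<beta> \<prec> u \<longrightarrow> u \<prec> \<gamma> \<longrightarrow> P u))"

definition lgerm :: "('a \<Rightarrow> bool) \<Rightarrow> bool" where
  "lgerm P \<longleftrightarrow> (\<exists>\<gamma>\<in>U. \<forall>u\<in>U. u \<prec> \<gamma> \<longrightarrow> P u)"

text \<open>The truth of \<open>P\<close> at the boundary point of \<open>X\<close> with \<open>j\<close> predecessors, or immediately to its right.\<close>

definition cutval :: "bool \<Rightarrow> nat \<Rightarrow> ('a \<Rightarrow> bool) \<Rightarrow> ('a \<Rightarrow> bool) \<Rightarrow> bool" where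
  "cutval s j X P \<longleftrightarrow> (\<exists>\<beta>\<in>U. bdry X \<beta> \<and> card {u \<in> U. bdry X u \<and> u \<prec> \<beta>} = j \<and> (if s then P \<beta> else rgerm P \<beta>))"

text \<open>The number of predecessors identifies a boundary point, since it grows strictly along
  the boundary.\<close>

lemma cutval_iff:
  assumes "tame X" "\<beta> \<in> U" "bdry X \<beta>" "card {u \<in> U. bdry X u \<and> u \<prec> \<beta>} = j"
  shows "cutval s j X P \<longleftrightarrow> (if s then P \<beta> else rgerm P \<beta>)"
proof -
  have mono: "card {u \<in> U. bdry X u \<and> u \<prec> \<beta>1} < card {u \<in> U. bdry X u \<and> u \<prec> \<beta>2}"
    if "\<beta>1 \<in> U" "bdry X \<beta>1" "\<beta>1 \<prec> \<beta>2" for \<beta>1 \<beta>2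
  proof (rule psubset_card_mono)
    show "finite {u \<in> U. bdry X u \<and> u \<prec> \<beta>2}"
      by (rule finite_subset[OF _ finite_bdry[OF assms(1)]]) blast
    show "{u \<in> U. bdry X u \<and> u \<prec> \<beta>1} \<subset> {u \<in> U. bdry X u \<and> u \<prec> \<beta>2}"
      using that less_trans by auto
  qed
  have "\<beta>' = \<beta>" if "\<beta>' \<in> U" "bdry X \<beta>'" "card {u \<in> U. bdry X u \<and> u \<prec> \<beta>'} = j" for \<beta>'
  proof (rule ccontr)
    assume "\<beta>' \<noteq> \<beta>"
    then have "\<beta>' \<prec> \<beta> \<or> \<beta> \<prec> \<beta>'" by (simp add: neq_iff)
    then show False
    proof
      assume "\<beta>' \<prec> \<beta>"
      from mono[OF that(1,2) this] show False unfolding that(3) assms(4) by simp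
    next
      assume "\<beta> \<prec> \<beta>'"
      from mono[OF assms(2,3) this] show False unfolding that(3) assms(4) by simp
    qed
  qed
  then show ?thesis unfolding cutval_def using assms by blast
qed

text \<open>If \<open>x\<close> is no boundary point and \<open>\<beta>\<close> is the greatest
  boundary point below it, no predicate changes between \<open>\<beta>\<close> and \<open>x\<close>,
  so truth at \<open>x\<close> is truth in the right germ at \<open>\<beta>\<close>. Without
  boundary points below \<open>x\<close> the germ at minus infinity takes this role. The point
  \<open>\<beta>\<close> is named by one predicate \<open>P h\<close> and a number \<open>j\<close>
  below \<open>K\<close>, and these names can be counted.\<close>

lemma cut_type:
  assumes I: "finite I" and tm: "\<And>i. i \<in> I \<Longrightarrow> tame (P i)" and x: "x \<in> U"
    and K: "\<And>i. i \<in> I \<Longrightarrow> card {u \<in> U. bdry (P i) u} \<le> K"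
  shows "(\<forall>i\<in>I. P i x = lgerm (P i)) \<or> (\<exists>h\<in>I. \<exists>s. \<exists>j<K. \<forall>i\<in>I. P i x = cutval s j (P h) (P i))"
proof -
  define E where "E = (\<Union>i\<in>I. {u \<in> U. bdry (P i) u})"
  have E: "finite E" "E \<subseteq> U" unfolding E_def using I finite_bdry[OF tm] by auto
  have at: "\<exists>h\<in>I. \<exists>s. \<exists>j<K. \<forall>i\<in>I. P i x = cutval s j (P h) (P i)"
    if \<beta>: "\<beta> \<in> E" and s: "\<forall>i\<in>I. P i x = (if s then P i \<beta> else rgerm (P i) \<beta>)" for \<beta> s
  proof -
    obtain h where h: "h \<in> I" "\<beta> \<in> U" "bdry (P h) \<beta>" using \<beta> unfolding E_def by blast
    let ?j = "card {u \<in> U. bdry (P h) u \<and> u \<prec> \<beta>}"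
    have "?j < card {u \<in> U. bdry (P h) u}"
      by (rule psubset_card_mono[OF finite_bdry[OF tm[OF h(1)]]]) (use h in auto)
    then have "?j < K" using K[OF h(1)] by simp
    moreover have "\<forall>i\<in>I. P i x = cutval s ?j (P h) (P i)"
      unfolding cutval_iff[OF tm[OF h(1)] h(2,3) refl] by (rule s)
    ultimately show ?thesis using h(1) by blast
  qed
  have const: "P i u = P i x" if "i \<in> I" "u \<in> U" "u \<preceq> x" "\<forall>c\<in>E. \<not> (u \<preceq> c \<and> c \<preceq> x)" for i u
  proof (cases "u = x")
    case False
    then have "u \<prec> x" using that(3) by simp
    moreover have "\<forall>c\<in>{u \<in> U. bdry (P i) u}. \<not> (u \<preceq> c \<and> c \<preceq> x)" using that(1,4) unfolding E_def by blast
    ultimately show ?thesis using breaks_bdry[OF tm[OF that(1)]] that(2) x unfolding breaks_def by blast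
  qed simp
  show ?thesis
  proof (cases "x \<in> E")
    case True
    show ?thesis by (rule disjI2, rule at[OF True, of True]) simp
  next
    case xE: False
    show ?thesis
    proof (cases "{c \<in> E. c \<prec> x} = {}")
      case True
      have "P i x = lgerm (P i)" if i: "i \<in> I" for i
      proof -
        have c: "P i u = P i x" if "u \<in> U" "u \<prec> x" for u
          by (rule const[OF i that(1)]) (use that True xE in \<open>auto simp: le_less\<close>)
        show ?thesis
        proof
          assume "P i x"
          then show "lgerm (P i)" unfolding lgerm_def using c x by blast
        next
          assume "lgerm (P i)"
          then obtain \<gamma> where g: "\<gamma> \<in> U" "\<forall>u\<in>U. u \<prec> \<gamma> \<longrightarrow> P i u" unfolding lgerm_def by blast
          have "min \<gamma> x \<in> U" using g(1) x by (simp add: min_def)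
          then obtain u where "u \<in> U" "u \<prec> min \<gamma> x" using ex_less by blast
          then show "P i x" using c g(2) by auto
        qed
      qed
      then show ?thesis by blast
    next
      case False
      have "finite {c \<in> E. c \<prec> x}" using E(1) by simp
      from finite_greatest[OF this False] obtain \<beta> where b: "\<beta> \<in> E" "\<beta> \<prec> x" "\<forall>c\<in>{c \<in> E. c \<prec> x}. c \<preceq> \<beta>" by blast
      have bU: "\<beta> \<in> U" using b(1) E(2) by blast
      have "P i x = rgerm (P i) \<beta>" if i: "i \<in> I" for i
      proof -
        have c: "P i u = P i x" if "u \<in> U" "\<beta> \<prec> u" "u \<prec> x" for u
        proof (rule const[OF i that(1)])
          show "u \<preceq> x" using that by simp
          show "\<forall>c\<in>E. \<not> (u \<preceq> c \<and> c \<preceq> x)"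
            using b(3) xE that(2) by (metis (mono_tags, lifting) le_less less_le_trans mem_Collect_eq not_less)
        qed
        show ?thesis
        proof
          assume "P i x"
          then show "rgerm (P i) \<beta>" unfolding rgerm_def using c x b(2) by blast
        next
          assume "rgerm (P i) \<beta>"
          then obtain \<gamma> where g: "\<gamma> \<in> U" "\<beta> \<prec> \<gamma>" "\<forall>u\<in>U. \<beta> \<prec> u \<longrightarrow> u \<prec> \<gamma> \<longrightarrow> P i u" unfolding rgerm_def by blast
          have "min \<gamma> x \<in> U" using g(1) x by (simp add: min_def)
          moreover have "\<beta> \<prec> min \<gamma> x" using g(2) b(2) by simp
          ultimately obtain u where "u \<in> U" "\<beta> \<prec> u" "u \<prec> min \<gamma> x" using dense[OF bU] by blast
          then show "P i x" using c g(3) by auto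
        qed
      qed
      then show ?thesis by (intro disjI2 at[OF b(1), of False]) simp
    qed
  qed
qed

section \<open>Cuts as formulas, and the count\<close>

text \<open>The hypothesis covers every reindexing \<open>\<sigma>\<close> because
  \<open>bdry\<close> binds variables and so shifts the assignment on which \<open>X\<close>
  depends; \<open>Def_cutval\<close> has the same form for the same reason.\<close>

lemma Def_bdry':
  assumes X: "\<And>\<sigma> t. T {} t \<Longrightarrow> Def {} (\<lambda>\<epsilon>. X (\<lambda>i. \<epsilon> (\<sigma> i)) (t \<epsilon>))" and t: "T {} t"
  shows "Def {} (\<lambda>\<epsilon>. bdry (X (\<lambda>i. \<epsilon> (\<sigma> i))) (t \<epsilon>))"
proof -
  have l: "T {} (\<lambda>e. t (\<lambda>i. e (\<sigma> i)))" for \<sigma> by (rule T_lift[OF t])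
  show ?thesis unfolding bdry_def
    by (intro dfs Def_ex[of "{}" "\<lambda>\<epsilon> x. \<epsilon> 1 \<prec> x"] X T_var l t)
qed

lemma Def_cutval:
  assumes X: "\<And>\<sigma> t. T {} t \<Longrightarrow> Def {} (\<lambda>\<epsilon>. X (\<lambda>i. \<epsilon> (\<sigma> i)) (t \<epsilon>))"
    and P: "\<And>\<sigma> t. T {} t \<Longrightarrow> Def {} (\<lambda>\<epsilon>. P (\<lambda>i. \<epsilon> (\<sigma> i)) (t \<epsilon>))"
    and fin: "\<And>\<epsilon>. env \<epsilon> \<Longrightarrow> finite {u \<in> U. bdry (X \<epsilon>) u}"
  shows "Def {} (\<lambda>\<epsilon>. cutval s j (X \<epsilon>) (P \<epsilon>))"
proof -
  have c: "card A = j \<longleftrightarrow> j \<le> card A \<and> \<not> Suc j \<le> card A" for A :: "'a set" by auto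
  have D: "Def {} (\<lambda>\<epsilon>. k \<le> card {u \<in> U. bdry (X (\<lambda>i. \<epsilon> (Suc i))) u \<and> u \<prec> \<epsilon> 0})" for k
  proof (rule Def_card[of "{}" "\<lambda>\<epsilon> u. bdry (X (\<lambda>i. \<epsilon> (Suc i))) u \<and> u \<prec> \<epsilon> 0"])
    show "Def {} (\<lambda>e. bdry (X (\<lambda>i. e (Suc (Suc i)))) (e 0) \<and> e 0 \<prec> e (Suc 0))"
      by (intro Def_conj Def_bdry'[of X] Def_less X T_var)
    show "finite {u \<in> U. bdry (X (\<lambda>i. e (Suc i))) u \<and> u \<prec> e 0}" if "env e" for e
      by (rule finite_subset[OF _ fin[OF env_Suc[OF that]]]) blast
  qed
  have R: "Def {} (\<lambda>\<epsilon>. if s then P (\<lambda>i. \<epsilon> (Suc i)) (\<epsilon> 0) else rgerm (P (\<lambda>i. \<epsilon> (Suc i))) (\<epsilon> 0))"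
  proof (cases s)
    case True
    then show ?thesis using P[of "\<lambda>\<epsilon>. \<epsilon> 0" Suc, OF T_var] by simp
  next
    case False
    have "Def {} (\<lambda>\<epsilon>. rgerm (P (\<lambda>i. \<epsilon> (Suc i))) (\<epsilon> 0))" unfolding rgerm_def by (intro dfs P T_var)
    then show ?thesis using False by simp
  qed
  show ?thesis unfolding cutval_def c
    by (rule Def_ex[of "{}" "\<lambda>\<epsilon> \<beta>. bdry (X \<epsilon>) \<beta> \<and> (j \<le> card {u \<in> U. bdry (X \<epsilon>) u \<and> u \<prec> \<beta>} \<and>
       \<not> Suc j \<le> card {u \<in> U. bdry (X \<epsilon>) u \<and> u \<prec> \<beta>}) \<and> (if s then P \<epsilon> \<beta> else rgerm (P \<epsilon>) \<beta>)"])
      (intro Def_conj Def_not D R Def_bdry'[of X] X T_var)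
qed

lemma Def_sat_lists:
  assumes "\<phi> \<in> formulas L (Suc (length is + (length js + length ks)))" "T A s"
  shows "Def A (\<lambda>e. sat S (s e # map (\<lambda>i. e (f i)) is @ map (\<lambda>i. e (g i)) js @ map (\<lambda>i. e (h i)) ks) \<phi>)"
proof -
  have "Def A (\<lambda>e. sat S (map (\<lambda>\<tau>. \<tau> e) [s] @ map (vl e) (map (\<lambda>i. Inl (f i)) is @ map (\<lambda>i. Inl (g i)) js @ map (\<lambda>i. Inl (h i)) ks)) \<phi>)"
    by (rule Def_sat_terms) (use assms in auto)
  then show ?thesis by (simp add: o_def)
qed

lemma tame_sat:
  assumes "\<phi> \<in> formulas L (Suc p)" "z \<in> nlists p U"
  shows "tame (\<lambda>u. sat S (u # z) \<phi>)"
proof (rule tame_Def[of "\<lambda>u. sat S (u # z) \<phi>"])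
  show "Def U (\<lambda>e. sat S (e 0 # z) \<phi>)"
    by (rule Def_sat_params) (use assms nlistsE_set[OF assms(2)] in simp_all)
qed

text \<open>The coordinate \<open>u\<close> is eliminated at the price of the parameter tuple
  \<open>b0\<close> that supplies the boundary point. This tuple joins the fixed parameters
  \<open>w\<close>, while \<open>b\<close> goes on ranging over the parameter set.\<close>

lemma cutval_formula:
  assumes \<phi>: "\<phi> \<in> formulas L (Suc (m + (n + q)))" and \<phi>0: "\<phi>0 \<in> formulas L (Suc (m + (n + q)))"
  obtains \<psi> where "\<psi> \<in> formulas L (m + (n + (n + q)))"
    "\<forall>a\<in>nlists m U. \<forall>b\<in>nlists n U. \<forall>b0\<in>nlists n U. \<forall>w\<in>nlists q U. sat S (a @ b @ b0 @ w) \<psi> \<longleftrightarrow>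
      cutval s j (\<lambda>u. sat S (u # a @ b0 @ w) \<phi>0) (\<lambda>u. sat S (u # a @ b @ w) \<phi>)"
proof -
  note concl = that
  let ?F = "\<lambda>a d. cutval s j (\<lambda>u. sat S (u # a @ take n (drop n d) @ drop (n + n) d) \<phi>0) (\<lambda>u. sat S (u # a @ take n d @ drop (n + n) d) \<phi>)"
  let ?N = "n + (n + q)"
  have m: "take n (drop n (map f [0..<?N])) = map f [n..<n + n]" "drop (n + n) (map f [0..<?N]) = map f [n + n..<?N]"
    "take n (map f [0..<?N]) = map f [0..<n]" for f :: "nat \<Rightarrow> 'a"
    by (simp_all add: take_map drop_map)
  have "Def {} (\<lambda>e. ?F (map (\<lambda>i. e i) [0..<m]) (map (\<lambda>i. e (m + i)) [0..<?N]))"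
    unfolding m
  proof (rule Def_cutval[of "\<lambda>e u. sat S (u # map (\<lambda>i. e i) [0..<m] @ map (\<lambda>i. e (m + i)) [n..<n + n] @ map (\<lambda>i. e (m + i)) [n + n..<?N]) \<phi>0"
      "\<lambda>e u. sat S (u # map (\<lambda>i. e i) [0..<m] @ map (\<lambda>i. e (m + i)) [0..<n] @ map (\<lambda>i. e (m + i)) [n + n..<?N]) \<phi>"])
    fix \<epsilon> assume "env \<epsilon>"
    then have "map (\<lambda>i. \<epsilon> i) [0..<m] @ map (\<lambda>i. \<epsilon> (m + i)) [n..<n + n] @ map (\<lambda>i. \<epsilon> (m + i)) [n + n..<?N] \<in> nlists (m + (n + q)) U"
      by (intro nlistsI) (auto simp: env_nth)
    from finite_bdry[OF tame_sat[OF \<phi>0 this]]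
    show "finite {u \<in> U. bdry (\<lambda>u. sat S (u # map \<epsilon> [0..<m] @ map (\<lambda>i. \<epsilon> (m + i)) [n..<n + n] @ map (\<lambda>i. \<epsilon> (m + i)) [n + n..<?N]) \<phi>0) u}" by simp
  qed (intro Def_sat_lists; use \<phi> \<phi>0 in simp)+
  then obtain \<psi> where \<psi>: "\<psi> \<in> formulas L (m + ?N)" "\<forall>a\<in>nlists m U. \<forall>d\<in>nlists ?N U. ?F a d \<longleftrightarrow> sat S (a @ d) \<psi>"
    by (rule Def_pair_formula[of ?F]) (rule that)
  show thesis
  proof (rule concl[OF \<psi>(1)], intro ballI)
    fix a b b0 w assume a: "a \<in> nlists m U" "b \<in> nlists n U" "b0 \<in> nlists n U" "w \<in> nlists q U"
    have "b @ b0 @ w \<in> nlists ?N U"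
      using a nlistsE_set[OF a(2)] nlistsE_set[OF a(3)] nlistsE_set[OF a(4)] by (intro nlistsI) simp_all
    from \<psi>(2)[rule_format, OF a(1) this]
    show "sat S (a @ b @ b0 @ w) \<psi> \<longleftrightarrow> cutval s j (\<lambda>u. sat S (u # a @ b0 @ w) \<phi>0) (\<lambda>u. sat S (u # a @ b @ w) \<phi>)"
      using a by simp
  qed
qed

lemma lgerm_formula:
  assumes \<phi>: "\<phi> \<in> formulas L (Suc (m + n))"
  obtains \<psi> where "\<psi> \<in> formulas L (m + n)"
    "\<forall>a\<in>nlists m U. \<forall>b\<in>nlists n U. sat S (a @ b) \<psi> \<longleftrightarrow> lgerm (\<lambda>u. sat S (u # a @ b) \<phi>)"
proof -
  let ?F = "\<lambda>a d. lgerm (\<lambda>u. sat S (u # a @ d) \<phi>)"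
  have "Def {} (\<lambda>e. ?F (map (\<lambda>i. e i) [0..<m]) (map (\<lambda>i. e (m + i)) [0..<n]))"
    unfolding lgerm_def by (intro dfs Def_sat_pair \<phi> T_var)
  then obtain \<psi> where \<psi>: "\<psi> \<in> formulas L (m + n)" "\<forall>a\<in>nlists m U. \<forall>d\<in>nlists n U. ?F a d \<longleftrightarrow> sat S (a @ d) \<psi>"
    by (rule Def_pair_formula[of ?F]) (rule that)
  then show thesis using that by simp
qed

text \<open>By \<open>cut_type\<close> the first coordinate is described by one of at most
  \<open>2 * K * card \<Phi> * card B\<close> names, or by the germ at minus infinity. Given the
  name, the type of the point is determined by the type of the remaining coordinates for new
  formulas, so each coordinate contributes a factor linear in \<open>card B\<close>. The fixed tuple
  \<open>w\<close> collects the parameters of earlier names; the constant does not depend on it.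
  Formulas are indexed by \<open>\<Phi>\<close> through \<open>f\<close>, so that the index set
  stays the same while the formulas change.\<close>

lemma type_count:
  fixes \<Phi> :: "'i set"
  assumes UT: "\<And>p \<phi>. \<phi> \<in> formulas L (Suc p) \<Longrightarrow> \<exists>K. \<forall>z\<in>nlists p U. sat S z (tamef ltr K p \<phi>)"
    and \<Phi>: "finite \<Phi>" and f: "f ` \<Phi> \<subseteq> formulas L (m + (n + q))"
  shows "\<exists>C. \<forall>B w. finite B \<longrightarrow> B \<noteq> {} \<longrightarrow> B \<subseteq> nlists n U \<longrightarrow> w \<in> nlists q U \<longrightarrow>
    card ((\<lambda>a. {(\<phi>, b). \<phi> \<in> \<Phi> \<and> b \<in> B \<and> sat S (a @ b @ w) (f \<phi>)}) ` nlists m U) \<le> C * card B ^ m"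
  using f
proof (induction m arbitrary: q f)
  case 0
  show ?case by (rule exI[of _ 1]) simp
next
  case (Suc m)
  let ?types = "\<lambda>m f B w. (\<lambda>a. {(\<phi>, b). \<phi> \<in> \<Phi> \<and> b \<in> B \<and> sat S (a @ b @ w) (f \<phi>)}) ` nlists m U"
  have F: "f \<phi> \<in> formulas L (Suc (m + (n + q)))" if "\<phi> \<in> \<Phi>" for \<phi>
    using Suc.prems that by (simp add: image_subset_iff)
  have "\<exists>K. \<forall>z\<in>nlists (m + (n + q)) U. card {u \<in> U. bdry (\<lambda>u. sat S (u # z) (f \<phi>)) u} \<le> K" if \<phi>: "\<phi> \<in> \<Phi>" for \<phi>
  proof -
    obtain K where K: "\<forall>z\<in>nlists (m + (n + q)) U. sat S z (tamef ltr K (m + (n + q)) (f \<phi>))"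
      using UT[OF F[OF \<phi>]] by (rule exE) (rule that)
    have "card {u \<in> U. bdry (\<lambda>u. sat S (u # z) (f \<phi>)) u} \<le> K" if z: "z \<in> nlists (m + (n + q)) U" for z
    proof -
      obtain G where G: "finite G" "G \<subseteq> U" "card G \<le> K" "breaks G (\<lambda>u. sat S (u # z) (f \<phi>))"
        using bspec[OF K z] unfolding sat_tamef[OF F[OF \<phi>] z] by (elim exE conjE) (rule that)
      show ?thesis using card_mono[OF G(1) bdry_subset[OF G(1,2,4)]] G(3) by simp
    qed
    then show ?thesis by blast
  qed
  then have "\<forall>\<phi>\<in>\<Phi>. \<exists>K. \<forall>z\<in>nlists (m + (n + q)) U. card {u \<in> U. bdry (\<lambda>u. sat S (u # z) (f \<phi>)) u} \<le> K" by (rule ballI)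
  then obtain \<kappa> where \<kappa>: "\<forall>\<phi>\<in>\<Phi>. \<forall>z\<in>nlists (m + (n + q)) U. card {u \<in> U. bdry (\<lambda>u. sat S (u # z) (f \<phi>)) u} \<le> \<kappa> \<phi>"
    by (rule bchoice[THEN exE])
  define K where "K = sum \<kappa> \<Phi>"
  have K: "card {u \<in> U. bdry (\<lambda>u. sat S (u # z) (f \<phi>)) u} \<le> K" if "\<phi> \<in> \<Phi>" "z \<in> nlists (m + (n + q)) U" for \<phi> z
  proof -
    have "\<kappa> \<phi> \<le> K" unfolding K_def by (rule member_le_sum) (use that \<Phi> in auto)
    then show ?thesis using \<kappa> that by (meson le_trans)
  qed
  let ?good = "\<lambda>s j h \<phi> \<psi>. \<psi> \<in> formulas L (m + (n + (n + q))) \<and>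
    (\<forall>a\<in>nlists m U. \<forall>b\<in>nlists n U. \<forall>c\<in>nlists n U. \<forall>w\<in>nlists q U. sat S (a @ b @ c @ w) \<psi> \<longleftrightarrow>
      cutval s j (\<lambda>u. sat S (u # a @ c @ w) (f h)) (\<lambda>u. sat S (u # a @ b @ w) (f \<phi>)))"
  define \<psi> where "\<psi> s j h \<phi> = (SOME \<psi>. ?good s j h \<phi> \<psi>)" for s j h \<phi>
  have \<psi>: "?good s j h \<phi> (\<psi> s j h \<phi>)" if "h \<in> \<Phi>" "\<phi> \<in> \<Phi>" for s j h \<phi>
    unfolding \<psi>_def
  proof (rule someI_ex)
    note hyp = that
    obtain \<psi> where "\<psi> \<in> formulas L (m + (n + (n + q)))"
      "\<forall>a\<in>nlists m U. \<forall>b\<in>nlists n U. \<forall>c\<in>nlists n U. \<forall>w\<in>nlists q U. sat S (a @ b @ c @ w) \<psi> \<longleftrightarrow>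
      cutval s j (\<lambda>u. sat S (u # a @ c @ w) (f h)) (\<lambda>u. sat S (u # a @ b @ w) (f \<phi>))"
      by (rule cutval_formula[OF F[OF hyp(2)] F[OF hyp(1)], of s j]) (rule that)
    then show "\<exists>\<psi>. ?good s j h \<phi> \<psi>" by (intro exI conjI)
  qed
  let ?goodl = "\<lambda>\<phi> \<psi>. \<psi> \<in> formulas L (m + (n + q)) \<and>
    (\<forall>a\<in>nlists m U. \<forall>b\<in>nlists (n + q) U. sat S (a @ b) \<psi> \<longleftrightarrow> lgerm (\<lambda>u. sat S (u # a @ b) (f \<phi>)))"
  define \<psi>l where "\<psi>l \<phi> = (SOME \<psi>. ?goodl \<phi> \<psi>)" for \<phi>
  have \<psi>l: "?goodl \<phi> (\<psi>l \<phi>)" if "\<phi> \<in> \<Phi>" for \<phi>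
    unfolding \<psi>l_def
  proof (rule someI_ex)
    note hyp = that
    obtain \<psi> where "\<psi> \<in> formulas L (m + (n + q))"
      "\<forall>a\<in>nlists m U. \<forall>b\<in>nlists (n + q) U. sat S (a @ b) \<psi> \<longleftrightarrow> lgerm (\<lambda>u. sat S (u # a @ b) (f \<phi>))"
      by (rule lgerm_formula[OF F[OF hyp]]) (rule that)
    then show "\<exists>\<psi>. ?goodl \<phi> \<psi>" by (intro exI conjI)
  qed
  have "\<psi>l ` \<Phi> \<subseteq> formulas L (m + (n + q))" using \<psi>l by (intro image_subsetI) (rule conjunct1)
  from Suc.IH[OF this] obtain Cl where
    Cl: "\<forall>B w. finite B \<longrightarrow> B \<noteq> {} \<longrightarrow> B \<subseteq> nlists n U \<longrightarrow> w \<in> nlists q U \<longrightarrow> card (?types m \<psi>l B w) \<le> Cl * card B ^ m"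
    by (rule exE) (rule that)
  \<comment> \<open>The part of a name that does not depend on \<open>B\<close>; the tuple from
    \<open>B\<close> that completes it is appended to \<open>w\<close>.\<close>
  let ?T = "(UNIV :: bool set) \<times> {..<K} \<times> \<Phi>"
  have "\<forall>t\<in>?T. \<exists>C. \<forall>B w. finite B \<longrightarrow> B \<noteq> {} \<longrightarrow> B \<subseteq> nlists n U \<longrightarrow> w \<in> nlists (n + q) U \<longrightarrow>
      card (?types m (\<psi> (fst t) (fst (snd t)) (snd (snd t))) B w) \<le> C * card B ^ m"
  proof
    fix t assume "t \<in> ?T"
    then have "snd (snd t) \<in> \<Phi>" by auto
    then have "\<psi> (fst t) (fst (snd t)) (snd (snd t)) ` \<Phi> \<subseteq> formulas L (m + (n + (n + q)))"
      using \<psi> by (intro image_subsetI) (rule conjunct1)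
    then show "\<exists>C. \<forall>B w. finite B \<longrightarrow> B \<noteq> {} \<longrightarrow> B \<subseteq> nlists n U \<longrightarrow> w \<in> nlists (n + q) U \<longrightarrow>
      card (?types m (\<psi> (fst t) (fst (snd t)) (snd (snd t))) B w) \<le> C * card B ^ m" by (rule Suc.IH)
  qed
  then obtain C where C: "\<forall>t\<in>?T. \<forall>B w. finite B \<longrightarrow> B \<noteq> {} \<longrightarrow> B \<subseteq> nlists n U \<longrightarrow> w \<in> nlists (n + q) U \<longrightarrow>
      card (?types m (\<psi> (fst t) (fst (snd t)) (snd (snd t))) B w) \<le> C t * card B ^ m" by (rule bchoice[THEN exE])
  have fT: "finite ?T" using \<Phi> by simp
  show ?case
  proof (intro exI[of _ "Cl + sum C ?T"] allI impI)
    fix B w assume B: "finite B" "B \<noteq> {}" "B \<subseteq> nlists n U" and w: "w \<in> nlists q U"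
    have cw: "c @ w \<in> nlists (n + q) U" if "c \<in> B" for c
    proof -
      have "c \<in> nlists n U" using that B(3) by blast
      then show ?thesis using w nlistsE_set[of c n U] nlistsE_set[OF w] by (intro nlistsI) simp_all
    qed
    let ?R = "?types m \<psi>l B w \<union> (\<Union>t\<in>?T. \<Union>c\<in>B. ?types m (\<psi> (fst t) (fst (snd t)) (snd (snd t))) B (c @ w))"
    have fin: "finite (?types k g B' v)" if "finite B'" for k g B' v
    proof (rule finite_subset)
      show "?types k g B' v \<subseteq> Pow (\<Phi> \<times> B')" by blast
    qed (use \<Phi> that in simp)
    have sub: "?types (Suc m) f B w \<subseteq> ?R"
    proof (rule image_subsetI)
      fix a assume "a \<in> nlists (Suc m) U"
      then obtain x a' where a: "a = x # a'" "x \<in> U" "a' \<in> nlists m U" unfolding in_nlists_Suc_iff by blast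
      have z: "a' @ b @ w \<in> nlists (m + (n + q)) U" if "b \<in> B" for b
        using a(3) cw[OF that] nlistsE_set[OF a(3)] nlistsE_set[OF cw[OF that]] nlistsE_length[OF cw[OF that]] by (intro nlistsI) simp_all
      let ?P = "\<lambda>(\<phi>, b) u. sat S (u # a' @ b @ w) (f \<phi>)"
      have "(\<forall>i\<in>\<Phi> \<times> B. ?P i x = lgerm (?P i)) \<or> (\<exists>h\<in>\<Phi> \<times> B. \<exists>s. \<exists>j<K. \<forall>i\<in>\<Phi> \<times> B. ?P i x = cutval s j (?P h) (?P i))"
      proof (rule cut_type[OF _ _ a(2)])
        show "finite (\<Phi> \<times> B)" using \<Phi> B(1) by simp
        fix i assume "i \<in> \<Phi> \<times> B"
        then obtain \<phi> b where i: "i = (\<phi>, b)" "\<phi> \<in> \<Phi>" "b \<in> B" by blast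
        show "tame (?P i)" unfolding i(1) case_prod_conv by (rule tame_sat[OF F[OF i(2)] z[OF i(3)]])
        show "card {u \<in> U. bdry (?P i) u} \<le> K" unfolding i(1) case_prod_conv by (rule K[OF i(2) z[OF i(3)]])
      qed
      then show "{(\<phi>, b). \<phi> \<in> \<Phi> \<and> b \<in> B \<and> sat S (a @ b @ w) (f \<phi>)} \<in> ?R"
      proof
        assume l: "\<forall>i\<in>\<Phi> \<times> B. ?P i x = lgerm (?P i)"
        have "sat S (a @ b @ w) (f \<phi>) \<longleftrightarrow> sat S (a' @ b @ w) (\<psi>l \<phi>)" if "\<phi> \<in> \<Phi>" "b \<in> B" for \<phi> b
          using bspec[OF l, of "(\<phi>, b)"] \<psi>l[OF that(1)] that a(1,3) cw[OF that(2)] by simp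
        then have "{(\<phi>, b). \<phi> \<in> \<Phi> \<and> b \<in> B \<and> sat S (a @ b @ w) (f \<phi>)} = {(\<phi>, b). \<phi> \<in> \<Phi> \<and> b \<in> B \<and> sat S (a' @ b @ w) (\<psi>l \<phi>)}" by blast
        then show ?thesis using a(3) by blast
      next
        assume "\<exists>h\<in>\<Phi> \<times> B. \<exists>s. \<exists>j<K. \<forall>i\<in>\<Phi> \<times> B. ?P i x = cutval s j (?P h) (?P i)"
        then obtain h c s j where hc: "h \<in> \<Phi>" "c \<in> B" and j: "j < K"
          and l: "\<forall>i\<in>\<Phi> \<times> B. ?P i x = cutval s j (?P (h, c)) (?P i)" by blast
        have "sat S (a @ b @ w) (f \<phi>) \<longleftrightarrow> sat S (a' @ b @ c @ w) (\<psi> s j h \<phi>)" if "\<phi> \<in> \<Phi>" "b \<in> B" for \<phi> b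
        proof -
          have "b \<in> nlists n U" "c \<in> nlists n U" using B(3) that hc by blast+
          then have "sat S (a' @ b @ c @ w) (\<psi> s j h \<phi>) \<longleftrightarrow>
            cutval s j (\<lambda>u. sat S (u # a' @ c @ w) (f h)) (\<lambda>u. sat S (u # a' @ b @ w) (f \<phi>))"
            using conjunct2[OF \<psi>[OF hc(1) that(1), of s j]] a(3) w by blast
          then show ?thesis using bspec[OF l, of "(\<phi>, b)"] that a(1) by simp
        qed
        then have "{(\<phi>, b). \<phi> \<in> \<Phi> \<and> b \<in> B \<and> sat S (a @ b @ w) (f \<phi>)} =
          {(\<phi>, b). \<phi> \<in> \<Phi> \<and> b \<in> B \<and> sat S (a' @ b @ c @ w) (\<psi> s j h \<phi>)}" by blast
        then have "{(\<phi>, b). \<phi> \<in> \<Phi> \<and> b \<in> B \<and> sat S (a @ b @ w) (f \<phi>)} \<in> ?types m (\<psi> s j h) B (c @ w)" using a(3) by blast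
        moreover have "(s, j, h) \<in> ?T" using hc(1) j by simp
        ultimately show ?thesis using hc(2) by (intro UnI2 UN_I[of "(s, j, h)"] UN_I[of c]) simp_all
      qed
    qed
    have "card (?types (Suc m) f B w) \<le> card ?R"
      by (rule card_mono[OF _ sub]) (intro finite_UnI finite_UN_I fin B fT)
    also have "\<dots> \<le> card (?types m \<psi>l B w) + (\<Sum>t\<in>?T. \<Sum>c\<in>B. card (?types m (\<psi> (fst t) (fst (snd t)) (snd (snd t))) B (c @ w)))"
      by (intro Nat.le_trans[OF card_Un_le] add_left_mono Nat.le_trans[OF card_UN_le[OF fT]] sum_mono card_UN_le[OF B(1)])
    also have "\<dots> \<le> Cl * card B ^ m + (\<Sum>t\<in>?T. \<Sum>c\<in>B. C t * card B ^ m)"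
      by (intro add_mono sum_mono Cl[rule_format] C[rule_format] B w cw)
    also have "\<dots> = Cl * card B ^ m + sum C ?T * card B ^ Suc m"
      by (simp add: sum_distrib_left sum_distrib_right mult_ac)
    \<comment> \<open>The points described by the germ at minus infinity contribute only the power
      \<open>m\<close>, which is absorbed because \<open>B\<close> is nonempty.\<close>
    also have "\<dots> \<le> Cl * card B ^ Suc m + sum C ?T * card B ^ Suc m"
    proof -
      have "1 \<le> card B" using B(1,2) by (simp add: Suc_le_eq card_gt_0_iff)
      then have "card B ^ m \<le> card B ^ Suc m" by simp
      then show ?thesis by (intro add_right_mono mult_left_mono) simp_all
    qed
    finally show "card (?types (Suc m) f B w) \<le> (Cl + sum C ?T) * card B ^ Suc m" by (simp add: algebra_simps)
  qed
qed

end

section \<open>Distal cell decompositions from chain formulas\<close>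

lemma is_term_mono: "is_term L n t \<Longrightarrow> n \<le> k \<Longrightarrow> is_term L k t"
  by (induction t) auto

lemma formulas_mono: assumes "\<phi> \<in> formulas L n" "n \<le> k" shows "\<phi> \<in> formulas L k"
proof -
  have "is_formula L n \<phi> \<Longrightarrow> n \<le> k \<Longrightarrow> is_formula L k \<phi>"
    by (induction \<phi> arbitrary: n k) (auto intro: is_term_mono)
  then show ?thesis using assms by (simp add: formulas_def)
qed

text \<open>
  The exclusion formula is a function of the cell formula, so it is written into the cell formula as
  part of a tautology.
\<close>

lemma ex_cell_data:
  assumes \<Theta>: "finite \<Theta>" "\<And>\<psi> \<theta>. (\<psi>, \<theta>) \<in> \<Theta> \<Longrightarrow> \<psi> \<in> formulas L (m + k * n) \<and> \<theta> \<in> formulas L (n + k * n)"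
  obtains T where "num_params T = k" "finite (cell_fms T)" "cell_fms T \<subseteq> formulas L (m + k * n)"
    "\<forall>\<psi>\<in>cell_fms T. excl_fm T \<psi> \<in> formulas L (n + k * n)"
    "\<forall>(M :: ('f, 'r, 'a) struct) B. cells M m T B = {solutions M m \<psi> (concat bs) | \<psi> \<theta> bs.
        (\<psi>, \<theta>) \<in> \<Theta> \<and> bs \<in> nlists k B \<and> \<not> (\<exists>b\<in>B. sat M (b @ concat bs) \<theta>)}"
proof -
  \<comment> \<open>Quantifying all variables makes \<open>\<theta>\<close> a sentence, which may be
    placed inside a formula with other free variables and from which \<open>\<theta>\<close> can be
    recovered, as \<open>Exs\<close> is injective.\<close>
  let ?X = "\<lambda>\<theta>. Exs (n + k * n) \<theta> :: ('f, 'r) fm"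
  define code where "code = (\<lambda>(\<psi>, \<theta>). Conj \<psi> (Neg (Conj (?X \<theta>) (Neg (?X \<theta>)))))"
  define T where "T = \<lparr>num_params = k, cell_fms = code ` \<Theta>, excl_fm = (\<lambda>\<psi>. THE \<theta>. \<exists>\<psi>'. \<psi> = code (\<psi>', \<theta>))\<rparr>"
  have ex: "excl_fm T (code (\<psi>, \<theta>)) = \<theta>" for \<psi> \<theta>
    unfolding T_def code_def by (auto simp: Exs_inject)
  have sol: "solutions M m (code (\<psi>, \<theta>)) b = solutions M m \<psi> b" for M :: "('f, 'r, 'a) struct" and \<psi> \<theta> b
    by (auto simp: solutions_def code_def)
  show thesis
  proof (rule that[of T])
    show "num_params T = k" "finite (cell_fms T)" using \<Theta>(1) by (simp_all add: T_def)
    have "?X \<theta> \<in> formulas L (m + k * n)" if "\<theta> \<in> formulas L (n + k * n)" for \<theta>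
      by (rule formulas_mono[of _ _ 0]) (use that in \<open>auto intro: Exs_formulas\<close>)
    then show "cell_fms T \<subseteq> formulas L (m + k * n)" using \<Theta>(2) by (auto simp: T_def code_def)
    show "\<forall>\<psi>\<in>cell_fms T. excl_fm T \<psi> \<in> formulas L (n + k * n)"
    proof
      fix \<psi> assume "\<psi> \<in> cell_fms T"
      then obtain \<psi>' \<theta> where "\<psi> = code (\<psi>', \<theta>)" "(\<psi>', \<theta>) \<in> \<Theta>" by (auto simp: T_def)
      then show "excl_fm T \<psi> \<in> formulas L (n + k * n)" using ex \<Theta>(2) by simp
    qed
    show "\<forall>(M :: ('f, 'r, 'a) struct) B. cells M m T B = {solutions M m \<psi> (concat bs) | \<psi> \<theta> bs.
        (\<psi>, \<theta>) \<in> \<Theta> \<and> bs \<in> nlists k B \<and> \<not> (\<exists>b\<in>B. sat M (b @ concat bs) \<theta>)}"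
    proof (intro allI)
      fix M :: "('f, 'r, 'a) struct" and B
      have "cells M m T B = {solutions M m (code p) (concat bs) | p bs.
        p \<in> \<Theta> \<and> bs \<in> nlists k B \<and> \<not> (\<exists>b\<in>B. sat M (b @ concat bs) (excl_fm T (code p)))}"
        unfolding cells_def by (auto simp: T_def)
      also have "\<dots> = {solutions M m \<psi> (concat bs) | \<psi> \<theta> bs.
        (\<psi>, \<theta>) \<in> \<Theta> \<and> bs \<in> nlists k B \<and> \<not> (\<exists>b\<in>B. sat M (b @ concat bs) \<theta>)}"
        by (simp add: split_paired_Ex ex sol)
      finally show "cells M m T B = {solutions M m \<psi> (concat bs) | \<psi> \<theta> bs.
        (\<psi>, \<theta>) \<in> \<Theta> \<and> bs \<in> nlists k B \<and> \<not> (\<exists>b\<in>B. sat M (b @ concat bs) \<theta>)}" .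
    qed
  qed
qed

lemma nth_concat_blocks:
  "(\<And>b. b \<in> set bs \<Longrightarrow> length b = n) \<Longrightarrow> i < length bs \<Longrightarrow> j < n \<Longrightarrow> concat bs ! (i * n + j) = bs ! i ! j"
proof (induction bs arbitrary: i)
  case (Cons b bs)
  then show ?case by (cases i) (auto simp: nth_append)
qed simp

lemma map_nth_block:
  assumes "\<And>b. b \<in> set bs \<Longrightarrow> length b = n" "i < length bs" "length a = m"
  shows "map ((!) (a @ concat bs)) [m + i * n..<m + i * n + n] = bs ! i"
proof (rule nth_equalityI)
  show "length (map ((!) (a @ concat bs)) [m + i * n..<m + i * n + n]) = length (bs ! i)"
    using assms(1)[of "bs ! i"] assms(2) by simp
  fix j assume "j < length (map ((!) (a @ concat bs)) [m + i * n..<m + i * n + n])"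
  then have j: "j < n" by simp
  then show "map ((!) (a @ concat bs)) [m + i * n..<m + i * n + n] ! j = bs ! i ! j"
    using nth_concat_blocks[OF assms(1,2) j] assms(3) by (simp add: nth_append add.assoc)
qed

lemma chain_least:
  assumes "finite A" "A \<noteq> {}" "\<And>b b'. b \<in> A \<Longrightarrow> b' \<in> A \<Longrightarrow> F b \<subseteq> F b' \<or> F b' \<subseteq> F b"
  shows "\<exists>b\<in>A. \<forall>b'\<in>A. F b \<subseteq> F b'"
proof -
  obtain X where X: "X \<in> F ` A" "\<forall>Y\<in>F ` A. Y \<subseteq> X \<longrightarrow> X = Y"
    using finite_has_minimal[of "F ` A"] assms(1,2) by auto
  then obtain b where b: "b \<in> A" "X = F b" by blast
  then have "F b \<subseteq> F b'" if "b' \<in> A" for b' using assms(3)[OF b(1) that] X(2) that by blast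
  then show ?thesis using b(1) by blast
qed

lemma chain_greatest:
  assumes "finite A" "A \<noteq> {}" "\<And>b b'. b \<in> A \<Longrightarrow> b' \<in> A \<Longrightarrow> F b \<subseteq> F b' \<or> F b' \<subseteq> F b"
  shows "\<exists>b\<in>A. \<forall>b'\<in>A. F b' \<subseteq> F b"
  using chain_least[of A "\<lambda>b. - F b"] assms by blast

text \<open>
  In a cell, the \<open>i\<close>-th chain has the least member containing the cell at \<open>y\<^sub>i\<close> and the greatest member
  missing it at \<open>y\<^sub>r\<^sub>+\<^sub>i\<close>; these exist for \<open>i\<close> in \<open>P\<close> and \<open>Q\<close>, respectively.
\<close>

lemma dcc_of_chains:
  fixes M :: "('f, 'r, 'a) struct" and \<chi> :: "nat \<Rightarrow> ('f, 'r) fm"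
  assumes chain: "\<And>i. i < r \<Longrightarrow> chain_fm L M m n (\<chi> i)"
    and det: "\<And>\<phi> c c'. \<phi> \<in> \<Phi> \<Longrightarrow> c \<in> nlists (m + n) (univ M) \<Longrightarrow> c' \<in> nlists (m + n) (univ M) \<Longrightarrow>
      \<forall>i<r. sat M c (\<chi> i) = sat M c' (\<chi> i) \<Longrightarrow> sat M c \<phi> = sat M c' \<phi>"
    and count: "\<And>B. finite B \<Longrightarrow> B \<noteq> {} \<Longrightarrow> B \<subseteq> nlists n (univ M) \<Longrightarrow>
      card ((\<lambda>a. {(i, b). i < r \<and> b \<in> B \<and> sat M (a @ b) (\<chi> i)}) ` nlists m (univ M)) \<le> C * card B ^ m"
  shows "\<exists>T. distal_cell_decomposition L M m n \<Phi> T \<and> has_exponent M m n T (real m)"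
proof -
  let ?U = "univ M" and ?k = "r + r"
  let ?s = "\<lambda>i b. solutions M m (\<chi> i) b"
  have \<chi>: "\<chi> i \<in> formulas L (m + n)" if "i < r" for i using chain[OF that] by (simp add: chain_fm_def)
  let ?y = "\<lambda>d i. [d + i * n..<d + i * n + n]"
  define \<psi> where "\<psi> P Q = Conjs (map (\<lambda>i. sub ([0..<m] @ ?y m i) (\<chi> i)) (filter (\<lambda>i. i \<in> P) [0..<r]) @
    map (\<lambda>i. Neg (sub ([0..<m] @ ?y m (r + i)) (\<chi> i))) (filter (\<lambda>i. i \<in> Q) [0..<r]))" for P Q
  \<comment> \<open>A tuple is excluded if, for some chain, its member neither contains the least
    member around the cell nor is contained in the greatest member missing it. Such a member might
    cut the cell.\<close>
  define \<theta> where "\<theta> P Q = Neg (Conjs (map (\<lambda>i. Neg (Conjs ((if i \<in> P then [Neg (incl_fm m (?y n i) [0..<n] (\<chi> i))] else []) @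
    (if i \<in> Q then [Neg (incl_fm m [0..<n] (?y n (r + i)) (\<chi> i))] else [])))) [0..<r]))" for P Q
  have blk: "d + i * n + n \<le> d + ?k * n" if "i < ?k" for i d
    using mult_le_mono1[of "Suc i" ?k n] that by simp
  have yl: "length (?y d i) = n" for d i by simp
  have yk: "v < d + ?k * n" if "v \<in> set (?y d i)" "i < ?k" for v d i using that blk[OF that(2), of d] by auto
  have \<psi>F: "\<psi> P Q \<in> formulas L (m + ?k * n)" for P Q
  proof -
    have "sub ([0..<m] @ ?y m i) (\<chi> j) \<in> formulas L (m + ?k * n)" if "i < ?k" "j < r" for i j
      by (rule sub_formulas) (use \<chi>[OF that(2)] yk[OF _ that(1)] in \<open>simp, force\<close>)
    then show ?thesis unfolding \<psi>_def by (intro Conjs_formulas) auto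
  qed
  have \<theta>F: "\<theta> P Q \<in> formulas L (n + ?k * n)" for P Q
  proof -
    have "incl_fm m (?y n i) [0..<n] (\<chi> i) \<in> formulas L (n + ?k * n)" if "i < r" for i
      by (rule incl_fm_formulas[OF \<chi>[OF that]]) (use yk[of _ n i] that in force)+
    moreover have "incl_fm m [0..<n] (?y n (r + i)) (\<chi> i) \<in> formulas L (n + ?k * n)" if "i < r" for i
      by (rule incl_fm_formulas[OF \<chi>[OF that]]) (use yk[of _ n "r + i"] that in force)+
    ultimately show ?thesis unfolding \<theta>_def formulas_simps(1)
      by (intro Conjs_formulas) (auto simp: Conjs_formulas simp del: sat.simps intro!: Conjs_formulas split: if_splits)
  qed
  let ?\<Theta> = "(\<lambda>(P, Q). (\<psi> P Q, \<theta> P Q)) ` (Pow {..<r} \<times> Pow {..<r})"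
  obtain T where T: "num_params T = ?k" "finite (cell_fms T)" "cell_fms T \<subseteq> formulas L (m + ?k * n)"
    "\<forall>\<psi>\<in>cell_fms T. excl_fm T \<psi> \<in> formulas L (n + ?k * n)"
    "\<forall>(M :: ('f, 'r, 'a) struct) B. cells M m T B = {solutions M m \<psi> (concat bs) | \<psi> \<theta> bs.
        (\<psi>, \<theta>) \<in> ?\<Theta> \<and> bs \<in> nlists ?k B \<and> \<not> (\<exists>b\<in>B. sat M (b @ concat bs) \<theta>)}"
    by (rule ex_cell_data[of ?\<Theta> L m ?k n]) (use \<psi>F \<theta>F in auto)
  have bl: "length b = n" if "bs \<in> nlists ?k B" "B \<subseteq> nlists n ?U" "b \<in> set bs" for bs B b
    using nlistsE_set[OF that(1)] that(2,3) nlistsE_length[of b n ?U] by blast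
  have bi: "bs ! i \<in> B" if "bs \<in> nlists ?k B" "i < ?k" for bs B i using nlistsE_nth_in[OF that] .
  have ps: "a \<in> solutions M m (\<psi> P Q) (concat bs) \<longleftrightarrow>
      a \<in> nlists m ?U \<and> (\<forall>i\<in>P. a \<in> ?s i (bs ! i)) \<and> (\<forall>i\<in>Q. a \<notin> ?s i (bs ! (r + i)))"
    if bs: "bs \<in> nlists ?k B" "B \<subseteq> nlists n ?U" and PQ: "P \<subseteq> {..<r}" "Q \<subseteq> {..<r}" for a P Q bs B
  proof (cases "a \<in> nlists m ?U")
    case True
    have la: "length a = m" using True by simp
    have lb: "length bs = ?k" using bs(1) by simp
    have s: "sat M (a @ concat bs) (sub ([0..<m] @ ?y m j) (\<chi> i)) \<longleftrightarrow> a \<in> ?s i (bs ! j)" if "i < r" "j < ?k" for i j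
    proof -
      have "map ((!) (a @ concat bs)) [0..<m] = a" using la by (auto intro!: nth_equalityI simp: nth_append)
      moreover have "map ((!) (a @ concat bs)) (?y m j) = bs ! j"
        by (rule map_nth_block[OF _ _ la]) (use bl[OF bs] that(2) lb in auto)
      moreover have "\<chi> i \<in> formulas L (length ([0..<m] @ ?y m j))" using \<chi>[OF that(1)] by simp
      ultimately show ?thesis using True sat_sub[of "\<chi> i" L "[0..<m] @ ?y m j" M "a @ concat bs"] by (simp add: solutions_def)
    qed
    have "sat M (a @ concat bs) (\<psi> P Q) \<longleftrightarrow>
        (\<forall>i\<in>{i. i < r \<and> i \<in> P}. sat M (a @ concat bs) (sub ([0..<m] @ ?y m i) (\<chi> i))) \<and>
        (\<forall>i\<in>{i. i < r \<and> i \<in> Q}. \<not> sat M (a @ concat bs) (sub ([0..<m] @ ?y m (r + i)) (\<chi> i)))"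
      unfolding \<psi>_def sat_Conjs by (simp add: ball_Un)
    also have "\<dots> \<longleftrightarrow> (\<forall>i\<in>{i. i < r \<and> i \<in> P}. a \<in> ?s i (bs ! i)) \<and> (\<forall>i\<in>{i. i < r \<and> i \<in> Q}. a \<notin> ?s i (bs ! (r + i)))"
      using s by simp
    also have "\<dots> \<longleftrightarrow> (\<forall>i\<in>P. a \<in> ?s i (bs ! i)) \<and> (\<forall>i\<in>Q. a \<notin> ?s i (bs ! (r + i)))"
      using PQ by blast
    finally show ?thesis using True by (simp add: solutions_def)
  qed (simp add: solutions_def)
  have th: "\<not> sat M (b @ concat bs) (\<theta> P Q) \<longleftrightarrow>
      (\<forall>i<r. (i \<in> P \<and> ?s i (bs ! i) \<subseteq> ?s i b) \<or> (i \<in> Q \<and> ?s i b \<subseteq> ?s i (bs ! (r + i))))"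
    if bs: "bs \<in> nlists ?k B" "B \<subseteq> nlists n ?U" and b: "b \<in> B" for b P Q bs B
  proof -
    have lb: "length b = n" using b bs(2) nlistsE_length by blast
    have l: "length bs = ?k" using bs(1) by simp
    have m0: "map ((!) (b @ concat bs)) [0..<n] = b" using lb by (auto intro!: nth_equalityI simp: nth_append)
    have mj: "map ((!) (b @ concat bs)) (?y n j) = bs ! j" if "j < ?k" for j
      by (rule map_nth_block[OF _ _ lb]) (use bl[OF bs] that l in auto)
    have inc: "sat M (b @ concat bs) (incl_fm m (?y n i) [0..<n] (\<chi> i)) \<longleftrightarrow> ?s i (bs ! i) \<subseteq> ?s i b"
      "sat M (b @ concat bs) (incl_fm m [0..<n] (?y n (r + i)) (\<chi> i)) \<longleftrightarrow> ?s i b \<subseteq> ?s i (bs ! (r + i))" if "i < r" for i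
      using that by (simp_all only: sat_incl_fm[OF \<chi>[OF that]] length_upt diff_add_inverse diff_zero m0 mj trans_less_add1 add_less_cancel_left)
    have "\<not> sat M (b @ concat bs) (\<theta> P Q) \<longleftrightarrow> (\<forall>i<r. (i \<in> P \<and> sat M (b @ concat bs) (incl_fm m (?y n i) [0..<n] (\<chi> i))) \<or>
        (i \<in> Q \<and> sat M (b @ concat bs) (incl_fm m [0..<n] (?y n (r + i)) (\<chi> i))))"
      unfolding \<theta>_def by (simp add: sat_Conjs Ball_def bex_Un split: if_split) blast
    then show ?thesis using inc by simp
  qed
  have cell: "\<exists>P Q bs. P \<subseteq> {..<r} \<and> Q \<subseteq> {..<r} \<and> bs \<in> nlists ?k B \<and> \<Delta> = solutions M m (\<psi> P Q) (concat bs) \<and>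
      (\<forall>b\<in>B. \<forall>i<r. (i \<in> P \<and> ?s i (bs ! i) \<subseteq> ?s i b) \<or> (i \<in> Q \<and> ?s i b \<subseteq> ?s i (bs ! (r + i))))"
    if "\<Delta> \<in> cells M m T B" "B \<subseteq> nlists n ?U" for \<Delta> B
  proof -
    have "\<Delta> \<in> {solutions M m \<psi> (concat bs) | \<psi> \<theta> bs.
        (\<psi>, \<theta>) \<in> ?\<Theta> \<and> bs \<in> nlists ?k B \<and> \<not> (\<exists>b\<in>B. sat M (b @ concat bs) \<theta>)}" using that(1) T(5) by simp
    then obtain \<psi>' \<theta>' bs where *: "\<Delta> = solutions M m \<psi>' (concat bs)" "(\<psi>', \<theta>') \<in> ?\<Theta>" "bs \<in> nlists ?k B"
      "\<not> (\<exists>b\<in>B. sat M (b @ concat bs) \<theta>')" unfolding mem_Collect_eq by (elim exE conjE) (rule that)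
    from *(2) obtain P Q where PQ: "P \<subseteq> {..<r}" "Q \<subseteq> {..<r}" "\<psi>' = \<psi> P Q" "\<theta>' = \<theta> P Q" by auto
    have "\<forall>b\<in>B. \<forall>i<r. (i \<in> P \<and> ?s i (bs ! i) \<subseteq> ?s i b) \<or> (i \<in> Q \<and> ?s i b \<subseteq> ?s i (bs ! (r + i)))"
    proof
      fix b assume b: "b \<in> B"
      then have "\<not> sat M (b @ concat bs) (\<theta> P Q)" using *(4) unfolding PQ(4) by blast
      then show "\<forall>i<r. (i \<in> P \<and> ?s i (bs ! i) \<subseteq> ?s i b) \<or> (i \<in> Q \<and> ?s i b \<subseteq> ?s i (bs ! (r + i)))"
        unfolding th[OF *(3) that(2) b] .
    qed
    then show ?thesis using PQ(1,2) *(3) *(1)[unfolded PQ(3)] by (intro exI conjI)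
  qed
  define tp where "tp B a = {(i, b). i < r \<and> b \<in> B \<and> sat M (a @ b) (\<chi> i)}" for B a
  \<comment> \<open>Whatever parameters define it, a nonempty cell is a full class of points with
    the same type over \<open>B\<close>: the exclusion condition determines the type from the cell,
    and the parameters lie in \<open>B\<close>. So cells are counted by types and not by their
    parameters.\<close>
  have cls: "\<Delta> = {a' \<in> nlists m ?U. tp B a' = tp B a}"
    if D: "\<Delta> \<in> cells M m T B" and B: "B \<subseteq> nlists n ?U" and a: "a \<in> \<Delta>" for \<Delta> B a
  proof -
    obtain P Q bs where *: "P \<subseteq> {..<r}" "Q \<subseteq> {..<r}" "bs \<in> nlists ?k B" "\<Delta> = solutions M m (\<psi> P Q) (concat bs)"
      "\<forall>b\<in>B. \<forall>i<r. (i \<in> P \<and> ?s i (bs ! i) \<subseteq> ?s i b) \<or> (i \<in> Q \<and> ?s i b \<subseteq> ?s i (bs ! (r + i)))"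
      using cell[OF D B] by blast
    have mem: "x \<in> \<Delta> \<longleftrightarrow> x \<in> nlists m ?U \<and> (\<forall>i\<in>P. x \<in> ?s i (bs ! i)) \<and> (\<forall>i\<in>Q. x \<notin> ?s i (bs ! (r + i)))" for x
      unfolding *(4) by (rule ps[OF *(3) B *(1,2)])
    have tps: "(i, b) \<in> tp B x \<longleftrightarrow> i < r \<and> b \<in> B \<and> x \<in> ?s i b" if "x \<in> nlists m ?U" for x i b
      using that by (simp add: tp_def solutions_def)
    have inP: "bs ! i \<in> B" "bs ! (r + i) \<in> B" if "i < r" for i using bi[OF *(3)] that by simp_all
    have val: "(i, b) \<in> tp B x \<longleftrightarrow> i < r \<and> b \<in> B \<and> i \<in> P \<and> ?s i (bs ! i) \<subseteq> ?s i b" if "x \<in> \<Delta>" for x i b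
    proof -
      have x: "x \<in> nlists m ?U" "\<forall>i\<in>P. x \<in> ?s i (bs ! i)" "\<forall>i\<in>Q. x \<notin> ?s i (bs ! (r + i))" using that mem by blast+
      show ?thesis unfolding tps[OF x(1)] using x(2,3) *(5) by blast
    qed
    show ?thesis
    proof (rule Set.set_eqI)
      fix x
      show "x \<in> \<Delta> \<longleftrightarrow> x \<in> {a' \<in> nlists m ?U. tp B a' = tp B a}"
      proof
        assume x: "x \<in> \<Delta>"
        have "tp B x = tp B a" by (rule Set.set_eqI) (use val[OF x] val[OF a] in auto)
        then show "x \<in> {a' \<in> nlists m ?U. tp B a' = tp B a}" using x mem by blast
      next
        assume "x \<in> {a' \<in> nlists m ?U. tp B a' = tp B a}"
        then have x: "x \<in> nlists m ?U" "tp B x = tp B a" by blast+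
        have aU: "a \<in> nlists m ?U" using a mem by blast
        have "x \<in> ?s i b \<longleftrightarrow> a \<in> ?s i b" if "i < r" "b \<in> B" for i b
          using tps[OF x(1), of i b] tps[OF aU, of i b] x(2) that by blast
        then show "x \<in> \<Delta>" using mem[of x] mem[of a] a x(1) inP *(1,2) by blast
      qed
    qed
  qed
  have cover: "a \<in> \<Union>(cells M m T B)" if B: "finite B" "B \<noteq> {}" "B \<subseteq> nlists n ?U" and a: "a \<in> nlists m ?U" for a B
  proof -
    obtain b0 where b0: "b0 \<in> B" using B(2) by blast
    have ch: "?s i b \<subseteq> ?s i b' \<or> ?s i b' \<subseteq> ?s i b" if "i < r" "b \<in> B" "b' \<in> B" for i b b'
      using chain[OF that(1)] that(2,3) B(3) unfolding chain_fm_def by blast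
    let ?P = "{i. i < r \<and> (\<exists>b\<in>B. a \<in> ?s i b)}" and ?Q = "{i. i < r \<and> (\<exists>b\<in>B. a \<notin> ?s i b)}"
    have "\<exists>b\<in>B. a \<in> ?s i b \<and> (\<forall>b'\<in>B. a \<in> ?s i b' \<longrightarrow> ?s i b \<subseteq> ?s i b')" if "i \<in> ?P" for i
    proof -
      have i: "i < r" and ne: "{b \<in> B. a \<in> ?s i b} \<noteq> {}" using that by blast+
      have "\<exists>b\<in>{b \<in> B. a \<in> ?s i b}. \<forall>b'\<in>{b \<in> B. a \<in> ?s i b}. ?s i b \<subseteq> ?s i b'"
        by (rule chain_least[OF _ ne]) (use B(1) ch[OF i] in simp_all)
      then show ?thesis by blast
    qed
    \<comment> \<open>For \<open>i\<close> outside \<open>?P\<close> any element of \<open>B\<close>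
      fills the slot; the same is done for \<open>?Q\<close>.\<close>
    then have "\<forall>i. \<exists>b\<in>B. i \<in> ?P \<longrightarrow> a \<in> ?s i b \<and> (\<forall>b'\<in>B. a \<in> ?s i b' \<longrightarrow> ?s i b \<subseteq> ?s i b')" using b0 by blast
    then obtain \<beta> where \<beta>: "\<forall>i. \<beta> i \<in> B \<and> (i \<in> ?P \<longrightarrow> a \<in> ?s i (\<beta> i) \<and> (\<forall>b'\<in>B. a \<in> ?s i b' \<longrightarrow> ?s i (\<beta> i) \<subseteq> ?s i b'))"
      unfolding Bex_def by (rule choice[THEN exE])
    have "\<exists>b\<in>B. a \<notin> ?s i b \<and> (\<forall>b'\<in>B. a \<notin> ?s i b' \<longrightarrow> ?s i b' \<subseteq> ?s i b)" if "i \<in> ?Q" for i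
    proof -
      have i: "i < r" and ne: "{b \<in> B. a \<notin> ?s i b} \<noteq> {}" using that by blast+
      have "\<exists>b\<in>{b \<in> B. a \<notin> ?s i b}. \<forall>b'\<in>{b \<in> B. a \<notin> ?s i b}. ?s i b' \<subseteq> ?s i b"
        by (rule chain_greatest[OF _ ne]) (use B(1) ch[OF i] in simp_all)
      then show ?thesis by blast
    qed
    then have "\<forall>i. \<exists>b\<in>B. i \<in> ?Q \<longrightarrow> a \<notin> ?s i b \<and> (\<forall>b'\<in>B. a \<notin> ?s i b' \<longrightarrow> ?s i b' \<subseteq> ?s i b)" using b0 by blast
    then obtain \<gamma> where \<gamma>: "\<forall>i. \<gamma> i \<in> B \<and> (i \<in> ?Q \<longrightarrow> a \<notin> ?s i (\<gamma> i) \<and> (\<forall>b'\<in>B. a \<notin> ?s i b' \<longrightarrow> ?s i b' \<subseteq> ?s i (\<gamma> i)))"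
      unfolding Bex_def by (rule choice[THEN exE])
    let ?bs = "map \<beta> [0..<r] @ map \<gamma> [0..<r]"
    have bs: "?bs \<in> nlists ?k B" by (rule nlistsI) (use \<beta> \<gamma> in auto)
    have bn: "?bs ! i = \<beta> i" "?bs ! (r + i) = \<gamma> i" if "i < r" for i using that by (simp_all add: nth_append)
    have PQ: "?P \<subseteq> {..<r}" "?Q \<subseteq> {..<r}" by auto
    have "a \<in> solutions M m (\<psi> ?P ?Q) (concat ?bs)"
      unfolding ps[OF bs B(3) PQ] using a \<beta> \<gamma> bn by auto
    moreover have nth: "\<not> sat M (b @ concat ?bs) (\<theta> ?P ?Q)" if b: "b \<in> B" for b
      unfolding th[OF bs B(3) b]
    proof (intro allI impI)
      fix i assume i: "i < r"
      show "(i \<in> ?P \<and> ?s i (?bs ! i) \<subseteq> ?s i b) \<or> (i \<in> ?Q \<and> ?s i b \<subseteq> ?s i (?bs ! (r + i)))"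
      proof (cases "a \<in> ?s i b")
        case True
        then have "i \<in> ?P" using i b by blast
        then show ?thesis using \<beta> b True bn(1)[OF i] by simp
      next
        case False
        then have "i \<in> ?Q" using i b by blast
        then show ?thesis using \<gamma> b False bn(2)[OF i] by simp
      qed
    qed
    moreover have inT: "(\<psi> ?P ?Q, \<theta> ?P ?Q) \<in> ?\<Theta>" using PQ by (intro image_eqI[of _ _ "(?P, ?Q)"]) auto
    ultimately have "solutions M m (\<psi> ?P ?Q) (concat ?bs) \<in> cells M m T B" 
      unfolding T(5)[rule_format] mem_Collect_eq
      by (intro exI[of _ "\<psi> ?P ?Q"] exI[of _ "\<theta> ?P ?Q"] exI[of _ ?bs] conjI refl inT bs notI) (elim bexE, use nth in blast)
    then show ?thesis using \<open>a \<in> solutions M m (\<psi> ?P ?Q) (concat ?bs)\<close> by blast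
  qed
  have cU: "\<Delta> \<subseteq> nlists m ?U" if "\<Delta> \<in> cells M m T B" for \<Delta> B
    using that unfolding cells_def solutions_def by blast
  have "distal_cell_decomposition L M m n \<Phi> T"
    unfolding distal_cell_decomposition_def T(1)
  proof (intro conjI allI impI ballI T(2,3) T(4)[rule_format])
    fix B assume B: "finite B" "B \<noteq> {}" "B \<subseteq> nlists n ?U"
    show "\<Union>(cells M m T B) = nlists m ?U" using cover[OF B] cU by blast
    fix \<Delta> assume D: "\<Delta> \<in> cells M m T B"
    show "\<not> crossed M m \<Phi> B \<Delta>"
    proof
      assume "crossed M m \<Phi> B \<Delta>"
      then obtain \<phi> b a a' where c: "\<phi> \<in> \<Phi>" "b \<in> B" "a \<in> \<Delta>" "a' \<in> \<Delta>" "a \<in> solutions M m \<phi> b" "a' \<notin> solutions M m \<phi> b"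
        unfolding crossed_def by blast
      have aU: "a \<in> nlists m ?U" "a' \<in> nlists m ?U" "tp B a' = tp B a" using c(3,4) cls[OF D B(3) c(3)] by blast+
      have bU: "b \<in> nlists n ?U" using c(2) B(3) by blast
      have ab: "a @ b \<in> nlists (m + n) ?U" "a' @ b \<in> nlists (m + n) ?U"
        using aU(1,2) bU nlistsE_set[OF aU(1)] nlistsE_set[OF aU(2)] nlistsE_set[OF bU] by (intro nlistsI; simp)+
      have "sat M (a @ b) (\<chi> i) = sat M (a' @ b) (\<chi> i)" if "i < r" for i
      proof -
        have "(i, b) \<in> tp B a' \<longleftrightarrow> (i, b) \<in> tp B a" unfolding aU(3) ..
        then show ?thesis using that c(2) by (simp add: tp_def)
      qed
      then have "sat M (a @ b) \<phi> = sat M (a' @ b) \<phi>" using det[OF c(1) ab] by blast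
      then show False using c(5,6) aU by (simp add: solutions_def)
    qed
  qed
  moreover have "has_exponent M m n T (real m)"
    unfolding has_exponent_def
  \<comment> \<open>The additional 1 accounts for the empty cell, which belongs to no type.\<close>
  proof (intro exI[of _ "real (C + 1)"] allI impI)
    fix B assume B: "finite B" "B \<noteq> {}" "B \<subseteq> nlists n ?U"
    let ?S = "tp B ` nlists m ?U"
    have fS: "finite ?S"
    proof (rule finite_subset)
      show "?S \<subseteq> Pow ({..<r} \<times> B)" by (auto simp: tp_def)
    qed (use B(1) in simp)
    have "cells M m T B \<subseteq> insert {} ((\<lambda>t. {a' \<in> nlists m ?U. tp B a' = t}) ` ?S)"
    proof
      fix \<Delta> assume D: "\<Delta> \<in> cells M m T B"
      show "\<Delta> \<in> insert {} ((\<lambda>t. {a' \<in> nlists m ?U. tp B a' = t}) ` ?S)"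
      proof (cases "\<Delta> = {}")
        case False
        then obtain a where a: "a \<in> \<Delta>" by blast
        then have "a \<in> nlists m ?U" using cU[OF D] by blast
        then show ?thesis using cls[OF D B(3) a] by blast
      qed simp
    qed
    then have "card (cells M m T B) \<le> card (insert {} ((\<lambda>t. {a' \<in> nlists m ?U. tp B a' = t}) ` ?S))"
      by (rule card_mono[rotated]) (use fS in simp)
    also have "\<dots> \<le> Suc (card ?S)"
    proof -
      have "card (insert {} ((\<lambda>t. {a' \<in> nlists m ?U. tp B a' = t}) ` ?S)) \<le> Suc (card ((\<lambda>t. {a' \<in> nlists m ?U. tp B a' = t}) ` ?S))"
        using fS by (simp add: card_insert_if)
      then show ?thesis using card_image_le[OF fS, of "\<lambda>t. {a' \<in> nlists m ?U. tp B a' = t}"] by (meson Suc_le_mono le_trans)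
    qed
    also have "\<dots> \<le> Suc (C * card B ^ m)" using count[OF B] unfolding tp_def[abs_def] by simp
    also have "\<dots> \<le> (C + 1) * card B ^ m"
    proof -
      have "0 < card B" using B(1,2) by (simp add: card_gt_0_iff)
      then have "1 \<le> card B ^ m" by (simp add: Suc_le_eq)
      then show ?thesis by simp
    qed
    finally have "real (card (cells M m T B)) \<le> real ((C + 1) * card B ^ m)" by (rule of_nat_mono)
    also have "\<dots> = real (C + 1) * real (card B) powr real m"
      using B(1,2) by (simp add: powr_realpow card_gt_0_iff algebra_simps)
    finally show "real (card (cells M m T B)) \<le> real (C + 1) * real (card B) powr real m" .
  qed
  ultimately show ?thesis by blast
qed

section \<open>From the definition of o-minimality to tame predicates\<close>

lemma (in og) tame_interval_union:
  assumes F: "finite F" and FI: "F \<subseteq> {{a} | a. a \<in> U} \<union> {open_interval S ltr l u | l u. set_option l \<subseteq> U \<and> set_option u \<subseteq> U}"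
    and P: "{x \<in> U. P x} = \<Union>F"
  shows "tame P"
proof -
  have lr: "(x, y) \<in> less_rel S ltr \<longleftrightarrow> x \<prec> y" if "x \<in> U" "y \<in> U" for x y
    using that by (simp add: less_rel_def ltr_iff)
  have "\<exists>E. finite E \<and> E \<subseteq> U \<and> breaks E (\<lambda>x. x \<in> D)" if D: "D \<in> F" for D
  proof -
    consider a where "a \<in> U" "D = {a}" | l u where "set_option l \<subseteq> U" "set_option u \<subseteq> U" "D = open_interval S ltr l u"
      using FI D by blast
    then show ?thesis
    proof cases
      case 1
      have "breaks {a} (\<lambda>x. x \<in> D)" unfolding breaks_def 1(2)
      proof (intro ballI impI)
        fix x y assume "x \<prec> y" "\<forall>c\<in>{a}. \<not> (x \<preceq> c \<and> c \<preceq> y)"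
        then have "x \<noteq> a" "y \<noteq> a" using less_imp_le by blast+
        then show "(x \<in> {a}) = (y \<in> {a})" by simp
      qed
      then show ?thesis using 1(1) by blast
    next
      case 2
      have lo: "(\<forall>a. l = Some a \<longrightarrow> (a, x) \<in> less_rel S ltr) = (\<forall>a. l = Some a \<longrightarrow> (a, y) \<in> less_rel S ltr)"
        if "x \<in> U" "y \<in> U" "x \<prec> y" "\<forall>c\<in>set_option l. \<not> (x \<preceq> c \<and> c \<preceq> y)" for x y
      proof (cases l)
        case (Some a)
        then have "a \<in> U" "\<not> (x \<preceq> a \<and> a \<preceq> y)" using 2(1) that(4) by auto
        then have "a \<prec> x \<longleftrightarrow> a \<prec> y" using that(3) by auto
        then show ?thesis using Some lr[OF \<open>a \<in> U\<close>] that by simp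
      qed simp
      have up: "(\<forall>a. u = Some a \<longrightarrow> (x, a) \<in> less_rel S ltr) = (\<forall>a. u = Some a \<longrightarrow> (y, a) \<in> less_rel S ltr)"
        if "x \<in> U" "y \<in> U" "x \<prec> y" "\<forall>c\<in>set_option u. \<not> (x \<preceq> c \<and> c \<preceq> y)" for x y
      proof (cases u)
        case (Some a)
        then have "a \<in> U" "\<not> (x \<preceq> a \<and> a \<preceq> y)" using 2(2) that(4) by auto
        then have "x \<prec> a \<longleftrightarrow> y \<prec> a" using that(3) by auto
        then show ?thesis using Some lr[OF _ \<open>a \<in> U\<close>] that by simp
      qed simp
      have "breaks (set_option l \<union> set_option u) (\<lambda>x. x \<in> D)"
        unfolding breaks_def 2(3) open_interval_def
      proof (intro ballI impI)
        fix x y assume *: "x \<in> U" "y \<in> U" "x \<prec> y" "\<forall>c\<in>set_option l \<union> set_option u. \<not> (x \<preceq> c \<and> c \<preceq> y)"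
        then show "(x \<in> {c \<in> U. (\<forall>a. l = Some a \<longrightarrow> (a, c) \<in> less_rel S ltr) \<and> (\<forall>b. u = Some b \<longrightarrow> (c, b) \<in> less_rel S ltr)}) =
          (y \<in> {c \<in> U. (\<forall>a. l = Some a \<longrightarrow> (a, c) \<in> less_rel S ltr) \<and> (\<forall>b. u = Some b \<longrightarrow> (c, b) \<in> less_rel S ltr)})"
          using lo[OF *(1-3)] up[OF *(1-3)] by simp
      qed
      moreover have "finite (set_option l \<union> set_option u)" by (cases l; cases u) simp_all
      ultimately show ?thesis using 2(1,2) by (intro exI[of _ "set_option l \<union> set_option u"]) simp
    qed
  qed
  then have "\<forall>D\<in>F. \<exists>E. finite E \<and> E \<subseteq> U \<and> breaks E (\<lambda>x. x \<in> D)" by (rule ballI)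
  then obtain E where E: "\<forall>D\<in>F. finite (E D) \<and> E D \<subseteq> U \<and> breaks (E D) (\<lambda>x. x \<in> D)" by (rule bchoice[THEN exE])
  have "breaks (\<Union>D\<in>F. E D) P"
    unfolding breaks_def
  proof (intro ballI impI)
    fix x y assume *: "x \<in> U" "y \<in> U" "x \<prec> y" "\<forall>c\<in>\<Union>D\<in>F. E D. \<not> (x \<preceq> c \<and> c \<preceq> y)"
    have "x \<in> D \<longleftrightarrow> y \<in> D" if "D \<in> F" for D
    proof -
      have "breaks (E D) (\<lambda>x. x \<in> D)" using E that by blast
      moreover have "\<forall>c\<in>E D. \<not> (x \<preceq> c \<and> c \<preceq> y)" using *(4) that by blast
      ultimately show ?thesis using *(1-3) unfolding breaks_def by blast
    qed
    then have "x \<in> \<Union>F \<longleftrightarrow> y \<in> \<Union>F" by blast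
    then show "P x = P y" unfolding P[symmetric] using *(1,2) by simp
  qed
  moreover have "finite (\<Union>D\<in>F. E D)" "(\<Union>D\<in>F. E D) \<subseteq> U" using F E by auto
  ultimately show ?thesis unfolding tame_def by blast
qed

lemma o_minimal_og_ax:
  fixes L :: "('f, 'r) language" and M :: "('f, 'r, 'a) struct"
  assumes G: "expands_ordered_group L M lt pl" and O: "o_minimal L M lt" and nontriv: "\<not> (\<exists>u. univ M = {u})"
  shows "sat M [] (og_ax lt pl)" and "\<And>p \<phi> m. \<phi> \<in> formulas L (Suc p) \<Longrightarrow> m \<in> nlists p (univ M) \<Longrightarrow> \<exists>K. sat M m (tamef lt K p \<phi>)"
proof -
  have M: "is_structure L M" and ar: "rel_arity L lt = 2" "fun_arity L pl = 2"
    and lin: "strict_linear_order_on (univ M) (less_rel M lt)"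
    and mono: "\<forall>a b. (a, b) \<in> less_rel M lt \<longrightarrow> (\<forall>c\<in>univ M.
        (fun_int M pl [a, c], fun_int M pl [b, c]) \<in> less_rel M lt \<and>
        (fun_int M pl [c, a], fun_int M pl [c, b]) \<in> less_rel M lt)"
    using G unfolding expands_ordered_group_def by blast+
  obtain e where "group \<lparr>carrier = univ M, mult = (\<lambda>a b. fun_int M pl [a, b]), one = e\<rparr>"
    using G unfolding expands_ordered_group_def by blast
  then interpret G: group "\<lparr>carrier = univ M, mult = (\<lambda>a b. fun_int M pl [a, b]), one = e\<rparr>" .
  let ?R = "\<lambda>x y. rel_int M lt [x, y]" and ?P = "\<lambda>x y. fun_int M pl [x, y]"
  have e: "e \<in> univ M" using G.one_closed by simp
  have unit: "\<forall>x\<in>univ M. ?P e x = x \<and> ?P x e = x" using G.l_one G.r_one by simp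
  have a5: "\<forall>x\<in>univ M. \<forall>y\<in>univ M. \<forall>z\<in>univ M. ?P (?P x y) z = ?P x (?P y z)" using G.m_assoc by simp
  have inv: "\<forall>x\<in>univ M. \<exists>y\<in>univ M. ?P y x = e \<and> ?P x y = e" using G.l_inv G.r_inv G.inv_closed by (metis monoid.select_convs(1) partial_object.select_convs(1) monoid.select_convs(2))
  have cl: "?P x y \<in> univ M" if "x \<in> univ M" "y \<in> univ M" for x y using G.m_closed that by simp
  have lr: "(x, y) \<in> less_rel M lt \<longleftrightarrow> x \<in> univ M \<and> y \<in> univ M \<and> ?R x y" for x y by (simp add: less_rel_def)
  have a1: "\<forall>x\<in>univ M. \<not> ?R x x" using lin lr unfolding strict_linear_order_on_def irrefl_def by blast
  have a2: "\<forall>x\<in>univ M. \<forall>y\<in>univ M. \<forall>z\<in>univ M. ?R x y \<longrightarrow> ?R y z \<longrightarrow> ?R x z"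
    using lin lr unfolding strict_linear_order_on_def trans_def by blast
  have a3: "\<forall>x\<in>univ M. \<forall>y\<in>univ M. y = x \<or> ?R x y \<or> ?R y x"
    using lin lr unfolding strict_linear_order_on_def total_on_def by blast
  have a6: "\<forall>x\<in>univ M. \<forall>y\<in>univ M. \<forall>z\<in>univ M. ?R x y \<longrightarrow> ?R (?P z x) (?P z y) \<and> ?R (?P x z) (?P y z)"
    using mono lr by blast
  have nt: "\<exists>x\<in>univ M. x \<noteq> e" using nontriv e by blast
  obtain le less where le: "class.linorder le less" "\<And>x y. x \<in> univ M \<Longrightarrow> y \<in> univ M \<Longrightarrow> less x y \<longleftrightarrow> ?R x y"
    by (rule ex_linorder_extension[OF a1 a2 a3]) (rule that)
  obtain ng where ng: "\<forall>x\<in>univ M. ng x \<in> univ M \<and> ?P (ng x) x = e \<and> ?P x (ng x) = e" using inv by metis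
  interpret linorder le less by (rule le(1))
  interpret og le less L M lt pl e ng
  proof unfold_locales
    fix x y z
    show "is_structure L M" "rel_arity L lt = 2" "fun_arity L pl = 2" "e \<in> univ M" by fact+
    show "\<exists>x\<in>univ M. x \<noteq> e" by fact
    assume x: "x \<in> univ M"
    show "ng x \<in> univ M" "?P e x = x" "?P x e = x" "?P (ng x) x = e" "?P x (ng x) = e" using unit ng x by blast+
    assume y: "y \<in> univ M"
    show "?R x y = less x y" using le(2) x y by simp
    assume z: "z \<in> univ M"
    show "?P (?P x y) z = ?P x (?P y z)" using a5 x y z by blast
    assume "less x y"
    then have "?R x y" using le(2) x y by blast
    then have "?R (?P z x) (?P z y)" "?R (?P x z) (?P y z)" using a6 x y z by blast+
    then show "less (?P z x) (?P z y)" "less (?P x z) (?P y z)"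
      using le(2)[OF cl[OF z x] cl[OF z y]] le(2)[OF cl[OF x z] cl[OF y z]] by simp_all
  qed
  have om: "\<forall>p. \<forall>\<phi>\<in>formulas L (Suc p). \<forall>b\<in>nlists p (univ M). \<exists>F. finite F \<and>
            F \<subseteq> {{a} | a. a \<in> univ M} \<union>
                {open_interval M lt l u | l u. set_option l \<subseteq> univ M \<and> set_option u \<subseteq> univ M} \<and>
            {a \<in> univ M. sat M (a # b) \<phi>} = \<Union>F"
    using O unfolding o_minimal_def by (elim conjE)
  have tame: "tame (\<lambda>u. sat M (u # m) \<phi>)" if \<phi>: "\<phi> \<in> formulas L (Suc p)" "m \<in> nlists p (univ M)" for \<phi> p m
  proof -
    obtain F where "finite F" "F \<subseteq> {{a} | a. a \<in> univ M} \<union>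
                {open_interval M lt l u | l u. set_option l \<subseteq> univ M \<and> set_option u \<subseteq> univ M}"
            "{a \<in> univ M. sat M (a # m) \<phi>} = \<Union>F"
      using om[rule_format, OF \<phi>] by (elim exE conjE) (rule that)
    then show ?thesis by (rule tame_interval_union)
  qed
  \<comment> \<open>The set of doubles is definable without parameters, which is what the proof of
    density requires.\<close>
  have "tame (\<lambda>u. sat M (u # []) (Ex (Eq (Var 1) (App pl [Var 0, Var 0]))))"
    by (rule tame[of _ 0]) (use ar in auto)
  then have "tame (\<lambda>x. \<exists>y\<in>univ M. x = add y y)" by (simp add: add_def)
  then have dense: "\<exists>z\<in>univ M. less x z \<and> less z y" if "x \<in> univ M" "y \<in> univ M" "less x y" for x y
    by (rule tame_dense) (fact that)+
  then have a4: "\<forall>x\<in>univ M. \<forall>y\<in>univ M. ?R x y \<longrightarrow> (\<exists>z\<in>univ M. ?R x z \<and> ?R z y)"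
    using le(2) by blast
  show "sat M [] (og_ax lt pl)"
    unfolding sat_og_ax by (intro conjI a1 a2 a3 a4 a5 a6) (rule bexI[OF _ e], intro conjI unit inv nt)
  show "\<exists>K. sat M m (tamef lt K p \<phi>)" if \<phi>: "\<phi> \<in> formulas L (Suc p)" "m \<in> nlists p (univ M)" for p \<phi> m
  proof -
    obtain F where "finite F" "F \<subseteq> univ M" "breaks F (\<lambda>u. sat M (u # m) \<phi>)" using tame[OF \<phi>] unfolding tame_def by blast
    then show ?thesis unfolding sat_tamef[OF \<phi>] by blast
  qed
qed

lemma finite_chains_dcc:
  fixes M :: "('f, 'r, 'a) struct"
  assumes X: "finite X" "\<forall>\<chi>\<in>X. chain_fm L M m n \<chi>"
    and det: "\<And>\<phi> c c'. \<phi> \<in> \<Phi> \<Longrightarrow> c \<in> nlists (m + n) (univ M) \<Longrightarrow> c' \<in> nlists (m + n) (univ M) \<Longrightarrow>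
      \<forall>\<chi>\<in>X. sat M c \<chi> = sat M c' \<chi> \<Longrightarrow> sat M c \<phi> = sat M c' \<phi>"
    and count: "\<exists>C. \<forall>B. finite B \<longrightarrow> B \<noteq> {} \<longrightarrow> B \<subseteq> nlists n (univ M) \<longrightarrow>
      card ((\<lambda>a. {(\<chi>, b). \<chi> \<in> X \<and> b \<in> B \<and> sat M (a @ b) \<chi>}) ` nlists m (univ M)) \<le> C * card B ^ m"
  shows "\<exists>T. distal_cell_decomposition L M m n \<Phi> T \<and> has_exponent M m n T (real m)"
proof -
  obtain \<chi>s where \<chi>s: "set \<chi>s = X" using X(1) finite_list by blast
  obtain C where C: "\<forall>B. finite B \<longrightarrow> B \<noteq> {} \<longrightarrow> B \<subseteq> nlists n (univ M) \<longrightarrow>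
      card ((\<lambda>a. {(\<chi>, b). \<chi> \<in> X \<and> b \<in> B \<and> sat M (a @ b) \<chi>}) ` nlists m (univ M)) \<le> C * card B ^ m"
    using count by (rule exE) (rule that)
  show ?thesis
  proof (rule dcc_of_chains[of "length \<chi>s" L M m n "(!) \<chi>s" \<Phi> C])
    show "chain_fm L M m n (\<chi>s ! i)" if "i < length \<chi>s" for i using X(2) \<chi>s nth_mem[OF that] by blast
    show "sat M c \<phi> = sat M c' \<phi>" if "\<phi> \<in> \<Phi>" "c \<in> nlists (m + n) (univ M)" "c' \<in> nlists (m + n) (univ M)"
      "\<forall>i<length \<chi>s. sat M c (\<chi>s ! i) = sat M c' (\<chi>s ! i)" for \<phi> c c'
      by (rule det[OF that(1-3)]) (use that(4) \<chi>s in \<open>auto simp: in_set_conv_nth\<close>)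
    fix B assume B: "finite B" "B \<noteq> {}" "B \<subseteq> nlists n (univ M)"
    let ?t = "\<lambda>a. {(\<chi>, b). \<chi> \<in> X \<and> b \<in> B \<and> sat M (a @ b) \<chi>}"
    have "(\<lambda>a. {(i, b). i < length \<chi>s \<and> b \<in> B \<and> sat M (a @ b) (\<chi>s ! i)}) ` nlists m (univ M) =
      (\<lambda>t. {(i, b). i < length \<chi>s \<and> b \<in> B \<and> (\<chi>s ! i, b) \<in> t}) ` ?t ` nlists m (univ M)"
      unfolding image_image using \<chi>s by (intro image_cong refl) auto
    moreover have "finite (?t ` nlists m (univ M))"
    proof (rule finite_subset)
      show "?t ` nlists m (univ M) \<subseteq> Pow (X \<times> B)" by auto
    qed (use X(1) B(1) in simp)
    ultimately have "card ((\<lambda>a. {(i, b). i < length \<chi>s \<and> b \<in> B \<and> sat M (a @ b) (\<chi>s ! i)}) ` nlists m (univ M)) \<le> card (?t ` nlists m (univ M))"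
      using card_image_le by simp
    also have "\<dots> \<le> C * card B ^ m" using C B by blast
    finally show "card ((\<lambda>a. {(i, b). i < length \<chi>s \<and> b \<in> B \<and> sat M (a @ b) (\<chi>s ! i)}) ` nlists m (univ M)) \<le> C * card B ^ m" .
  qed
qed

theorem theorem4p2:
  fixes L :: "('f, 'r) language"
    and M :: "('f, 'r, 'a) struct"
    and lt :: 'r and pl :: 'f
    and m n :: nat
    and \<Phi> :: "('f, 'r) fm set"
  assumes "expands_ordered_group L M lt pl"
    and "o_minimal L M lt"
    and "locally_modular_theory TYPE(('f, 'r, 'a) model_universe) L (Th L M)"
    and "finite \<Phi>"
    and "\<Phi> \<subseteq> formulas L (m + n)"
  shows "\<exists>T. distal_cell_decomposition L M m n \<Phi> T \<and> has_exponent M m n T (real m)"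
proof (cases "\<exists>u. univ M = {u}")
  \<comment> \<open>The group with one element is not densely ordered in the sense of
    \<open>og_ax\<close>, which demands a nonzero element. Here there is just one tuple of each
    length, so every formula is a chain formula and there is one type.\<close>
  case True
  then obtain u where u: "univ M = {u}" by blast
  have sing: "c = c'" if "c \<in> nlists k (univ M)" "c' \<in> nlists k (univ M)" for c c' k
  proof (rule nth_equalityI)
    show "length c = length c'" using that by simp
    show "c ! i = c' ! i" if "i < length c" for i
      using that nlistsE_nth_in[OF \<open>c \<in> nlists k (univ M)\<close>, of i] nlistsE_nth_in[OF \<open>c' \<in> nlists k (univ M)\<close>, of i] u \<open>c \<in> nlists k (univ M)\<close> by simp
  qed
  have chain: "\<forall>\<chi>\<in>\<Phi>. chain_fm L M m n \<chi>"
    unfolding chain_fm_def using assms(5) sing by blast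
  have det: "sat M c \<phi> = sat M c' \<phi>" if "c \<in> nlists (m + n) (univ M)" "c' \<in> nlists (m + n) (univ M)" for \<phi> c c'
    using sing[OF that] by simp
  have im: "card (f ` nlists m (univ M)) \<le> 1" for f :: "'a list \<Rightarrow> (('f, 'r) fm \<times> 'a list) set"
  proof -
    have "f ` nlists m (univ M) \<subseteq> {f (replicate m u)}"
    proof (rule image_subsetI)
      fix c assume c: "c \<in> nlists m (univ M)"
      have "set (replicate m u) \<subseteq> univ M" unfolding u set_replicate_conv_if by (cases "m = 0") simp_all
      then have "replicate m u \<in> nlists m (univ M)" by (intro nlistsI length_replicate)
      from sing[OF c this] have "c = replicate m u" .
      then show "f c \<in> {f (replicate m u)}" by simp
    qed
    from card_mono[OF _ this] show ?thesis by simp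
  qed
  have count: "card ((\<lambda>a. {(\<chi>, b). \<chi> \<in> \<Phi> \<and> b \<in> B \<and> sat M (a @ b) \<chi>}) ` nlists m (univ M)) \<le> 1 * card B ^ m"
    if "finite B" "B \<noteq> {}" for B
  proof -
    have "1 \<le> card B ^ m" using that by (simp add: Suc_le_eq card_gt_0_iff)
    then show ?thesis using im unfolding mult_1 by (rule Nat.le_trans[rotated])
  qed
  show ?thesis
    by (rule finite_chains_dcc[OF assms(4) chain det], assumption+) (use count in blast)
next
  case False
  have M: "is_structure L M" and ar: "rel_arity L lt = 2" "fun_arity L pl = 2"
    using assms(1) unfolding expands_ordered_group_def by blast+
  note ax = o_minimal_og_ax(1)[OF assms(1,2) False] and tm = o_minimal_og_ax(2)[OF assms(1,2) False]
  have "\<forall>\<phi>\<in>\<Phi>. \<exists>X. finite X \<and> (\<forall>\<chi>\<in>X. chain_fm L M m n \<chi>) \<and>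
    (\<forall>c\<in>nlists (m + n) (univ M). \<forall>c'\<in>nlists (m + n) (univ M).
      (\<forall>\<chi>\<in>X. sat M c \<chi> = sat M c' \<chi>) \<longrightarrow> sat M c \<phi> = sat M c' \<phi>)"
    using finite_chains[OF M ar ax tm assms(3)] assms(5) by blast
  then obtain X where X: "\<forall>\<phi>\<in>\<Phi>. finite (X \<phi>) \<and> (\<forall>\<chi>\<in>X \<phi>. chain_fm L M m n \<chi>) \<and>
    (\<forall>c\<in>nlists (m + n) (univ M). \<forall>c'\<in>nlists (m + n) (univ M).
      (\<forall>\<chi>\<in>X \<phi>. sat M c \<chi> = sat M c' \<chi>) \<longrightarrow> sat M c \<phi> = sat M c' \<phi>)" by (rule bchoice[THEN exE])
  let ?X = "\<Union>\<phi>\<in>\<Phi>. X \<phi>"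
  have fX: "finite ?X" using assms(4) X by blast
  have cX: "\<forall>\<chi>\<in>?X. chain_fm L M m n \<chi>" using X by blast
  have mod: "is_model L M (Th L M)" unfolding is_model_def Th_def using M by blast
  obtain le less zr ng where "omin le less L M lt pl zr ng" by (rule ex_omin_model[OF M ar ax tm mod])
  then interpret omin le less L M lt pl zr ng .
  have UT: "\<exists>K. \<forall>z\<in>nlists p (univ M). sat M z (tamef lt K p \<phi>)" if "\<phi> \<in> formulas L (Suc p)" for p \<phi>
    using uniform_tame[OF M ar ax tm that] by (simp add: sat_Exs)
  \<comment> \<open>The count starts with no fixed parameters, that is with \<open>q = 0\<close> and
    the empty tuple for \<open>w\<close>.\<close>
  have im: "id ` ?X \<subseteq> formulas L (m + (n + 0))" using cX by (auto simp: chain_fm_def)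
  obtain C where C: "\<forall>B w. finite B \<longrightarrow> B \<noteq> {} \<longrightarrow> B \<subseteq> nlists n (univ M) \<longrightarrow> w \<in> nlists 0 (univ M) \<longrightarrow>
    card ((\<lambda>a. {(\<phi>, b). \<phi> \<in> ?X \<and> b \<in> B \<and> sat M (a @ b @ w) (id \<phi>)}) ` nlists m (univ M)) \<le> C * card B ^ m"
    by (rule exE[OF type_count[OF UT fX im]]) (assumption | rule that)+
  show ?thesis
  proof (rule finite_chains_dcc[OF fX cX])
    show "sat M c \<phi> = sat M c' \<phi>" if "\<phi> \<in> \<Phi>" "c \<in> nlists (m + n) (univ M)" "c' \<in> nlists (m + n) (univ M)"
      "\<forall>\<chi>\<in>?X. sat M c \<chi> = sat M c' \<chi>" for \<phi> c c'
      using X that by blast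
    show "\<exists>C. \<forall>B. finite B \<longrightarrow> B \<noteq> {} \<longrightarrow> B \<subseteq> nlists n (univ M) \<longrightarrow>
      card ((\<lambda>a. {(\<chi>, b). \<chi> \<in> ?X \<and> b \<in> B \<and> sat M (a @ b) \<chi>}) ` nlists m (univ M)) \<le> C * card B ^ m"
      using C[rule_format, of _ "[]"] by (intro exI[of _ C]) simp
  qed
qed

end
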